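(* Let $\lambda\in(0,1)$, $T>0$, let $f:\mathbb{R}\to\mathbb{R}$ be Lipschitz continuous, and let $u_0\in L^1(\mathbb{R})\cap BV(\mathbb{R})$. Then there exists a unique BV entropy solution of $$\partial_tu+\partial_xf(u)=g[u]\ \text{ in }Q_T=\mathbb{R}\times(0,T),\qquad u(\cdot,0)=u_0 .$$
   Context: Operator: $g[\varphi](x)=c_\lambda\int_{|z|>0}\frac{\varphi(x+z)-\varphi(x)}{|z|^{1+\lambda}}dz$ is the fractional Laplacian $-(-\partial_x^2)^{\lambda/2}$ acting in $x$, $c_\lambda>0$ its normalizing constant. BV entropy solution: for $k\in\mathbb{R}$ let $\eta_k(u)=|u-k|$, $\eta_k'(u)=\mathrm{sgn}(u-k)$, $q_k(u)=\eta_k'(u)(f(u)-f(k))$. A function $u\in L^\infty(Q_T)$ is a BV entropy solution if (i) $u\in C([0,T];L^1(\mathbb{R}))\cap L^\infty(0,T;BV(\mathbb{R}))$, and (ii) for all $k\in\mathbb{R}$ and all nonnegative $\varphi\in C_c^\infty(\mathbb{R}\times[0,T])$, $$\int_{Q_T}\big(\eta_k(u)\varphi_t+q_k(u)\varphi_x+\eta_k'(u)g[u]\varphi\big)dx\,dt+\int_{\mathbb{R}}\eta_k(u_0(x))\varphi(x,0)dx-\int_{\mathbb{R}}\eta_k(u(x,T))\varphi(x,T)dx\ge0.$$ *)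

theory Defs
  imports "HOL-Analysis.Analysis"
begin

text \<open>
  Elements of Lebesgue spaces are represented by Borel functions; every class has a Borel
  representative, and all notions below depend on the classes only. A function of
  \<open>(x, t)\<close> is a function on \<^typ>\<open>real \<times> real\<close>, space variable first.
\<close>

text \<open>
  The constant for which the operator has Fourier symbol \<open>- \<bar>\<xi>\<bar> powr lam\<close>, i.e. the inverse of
  the integral of \<open>(1 - cos z) / \<bar>z\<bar> powr (1 + lam)\<close> over the real line.
\<close>
definition c_frac :: "real \<Rightarrow> real" where
  "c_frac lam = lam * 2 powr (lam - 1) * Gamma ((1 + lam) / 2) / (sqrt pi * Gamma (1 - lam / 2))"

definition frac_laplace :: "real \<Rightarrow> (real \<Rightarrow> real) \<Rightarrow> real \<Rightarrow> real" where
  "frac_laplace lam v x =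
     c_frac lam * (LINT z:{z. \<bar>z\<bar> > 0}|lborel. (v (x + z) - v x) / \<bar>z\<bar> powr (1 + lam))"

definition total_variation :: "(real \<Rightarrow> real) \<Rightarrow> ereal" where
  "total_variation v =
     (SUP \<phi> \<in> {\<phi> :: real \<Rightarrow> real. \<phi> C1_differentiable_on UNIV \<and>
                  compact (closure {x. \<phi> x \<noteq> 0}) \<and> (\<forall>x. \<bar>\<phi> x\<bar> \<le> 1)}.
        ereal (LINT x|lborel. v x * deriv \<phi> x))"

definition bv_norm :: "(real \<Rightarrow> real) \<Rightarrow> ereal" where
  "bv_norm v = ereal (LINT x|lborel. \<bar>v x\<bar>) + total_variation v"

definition BV :: "(real \<Rightarrow> real) set" where
  "BV = {v. integrable lborel v \<and> total_variation v < \<infinity>}"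

definition Q :: "real \<Rightarrow> (real \<times> real) set" where
  "Q T = UNIV \<times> {0<..<T}"

definition Linf_Q :: "real \<Rightarrow> (real \<times> real \<Rightarrow> real) set" where
  "Linf_Q T = {u. set_borel_measurable lborel (Q T) u \<and>
                  (\<exists>C. AE p in lborel. p \<in> Q T \<longrightarrow> \<bar>u p\<bar> \<le> C)}"

definition C_L1 :: "real \<Rightarrow> (real \<times> real \<Rightarrow> real) set" where
  "C_L1 T = {u. \<forall>t\<in>{0..T}. integrable lborel (\<lambda>x. u (x, t)) \<and>
                  ((\<lambda>s. LINT x|lborel. \<bar>u (x, s) - u (x, t)\<bar>) \<longlongrightarrow> 0) (at t within {0..T})}"

text \<open>
  As usual for the nonseparable space BV, no strong measurability of \<open>t \<mapsto> u (\<cdot>, t)\<close> with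
  values in BV is required.
\<close>
definition Linf_BV :: "real \<Rightarrow> (real \<times> real \<Rightarrow> real) set" where
  "Linf_BV T = {u. \<exists>C::real. AE t in lborel. t \<in> {0<..<T} \<longrightarrow>
                     (\<lambda>x. u (x, t)) \<in> BV \<and> bv_norm (\<lambda>x. u (x, t)) \<le> ereal C}"

definition dx :: "(real \<times> real \<Rightarrow> real) \<Rightarrow> real \<times> real \<Rightarrow> real" where
  "dx \<phi> = (\<lambda>(x, t). deriv (\<lambda>y. \<phi> (y, t)) x)"

definition dt :: "(real \<times> real \<Rightarrow> real) \<Rightarrow> real \<times> real \<Rightarrow> real" where
  "dt \<phi> = (\<lambda>(x, t). deriv (\<lambda>s. \<phi> (x, s)) t)"

primrec Ck :: "nat \<Rightarrow> (real \<times> real \<Rightarrow> real) \<Rightarrow> bool" where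
  "Ck 0 \<phi> \<longleftrightarrow> continuous_on UNIV \<phi>"
| "Ck (Suc k) \<phi> \<longleftrightarrow>
     continuous_on UNIV \<phi> \<and>
     (\<forall>x t. (\<lambda>y. \<phi> (y, t)) differentiable at x) \<and>
     (\<forall>x t. (\<lambda>s. \<phi> (x, s)) differentiable at t) \<and>
     Ck k (dx \<phi>) \<and> Ck k (dt \<phi>)"

text \<open>
  A smooth compactly supported function on the closed strip \<open>\<real> \<times> [0, T]\<close> is taken to be (the
  restriction of) one on the plane. It need not vanish at \<open>t = 0\<close> and \<open>t = T\<close>, and sign
  conditions on it are to be imposed on the strip only.
\<close>
definition test_functions :: "(real \<times> real \<Rightarrow> real) set" where
  "test_functions = {\<phi>. (\<forall>k. Ck k \<phi>) \<and> compact (closure {p. \<phi> p \<noteq> 0})}"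

definition \<eta> :: "real \<Rightarrow> real \<Rightarrow> real" where
  "\<eta> k u = \<bar>u - k\<bar>"

definition \<eta>' :: "real \<Rightarrow> real \<Rightarrow> real" where
  "\<eta>' k u = sgn (u - k)"

definition entropy_flux :: "(real \<Rightarrow> real) \<Rightarrow> real \<Rightarrow> real \<Rightarrow> real" where
  "entropy_flux f k u = \<eta>' k u * (f u - f k)"

text \<open>
  By membership in \<open>C_L1\<close>, the traces \<open>u (\<cdot>, t)\<close> are meaningful for every \<open>t\<close> in \<open>[0, T]\<close>,
  in particular for \<open>t = T\<close>.
\<close>
definition BV_entropy_solution ::
  "real \<Rightarrow> real \<Rightarrow> (real \<Rightarrow> real) \<Rightarrow> (real \<Rightarrow> real) \<Rightarrow> (real \<times> real \<Rightarrow> real) \<Rightarrow> bool" where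
  "BV_entropy_solution lam T f u0 u \<longleftrightarrow>
     u \<in> Linf_Q T \<and> u \<in> C_L1 T \<and> u \<in> Linf_BV T \<and>
     (\<forall>k. \<forall>\<phi>\<in>test_functions. (\<forall>x. \<forall>t\<in>{0..T}. \<phi> (x, t) \<ge> 0) \<longrightarrow>
        (LINT (x, t):Q T|lborel.
            \<eta> k (u (x, t)) * dt \<phi> (x, t) + entropy_flux f k (u (x, t)) * dx \<phi> (x, t)
            + \<eta>' k (u (x, t)) * frac_laplace lam (\<lambda>y. u (y, t)) x * \<phi> (x, t))
        + (LINT x|lborel. \<eta> k (u0 x) * \<phi> (x, 0))
        - (LINT x|lborel. \<eta> k (u (x, T)) * \<phi> (x, T)) \<ge> 0)"

end

theory Submission
  imports Defs
begin

text \<open>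
  Split \<open>f u - f 0 = p u - m u\<close> into nondecreasing parts, discretize the transport by upwind
  differences, cut off the jumps smaller than the mesh size \<open>h\<close> and discretize time by explicit Euler
  steps. Under a CFL condition every step is a translation-invariant \<open>L\<^sup>1\<close> contraction, so
  \<open>\<integral> \<bar>u (x + z, t) - u (x, t)\<bar> dx \<le> C \<bar>z\<bar>\<close> persists with the constant of \<open>u0\<close>. Since \<open>lam < 1\<close>, this bound
  alone makes the fractional Laplacian of \<open>u\<close> an \<open>L\<^sup>1\<close> function, and the contribution of the small jumps
  vanishes with \<open>h\<close>.

  Both the polygonal approximations and the entropy solutions satisfy Kruzkov's inequality with a
  mollifier \<open>\<rho> (x - y)\<close> and the level \<open>k = w y\<close>, up to an error that tends to zero. Doubling
  variables, the flux terms cancel by antisymmetry, and the jump terms have a sign by Kato's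
  inequality. The resulting \<open>L\<^sup>1\<close> comparison shows that the approximations form a Cauchy sequence and
  that entropy solutions are unique. In the limit the entropy inequality is obtained for levels \<open>k\<close>
  with \<open>{u = k}\<close> null, and for the others by averaging the limits from above and below, as \<open>sgn 0 = 0\<close>.
\<close>

section \<open>Integrals over the line and the plane\<close>

text \<open>Space is never put on a grid: the schemes use shifts by \<open>h\<close> but act on
  functions of a continuous variable, so they commute with all translations and not only with
  multiples of \<open>h\<close>. The parameters are sent to their limits in a fixed order. The
  mollifier radius \<open>R\<close> is fixed first, because the consistency error of the difference
  quotients is measured on the mollifier and tends to zero only for fixed \<open>R\<close>; it
  leaves an error proportional to \<open>C * R\<close>. Then \<open>h\<close> tends to zero. The
  time step is chosen separately for each \<open>h\<close>, since the CFL condition and the time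
  error both involve constants that grow as \<open>h\<close> shrinks. Time is not mollified in the
  doubling: the rates are merely measurable in time, and the two one-sided integral bounds are
  joined by averaging over small squares on the diagonal. In the final limit the obstacle is the
  discontinuous sign in front of the jump term: it is first kept on the approximation while every
  other factor is replaced by its limit, and only then does it converge almost everywhere.\<close>

lemma integrable_shift:
  fixes f :: "real \<Rightarrow> real"
  assumes "integrable lborel f"
  shows "integrable lborel (\<lambda>x. f (x + c))"
  using lborel_integrable_real_affine[OF assms, of 1 c] by (simp add: add.commute)

lemma integrable_reflect:
  fixes f :: "real \<Rightarrow> real"
  assumes "integrable lborel f"
  shows "integrable lborel (\<lambda>y. f (x - y))"
  using lborel_integrable_real_affine[OF assms, of "-1" x] by simp

lemma integral_shift:
  fixes f :: "real \<Rightarrow> real"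
  shows "(LINT x|lborel. f (x + c)) = (LINT x|lborel. f x)"
  using lborel_integral_real_affine[of 1 f c] by (simp add: add.commute)

lemma integral_reflect:
  fixes f :: "real \<Rightarrow> real"
  shows "(LINT y|lborel. f (x - y)) = (LINT y|lborel. f y)"
  using lborel_integral_real_affine[of "-1" f x] by simp

lemma integrable_lborel_measurable:
  "integrable lborel f \<Longrightarrow> f \<in> borel_measurable borel"
  using borel_measurable_integrable by force

lemma borel_measurable_fst [measurable (raw)]:
  fixes f :: "'c \<Rightarrow> 'a::second_countable_topology \<times> 'b::second_countable_topology"
  assumes "f \<in> borel_measurable M"
  shows "(\<lambda>x. fst (f x)) \<in> borel_measurable M"
  by (rule measurable_compose[OF assms]) (intro borel_measurable_continuous_onI continuous_intros)

lemma borel_measurable_snd [measurable (raw)]: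
  fixes f :: "'c \<Rightarrow> 'a::second_countable_topology \<times> 'b::second_countable_topology"
  assumes "f \<in> borel_measurable M"
  shows "(\<lambda>x. snd (f x)) \<in> borel_measurable M"
  by (rule measurable_compose[OF assms]) (intro borel_measurable_continuous_onI continuous_intros)

lemma integrable_lborel_pairI:
  fixes f :: "'a::euclidean_space \<times> 'b::euclidean_space \<Rightarrow> real"
  assumes [measurable]: "f \<in> borel_measurable borel"
    and 1: "AE x in lborel. integrable lborel (\<lambda>y. f (x, y))"
    and 2: "integrable lborel (\<lambda>x. LINT y|lborel. \<bar>f (x, y)\<bar>)"
  shows "integrable lborel f"
  using lborel_pair.Fubini_integrable[of f] assms by (simp add: lborel_prod)

lemma lborel_fubini:
  fixes f :: "'a::euclidean_space \<times> 'b::euclidean_space \<Rightarrow> real"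
  assumes "integrable lborel f"
  shows lborel_fubini_fst: "(LINT x|lborel. LINT y|lborel. f (x, y)) = (LINT p|lborel. f p)"
    and lborel_fubini_snd: "(LINT y|lborel. LINT x|lborel. f (x, y)) = (LINT p|lborel. f p)"
    and lborel_integrable_fst: "integrable lborel (\<lambda>x. LINT y|lborel. f (x, y))"
    and lborel_integrable_snd: "integrable lborel (\<lambda>y. LINT x|lborel. f (x, y))"
    and lborel_AE_integrable_fst: "AE x in lborel. integrable lborel (\<lambda>y. f (x, y))"
    and lborel_AE_integrable_snd: "AE y in lborel. integrable lborel (\<lambda>x. f (x, y))"
proof -
  have i: "integrable (lborel \<Otimes>\<^sub>M lborel) f" using assms by (simp add: lborel_prod)
  have i': "integrable (lborel \<Otimes>\<^sub>M lborel) (case_prod (\<lambda>x y. f (x, y)))" using i by simp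
  show "(LINT x|lborel. LINT y|lborel. f (x, y)) = (LINT p|lborel. f p)"
    using lborel_pair.integral_fst'[OF i] by (simp add: lborel_prod)
  show "(LINT y|lborel. LINT x|lborel. f (x, y)) = (LINT p|lborel. f p)"
    using lborel_pair.integral_snd[OF i'] by (simp add: lborel_prod)
  show "integrable lborel (\<lambda>x. LINT y|lborel. f (x, y))"
    using lborel_pair.integrable_fst'[OF i] by simp
  show "integrable lborel (\<lambda>y. LINT x|lborel. f (x, y))"
    using lborel_pair.integrable_snd[OF i'] by simp
  show "AE x in lborel. integrable lborel (\<lambda>y. f (x, y))"
    using lborel_pair.AE_integrable_fst'[OF i] by simp
  show "AE y in lborel. integrable lborel (\<lambda>x. f (x, y))"
    using lborel_pair.AE_integrable_snd[OF i'] by simp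
qed

lemma lborel_fubini_swap:
  fixes f :: "'a::euclidean_space \<times> 'b::euclidean_space \<Rightarrow> real"
  assumes "integrable lborel f"
  shows "(LINT x|lborel. LINT y|lborel. f (x, y)) = (LINT y|lborel. LINT x|lborel. f (x, y))"
  using lborel_fubini[OF assms] by simp

lemma convolution_integrable:
  fixes f g :: "real \<Rightarrow> real"
  assumes f: "integrable lborel f" and g: "integrable lborel g"
  shows "integrable lborel (\<lambda>p. f (fst p) * g (fst p - snd p))"
    and "integrable lborel (\<lambda>p. f (snd p) * g (fst p - snd p))"
    and "(LINT p|lborel. f (fst p) * g (fst p - snd p)) = (LINT x|lborel. f x) * (LINT x|lborel. g x)"
    and "(LINT p|lborel. f (snd p) * g (fst p - snd p)) = (LINT x|lborel. f x) * (LINT x|lborel. g x)"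
proof -
  note [measurable] = f[THEN integrable_lborel_measurable] g[THEN integrable_lborel_measurable]
  have "integrable lborel (\<lambda>x. LINT y|lborel. \<bar>f x * g (x - y)\<bar>)"
    using f by (simp add: abs_mult integral_reflect[of "\<lambda>y. \<bar>g y\<bar>"])
  then show A: "integrable lborel (\<lambda>p. f (fst p) * g (fst p - snd p))"
    by (intro integrable_lborel_pairI) (auto simp: integrable_reflect g)
  have gs: "integrable lborel (\<lambda>x. g (x - y))" for y
    using integrable_shift[OF g, of "-y"] by simp
  have is': "(LINT x|lborel. \<bar>g (x - y)\<bar>) = (LINT x|lborel. \<bar>g x\<bar>)"
           "(LINT x|lborel. g (x - y)) = (LINT x|lborel. g x)" for y
    using integral_shift[of "\<lambda>x. \<bar>g x\<bar>" "-y"] integral_shift[of g "-y"] by simp_all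
  have "integrable lborel (\<lambda>p. f (fst p) * g (snd p - fst p))"
    using f by (intro integrable_lborel_pairI) (auto simp: gs abs_mult is')
  then have "integrable (lborel \<Otimes>\<^sub>M lborel) (\<lambda>(x, y). f x * g (y - x))"
    by (simp add: lborel_prod case_prod_beta')
  from lborel_pair.integrable_product_swap[OF this]
  show B: "integrable lborel (\<lambda>p. f (snd p) * g (fst p - snd p))"
    by (simp add: lborel_prod case_prod_beta')
  show "(LINT p|lborel. f (fst p) * g (fst p - snd p)) = (LINT x|lborel. f x) * (LINT x|lborel. g x)"
    using lborel_fubini_fst[OF A] by (simp add: integral_reflect)
  show "(LINT p|lborel. f (snd p) * g (fst p - snd p)) = (LINT x|lborel. f x) * (LINT x|lborel. g x)"
    using lborel_fubini_snd[OF B] by (simp add: is')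
qed

section \<open>Translation moduli and jump operators\<close>

text \<open>
  \<open>BV\<close> is handled through the \<open>L\<^sup>1\<close> modulus of continuity of translations, which every
  translation-invariant \<open>L\<^sup>1\<close> contraction preserves.
\<close>

definition bvc :: "real \<Rightarrow> (real \<Rightarrow> real) \<Rightarrow> bool" where
  "bvc C w \<longleftrightarrow> integrable lborel w \<and> (LINT x|lborel. \<bar>w x\<bar>) \<le> C \<and>
     (\<forall>z. (LINT x|lborel. \<bar>w (x + z) - w x\<bar>) \<le> C * \<bar>z\<bar>)"

lemma bvcD:
  assumes "bvc C w"
  shows "integrable lborel w" "(LINT x|lborel. \<bar>w x\<bar>) \<le> C"
    "(LINT x|lborel. \<bar>w (x + z) - w x\<bar>) \<le> C * \<bar>z\<bar>" "0 \<le> C"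
    "integrable lborel (\<lambda>x. w (x + z))" "w \<in> borel_measurable borel"
proof -
  show 1: "integrable lborel w" "(LINT x|lborel. \<bar>w x\<bar>) \<le> C"
    "(LINT x|lborel. \<bar>w (x + z) - w x\<bar>) \<le> C * \<bar>z\<bar>"
    using assms by (auto simp: bvc_def)
  show "0 \<le> C" using 1(2) by (rule order_trans[rotated]) simp
  show "integrable lborel (\<lambda>x. w (x + z))" using 1 integrable_shift by blast
  show "w \<in> borel_measurable borel" using 1(1) by (rule integrable_lborel_measurable)
qed

text \<open>Short translations are controlled by the modulus, long ones by the norms of the two
  copies. The factor 2 merges both cases into the weight \<open>min 1 |z|\<close>, which is the
  weight built into \<open>kern\<close>.\<close>

lemma bvc_min:
  assumes "bvc C w"
  shows "(LINT x|lborel. \<bar>w (x + z) - w x\<bar>) \<le> 2 * C * min 1 \<bar>z\<bar>"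
proof -
  note w = bvcD[OF assms]
  have "(LINT x|lborel. \<bar>w (x + z) - w x\<bar>) \<le> (LINT x|lborel. \<bar>w (x + z)\<bar> + \<bar>w x\<bar>)"
    by (intro integral_mono) (auto intro!: Bochner_Integration.integrable_diff
        Bochner_Integration.integrable_add integrable_abs w)
  also have "\<dots> = (LINT x|lborel. \<bar>w (x + z)\<bar>) + (LINT x|lborel. \<bar>w x\<bar>)"
    by (intro Bochner_Integration.integral_add integrable_abs w)
  also have "\<dots> \<le> 2 * C" using w(2) integral_shift[of "\<lambda>x. \<bar>w x\<bar>" z] by simp
  finally have a: "(LINT x|lborel. \<bar>w (x + z) - w x\<bar>) \<le> 2 * C" .
  have "C * \<bar>z\<bar> \<le> 2 * C * \<bar>z\<bar>" using w(4) by (simp add: mult_right_mono)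
  then show ?thesis using a w(3)[of z] by (auto simp: min_def)
qed

lemma L1_diff_triangle:
  fixes f g h :: "real \<Rightarrow> real"
  assumes "integrable lborel f" "integrable lborel g" "integrable lborel h"
  shows "(LINT x|lborel. \<bar>f x - h x\<bar>) \<le> (LINT x|lborel. \<bar>f x - g x\<bar>) + (LINT x|lborel. \<bar>g x - h x\<bar>)"
proof -
  have "(LINT x|lborel. \<bar>f x - h x\<bar>) \<le> (LINT x|lborel. \<bar>f x - g x\<bar> + \<bar>g x - h x\<bar>)"
    by (intro integral_mono) (auto intro!: Bochner_Integration.integrable_diff
        Bochner_Integration.integrable_add integrable_abs assms)
  also have "\<dots> = (LINT x|lborel. \<bar>f x - g x\<bar>) + (LINT x|lborel. \<bar>g x - h x\<bar>)"
    using assms by (intro Bochner_Integration.integral_add) auto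
  finally show ?thesis .
qed

text \<open>The translate of \<open>f - g\<close> has the same norm as \<open>f - g\<close>, and
  each of the two enters once; hence the factor 2.\<close>

lemma L1_translation_limit:
  fixes f g :: "real \<Rightarrow> real"
  assumes "integrable lborel f" "integrable lborel g"
  shows "(LINT x|lborel. \<bar>f (x + z) - f x\<bar>) \<le>
         (LINT x|lborel. \<bar>g (x + z) - g x\<bar>) + 2 * (LINT x|lborel. \<bar>f x - g x\<bar>)"
proof -
  note i = integrable_shift[OF assms(1), of z] integrable_shift[OF assms(2), of z]
  have "(LINT x|lborel. \<bar>f (x + z) - f x\<bar>) \<le>
     (LINT x|lborel. \<bar>f (x + z) - g (x + z)\<bar>) + (LINT x|lborel. \<bar>g (x + z) - f x\<bar>)"
    by (intro L1_diff_triangle i assms)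
  also have "(LINT x|lborel. \<bar>g (x + z) - f x\<bar>) \<le>
     (LINT x|lborel. \<bar>g (x + z) - g x\<bar>) + (LINT x|lborel. \<bar>g x - f x\<bar>)"
    by (intro L1_diff_triangle i assms)
  finally show ?thesis
    using integral_shift[of "\<lambda>x. \<bar>f x - g x\<bar>" z] by (simp add: abs_minus_commute)
qed

text \<open>Lower semicontinuity with an unchanged constant. It carries the bound from almost every
  time to every time, and from the approximations to their limit.\<close>

lemma bvc_limit:
  assumes f: "integrable lborel f"
    and ap: "\<And>e. e > 0 \<Longrightarrow> \<exists>g. bvc C g \<and> (LINT x|lborel. \<bar>f x - g x\<bar>) < e"
  shows "bvc C f"
  unfolding bvc_def
proof (intro conjI allI f)
  show "(LINT x|lborel. \<bar>f x\<bar>) \<le> C"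
  proof (rule field_le_epsilon)
    fix e :: real assume "e > 0"
    then obtain g where g: "bvc C g" "(LINT x|lborel. \<bar>f x - g x\<bar>) < e" using ap by blast
    have "(LINT x|lborel. \<bar>f x - 0\<bar>) \<le> (LINT x|lborel. \<bar>f x - g x\<bar>) + (LINT x|lborel. \<bar>g x - 0\<bar>)"
      by (intro L1_diff_triangle f bvcD[OF g(1)]) auto
    then show "(LINT x|lborel. \<bar>f x\<bar>) \<le> C + e" using g(2) bvcD(2)[OF g(1)] by simp
  qed
  fix z
  show "(LINT x|lborel. \<bar>f (x + z) - f x\<bar>) \<le> C * \<bar>z\<bar>"
  proof (rule field_le_epsilon)
    fix e :: real assume "e > 0"
    then obtain g where g: "bvc C g" "(LINT x|lborel. \<bar>f x - g x\<bar>) < e/2" using ap[of "e/2"] by auto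
    from L1_translation_limit[OF f bvcD(1)[OF g(1)], of z] g(2) bvcD(3)[OF g(1), of z]
    show "(LINT x|lborel. \<bar>f (x + z) - f x\<bar>) \<le> C * \<bar>z\<bar> + e" by simp
  qed
qed

definition kern :: "(real \<Rightarrow> real) \<Rightarrow> bool" where
  "kern K \<longleftrightarrow> (\<forall>z. 0 \<le> K z) \<and> K \<in> borel_measurable borel \<and> integrable lborel (\<lambda>z. min 1 \<bar>z\<bar> * K z)"

definition kmass :: "(real \<Rightarrow> real) \<Rightarrow> real" where
  "kmass K = (LINT z|lborel. min 1 \<bar>z\<bar> * K z)"

definition G :: "(real \<Rightarrow> real) \<Rightarrow> (real \<Rightarrow> real) \<Rightarrow> real \<Rightarrow> real" where
  "G K w x = (LINT z|lborel. (w (x + z) - w x) * K z)"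

lemma kernD:
  assumes "kern K"
  shows "0 \<le> K z" "K \<in> borel_measurable borel" "integrable lborel (\<lambda>z. min 1 \<bar>z\<bar> * K z)" "0 \<le> kmass K"
  using assms by (auto simp: kern_def kmass_def)

text \<open>The integration over \<open>x\<close> comes first: for fixed \<open>z\<close>,
  \<open>bvc_min\<close> bounds it by \<open>2 * C * min 1 |z| * K z\<close>, which is integrable in
  \<open>z\<close>. Tonelli then gives the rest. For a singular kernel the inner integral over
  \<open>z\<close> is known to converge only for almost every \<open>x\<close>, which is why later
  splittings of \<open>G\<close> hold almost everywhere.\<close>

lemma G_pair:
  assumes w: "bvc C w" and K: "kern K"
  shows G_pair_integrable: "integrable lborel (\<lambda>p. (w (fst p + snd p) - w (fst p)) * K (snd p))" (is "integrable _ ?f")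
    and G_integrable: "integrable lborel (G K w)"
    and G_AE_integrable: "AE x in lborel. integrable lborel (\<lambda>z. (w (x + z) - w x) * K z)"
    and G_bound: "(LINT x|lborel. \<bar>G K w x\<bar>) \<le> 2 * C * kmass K"
proof -
  note W = bvcD[OF w] and k = kernD[OF K]
  note [measurable] = W(6) k(2)
  have *: "integrable lborel (\<lambda>z. LINT x|lborel. \<bar>(w (x + z) - w x) * K z\<bar>)"
  proof (rule Bochner_Integration.integrable_bound)
    show "integrable lborel (\<lambda>z. 2 * C * (min 1 \<bar>z\<bar> * K z))" using k by simp
    show "AE z in lborel. norm (LINT x|lborel. \<bar>(w (x + z) - w x) * K z\<bar>) \<le> norm (2 * C * (min 1 \<bar>z\<bar> * K z))"
    proof (rule AE_I2)
      fix z
      have "(LINT x|lborel. \<bar>(w (x + z) - w x) * K z\<bar>) = (LINT x|lborel. \<bar>w (x + z) - w x\<bar>) * K z"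
        using k(1)[of z] by (simp add: abs_mult)
      also have "\<dots> \<le> 2 * C * min 1 \<bar>z\<bar> * K z"
        by (intro mult_right_mono bvc_min w k)
      finally have "(LINT x|lborel. \<bar>(w (x + z) - w x) * K z\<bar>) \<le> 2 * C * (min 1 \<bar>z\<bar> * K z)" by simp
      then show "norm (LINT x|lborel. \<bar>(w (x + z) - w x) * K z\<bar>) \<le> norm (2 * C * (min 1 \<bar>z\<bar> * K z))"
        by simp
    qed
  qed measurable
  have "integrable lborel (\<lambda>p. (w (snd p + fst p) - w (snd p)) * K (fst p))"
    using * by (intro integrable_lborel_pairI) (auto intro!: integrable_mult_left Bochner_Integration.integrable_diff W)
  then have "integrable (lborel \<Otimes>\<^sub>M lborel) (\<lambda>(z, x). (w (x + z) - w x) * K z)"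
    by (simp add: lborel_prod case_prod_beta')
  from lborel_pair.integrable_product_swap[OF this]
  show A: "integrable lborel ?f" by (simp add: lborel_prod case_prod_beta')
  show B: "integrable lborel (G K w)"
    using lborel_integrable_fst[OF A] by (simp add: G_def[abs_def])
  show "AE x in lborel. integrable lborel (\<lambda>z. (w (x + z) - w x) * K z)"
    using lborel_AE_integrable_fst[OF A] by simp
  have A': "integrable lborel (\<lambda>p. \<bar>?f p\<bar>)" using A by simp
  have "(LINT x|lborel. \<bar>G K w x\<bar>) \<le> (LINT x|lborel. LINT z|lborel. \<bar>(w (x + z) - w x) * K z\<bar>)"
    using lborel_integrable_fst[OF A'] B[THEN integrable_abs]
    by (intro integral_mono) (auto simp: G_def intro!: integral_abs_bound)
  also have "\<dots> = (LINT z|lborel. LINT x|lborel. \<bar>(w (x + z) - w x) * K z\<bar>)"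
    using lborel_fubini_swap[OF A'] by simp
  also have "\<dots> \<le> (LINT z|lborel. 2 * C * (min 1 \<bar>z\<bar> * K z))"
  proof (intro integral_mono *)
    fix z
    have "(LINT x|lborel. \<bar>(w (x + z) - w x) * K z\<bar>) = (LINT x|lborel. \<bar>w (x + z) - w x\<bar>) * K z"
      using k(1)[of z] by (simp add: abs_mult)
    also have "\<dots> \<le> 2 * C * min 1 \<bar>z\<bar> * K z"
      by (intro mult_right_mono bvc_min w k)
    finally show "(LINT x|lborel. \<bar>(w (x + z) - w x) * K z\<bar>) \<le> 2 * C * (min 1 \<bar>z\<bar> * K z)" by simp
  qed (use k in simp)
  also have "\<dots> = 2 * C * kmass K" by (simp add: kmass_def)
  finally show "(LINT x|lborel. \<bar>G K w x\<bar>) \<le> 2 * C * kmass K" .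
qed

lemma measurable_G [measurable (raw)]:
  fixes v :: "'a::euclidean_space \<Rightarrow> real \<Rightarrow> real"
  assumes [measurable]: "(\<lambda>p. v (fst p) (snd p)) \<in> borel_measurable borel" "K \<in> borel_measurable borel"
    "g \<in> borel_measurable borel"
  shows "(\<lambda>s. G K (v s) (g s)) \<in> borel_measurable borel"
proof -
  have *: "(\<lambda>p. v (h p) (j p)) \<in> borel_measurable borel"
    if [measurable]: "h \<in> borel_measurable borel" "j \<in> borel_measurable borel"
    for h :: "'a \<times> real \<Rightarrow> 'a" and j
    using measurable_compose[OF borel_measurable_Pair[OF that] assms(1)] by simp
  have "(\<lambda>p. (v (fst p) (g (fst p) + snd p) - v (fst p) (g (fst p))) * K (snd p)) \<in> borel_measurable borel"
    by (intro borel_measurable_times borel_measurable_diff *) measurable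
  then have "(\<lambda>(s,z). (v s (g s + z) - v s (g s)) * K z) \<in> borel_measurable (borel \<Otimes>\<^sub>M lborel)"
    by (subst measurable_cong_sets[OF sets_pair_measure_cong[OF refl sets_lborel] refl])
       (simp add: borel_prod case_prod_beta')
  from sigma_finite_measure.borel_measurable_lebesgue_integral[OF _ this]
  show ?thesis unfolding G_def by (simp add: sigma_finite_lborel)
qed

text \<open>For a kernel of finite mass the operator is Lipschitz on all of \<open>L1\<close>: each
  end point of the jump costs one mass of the kernel. The pointwise integrability assumptions allow
  the two integrals to be subtracted at every \<open>x\<close>.\<close>

lemma G_diff_w:
  assumes w: "integrable lborel w1" "integrable lborel w2" and K: "\<And>z. 0 \<le> K z" "integrable lborel K"
     "\<And>x. integrable lborel (\<lambda>z. (w1 (x + z) - w1 x) * K z)" "\<And>x. integrable lborel (\<lambda>z. (w2 (x + z) - w2 x) * K z)"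
  shows "integrable lborel (\<lambda>x. G K w1 x - G K w2 x)"
    "(LINT x|lborel. \<bar>G K w1 x - G K w2 x\<bar>) \<le> 2 * (LINT z|lborel. K z) * (LINT x|lborel. \<bar>w1 x - w2 x\<bar>)"
proof -
  note [measurable] = w[THEN integrable_lborel_measurable] K(2)[THEN integrable_lborel_measurable]
  define d where "d = (\<lambda>x. w1 x - w2 x)"
  have di: "integrable lborel d" unfolding d_def using w by simp
  note [measurable] = di[THEN integrable_lborel_measurable]
  let ?f = "\<lambda>p. (d (fst p + snd p) - d (fst p)) * K (snd p)"
  have ds: "integrable lborel (\<lambda>x. d (x + z))" for z using integrable_shift[OF di] .
  have e: "(LINT x|lborel. \<bar>(d (x + z) - d x) * K z\<bar>) \<le> 2 * (LINT x|lborel. \<bar>d x\<bar>) * K z" for z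
  proof -
    have "(LINT x|lborel. \<bar>(d (x + z) - d x) * K z\<bar>) \<le> (LINT x|lborel. (\<bar>d (x + z)\<bar> + \<bar>d x\<bar>) * K z)"
      using K(1) by (intro integral_mono)
        (auto intro!: integrable_abs integrable_mult_left Bochner_Integration.integrable_diff
         Bochner_Integration.integrable_add ds di mult_right_mono simp: abs_mult)
    also have "\<dots> = ((LINT x|lborel. \<bar>d (x + z)\<bar>) + (LINT x|lborel. \<bar>d x\<bar>)) * K z"
      using integrable_abs[OF ds] integrable_abs[OF di] by simp
    also have "(LINT x|lborel. \<bar>d (x + z)\<bar>) = (LINT x|lborel. \<bar>d x\<bar>)" using integral_shift[of "\<lambda>x. \<bar>d x\<bar>" z] .
    finally show ?thesis by simp
  qed
  have *: "integrable lborel (\<lambda>z. LINT x|lborel. \<bar>(d (x + z) - d x) * K z\<bar>)"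
  proof (rule Bochner_Integration.integrable_bound)
    show "integrable lborel (\<lambda>z. 2 * (LINT x|lborel. \<bar>d x\<bar>) * K z)" using K by simp
    show "AE z in lborel. norm (LINT x|lborel. \<bar>(d (x + z) - d x) * K z\<bar>) \<le> norm (2 * (LINT x|lborel. \<bar>d x\<bar>) * K z)"
      using e K(1) by (auto intro!: AE_I2)
  qed measurable
  have "integrable lborel (\<lambda>p. (d (snd p + fst p) - d (snd p)) * K (fst p))"
    using * by (intro integrable_lborel_pairI)
      (auto intro!: integrable_mult_left Bochner_Integration.integrable_diff ds di)
  then have "integrable (lborel \<Otimes>\<^sub>M lborel) (\<lambda>(z, x). (d (x + z) - d x) * K z)"
    by (simp add: lborel_prod case_prod_beta')
  from lborel_pair.integrable_product_swap[OF this]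
  have A: "integrable lborel ?f" by (simp add: lborel_prod case_prod_beta')
  have A': "integrable lborel (\<lambda>p. \<bar>?f p\<bar>)" using A by simp
  have eq: "G K w1 x - G K w2 x = (LINT z|lborel. (d (x + z) - d x) * K z)" for x
    unfolding G_def d_def Bochner_Integration.integral_diff[OF K(3,4), symmetric]
    by (simp add: left_diff_distrib right_diff_distrib algebra_simps)
  show B: "integrable lborel (\<lambda>x. G K w1 x - G K w2 x)"
    using lborel_integrable_fst[OF A] by (simp add: eq)
  have "(LINT x|lborel. \<bar>G K w1 x - G K w2 x\<bar>) \<le> (LINT x|lborel. LINT z|lborel. \<bar>(d (x + z) - d x) * K z\<bar>)"
    using lborel_integrable_fst[OF A'] B[THEN integrable_abs]
    by (intro integral_mono) (auto simp: eq intro!: integral_abs_bound)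
  also have "\<dots> = (LINT z|lborel. LINT x|lborel. \<bar>(d (x + z) - d x) * K z\<bar>)"
    using lborel_fubini_swap[OF A'] by simp
  also have "\<dots> \<le> (LINT z|lborel. 2 * (LINT x|lborel. \<bar>d x\<bar>) * K z)"
    by (intro integral_mono * e) (use K in simp)
  finally show "(LINT x|lborel. \<bar>G K w1 x - G K w2 x\<bar>) \<le> 2 * (LINT z|lborel. K z) * (LINT x|lborel. \<bar>w1 x - w2 x\<bar>)"
    by (simp add: d_def ac_simps)
qed

section \<open>The kernel of the fractional Laplacian\<close>

definition J :: "real \<Rightarrow> real \<Rightarrow> real" where
  "J lam z = c_frac lam / \<bar>z\<bar> powr (1 + lam)"

text \<open>The increment vanishes at \<open>z = 0\<close>, so the two integrands agree everywhere,
  including the origin excluded on the left.\<close>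

lemma frac_laplace_eq_G: "frac_laplace lam v x = G (J lam) v x"
proof -
  have "frac_laplace lam v x = (LINT z|lborel. c_frac lam * (indicator {z. \<bar>z\<bar> > 0} z *\<^sub>R ((v (x + z) - v x) / \<bar>z\<bar> powr (1 + lam))))"
    unfolding frac_laplace_def set_lebesgue_integral_def by (rule integral_mult_right_zero[symmetric])
  also have "\<dots> = G (J lam) v x"
    unfolding G_def J_def by (intro Bochner_Integration.integral_cong) (auto simp: indicator_def)
  finally show ?thesis .
qed

lemma c_frac_nonneg:
  assumes "0 < lam" "lam < 1"
  shows "0 \<le> c_frac lam"
  unfolding c_frac_def using assms by (auto intro!: divide_nonneg_nonneg mult_nonneg_nonneg Gamma_real_nonneg)

lemma integrable_lborel_from_has_integral:
  fixes f :: "real \<Rightarrow> real"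
  assumes "(f has_integral I) S" "f \<in> borel_measurable borel" "S \<in> sets borel" "\<And>x. x \<in> S \<Longrightarrow> 0 \<le> f x"
  shows "integrable lborel (\<lambda>x. indicator S x * f x)"
proof -
  have "f absolutely_integrable_on S"
    using assms by (intro nonnegative_absolutely_integrable_1) (auto simp: integrable_on_def)
  then have "integrable lebesgue (\<lambda>x. indicator S x *\<^sub>R f x)"
    by (simp add: set_integrable_def)
  then show ?thesis using assms
    by (subst (asm) integrable_completion) auto
qed

lemma integrable_even:
  fixes f :: "real \<Rightarrow> real"
  assumes "integrable lborel (\<lambda>x. indicator {0<..} x * f x)" "\<And>x. f (- x) = f x"
  shows "integrable lborel f"
proof -
  have 1: "integrable lborel (\<lambda>x. indicator {..<0} x * f x)"
    using lborel_integrable_real_affine[OF assms(1), of "-1" 0]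
    by (rule back_subst[of "integrable lborel"]) (auto simp: indicator_def assms(2))
  have 2: "integrable lborel (\<lambda>x. indicator {0} x * f 0)" by simp
  show ?thesis
    by (rule back_subst[of "integrable lborel", OF Bochner_Integration.integrable_add[OF Bochner_Integration.integrable_add[OF 1 2] assms(1)]])
       (auto simp: indicator_def fun_eq_iff)
qed

lemma J_nonneg: "0 < lam \<Longrightarrow> lam < 1 \<Longrightarrow> 0 \<le> J lam z"
  unfolding J_def using c_frac_nonneg by auto

lemma measurable_J [measurable]: "J lam \<in> borel_measurable borel"
  unfolding J_def by measurable

text \<open>Near the origin the weighted kernel is a multiple of \<open>x powr (- lam)\<close>,
  integrable because \<open>lam < 1\<close>; at infinity it is a multiple of
  \<open>x powr (-1 - lam)\<close>, integrable because \<open>0 < lam\<close>. The negative half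
  line follows by symmetry.\<close>

lemma kern_J:
  assumes "0 < lam" "lam < 1"
  shows "kern (J lam)"
proof -
  have "integrable lborel (\<lambda>x. indicator {0<..} x * (min 1 \<bar>x\<bar> * J lam x))"
  proof -
    have a: "integrable lborel (\<lambda>x. indicator {0..1} x * (x powr (- lam)))"
      using assms by (intro integrable_lborel_from_has_integral[OF has_integral_powr_from_0]) auto
    have b: "integrable lborel (\<lambda>x. indicator {1..} x * (x powr (-1 - lam)))"
      using assms by (intro integrable_lborel_from_has_integral[OF has_integral_powr_to_inf]) auto
    have "integrable lborel (\<lambda>x. c_frac lam * (indicator {0..1} x * (x powr (- lam)) + indicator {1..} x * (x powr (-1 - lam))))"
      using a b by simp
    then show ?thesis
    proof (rule Bochner_Integration.integrable_bound)
      show "AE x in lborel. norm (indicator {0<..} x * (min 1 \<bar>x\<bar> * J lam x)) \<le>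
        norm (c_frac lam * (indicator {0..1} x * (x powr (- lam)) + indicator {1..} x * (x powr (-1 - lam))))"
      proof (rule AE_I2)
        fix x :: real
        have c: "0 \<le> c_frac lam" using c_frac_nonneg assms by blast
        consider "x \<le> 0" | "0 < x" "x < 1" | "x \<ge> 1" by linarith
        then show "norm (indicator {0<..} x * (min 1 \<bar>x\<bar> * J lam x)) \<le>
          norm (c_frac lam * (indicator {0..1} x * (x powr (- lam)) + indicator {1..} x * (x powr (-1 - lam))))"
        proof cases
          case 2
          have "x * (c_frac lam / x powr (1 + lam)) = c_frac lam * x powr (- lam)"
            using 2 by (simp add: powr_add powr_minus field_simps)
          then show ?thesis using 2 c by (simp add: J_def)
        next
          case 3
          have "c_frac lam / x powr (1 + lam) = c_frac lam * x powr (-1 - lam)"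
            using 3 by (simp add: powr_minus_divide[symmetric] divide_powr_uminus)
          moreover have "c_frac lam * x powr (-1 - lam) \<le> c_frac lam * (x powr (- lam) * indicator {0..1} x + x powr (-1 - lam))"
            using c by (intro mult_left_mono) auto
          ultimately show ?thesis using 3 c by (simp add: J_def mult.commute)
        qed simp
      qed
    qed measurable
  qed
  then have "integrable lborel (\<lambda>x. min 1 \<bar>x\<bar> * J lam x)"
    by (rule integrable_even) (simp add: J_def)
  then show ?thesis unfolding kern_def using J_nonneg[OF assms] by auto
qed

text \<open>The far part has finite mass and can enter an explicit scheme; the near part carries the
  singularity but has small weighted mass \<open>kmass\<close>.\<close>

definition far_part :: "real \<Rightarrow> (real \<Rightarrow> real) \<Rightarrow> real \<Rightarrow> real" where
  "far_part r K z = (if \<bar>z\<bar> > r then K z else 0)"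

definition near_part :: "real \<Rightarrow> (real \<Rightarrow> real) \<Rightarrow> real \<Rightarrow> real" where
  "near_part r K z = (if \<bar>z\<bar> > r then 0 else K z)"

lemma measurable_far_part_near_part [measurable]:
  assumes [measurable]: "K \<in> borel_measurable borel"
  shows "far_part r K \<in> borel_measurable borel" "near_part r K \<in> borel_measurable borel"
  unfolding far_part_def near_part_def by measurable

lemma kern_far_part: assumes K: "kern K" shows "kern (far_part r K)" and "kern (near_part r K)"
  and "kmass (far_part r K) \<le> kmass K"
proof -
  note [measurable] = kernD(2)[OF K]
  have *: "integrable lborel (\<lambda>z. min 1 \<bar>z\<bar> * far_part r K z)" "integrable lborel (\<lambda>z. min 1 \<bar>z\<bar> * near_part r K z)"
    by (rule Bochner_Integration.integrable_bound[OF kernD(3)[OF K]];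
        auto simp: far_part_def near_part_def)+
  show "kern (far_part r K)" "kern (near_part r K)"
    unfolding kern_def using kernD(1)[OF K] * by (auto simp: far_part_def near_part_def)
  show "kmass (far_part r K) \<le> kmass K" unfolding kmass_def
    by (intro integral_mono * kernD(3)[OF K]) (use kernD(1)[OF K] in \<open>auto simp: far_part_def\<close>)
qed

lemma integrable_far_part: assumes K: "kern K" and r: "0 < r" shows "integrable lborel (far_part r K)"
proof -
  note [measurable] = kernD(2)[OF K]
  have "integrable lborel (\<lambda>z. (1 / min 1 r) * (min 1 \<bar>z\<bar> * K z))" using kernD(3)[OF K] by simp
  then show ?thesis
  proof (rule Bochner_Integration.integrable_bound)
    show "AE z in lborel. norm (far_part r K z) \<le> norm ((1 / min 1 r) * (min 1 \<bar>z\<bar> * K z))"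
    proof (rule AE_I2)
      fix z
      have "min 1 r * K z \<le> min 1 \<bar>z\<bar> * K z" if "\<bar>z\<bar> > r"
        using that kernD(1)[OF K, of z] by (intro mult_right_mono) auto
      then show "norm (far_part r K z) \<le> norm ((1 / min 1 r) * (min 1 \<bar>z\<bar> * K z))"
        using kernD(1)[OF K, of z] r by (auto simp: far_part_def field_simps)
    qed
  qed measurable
qed

text \<open>Dominated convergence, the weight taking care of the origin. Together with
  \<open>G_far_part_error\<close> this makes the truncation error small uniformly over all functions
  with the same \<open>bvc\<close> constant.\<close>

lemma kmass_near_part_tendsto:
  assumes K: "kern K" and r: "r \<longlonglongrightarrow> 0"
  shows "(\<lambda>n. kmass (near_part (r n) K)) \<longlonglongrightarrow> 0"
proof -
  note [measurable] = kernD(2)[OF K]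
  have "(\<lambda>n. LINT z|lborel. min 1 \<bar>z\<bar> * near_part (r n) K z) \<longlonglongrightarrow> integral\<^sup>L lborel (\<lambda>z::real. 0::real)"
  proof (rule integral_dominated_convergence[where w="\<lambda>z. min 1 \<bar>z\<bar> * K z"])
    show "AE z in lborel. (\<lambda>n. min 1 \<bar>z\<bar> * near_part (r n) K z) \<longlonglongrightarrow> 0"
    proof (rule AE_I2)
      fix z :: real
      show "(\<lambda>n. min 1 \<bar>z\<bar> * near_part (r n) K z) \<longlonglongrightarrow> 0"
      proof (cases "z = 0")
        case False
        then have "eventually (\<lambda>n. r n < \<bar>z\<bar>) sequentially"
          using order_tendstoD(2)[OF r, of "\<bar>z\<bar>"] by simp
        then show ?thesis
          by (intro tendsto_eventually) (elim eventually_mono, simp add: near_part_def)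
      qed simp
    qed
    show "AE z in lborel. norm (min 1 \<bar>z\<bar> * near_part (r n) K z) \<le> min 1 \<bar>z\<bar> * K z" for n
      using kernD(1)[OF K] by (auto simp: near_part_def)
  qed (use kernD(3)[OF K] in measurable)
  then show ?thesis by (simp add: kmass_def)
qed

lemma G_far_part_split:
  assumes w: "bvc C w" and K: "kern K"
  shows "AE x in lborel. G K w x - G (far_part r K) w x = G (near_part r K) w x"
  using G_AE_integrable[OF w kern_far_part(1)[OF K, of r]] G_AE_integrable[OF w kern_far_part(2)[OF K, of r]]
proof eventually_elim
  case (elim x)
  have "G K w x = (LINT z|lborel. (w (x + z) - w x) * far_part r K z + (w (x + z) - w x) * near_part r K z)"
    unfolding G_def by (intro Bochner_Integration.integral_cong) (auto simp: far_part_def near_part_def)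
  also have "\<dots> = G (far_part r K) w x + G (near_part r K) w x"
    unfolding G_def by (intro Bochner_Integration.integral_add elim)
  finally show ?case by simp
qed

lemma G_far_part_error:
  assumes w: "bvc C w" and K: "kern K"
  shows "(LINT x|lborel. \<bar>G K w x - G (far_part r K) w x\<bar>) \<le> 2 * C * kmass (near_part r K)"
proof -
  have "(LINT x|lborel. \<bar>G K w x - G (far_part r K) w x\<bar>) = (LINT x|lborel. \<bar>G (near_part r K) w x\<bar>)"
    using G_far_part_split[OF w K, of r] G_integrable[OF w K] G_integrable[OF w kern_far_part(1)[OF K]] G_integrable[OF w kern_far_part(2)[OF K]]
    by (intro integral_cong_AE) auto
  also have "\<dots> \<le> 2 * C * kmass (near_part r K)" by (rule G_bound[OF w kern_far_part(2)[OF K]])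
  finally show ?thesis .
qed

lemma integrable_bounded_mult:
  fixes f g :: "'a::euclidean_space \<Rightarrow> real"
  assumes "integrable lborel f" "g \<in> borel_measurable borel" "\<And>x. \<bar>g x\<bar> \<le> B"
  shows "integrable lborel (\<lambda>x. f x * g x)" "integrable lborel (\<lambda>x. g x * f x)"
proof -
  note [measurable] = assms(2) borel_measurable_integrable[OF assms(1)]
  show 1: "integrable lborel (\<lambda>x. f x * g x)"
    by (rule Bochner_Integration.integrable_bound[OF integrable_mult_left[OF assms(1), of B]])
       (use assms(3) in \<open>auto simp: abs_mult intro!: mult_left_mono order_trans[OF assms(3)] AE_I2\<close>)
  then show "integrable lborel (\<lambda>x. g x * f x)" by (simp add: mult.commute)
qed

text \<open>The mean of \<open>w\<close> over an interval of length \<open>h\<close> ending at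
  \<open>x\<close> is \<open>1 / h\<close> times the integral of \<open>w s - w (s - h)\<close> over
  the half line up to \<open>x\<close>, because everything further left cancels. The translation
  modulus bounds this by \<open>C\<close>. The means converge to \<open>w\<close> almost everywhere
  along a subsequence.\<close>

lemma AE_bounded_bvc:
  assumes w: "bvc C w"
  shows "AE x in lborel. \<bar>w x\<bar> \<le> C"
proof -
  note W = bvcD[OF w]
  note [measurable] = W(6)
  \<comment> \<open>The uniform probability density on an interval ending at the origin. With this
    kernel \<open>G (K n) w x\<close> is exactly the mean over the interval minus
    \<open>w x\<close>, so \<open>G_bound\<close> yields the \<open>L1\<close> convergence of the
    means.\<close>
  define K where "K = (\<lambda>n z. real (Suc n) * indicator {- 1 / real (Suc n) .. 0} z :: real)"
  have [measurable]: "K n \<in> borel_measurable borel" for n unfolding K_def by measurable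
  have Ki: "integrable lborel (K n)" for n unfolding K_def by (intro integrable_mult_right) (auto intro!: integrable_real_indicator)
  have Kint: "(LINT z|lborel. K n z) = 1" for n unfolding K_def by simp
  have Kn: "0 \<le> K n z" for n z by (simp add: K_def)
  have mi: "integrable lborel (\<lambda>z. min 1 \<bar>z\<bar> * K n z)" for n
    by (rule integrable_bounded_mult(2)[OF Ki, where B=1]) auto
  have k: "kern (K n)" for n unfolding kern_def using Kn mi by auto
  have km: "kmass (K n) \<le> 1 / real (Suc n)" for n
  proof -
    have "kmass (K n) \<le> (LINT z|lborel. (1 / real (Suc n)) * K n z)"
      unfolding kmass_def
    proof (intro integral_mono mi integrable_mult_right Ki)
      fix z show "min 1 \<bar>z\<bar> * K n z \<le> 1 / real (Suc n) * K n z"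
      proof (cases "z \<in> {- 1 / real (Suc n) .. 0}")
        case True
        then have "min 1 \<bar>z\<bar> \<le> 1 / real (Suc n)" by auto
        then show ?thesis using Kn by (rule mult_right_mono)
      qed (auto simp: K_def)
    qed
    then show ?thesis using Kint by simp
  qed
  have lim: "(\<lambda>n. LINT x|lborel. norm (G (K n) w x)) \<longlonglongrightarrow> 0"
  proof (rule tendsto_sandwich[OF _ _ tendsto_const])
    show "\<forall>\<^sub>F n in sequentially. (LINT x|lborel. norm (G (K n) w x)) \<le> 2 * C * (1 / real (Suc n))"
    proof (rule always_eventually, rule allI)
      fix n
      have "(LINT x|lborel. norm (G (K n) w x)) \<le> 2 * C * kmass (K n)" using G_bound[OF w k, of n] by simp
      also have "\<dots> \<le> 2 * C * (1 / real (Suc n))" using W(4) km by (intro mult_left_mono) auto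
      finally show "(LINT x|lborel. norm (G (K n) w x)) \<le> 2 * C * (1 / real (Suc n))" .
    qed
    show "(\<lambda>n. 2 * C * (1 / real (Suc n))) \<longlonglongrightarrow> 0"
      using tendsto_mult_right_zero[OF LIMSEQ_inverse_real_of_nat, of "2*C"] by (simp add: inverse_eq_divide)
  qed auto
  from tendsto_L1_AE_subseq[OF G_integrable[OF w k] lim]
  obtain s where s: "strict_mono s" "AE x in lborel. (\<lambda>n. G (K (s n)) w x) \<longlonglongrightarrow> 0" by blast
  have avg: "\<bar>LINT z|lborel. w (x + z) * K n z\<bar> \<le> C" for x n
  proof -
    define h where "h = 1 / real (Suc n)"
    have h: "0 < h" "real (Suc n) = 1 / h" unfolding h_def by auto
    have Kh: "K n = (\<lambda>z. (1 / h) * indicator {- h..0} z)" by (simp add: K_def h_def)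
    \<comment> \<open>The primitive of \<open>w\<close> from minus infinity; shifting its end point
      by \<open>h\<close> is the same as shifting the integrand.\<close>
    define I where "I = (\<lambda>y. LINT s|lborel. indicator {..y} s * w s)"
    have ii: "integrable lborel (\<lambda>s. indicator {..y} s * w s)" for y
      by (rule integrable_bounded_mult(2)[OF W(1), where B=1]) (auto simp: indicator_def)
    have sh: "I (x - h) = (LINT s|lborel. indicator {..x} s * w (s - h))"
    proof -
      have "(LINT s|lborel. indicator {..x} s * w (s - h)) = (LINT s|lborel. indicator {..x} (s + h) * w ((s + h) - h))"
        by (rule integral_shift[symmetric])
      also have "\<dots> = I (x - h)" unfolding I_def
        by (intro Bochner_Integration.integral_cong) (auto simp: indicator_def)
      finally show ?thesis by simp
    qed
    have wsh: "integrable lborel (\<lambda>s. w (s - h))" using integrable_shift[OF W(1), of "-h"] by simp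
    have ish: "integrable lborel (\<lambda>s. indicator {..x} s * w (s - h))"
      by (rule integrable_bounded_mult(2)[OF wsh, where B=1]) (auto simp: indicator_def)
    have "(LINT z|lborel. w (x + z) * K n z) = (LINT s|lborel. w s * K n (s - x))"
      using integral_shift[of "\<lambda>s. w s * K n (s - x)" x] by (simp add: add.commute)
    also have "\<dots> = (LINT s|lborel. (1 / h) * (indicator {x-h..x} s * w s))"
      by (intro Bochner_Integration.integral_cong) (auto simp: Kh indicator_def)
    also have "\<dots> = (1 / h) * (LINT s|lborel. indicator {x-h..x} s * w s)" by simp
    also have "(LINT s|lborel. indicator {x-h..x} s * w s) = (LINT s|lborel. indicator {..x} s * w s - indicator {..x-h} s * w s)"
    proof (intro integral_cong_AE)
      have "AE s in lborel. s \<noteq> x - h" by (simp add: AE_lborel_singleton)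
      then show "AE s in lborel. indicator {x-h..x} s * w s = indicator {..x} s * w s - indicator {..x-h} s * w s"
        by eventually_elim (use h in \<open>auto simp: indicator_def\<close>)
    qed measurable
    also have "\<dots> = I x - I (x - h)" unfolding I_def by (intro Bochner_Integration.integral_diff ii)
    also have "\<dots> = (LINT s|lborel. indicator {..x} s * w s - indicator {..x} s * w (s - h))"
      unfolding sh unfolding I_def by (rule Bochner_Integration.integral_diff[symmetric, OF ii ish])
    finally have e: "(LINT z|lborel. w (x + z) * K n z) = (1 / h) * (LINT s|lborel. indicator {..x} s * w s - indicator {..x} s * w (s - h))" .
    have "\<bar>LINT s|lborel. indicator {..x} s * w s - indicator {..x} s * w (s - h)\<bar> \<le> (LINT s|lborel. \<bar>w (s + (-h)) - w s\<bar>)"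
    proof (intro order_trans[OF integral_abs_bound] integral_mono integrable_abs Bochner_Integration.integrable_diff ii ish)
      fix s show "\<bar>indicator {..x} s * w s - indicator {..x} s * w (s - h)\<bar> \<le> \<bar>w (s + (-h)) - w s\<bar>"
        by (auto simp: indicator_def)
    qed (use W(1) W(5)[of "-h"] in auto)
    also have "\<dots> \<le> C * h" using W(3)[of "-h"] h by simp
    finally show ?thesis unfolding e using h by (simp add: abs_mult field_simps)
  qed
  show ?thesis using s(2)
  proof eventually_elim
    case (elim x)
    have iw: "integrable lborel (\<lambda>z. w (x + z) * K n z)" for n
      using integrable_shift[OF W(1), of x]
      by (intro integrable_bounded_mult(1)[where B="real (Suc n)"]) (auto simp: K_def indicator_def add.commute)
    have g: "G (K n) w x = (LINT z|lborel. w (x + z) * K n z) - w x" for n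
      unfolding G_def left_diff_distrib using iw Ki Kint by simp
    have "\<bar>w x\<bar> \<le> C + \<bar>G (K (s n)) w x\<bar>" for n
      using avg[of x "s n"] g[of "s n"] by linarith
    moreover have "(\<lambda>n. C + \<bar>G (K (s n)) w x\<bar>) \<longlonglongrightarrow> C + 0"
      using elim by (intro tendsto_add tendsto_const tendsto_rabs_zero)
    ultimately show "\<bar>w x\<bar> \<le> C" by (intro LIMSEQ_le_const[where x=C]) auto
  qed
qed

section \<open>Total variation and the translation modulus\<close>

definition cutoff :: "real \<Rightarrow> real \<Rightarrow> real" where
  "cutoff n x = max 0 (min 1 (n - \<bar>x\<bar>))"

lemma compact_supportI:
  fixes f :: "'a::euclidean_space \<Rightarrow> real"
  assumes "\<And>x. norm x > R \<Longrightarrow> f x = 0"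
  shows "compact (closure {x. f x \<noteq> 0})"
proof -
  have "{x. f x \<noteq> 0} \<subseteq> cball 0 R" using assms by (auto simp: not_less[symmetric])
  then show ?thesis
    by (meson bounded_cball bounded_subset compact_closure)
qed

lemma compact_supportE:
  fixes f :: "'a::euclidean_space \<Rightarrow> real"
  assumes "compact (closure {x. f x \<noteq> 0})"
  obtains R where "R > 0" "\<And>x. norm x > R \<Longrightarrow> f x = 0"
proof -
  have "bounded {x. f x \<noteq> 0}" using assms compact_closure by blast
  then obtain R where "R > 0" "\<forall>x\<in>{x. f x \<noteq> 0}. norm x \<le> R" using bounded_pos by blast
  then show ?thesis by (intro that[of R]) (auto simp: not_le[symmetric])
qed

text \<open>The optimal test function \<open>sgn g\<close> is approximated almost everywhere by
  continuous functions, since measurable functions are such limits. Clipping to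
  \<open>[-1, 1]\<close> and multiplying by \<open>cutoff\<close> make the approximants admissible
  without changing the limit, and \<open>|g|\<close> dominates.\<close>

lemma L1_norm_dual:
  fixes g :: "real \<Rightarrow> real"
  assumes g: "integrable lborel g"
    and b: "\<And>\<phi>. continuous_on UNIV \<phi> \<Longrightarrow> compact (closure {x. \<phi> x \<noteq> 0}) \<Longrightarrow> (\<And>x. \<bar>\<phi> x\<bar> \<le> 1) \<Longrightarrow>
       (LINT x|lborel. g x * \<phi> x) \<le> c"
  shows "(LINT x|lborel. \<bar>g x\<bar>) \<le> c"
proof -
  note [measurable] = integrable_lborel_measurable[OF g]
  have "(\<lambda>x. sgn (g x)) \<in> borel_measurable lebesgue" by (intro measurable_completion) measurable
  then have "(\<lambda>x. sgn (g x)) measurable_on UNIV" by (rule lebesgue_measurable_imp_measurable_on) simp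
  then obtain N s where N: "negligible N" and s: "\<And>n. continuous_on UNIV (s n)"
    and l: "\<And>x. x \<notin> N \<Longrightarrow> (\<lambda>n. s n x) \<longlonglongrightarrow> sgn (g x)"
    unfolding measurable_on_def by auto
  define \<phi> where "\<phi> n x = max (-1) (min 1 (s n x)) * cutoff (real n) x" for n x
  have c: "continuous_on UNIV (\<phi> n)" for n
    unfolding \<phi>_def cutoff_def by (intro continuous_intros s)
  note [measurable] = borel_measurable_continuous_onI[OF c]
  have b1: "\<bar>\<phi> n x\<bar> \<le> 1" for n x
    unfolding \<phi>_def abs_mult by (intro mult_le_one) (auto simp: cutoff_def)
  have le: "(LINT x|lborel. g x * \<phi> n x) \<le> c" for n
    by (intro b c b1 compact_supportI[of "real n"]) (auto simp: \<phi>_def cutoff_def)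
  have ae: "AE x in lborel. x \<notin> N"
    using N by (metis AE_completion_iff AE_not_in negligible_iff_null_sets)
  have "(\<lambda>n. LINT x|lborel. g x * \<phi> n x) \<longlonglongrightarrow> (LINT x|lborel. \<bar>g x\<bar>)"
  proof (rule integral_dominated_convergence[where w="\<lambda>x. \<bar>g x\<bar>"])
    show "AE x in lborel. (\<lambda>n. g x * \<phi> n x) \<longlonglongrightarrow> \<bar>g x\<bar>"
      using ae
    proof eventually_elim
      case (elim x)
      have "eventually (\<lambda>n. cutoff (real n) x = 1) sequentially"
      proof -
        have "eventually (\<lambda>n. 1 + \<bar>x\<bar> \<le> real n) sequentially"
          using filterlim_real_sequentially by (simp add: filterlim_at_top)
        then show ?thesis by eventually_elim (auto simp: cutoff_def)
      qed
      then have "(\<lambda>n. cutoff (real n) x) \<longlonglongrightarrow> 1" by (rule tendsto_eventually)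
      moreover have "(\<lambda>n. max (-1) (min 1 (s n x))) \<longlonglongrightarrow> max (-1) (min 1 (sgn (g x)))"
        by (intro tendsto_intros l elim)
      ultimately have "(\<lambda>n. g x * \<phi> n x) \<longlonglongrightarrow> g x * (max (-1) (min 1 (sgn (g x))) * 1)"
        unfolding \<phi>_def by (intro tendsto_mult tendsto_const)
      moreover have "g x * (max (-1) (min 1 (sgn (g x))) * 1) = \<bar>g x\<bar>" by (auto simp: sgn_if)
      ultimately show ?case by simp
    qed
    show "AE x in lborel. norm (g x * \<phi> n x) \<le> \<bar>g x\<bar>" for n
      using b1 by (auto simp: abs_mult intro!: mult_left_le AE_I2)
  qed (use g in auto)
  then show ?thesis by (rule LIMSEQ_le_const2) (use le in auto)
qed

lemma DERIV_antiderivative_bounds: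
  fixes P \<phi> :: "real \<Rightarrow> real"
  assumes P: "\<And>x. (P has_real_derivative \<phi> x) (at x)" and z: "z > 0"
  obtains \<xi> where "x - z < \<xi>" "\<xi> < x" "P x - P (x - z) = z * \<phi> \<xi>"
proof -
  have "\<exists>\<xi>. x - z < \<xi> \<and> \<xi> < x \<and> P x - P (x - z) = (x - (x - z)) * \<phi> \<xi>"
    by (rule MVT2) (use z P in auto)
  then show ?thesis using that by auto
qed

text \<open>By duality it is enough to test \<open>w (x + z) - w x\<close> with
  \<open>\<phi>\<close>. Moving the shift to \<open>\<phi>\<close> turns the difference into
  \<open>z\<close> times the derivative of \<open>\<psi>\<close>, where \<open>\<psi>\<close> is
  minus the mean of \<open>\<phi>\<close> over an interval of length \<open>z\<close>. A mean keeps
  the bound 1, the compact support, and gains a derivative, so \<open>\<psi>\<close> competes in the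
  supremum. Negative \<open>z\<close> reduces to positive \<open>z\<close> by a translation.\<close>

lemma total_variation_translation:
  assumes w: "integrable lborel w" and tv: "total_variation w \<le> ereal V"
  shows "(LINT x|lborel. \<bar>w (x + z) - w x\<bar>) \<le> V * \<bar>z\<bar>"
proof -
  have pos: "(LINT x|lborel. \<bar>w (x + z) - w x\<bar>) \<le> V * z" if z: "z > 0" for z
  proof (rule L1_norm_dual)
    have wz: "integrable lborel (\<lambda>x. w (x + z))" using integrable_shift[OF w] .
    show "integrable lborel (\<lambda>x. w (x + z) - w x)" using wz w by simp
    fix \<phi> :: "real \<Rightarrow> real"
    assume c: "continuous_on UNIV \<phi>" and s: "compact (closure {x. \<phi> x \<noteq> 0})" and b: "\<And>x. \<bar>\<phi> x\<bar> \<le> 1"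
    note [measurable] = borel_measurable_continuous_onI[OF c]
    have "\<exists>F. \<forall>x::real. -\<infinity> < ereal x \<longrightarrow> ereal x < \<infinity> \<longrightarrow> (F has_vector_derivative \<phi> x) (at x)"
      by (rule einterval_antiderivative) (use c in \<open>auto simp: continuous_on_eq_continuous_at\<close>)
    then obtain P where P: "\<And>x. (P has_real_derivative \<phi> x) (at x)"
      by (auto simp: has_real_derivative_iff_has_vector_derivative)
    define \<psi> where "\<psi> x = (P (x - z) - P x) / z" for x
    have d: "(\<psi> has_real_derivative (\<phi> (x - z) - \<phi> x) / z) (at x)" for x
      unfolding \<psi>_def using z by (auto intro!: derivative_eq_intros P[THEN DERIV_chain2])
    obtain R where R: "R > 0" "\<And>x. norm x > R \<Longrightarrow> \<phi> x = 0" using compact_supportE[OF s] by metis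
    have "\<psi> \<in> {\<phi> :: real \<Rightarrow> real. \<phi> C1_differentiable_on UNIV \<and>
                  compact (closure {x. \<phi> x \<noteq> 0}) \<and> (\<forall>x. \<bar>\<phi> x\<bar> \<le> 1)}"
    proof (intro CollectI conjI allI)
      show "\<psi> C1_differentiable_on UNIV" unfolding C1_differentiable_on_def
        using z by (intro exI[of _ "\<lambda>x. (\<phi> (x - z) - \<phi> x) / z"])
          (auto intro!: continuous_intros continuous_on_compose2[OF c] c simp: d has_real_derivative_iff_has_vector_derivative[symmetric])
      show "compact (closure {x. \<psi> x \<noteq> 0})"
      proof (rule compact_supportI[of "R + z"])
        fix x :: real assume x: "norm x > R + z"
        obtain \<xi> where "x - z < \<xi>" "\<xi> < x" "P x - P (x - z) = z * \<phi> \<xi>"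
          using DERIV_antiderivative_bounds[OF P z] by metis
        moreover have "norm \<xi> > R" using x calculation(1,2) z by (auto simp: abs_if split: if_splits)
        ultimately show "\<psi> x = 0" using R(2)[of \<xi>] by (simp add: \<psi>_def)
      qed
      fix x
      obtain \<xi> where "P x - P (x - z) = z * \<phi> \<xi>" using DERIV_antiderivative_bounds[OF P z] by metis
      then have "\<psi> x = - \<phi> \<xi>" using z by (simp add: \<psi>_def field_simps)
      then show "\<bar>\<psi> x\<bar> \<le> 1" using b by simp
    qed
    then have "ereal (LINT x|lborel. w x * deriv \<psi> x) \<le> total_variation w"
      unfolding total_variation_def by (rule SUP_upper)
    also have "deriv \<psi> = (\<lambda>x. (\<phi> (x - z) - \<phi> x) / z)" using d DERIV_imp_deriv by blast
    also note tv
    finally have "(LINT x|lborel. w x * ((\<phi> (x - z) - \<phi> x) / z)) \<le> V" by simp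
    then have le: "(LINT x|lborel. w x * (\<phi> (x - z) - \<phi> x)) \<le> V * z"
      using z by (simp add: field_simps)
    have i: "integrable lborel (\<lambda>x. w (x + z) * \<phi> x)" "integrable lborel (\<lambda>x. w x * \<phi> (x - z))" "integrable lborel (\<lambda>x. w x * \<phi> x)"
      using b by (auto intro!: integrable_bounded_mult(1)[where B=1] w wz)
    have "(LINT x|lborel. (w (x + z) - w x) * \<phi> x) = (LINT x|lborel. w (x + z) * \<phi> x) - (LINT x|lborel. w x * \<phi> x)"
      using i by (simp add: left_diff_distrib)
    also have "(LINT x|lborel. w (x + z) * \<phi> x) = (LINT x|lborel. w x * \<phi> (x - z))"
      using integral_shift[of "\<lambda>x. w x * \<phi> (x - z)" z] by simp
    also have "\<dots> - (LINT x|lborel. w x * \<phi> x) = (LINT x|lborel. w x * (\<phi> (x - z) - \<phi> x))"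
      using i by (simp add: right_diff_distrib)
    finally show "(LINT x|lborel. (w (x + z) - w x) * \<phi> x) \<le> V * z" using le by simp
  qed
  consider "z > 0" | "z = 0" | "z < 0" by linarith
  then show ?thesis
  proof cases
    case 3
    have "(LINT x|lborel. \<bar>w (x + z) - w x\<bar>) = (LINT x|lborel. \<bar>w (x + (-z)) - w x\<bar>)"
      using integral_shift[of "\<lambda>x. \<bar>w (x + z) - w x\<bar>" "-z"] by (simp add: abs_minus_commute)
    then show ?thesis using pos[of "-z"] 3 by simp
  qed (use pos in auto)
qed

lemma total_variation_nonneg: "0 \<le> total_variation w"
proof -
  have "ereal (LINT x|lborel. w x * deriv (\<lambda>x. 0) x) \<le> total_variation w"
    unfolding total_variation_def by (rule SUP_upper) auto
  then show ?thesis by (simp add: zero_ereal_def)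
qed

lemma bv_norm_imp_bvc:
  assumes w: "w \<in> BV" and b: "bv_norm w \<le> ereal C"
  shows "bvc C w"
proof -
  have i: "integrable lborel w" using w by (simp add: BV_def)
  define I where "I = (LINT x|lborel. \<bar>w x\<bar>)"
  have I: "0 \<le> I" unfolding I_def by simp
  have s: "ereal I + total_variation w \<le> ereal C" using b by (simp add: bv_norm_def I_def)
  have "ereal I + 0 \<le> ereal C" using add_left_mono[OF total_variation_nonneg] s by (rule order_trans)
  moreover have "0 + total_variation w \<le> ereal C"
    using s I by (metis add_right_mono ereal_less_eq(5) order_trans)
  ultimately show ?thesis unfolding bvc_def
    using total_variation_translation[OF i] i by (auto simp: I_def)
qed

lemma BV_imp_bvc:
  assumes w: "w \<in> BV"
  obtains C where "bvc C w"
proof -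
  have "bv_norm w < \<infinity>" using w by (auto simp: bv_norm_def BV_def)
  moreover have "bv_norm w \<noteq> -\<infinity>"
    using total_variation_nonneg[of w] by (auto simp: bv_norm_def)
  ultimately obtain C where "bv_norm w = ereal C" by (cases "bv_norm w") auto
  then show ?thesis using bv_norm_imp_bvc[OF w, of C] that[of C] by simp
qed

lemma C1_compact_bounds:
  fixes \<phi> :: "real \<Rightarrow> real"
  assumes d: "\<And>x. (\<phi> has_real_derivative \<phi>' x) (at x)" and c: "continuous_on UNIV \<phi>'"
    and s: "\<And>x. norm x > R \<Longrightarrow> \<phi> x = 0"
  obtains B where "0 \<le> B" "\<And>x. \<bar>\<phi>' x\<bar> \<le> B" "\<And>x h. \<bar>\<phi> (x + h) - \<phi> x\<bar> \<le> B * \<bar>h\<bar>"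
    "\<And>x. norm x > R \<Longrightarrow> \<phi>' x = 0"
proof -
  have z: "\<phi>' x = 0" if "norm x > R" for x
  proof -
    have "open {x :: real. norm x > R}" by (intro open_Collect_less continuous_intros)
    then have "(\<phi> has_real_derivative 0) (at x)"
      by (rule has_field_derivative_transform_within_open[OF DERIV_const[of 0]]) (use that s in auto)
    then show ?thesis using d DERIV_unique by blast
  qed
  have "bounded (\<phi>' ` cball 0 R)"
    by (intro compact_imp_bounded compact_continuous_image continuous_on_subset[OF c]) auto
  then obtain B where B: "B > 0" "\<forall>x\<in>cball 0 R. \<bar>\<phi>' x\<bar> \<le> B"
    unfolding bounded_pos by auto
  have b: "\<bar>\<phi>' x\<bar> \<le> B" for x using B z[of x] by (cases "norm x > R") auto
  have "\<bar>\<phi> (x + h) - \<phi> x\<bar> \<le> B * \<bar>h\<bar>" for x h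
    using field_differentiable_bound[of UNIV \<phi> \<phi>' B "x + h" x] d b
    by (auto simp: has_field_derivative_at_within)
  then show ?thesis using that[of B] B b z by auto
qed

text \<open>The derivative of the test function is a limit of difference quotients, dominated by its
  Lipschitz constant. Summation by parts moves each quotient to \<open>w\<close>, where the modulus
  cancels the division by \<open>h n\<close>. The constant doubles because \<open>bv_norm\<close>
  adds the norm and the variation.\<close>

lemma bvc_imp_BV:
  assumes w: "bvc C w"
  shows "w \<in> BV" and "bv_norm w \<le> ereal (2 * C)"
proof -
  note W = bvcD[OF w]
  have "total_variation w \<le> ereal C"
    unfolding total_variation_def
  proof (rule SUP_least)
    fix \<phi> :: "real \<Rightarrow> real"
    assume "\<phi> \<in> {\<phi>. \<phi> C1_differentiable_on UNIV \<and> compact (closure {x. \<phi> x \<noteq> 0}) \<and> (\<forall>x. \<bar>\<phi> x\<bar> \<le> 1)}"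
    then have c1: "\<phi> C1_differentiable_on UNIV" and s: "compact (closure {x. \<phi> x \<noteq> 0})" and b: "\<And>x. \<bar>\<phi> x\<bar> \<le> 1" by auto
    from c1 obtain D where D: "\<And>x. (\<phi> has_real_derivative D x) (at x)" "continuous_on UNIV D"
      unfolding C1_differentiable_on_def by (auto simp: has_real_derivative_iff_has_vector_derivative)
    have dD: "deriv \<phi> = D" using D(1) DERIV_imp_deriv by blast
    obtain R where R: "R > 0" "\<And>x. norm x > R \<Longrightarrow> \<phi> x = 0" using compact_supportE[OF s] by metis
    obtain B where B: "0 \<le> B" "\<And>x. \<bar>D x\<bar> \<le> B" "\<And>x h. \<bar>\<phi> (x + h) - \<phi> x\<bar> \<le> B * \<bar>h\<bar>"
      using C1_compact_bounds[OF D R(2)] by metis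
    have contphi: "continuous_on UNIV \<phi>" using D(1) DERIV_isCont continuous_at_imp_continuous_on by blast
    note [measurable] = borel_measurable_continuous_onI[OF contphi] W(6) borel_measurable_continuous_onI[OF D(2)]
    define h where "h n = inverse (real (Suc n))" for n
    have h: "h n > 0" for n by (simp add: h_def)
    have hl: "h \<longlonglongrightarrow> 0" unfolding h_def by (rule LIMSEQ_inverse_real_of_nat)
    have lim: "(\<lambda>n. LINT x|lborel. w x * ((\<phi> (x + h n) - \<phi> x) / h n)) \<longlonglongrightarrow> (LINT x|lborel. w x * D x)"
    proof (rule integral_dominated_convergence[where w="\<lambda>x. \<bar>w x\<bar> * B"])
      show "AE x in lborel. (\<lambda>n. w x * ((\<phi> (x + h n) - \<phi> x) / h n)) \<longlonglongrightarrow> w x * D x"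
      proof (intro AE_I2 tendsto_mult tendsto_const)
        fix x
        have "((\<lambda>h. (\<phi> (x + h) - \<phi> x) / h) \<longlongrightarrow> D x) (at 0)" using D(1)[of x] by (simp add: DERIV_def)
        moreover have "filterlim h (at 0) sequentially"
          using hl h[THEN less_imp_neq, symmetric] by (simp add: filterlim_at always_eventually)
        ultimately show "(\<lambda>n. (\<phi> (x + h n) - \<phi> x) / h n) \<longlonglongrightarrow> D x"
          by (rule filterlim_compose)
      qed
      show "AE x in lborel. norm (w x * ((\<phi> (x + h n) - \<phi> x) / h n)) \<le> \<bar>w x\<bar> * B" for n
      proof (rule AE_I2)
        fix x
        have "\<bar>(\<phi> (x + h n) - \<phi> x) / h n\<bar> \<le> B"
          using B(3)[of x "h n"] h[of n] by (simp add: divide_le_eq)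
        then show "norm (w x * ((\<phi> (x + h n) - \<phi> x) / h n)) \<le> \<bar>w x\<bar> * B"
          unfolding real_norm_def abs_mult[of "w x"] by (intro mult_left_mono) auto
      qed
    qed (use W in auto)
    have "(LINT x|lborel. w x * ((\<phi> (x + h n) - \<phi> x) / h n)) \<le> C" for n
    proof -
      have wi: "integrable lborel (\<lambda>x. w (x + (- h n)))" using W(5) .
      have i: "integrable lborel (\<lambda>x. w x * \<phi> (x + h n))" "integrable lborel (\<lambda>x. w x * \<phi> x)" "integrable lborel (\<lambda>x. w (x + (- h n)) * \<phi> x)"
        using b by (auto intro!: integrable_bounded_mult(1)[where B=1] W simp del: add_uminus_conv_diff)
      have "(LINT x|lborel. w x * ((\<phi> (x + h n) - \<phi> x) / h n)) = ((LINT x|lborel. w x * \<phi> (x + h n)) - (LINT x|lborel. w x * \<phi> x)) / h n"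
        using i by (simp add: right_diff_distrib)
      also have "(LINT x|lborel. w x * \<phi> (x + h n)) = (LINT x|lborel. w (x + (- h n)) * \<phi> x)"
        using integral_shift[of "\<lambda>x. w x * \<phi> (x + h n)" "- h n"] by simp
      also have "\<dots> - (LINT x|lborel. w x * \<phi> x) = (LINT x|lborel. (w (x + (- h n)) - w x) * \<phi> x)"
        using i by (simp add: left_diff_distrib)
      also have "\<dots> \<le> (LINT x|lborel. \<bar>w (x + (- h n)) - w x\<bar>)"
      proof (intro integral_mono)
        show "integrable lborel (\<lambda>x. (w (x + (- h n)) - w x) * \<phi> x)"
          using b wi W(1) by (intro integrable_bounded_mult(1)[where B=1]) auto
        show "integrable lborel (\<lambda>x. \<bar>w (x + (- h n)) - w x\<bar>)" using wi W(1) by auto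
        fix x
        have "\<bar>(w (x + (- h n)) - w x) * \<phi> x\<bar> \<le> \<bar>w (x + (- h n)) - w x\<bar>"
          using b by (simp only: abs_mult) (intro mult_left_le, auto)
        then show "(w (x + (- h n)) - w x) * \<phi> x \<le> \<bar>w (x + (- h n)) - w x\<bar>" by linarith
      qed
      also have "\<dots> \<le> C * h n" using W(3)[of "- h n"] h[of n] by simp
      finally show ?thesis using h[of n] by (simp add: divide_right_mono field_simps)
    qed
    then have "(LINT x|lborel. w x * D x) \<le> C" by (intro LIMSEQ_le_const2[OF lim]) auto
    then show "ereal (LINT x|lborel. w x * deriv \<phi> x) \<le> ereal C" by (simp add: dD)
  qed
  note tv = this
  show "w \<in> BV" using tv W(1) by (auto simp: BV_def)
  have "bv_norm w \<le> ereal C + ereal C" unfolding bv_norm_def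
    using W(2) tv by (intro add_mono) auto
  then show "bv_norm w \<le> ereal (2 * C)" by simp
qed

section \<open>Bounded kernels of finite mass\<close>

lemma correlation_integrable:
  fixes f K :: "real \<Rightarrow> real"
  assumes f: "integrable lborel f" and K: "integrable lborel K"
  shows "integrable lborel (\<lambda>x. LINT z|lborel. f (x + z) * K z)"
    and "(LINT x|lborel. LINT z|lborel. f (x + z) * K z) = (LINT x|lborel. f x) * (LINT z|lborel. K z)"
proof -
  have Km: "integrable lborel (\<lambda>z. K (- z))" using integrable_reflect[OF K, of 0] by simp
  have Ki: "(LINT z|lborel. K (- z)) = (LINT z|lborel. K z)" using integral_reflect[of K 0] by simp
  have e: "(LINT z|lborel. f (x + z) * K z) = (LINT y|lborel. f y * K (- (x - y)))" for x
    using integral_shift[of "\<lambda>y. f y * K (- (x - y))" x] by (simp add: add.commute)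
  note c = convolution_integrable[OF f Km]
  show "integrable lborel (\<lambda>x. LINT z|lborel. f (x + z) * K z)"
    using lborel_integrable_fst[OF c(2)] by (simp add: e)
  show "(LINT x|lborel. LINT z|lborel. f (x + z) * K z) = (LINT x|lborel. f x) * (LINT z|lborel. K z)"
    using lborel_fubini_fst[OF c(2)] c(4) Ki by (simp add: e)
qed

text \<open>The finite mass enters the CFL condition. The upper bound makes
  \<open>w (x + z) * K z\<close> integrable for every \<open>x\<close> and not just for almost every
  one, so the gain and loss parts of \<open>G\<close> can be separated pointwise.\<close>

definition bkern :: "(real \<Rightarrow> real) \<Rightarrow> bool" where
  "bkern K \<longleftrightarrow> kern K \<and> integrable lborel K \<and> (\<exists>B. \<forall>z. K z \<le> B)"

lemma bkernD:
  assumes "bkern K"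
  shows "kern K" "integrable lborel K" "0 \<le> K z" "K \<in> borel_measurable borel" "0 \<le> (LINT z|lborel. K z)"
  using assms kernD by (auto simp: bkern_def intro!: integral_nonneg_AE)

lemma bkern_integrable_pt:
  assumes K: "bkern K" and w: "integrable lborel w"
  shows "integrable lborel (\<lambda>z. w (x + z) * K z)" "integrable lborel (\<lambda>z. (w (x + z) - w x) * K z)"
    "G K w x = (LINT z|lborel. w (x + z) * K z) - (LINT z|lborel. K z) * w x"
proof -
  obtain B where "\<And>z. K z \<le> B" using K by (auto simp: bkern_def)
  then show 1: "integrable lborel (\<lambda>z. w (x + z) * K z)"
    using integrable_shift[OF w, of x] bkernD[OF K]
    by (intro integrable_bounded_mult(1)[where B=B]) (auto simp: add.commute)
  show "integrable lborel (\<lambda>z. (w (x + z) - w x) * K z)"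
    using 1 bkernD[OF K] by (simp add: left_diff_distrib)
  show "G K w x = (LINT z|lborel. w (x + z) * K z) - (LINT z|lborel. K z) * w x"
    unfolding G_def left_diff_distrib
    by (subst Bochner_Integration.integral_diff[OF 1 integrable_mult_right[OF bkernD(2)[OF K]]]) simp
qed

lemma bkern_far_part:
  assumes K: "kern K" and r: "0 < r" and B: "\<And>z. \<bar>z\<bar> > r \<Longrightarrow> K z \<le> B"
  shows "bkern (far_part r K)"
proof -
  have "far_part r K z \<le> max 0 B" for z using B[of z] by (auto simp: far_part_def)
  then show ?thesis unfolding bkern_def using kern_far_part(1)[OF K] integrable_far_part[OF K r] by blast
qed

lemma bkern_far_part_J:
  assumes l: "0 < lam" "lam < 1" and r: "0 < r"
  shows "bkern (far_part r (J lam))"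
proof (rule bkern_far_part[OF kern_J[OF l] r])
  fix z :: real assume "\<bar>z\<bar> > r"
  then show "J lam z \<le> c_frac lam / r powr (1 + lam)"
    unfolding J_def using r l c_frac_nonneg[OF l]
    by (intro divide_left_mono powr_mono2) auto
qed

lemma G_bkern_integrable:
  assumes K: "bkern K" and w: "integrable lborel w"
  shows "integrable lborel (G K w)"
  using correlation_integrable(1)[OF w bkernD(2)[OF K]] w
  by (subst bkern_integrable_pt(3)[OF K w, abs_def]) simp

section \<open>Monotone schemes\<close>

text \<open>
  The flux is \<open>f u - f 0 = p u - m u\<close> with \<open>p\<close>, \<open>m\<close> nondecreasing: \<open>p\<close> is transported to the right
  and \<open>m\<close> to the left, each discretized by its upwind difference.
\<close>

locale split_flux =
  fixes p m :: "real \<Rightarrow> real" and L :: real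
  assumes mono_p: "mono p" and mono_m: "mono m" and p_plus_m: "\<And>u. p u + m u = L * u" and p_0: "p 0 = 0"
begin

lemma m_0: "m 0 = 0" using p_plus_m[of 0] p_0 by simp

lemma L_nonneg: "0 \<le> L"
  using monoD[OF mono_p, of 0 1] monoD[OF mono_m, of 0 1] p_plus_m[of 1] p_0 m_0 by simp

lemma p_m_diff: "\<bar>p a - p b\<bar> + \<bar>m a - m b\<bar> = L * \<bar>a - b\<bar>"
proof (cases "a \<le> b")
  case True
  then show ?thesis using monoD[OF mono_p True] monoD[OF mono_m True] p_plus_m[of a] p_plus_m[of b]
    by (simp add: algebra_simps)
next
  case False
  then have "b \<le> a" by simp
  then show ?thesis using monoD[OF mono_p \<open>b \<le> a\<close>] monoD[OF mono_m \<open>b \<le> a\<close>] p_plus_m[of a] p_plus_m[of b]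
    by (simp add: algebra_simps)
qed

lemma p_lip: "\<bar>p a - p b\<bar> \<le> L * \<bar>a - b\<bar>" and m_lip: "\<bar>m a - m b\<bar> \<le> L * \<bar>a - b\<bar>"
  using p_m_diff[of a b] by linarith+

lemma measurable_p [measurable]: "p \<in> borel_measurable borel" and measurable_m [measurable]: "m \<in> borel_measurable borel"
  using mono_p mono_m by (auto intro: borel_measurable_mono)

lemma integrable_p_m:
  assumes "integrable lborel w"
  shows "integrable lborel (\<lambda>x. p (w x))" "integrable lborel (\<lambda>x. m (w x))"
proof -
  note [measurable] = integrable_lborel_measurable[OF assms]
  have i: "integrable lborel (\<lambda>x. L * w x)" using assms by simp
  show "integrable lborel (\<lambda>x. p (w x))"
    by (rule Bochner_Integration.integrable_bound[OF i])
      (use p_lip[of _ 0] p_0 L_nonneg in \<open>auto simp: abs_mult\<close>)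
  show "integrable lborel (\<lambda>x. m (w x))"
    by (rule Bochner_Integration.integrable_bound[OF i])
      (use m_lip[of _ 0] m_0 L_nonneg in \<open>auto simp: abs_mult\<close>)
qed

text \<open>By monotonicity \<open>sgn (u - k) * (p u - p k)\<close> equals
  \<open>|p u - p k|\<close>, also where \<open>p\<close> is flat, and the remaining term is at most
  its absolute value. This is the discrete entropy inequality of an upwind difference, with
  \<open>u'\<close> the upwind neighbour.\<close>

lemma sgn_p: "sgn (u - k) * (p u' - p u) \<le> \<bar>p u' - p k\<bar> - \<bar>p u - p k\<bar>"
  using monoD[OF mono_p, of u k] monoD[OF mono_p, of k u] by (auto simp: sgn_if abs_if)

lemma sgn_m: "sgn (u - k) * (m u' - m u) \<le> \<bar>m u' - m k\<bar> - \<bar>m u - m k\<bar>"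
  using monoD[OF mono_m, of u k] monoD[OF mono_m, of k u] by (auto simp: sgn_if abs_if)

definition flux_diff :: "real \<Rightarrow> (real \<Rightarrow> real) \<Rightarrow> real \<Rightarrow> real" where
  "flux_diff h w x = (p (w (x - h)) - p (w x)) / h + (m (w (x + h)) - m (w x)) / h"

definition F :: "real \<Rightarrow> (real \<Rightarrow> real) \<Rightarrow> (real \<Rightarrow> real) \<Rightarrow> real \<Rightarrow> real" where
  "F h K w x = flux_diff h w x + G K w x"

lemma integrable_flux_diff:
  assumes "integrable lborel w"
  shows "integrable lborel (flux_diff h w)"
proof -
  note i = integrable_p_m[OF assms]
  have "integrable lborel (\<lambda>x. p (w (x - h)))" "integrable lborel (\<lambda>x. m (w (x + h)))"
    using integrable_shift[OF i(1), of "-h"] integrable_shift[OF i(2), of h] by auto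
  then show ?thesis unfolding flux_diff_def[abs_def] using i by auto
qed

lemma integrable_F:
  assumes "integrable lborel w" "bkern K"
  shows "integrable lborel (F h K w)"
  unfolding F_def[abs_def] using integrable_flux_diff[OF assms(1)] G_bkern_integrable[OF assms(2,1)] by simp

text \<open>The translation modulus at distance \<open>h\<close> cancels the division by
  \<open>h\<close>, and each of the two differences contributes \<open>L * C\<close>. The bound
  depends on \<open>h\<close> only through the kernel, and will be the speed of the polygons in
  \<open>L1\<close>.\<close>

lemma F_bound:
  assumes w: "bvc C w" and K: "bkern K" and h: "h > 0"
  shows "(LINT x|lborel. \<bar>F h K w x\<bar>) \<le> 2 * L * C + 2 * C * kmass K"
proof -
  note W = bvcD[OF w]
  note i = integrable_flux_diff[OF W(1), of h] G_bkern_integrable[OF K W(1)]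
  have wh: "integrable lborel (\<lambda>x. w (x + (- h)))" "integrable lborel (\<lambda>x. w (x + h))" by (rule W(5))+
  have "(LINT x|lborel. \<bar>flux_diff h w x\<bar>) \<le> (LINT x|lborel. (L / h) * \<bar>w (x + (-h)) - w x\<bar> + (L / h) * \<bar>w (x + h) - w x\<bar>)"
  proof (intro integral_mono)
    fix x
    have "\<bar>flux_diff h w x\<bar> \<le> \<bar>p (w (x - h)) - p (w x)\<bar> / h + \<bar>m (w (x + h)) - m (w x)\<bar> / h"
      unfolding flux_diff_def using h by (intro order_trans[OF abs_triangle_ineq]) auto
    also have "\<dots> \<le> L * \<bar>w (x + (-h)) - w x\<bar> / h + L * \<bar>w (x + h) - w x\<bar> / h"
      using p_lip m_lip h by (intro add_mono divide_right_mono) auto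
    finally show "\<bar>flux_diff h w x\<bar> \<le> (L / h) * \<bar>w (x + (-h)) - w x\<bar> + (L / h) * \<bar>w (x + h) - w x\<bar>" by simp
  qed (use i wh W(1) in \<open>auto intro!: Bochner_Integration.integrable_add\<close>)
  also have "\<dots> = (L / h) * (LINT x|lborel. \<bar>w (x + (-h)) - w x\<bar>) + (L / h) * (LINT x|lborel. \<bar>w (x + h) - w x\<bar>)"
    using wh W(1) by (subst Bochner_Integration.integral_add) auto
  also have "\<dots> \<le> (L / h) * (C * h) + (L / h) * (C * h)"
    using L_nonneg h W(3)[of "-h"] W(3)[of h] by (intro add_mono mult_left_mono) auto
  also have "\<dots> = 2 * L * C" using h by simp
  finally have 1: "(LINT x|lborel. \<bar>flux_diff h w x\<bar>) \<le> 2 * L * C" .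
  have "(LINT x|lborel. \<bar>F h K w x\<bar>) \<le> (LINT x|lborel. \<bar>flux_diff h w x\<bar> + \<bar>G K w x\<bar>)"
    unfolding F_def using i by (intro integral_mono) auto
  also have "\<dots> = (LINT x|lborel. \<bar>flux_diff h w x\<bar>) + (LINT x|lborel. \<bar>G K w x\<bar>)" using i by simp
  also have "\<dots> \<le> 2 * L * C + 2 * C * kmass K" using 1 G_bound[OF w bkernD(1)[OF K]] by simp
  finally show ?thesis .
qed

text \<open>Without a modulus the division by \<open>h\<close> remains. This large constant only
  affects the time discretization, where it is multiplied by a step that is chosen after
  \<open>h\<close>.\<close>

lemma F_lipschitz:
  assumes w: "integrable lborel w1" "integrable lborel w2" and K: "bkern K" and h: "h > 0"
  shows "(LINT x|lborel. \<bar>F h K w1 x - F h K w2 x\<bar>) \<le> (4 * L / h + 2 * (LINT z|lborel. K z)) * (LINT x|lborel. \<bar>w1 x - w2 x\<bar>)"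
proof -
  define d where "d x = \<bar>w1 x - w2 x\<bar>" for x
  have di: "integrable lborel d" unfolding d_def using w by simp
  note i = integrable_flux_diff[OF w(1), of h] integrable_flux_diff[OF w(2), of h] G_bkern_integrable[OF K w(1)] G_bkern_integrable[OF K w(2)]
  have dh: "integrable lborel (\<lambda>x. d (x + c))" for c using integrable_shift[OF di] .
  have "(LINT x|lborel. \<bar>flux_diff h w1 x - flux_diff h w2 x\<bar>) \<le> (LINT x|lborel. (L / h) * (d (x + (-h)) + d (x + h) + 2 * d x))"
  proof (intro integral_mono)
    fix x
    have "flux_diff h w1 x - flux_diff h w2 x = ((p (w1 (x - h)) - p (w2 (x - h))) - (p (w1 x) - p (w2 x)) + (m (w1 (x + h)) - m (w2 (x + h))) - (m (w1 x) - m (w2 x))) / h"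
      by (simp add: flux_diff_def add_divide_distrib diff_divide_distrib)
    also have "\<bar>\<dots>\<bar> \<le> (\<bar>p (w1 (x - h)) - p (w2 (x - h))\<bar> + \<bar>p (w1 x) - p (w2 x)\<bar> + \<bar>m (w1 (x + h)) - m (w2 (x + h))\<bar> + \<bar>m (w1 x) - m (w2 x)\<bar>) / h"
      using h by (simp add: divide_right_mono)
    also have "\<dots> \<le> (L * d (x - h) + L * d x + L * d (x + h) + L * d x) / h"
      unfolding d_def using h by (intro divide_right_mono add_mono p_lip m_lip) auto
    also have "\<dots> = (L / h) * (d (x + (-h)) + d (x + h) + 2 * d x)" by (simp add: field_simps)
    finally show "\<bar>flux_diff h w1 x - flux_diff h w2 x\<bar> \<le> (L / h) * (d (x + (-h)) + d (x + h) + 2 * d x)" .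
  qed (use i dh di in \<open>auto intro!: integrable_mult_right Bochner_Integration.integrable_add simp del: add_uminus_conv_diff\<close>)
  also have "\<dots> = (L / h) * ((LINT x|lborel. d (x + (-h))) + (LINT x|lborel. d (x + h)) + 2 * (LINT x|lborel. d x))"
    using dh[of "-h"] dh[of h] di by simp
  also have "\<dots> = (4 * L / h) * (LINT x|lborel. d x)" unfolding integral_shift by simp
  finally have 1: "(LINT x|lborel. \<bar>flux_diff h w1 x - flux_diff h w2 x\<bar>) \<le> (4 * L / h) * (LINT x|lborel. d x)" .
  have "(LINT x|lborel. \<bar>F h K w1 x - F h K w2 x\<bar>) \<le> (LINT x|lborel. \<bar>flux_diff h w1 x - flux_diff h w2 x\<bar> + \<bar>G K w1 x - G K w2 x\<bar>)"
    unfolding F_def using i by (intro integral_mono) auto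
  also have "\<dots> = (LINT x|lborel. \<bar>flux_diff h w1 x - flux_diff h w2 x\<bar>) + (LINT x|lborel. \<bar>G K w1 x - G K w2 x\<bar>)" using i by simp
  also have "(LINT x|lborel. \<bar>G K w1 x - G K w2 x\<bar>) \<le> 2 * (LINT z|lborel. K z) * (LINT x|lborel. d x)"
    unfolding d_def by (intro G_diff_w w bkernD[OF K] bkern_integrable_pt[OF K])
  finally show ?thesis using 1 by (simp add: d_def algebra_simps)
qed

definition euler_step :: "real \<Rightarrow> (real \<Rightarrow> real) \<Rightarrow> real \<Rightarrow> (real \<Rightarrow> real) \<Rightarrow> real \<Rightarrow> real" where
  "euler_step h K \<theta> w x = w x + \<theta> * F h K w x"

lemma euler_step_integrable:
  assumes "integrable lborel w" "bkern K"
  shows "integrable lborel (euler_step h K \<theta> w)"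
  unfolding euler_step_def[abs_def] using assms integrable_F[OF assms] by simp

text \<open>The difference of two steps combines \<open>d\<close>, the shifted differences of
  \<open>p\<close> and \<open>m\<close>, and an average of \<open>d\<close> against the kernel, all
  with nonnegative coefficients; the CFL condition is what makes the coefficient \<open>a\<close> of
  \<open>d\<close> nonnegative. Since the differences of \<open>p\<close> and \<open>m\<close> add
  up to \<open>L * |d|\<close> in absolute value, the total weight is
  \<open>a + \<theta> * L / h + \<theta> * \<mu> = 1\<close>.\<close>

lemma euler_step_contraction:
  assumes w: "integrable lborel w1" "integrable lborel w2" and K: "bkern K" and h: "h > 0" and th: "0 \<le> \<theta>"
    and cfl: "\<theta> * (L / h + (LINT z|lborel. K z)) \<le> 1"
  shows "(LINT x|lborel. \<bar>euler_step h K \<theta> w1 x - euler_step h K \<theta> w2 x\<bar>) \<le> (LINT x|lborel. \<bar>w1 x - w2 x\<bar>)"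
proof -
  define \<mu> where "\<mu> = (LINT z|lborel. K z)"
  define d where "d x = w1 x - w2 x" for x
  define P where "P x = p (w1 x) - p (w2 x)" for x
  define N where "N x = m (w1 x) - m (w2 x)" for x
  have di: "integrable lborel d" unfolding d_def using w by simp
  have ad: "integrable lborel (\<lambda>x. \<bar>d x\<bar>)" using di by simp
  have Pi: "integrable lborel P" "integrable lborel N" unfolding P_def N_def using integrable_p_m[OF w(1)] integrable_p_m[OF w(2)] by auto
  have PN: "\<bar>P x\<bar> + \<bar>N x\<bar> = L * \<bar>d x\<bar>" for x unfolding P_def N_def d_def by (rule p_m_diff)
  have PN': "P x + N x = L * d x" for x
    using p_plus_m[of "w1 x"] p_plus_m[of "w2 x"] by (simp add: P_def N_def d_def algebra_simps)
  define a where "a = 1 - \<theta> * (L / h + \<mu>)"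
  have a: "0 \<le> a" using cfl by (simp add: a_def \<mu>_def)
  note ic = correlation_integrable[OF ad bkernD(2)[OF K]]
  have i: "integrable lborel (\<lambda>x. \<bar>P (x + (-h))\<bar>)" "integrable lborel (\<lambda>x. \<bar>N (x + h)\<bar>)"
    by (intro integrable_abs integrable_shift Pi)+
  have eq: "euler_step h K \<theta> w1 x - euler_step h K \<theta> w2 x = a * d x + (\<theta> / h) * P (x + (-h)) + (\<theta> / h) * N (x + h) + \<theta> * (LINT z|lborel. d (x + z) * K z)" for x
  proof -
    have "G K w1 x - G K w2 x = (LINT z|lborel. d (x + z) * K z) - \<mu> * d x"
      unfolding bkern_integrable_pt(3)[OF K w(1)] bkern_integrable_pt(3)[OF K w(2)]
      using bkern_integrable_pt(1)[OF K w(1), of x] bkern_integrable_pt(1)[OF K w(2), of x]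
      by (simp add: d_def left_diff_distrib \<mu>_def algebra_simps)
    moreover have "flux_diff h w1 x - flux_diff h w2 x = (P (x + (-h)) + N (x + h) - L * d x) / h"
      unfolding PN'[symmetric] by (simp add: flux_diff_def P_def N_def add_divide_distrib diff_divide_distrib)
    ultimately have "F h K w1 x - F h K w2 x = (P (x + (-h)) + N (x + h) - L * d x) / h + (LINT z|lborel. d (x + z) * K z) - \<mu> * d x"
      by (simp add: F_def)
    moreover have "euler_step h K \<theta> w1 x - euler_step h K \<theta> w2 x = d x + \<theta> * (F h K w1 x - F h K w2 x)"
      by (simp add: euler_step_def d_def algebra_simps)
    ultimately show ?thesis using h by (simp only: a_def) (simp add: field_simps)
  qed
  have "(LINT x|lborel. \<bar>euler_step h K \<theta> w1 x - euler_step h K \<theta> w2 x\<bar>) \<le>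
     (LINT x|lborel. a * \<bar>d x\<bar> + (\<theta> / h) * \<bar>P (x + (-h))\<bar> + (\<theta> / h) * \<bar>N (x + h)\<bar> + \<theta> * (LINT z|lborel. \<bar>d (x + z)\<bar> * K z))"
  proof (intro integral_mono)
    show "integrable lborel (\<lambda>x. \<bar>euler_step h K \<theta> w1 x - euler_step h K \<theta> w2 x\<bar>)" using euler_step_integrable[OF w(1) K] euler_step_integrable[OF w(2) K] by simp
    show "integrable lborel (\<lambda>x. a * \<bar>d x\<bar> + (\<theta> / h) * \<bar>P (x + (-h))\<bar> + (\<theta> / h) * \<bar>N (x + h)\<bar> + \<theta> * (LINT z|lborel. \<bar>d (x + z)\<bar> * K z))"
      using ad i ic(1) by (intro Bochner_Integration.integrable_add integrable_mult_right)
    fix x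
    have "\<bar>LINT z|lborel. d (x + z) * K z\<bar> \<le> (LINT z|lborel. \<bar>d (x + z) * K z\<bar>)" by (rule integral_abs_bound)
    also have "\<dots> = (LINT z|lborel. \<bar>d (x + z)\<bar> * K z)" using bkernD(3)[OF K] by (simp add: abs_mult)
    finally have 1: "\<theta> * \<bar>LINT z|lborel. d (x + z) * K z\<bar> \<le> \<theta> * (LINT z|lborel. \<bar>d (x + z)\<bar> * K z)" using th by (rule mult_left_mono)
    have "\<bar>euler_step h K \<theta> w1 x - euler_step h K \<theta> w2 x\<bar> \<le> \<bar>a * d x\<bar> + \<bar>(\<theta> / h) * P (x + (-h))\<bar> + \<bar>(\<theta> / h) * N (x + h)\<bar> + \<bar>\<theta> * (LINT z|lborel. d (x + z) * K z)\<bar>"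
      unfolding eq by linarith
    also have "\<dots> = a * \<bar>d x\<bar> + (\<theta> / h) * \<bar>P (x + (-h))\<bar> + (\<theta> / h) * \<bar>N (x + h)\<bar> + \<theta> * \<bar>LINT z|lborel. d (x + z) * K z\<bar>"
      using a th h by (simp add: abs_mult)
    finally show "\<bar>euler_step h K \<theta> w1 x - euler_step h K \<theta> w2 x\<bar> \<le> a * \<bar>d x\<bar> + (\<theta> / h) * \<bar>P (x + (-h))\<bar> + (\<theta> / h) * \<bar>N (x + h)\<bar> + \<theta> * (LINT z|lborel. \<bar>d (x + z)\<bar> * K z)"
      using 1 by linarith
  qed
  also have "\<dots> = a * (LINT x|lborel. \<bar>d x\<bar>) + (\<theta> / h) * (LINT x|lborel. \<bar>P (x + (-h))\<bar>) + (\<theta> / h) * (LINT x|lborel. \<bar>N (x + h)\<bar>) + \<theta> * (LINT x|lborel. LINT z|lborel. \<bar>d (x + z)\<bar> * K z)"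
    using ad i ic(1) by (simp del: add_uminus_conv_diff)
  also have "\<dots> = a * (LINT x|lborel. \<bar>d x\<bar>) + (\<theta> / h) * ((LINT x|lborel. \<bar>P x\<bar>) + (LINT x|lborel. \<bar>N x\<bar>)) + \<theta> * ((LINT x|lborel. \<bar>d x\<bar>) * \<mu>)"
    unfolding ic(2) integral_shift[of "\<lambda>x. \<bar>P x\<bar>" "-h"] integral_shift[of "\<lambda>x. \<bar>N x\<bar>" h] \<mu>_def by (simp add: distrib_left)
  also have "(LINT x|lborel. \<bar>P x\<bar>) + (LINT x|lborel. \<bar>N x\<bar>) = L * (LINT x|lborel. \<bar>d x\<bar>)"
    using Pi by (subst Bochner_Integration.integral_add[symmetric]) (auto simp: PN)
  finally show ?thesis using h by (simp add: a_def d_def field_simps)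
qed

lemma F_translate: "F h K (\<lambda>x. w (x + z)) x = F h K w (x + z)"
  by (simp add: F_def flux_diff_def G_def algebra_simps)

text \<open>The contraction is applied twice: to \<open>w\<close> and zero, a fixed point of the
  step, for the norm, and to \<open>w\<close> and its translate, which commutes with the step, for
  the modulus.\<close>

lemma euler_step_bvc:
  assumes w: "bvc C w" and K: "bkern K" and h: "h > 0" and th: "0 \<le> \<theta>"
    and cfl: "\<theta> * (L / h + (LINT z|lborel. K z)) \<le> 1"
  shows "bvc C (euler_step h K \<theta> w)"
proof -
  note W = bvcD[OF w]
  have 0: "euler_step h K \<theta> (\<lambda>x. 0) x = 0" for x by (simp add: euler_step_def F_def flux_diff_def G_def)
  have "(LINT x|lborel. \<bar>euler_step h K \<theta> w x\<bar>) \<le> C"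
    using euler_step_contraction[OF W(1) _ K h th cfl, of "\<lambda>x. 0"] W(2) by (simp add: 0)
  moreover have "(LINT x|lborel. \<bar>euler_step h K \<theta> w (x + z) - euler_step h K \<theta> w x\<bar>) \<le> C * \<bar>z\<bar>" for z
    using euler_step_contraction[OF W(5)[of z] W(1) K h th cfl] W(3)[of z] by (simp add: euler_step_def F_translate)
  ultimately show ?thesis unfolding bvc_def using euler_step_integrable[OF W(1) K] by blast
qed

text \<open>After \<open>sgn_p\<close> and \<open>sgn_m\<close> the right side is a pair of
  differences of entropies, and shifting the integration variable moves them to the test function.
  For \<open>p\<close> the quotient looks forward and for \<open>m\<close> backward, opposite to the
  upwind directions.\<close>

lemma flux_diff_entropy:
  assumes w: "integrable lborel w" and h: "h > 0" and \<psi>: "integrable lborel \<psi>" "\<And>x. 0 \<le> \<psi> x" "\<And>x. \<psi> x \<le> B"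
  shows "integrable lborel (\<lambda>x. \<bar>p (w x) - p k\<bar> * ((\<psi> (x + h) - \<psi> x) / h) + \<bar>m (w x) - m k\<bar> * ((\<psi> (x - h) - \<psi> x) / h))"
    and "integrable lborel (\<lambda>x. sgn (w x - k) * flux_diff h w x * \<psi> x)"
    and "(LINT x|lborel. sgn (w x - k) * flux_diff h w x * \<psi> x) \<le>
     (LINT x|lborel. \<bar>p (w x) - p k\<bar> * ((\<psi> (x + h) - \<psi> x) / h) + \<bar>m (w x) - m k\<bar> * ((\<psi> (x - h) - \<psi> x) / h))"
proof -
  note [measurable] = integrable_lborel_measurable[OF w] integrable_lborel_measurable[OF \<psi>(1)]
    integrable_lborel_measurable[OF integrable_flux_diff[OF w]]
  have sh: "integrable lborel (\<lambda>x. w (x + c))" "integrable lborel (\<lambda>x. \<psi> (x + c))" for c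
    by (intro integrable_shift w \<psi>)+
  have Bn: "0 \<le> B" using \<psi>(2,3)[of 0] by simp
  have i: "integrable lborel (\<lambda>x. \<bar>r (w (x + c)) - r k\<bar> * \<psi> (x + c'))"
    if [measurable]: "r \<in> borel_measurable borel" and r: "\<And>a b. \<bar>r a - r b\<bar> \<le> L * \<bar>a - b\<bar>" for r c c'
  proof (rule Bochner_Integration.integrable_bound)
    show "integrable lborel (\<lambda>x. L * B * \<bar>w (x + c)\<bar> + L * \<bar>k\<bar> * \<psi> (x + c'))"
      using sh by (intro Bochner_Integration.integrable_add integrable_mult_right integrable_abs)
    show "AE x in lborel. norm (\<bar>r (w (x + c)) - r k\<bar> * \<psi> (x + c')) \<le> norm (L * B * \<bar>w (x + c)\<bar> + L * \<bar>k\<bar> * \<psi> (x + c'))"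
    proof (rule AE_I2)
      fix x
      have "\<bar>r (w (x + c)) - r k\<bar> * \<psi> (x + c') \<le> (L * (\<bar>w (x + c)\<bar> + \<bar>k\<bar>)) * \<psi> (x + c')"
        using \<psi>(2) L_nonneg by (intro mult_right_mono order_trans[OF r] mult_left_mono) auto
      also have "\<dots> = L * \<bar>w (x + c)\<bar> * \<psi> (x + c') + L * \<bar>k\<bar> * \<psi> (x + c')" by (simp add: algebra_simps)
      also have "L * \<bar>w (x + c)\<bar> * \<psi> (x + c') \<le> L * \<bar>w (x + c)\<bar> * B"
        using \<psi>(3) L_nonneg by (intro mult_left_mono) auto
      finally have "\<bar>r (w (x + c)) - r k\<bar> * \<psi> (x + c') \<le> L * B * \<bar>w (x + c)\<bar> + L * \<bar>k\<bar> * \<psi> (x + c')" by (simp add: ac_simps)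
      then show "norm (\<bar>r (w (x + c)) - r k\<bar> * \<psi> (x + c')) \<le> norm (L * B * \<bar>w (x + c)\<bar> + L * \<bar>k\<bar> * \<psi> (x + c'))"
        using \<psi>(2)[of "x + c'"] by (simp add: abs_mult)
    qed
  qed measurable
  note ip = i[OF measurable_p p_lip] and im = i[OF measurable_m m_lip]
  have ip0: "integrable lborel (\<lambda>x. \<bar>p (w x) - p k\<bar> * \<psi> (x + h))" "integrable lborel (\<lambda>x. \<bar>p (w x) - p k\<bar> * \<psi> x)"
    "integrable lborel (\<lambda>x. \<bar>p (w (x - h)) - p k\<bar> * \<psi> x)"
    using ip[of 0 h] ip[of 0 0] ip[of "-h" 0] by simp_all
  have im0: "integrable lborel (\<lambda>x. \<bar>m (w x) - m k\<bar> * \<psi> (x - h))" "integrable lborel (\<lambda>x. \<bar>m (w x) - m k\<bar> * \<psi> x)"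
    "integrable lborel (\<lambda>x. \<bar>m (w (x + h)) - m k\<bar> * \<psi> x)"
    using im[of 0 "-h"] im[of 0 0] im[of h 0] by simp_all
  have eq: "(\<lambda>x. \<bar>p (w x) - p k\<bar> * ((\<psi> (x + h) - \<psi> x) / h) + \<bar>m (w x) - m k\<bar> * ((\<psi> (x - h) - \<psi> x) / h)) =
    (\<lambda>x. (\<bar>p (w x) - p k\<bar> * \<psi> (x + h) - \<bar>p (w x) - p k\<bar> * \<psi> x + \<bar>m (w x) - m k\<bar> * \<psi> (x - h) - \<bar>m (w x) - m k\<bar> * \<psi> x) / h)"
    by (simp add: fun_eq_iff algebra_simps add_divide_distrib diff_divide_distrib)
  show I1: "integrable lborel (\<lambda>x. \<bar>p (w x) - p k\<bar> * ((\<psi> (x + h) - \<psi> x) / h) + \<bar>m (w x) - m k\<bar> * ((\<psi> (x - h) - \<psi> x) / h))"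
    unfolding eq using ip0 im0 by simp
  show I2: "integrable lborel (\<lambda>x. sgn (w x - k) * flux_diff h w x * \<psi> x)"
  proof -
    have "integrable lborel (\<lambda>x. flux_diff h w x * (sgn (w x - k) * \<psi> x))"
      by (rule integrable_bounded_mult(1)[OF integrable_flux_diff[OF w], where B=B])
        (use \<psi>(2,3) Bn in \<open>auto simp: sgn_if\<close>)
    then show ?thesis by (simp add: ac_simps)
  qed
  have "(LINT x|lborel. sgn (w x - k) * flux_diff h w x * \<psi> x) \<le>
    (LINT x|lborel. (\<bar>p (w (x - h)) - p k\<bar> * \<psi> x - \<bar>p (w x) - p k\<bar> * \<psi> x + \<bar>m (w (x + h)) - m k\<bar> * \<psi> x - \<bar>m (w x) - m k\<bar> * \<psi> x) / h)"
  proof (intro integral_mono I2)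
    fix x
    have "sgn (w x - k) * (p (w (x - h)) - p (w x)) + sgn (w x - k) * (m (w (x + h)) - m (w x)) \<le>
      (\<bar>p (w (x - h)) - p k\<bar> - \<bar>p (w x) - p k\<bar>) + (\<bar>m (w (x + h)) - m k\<bar> - \<bar>m (w x) - m k\<bar>)"
      by (intro add_mono sgn_p sgn_m)
    then have "(sgn (w x - k) * (p (w (x - h)) - p (w x)) + sgn (w x - k) * (m (w (x + h)) - m (w x))) * \<psi> x / h \<le>
      ((\<bar>p (w (x - h)) - p k\<bar> - \<bar>p (w x) - p k\<bar>) + (\<bar>m (w (x + h)) - m k\<bar> - \<bar>m (w x) - m k\<bar>)) * \<psi> x / h"
      using h \<psi>(2) by (intro divide_right_mono mult_right_mono) auto
    then show "sgn (w x - k) * flux_diff h w x * \<psi> x \<le> (\<bar>p (w (x - h)) - p k\<bar> * \<psi> x - \<bar>p (w x) - p k\<bar> * \<psi> x + \<bar>m (w (x + h)) - m k\<bar> * \<psi> x - \<bar>m (w x) - m k\<bar> * \<psi> x) / h"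
      by (simp add: flux_diff_def algebra_simps add_divide_distrib diff_divide_distrib)
  qed (use ip0 im0 in simp)
  also have "\<dots> = ((LINT x|lborel. \<bar>p (w (x - h)) - p k\<bar> * \<psi> x) - (LINT x|lborel. \<bar>p (w x) - p k\<bar> * \<psi> x) + (LINT x|lborel. \<bar>m (w (x + h)) - m k\<bar> * \<psi> x) - (LINT x|lborel. \<bar>m (w x) - m k\<bar> * \<psi> x)) / h"
    using ip0 im0 by simp
  also have "(LINT x|lborel. \<bar>p (w (x - h)) - p k\<bar> * \<psi> x) = (LINT x|lborel. \<bar>p (w x) - p k\<bar> * \<psi> (x + h))"
    using integral_shift[of "\<lambda>x. \<bar>p (w (x - h)) - p k\<bar> * \<psi> x" h] by simp
  also have "(LINT x|lborel. \<bar>m (w (x + h)) - m k\<bar> * \<psi> x) = (LINT x|lborel. \<bar>m (w x) - m k\<bar> * \<psi> (x - h))"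
    using integral_shift[of "\<lambda>x. \<bar>m (w (x + h)) - m k\<bar> * \<psi> x" "-h"] by simp
  also have "((LINT x|lborel. \<bar>p (w x) - p k\<bar> * \<psi> (x + h)) - (LINT x|lborel. \<bar>p (w x) - p k\<bar> * \<psi> x) + (LINT x|lborel. \<bar>m (w x) - m k\<bar> * \<psi> (x - h)) - (LINT x|lborel. \<bar>m (w x) - m k\<bar> * \<psi> x)) / h =
    (LINT x|lborel. \<bar>p (w x) - p k\<bar> * ((\<psi> (x + h) - \<psi> x) / h) + \<bar>m (w x) - m k\<bar> * ((\<psi> (x - h) - \<psi> x) / h))"
    unfolding eq using ip0 im0 by simp
  finally show "(LINT x|lborel. sgn (w x - k) * flux_diff h w x * \<psi> x) \<le>
     (LINT x|lborel. \<bar>p (w x) - p k\<bar> * ((\<psi> (x + h) - \<psi> x) / h) + \<bar>m (w x) - m k\<bar> * ((\<psi> (x - h) - \<psi> x) / h))" .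
qed

end

section \<open>Explicit Euler steps joined to a polygon in time\<close>

lemma abs_linear_local:
  fixes \<alpha> \<beta> k t a b :: real
  assumes t: "a < t" "t < b" and ne: "\<alpha> + \<beta> * t \<noteq> k \<or> \<beta> = 0"
  obtains S where "open S" "t \<in> S" "S \<subseteq> {a<..<b}"
    "\<And>s. s \<in> S \<Longrightarrow> \<bar>\<alpha> + \<beta> * s - k\<bar> = sgn (\<alpha> + \<beta> * t - k) * (\<alpha> + \<beta> * s - k)"
proof -
  consider "\<alpha> + \<beta> * t > k" | "\<alpha> + \<beta> * t < k" | "\<alpha> + \<beta> * t = k" "\<beta> = 0" using ne by linarith
  then show ?thesis
  proof cases
    case 1
    have "open ({a<..<b} \<inter> {s. \<alpha> + \<beta> * s > k})" by (intro open_Int open_greaterThanLessThan open_Collect_less continuous_intros)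
    then show ?thesis by (rule that) (use t 1 in auto)
  next
    case 2
    have "open ({a<..<b} \<inter> {s. \<alpha> + \<beta> * s < k})" by (intro open_Int open_greaterThanLessThan open_Collect_less continuous_intros)
    then show ?thesis by (rule that) (use t 2 in auto)
  next
    case 3
    show ?thesis by (rule that[of "{a<..<b}"]) (use t 3 in auto)
  qed
qed

lemma clip_add:
  fixes a d t :: real
  shows "0 \<le> a \<Longrightarrow> 0 \<le> d \<Longrightarrow> max 0 (min a t) + max 0 (min d (t - a)) = max 0 (min (a + d) t)"
  by (auto simp: max_def min_def)

locale euler = split_flux p m L for p m :: "real \<Rightarrow> real" and L +
  fixes h :: real and K :: "real \<Rightarrow> real" and \<delta> :: real and N :: nat and w0 :: "real \<Rightarrow> real" and C :: real
  assumes K: "bkern K" and h: "0 < h" and \<delta>: "0 < \<delta>" and cfl: "\<delta> * (L / h + (LINT z|lborel. K z)) \<le> 1"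
    and w0: "bvc C w0"
begin

definition D :: real where "D = 2 * L * C + 2 * C * kmass K"

definition euler_seq :: "nat \<Rightarrow> real \<Rightarrow> real" where "euler_seq n = (euler_step h K \<delta> ^^ n) w0"

lemma bvc_euler_step: "bvc C w \<Longrightarrow> 0 \<le> \<theta> \<Longrightarrow> \<theta> \<le> \<delta> \<Longrightarrow> bvc C (euler_step h K \<theta> w)"
proof (rule euler_step_bvc[OF _ K h])
  assume "0 \<le> \<theta>" "\<theta> \<le> \<delta>"
  then have "\<theta> * (L / h + (LINT z|lborel. K z)) \<le> \<delta> * (L / h + (LINT z|lborel. K z))"
    using L_nonneg h bkernD[OF K] by (intro mult_right_mono add_nonneg_nonneg) auto
  then show "\<theta> * (L / h + (LINT z|lborel. K z)) \<le> 1" using cfl by simp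
qed auto

lemma bvc_euler_seq: "bvc C (euler_seq n)"
  unfolding euler_seq_def using \<delta> by (induction n) (auto simp: w0 bvc_euler_step)

lemma euler_seq_integrable [simp]: "integrable lborel (euler_seq n)"
  using bvcD(1)[OF bvc_euler_seq] .

lemma F_euler_seq: "integrable lborel (F h K (euler_seq n))" "(LINT x|lborel. \<bar>F h K (euler_seq n) x\<bar>) \<le> D"
  using integrable_F[OF _ K] F_bound[OF bvc_euler_seq K h] by (auto simp: D_def)

lemma measurable_F_euler_seq [measurable]: "F h K (euler_seq n) \<in> borel_measurable borel"
  using integrable_lborel_measurable[OF F_euler_seq(1)] .

lemma D_nonneg: "0 \<le> D"
  using F_euler_seq(2)[of 0] by (rule order_trans[rotated]) simp

text \<open>The time that the interval from 0 to \<open>t\<close> spends in the slab with number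
  \<open>i\<close>. With these weights the polygon is one finite sum for all \<open>t\<close>: joint
  measurability and the Lipschitz bound in time are immediate, and the polygon is constant before 0
  and after the last node.\<close>

definition clip :: "nat \<Rightarrow> real \<Rightarrow> real" where "clip i t = max 0 (min \<delta> (t - real i * \<delta>))"

definition polygon :: "real \<Rightarrow> real \<Rightarrow> real" where
  "polygon t x = w0 x + (\<Sum>i<N. clip i t * F h K (euler_seq i) x)"

text \<open>The time derivative of the polygon off the nodes. The slabs are open, so at each node
  the value is 0 rather than a one-sided derivative.\<close>

definition slope :: "real \<Rightarrow> real \<Rightarrow> real" where
  "slope t x = (\<Sum>i<N. indicator {real i * \<delta> <..< real (Suc i) * \<delta>} t * F h K (euler_seq i) x)"

lemma sum_F_euler_seq: "w0 x + (\<Sum>i<n. \<delta> * F h K (euler_seq i) x) = euler_seq n x"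
proof (induction n)
  case (Suc n)
  have "euler_seq (Suc n) x = euler_seq n x + \<delta> * F h K (euler_seq n) x" by (simp add: euler_seq_def euler_step_def)
  then show ?case using Suc by simp
qed (simp add: euler_seq_def)

lemma grid_le: "i \<le> j \<Longrightarrow> real i * \<delta> \<le> real j * \<delta>"
  using \<delta> by (intro mult_right_mono) auto

lemma polygon_slab:
  assumes n: "n < N" and t: "real n * \<delta> \<le> t" "t \<le> real (Suc n) * \<delta>"
  shows "polygon t x = euler_seq n x + (t - real n * \<delta>) * F h K (euler_seq n) x"
proof -
  have c1: "clip i t = \<delta>" if "i < n" for i
    using grid_le[of "Suc i" n] that t \<delta> by (auto simp: clip_def algebra_simps)
  have c2: "clip n t = t - real n * \<delta>" using t \<delta> by (auto simp: clip_def algebra_simps)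
  have c3: "clip i t = 0" if "n < i" for i
    using grid_le[of "Suc n" i] that t \<delta> by (auto simp: clip_def algebra_simps)
  have "{..<N} = {..<n} \<union> {n} \<union> {n<..<N}" using n by auto
  then have "(\<Sum>i<N. clip i t * F h K (euler_seq i) x) = (\<Sum>i<n. clip i t * F h K (euler_seq i) x) + clip n t * F h K (euler_seq n) x + (\<Sum>i\<in>{n<..<N}. clip i t * F h K (euler_seq i) x)"
    by (simp add: sum.union_disjoint disjoint_iff)
  also have "(\<Sum>i\<in>{n<..<N}. clip i t * F h K (euler_seq i) x) = 0" by (intro sum.neutral) (auto simp: c3)
  finally show ?thesis using sum_F_euler_seq[of x n] by (simp add: polygon_def c1 c2)
qed

lemma polygon_0: "t \<le> 0 \<Longrightarrow> polygon t x = w0 x"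
proof -
  assume t: "t \<le> 0"
  have "clip i t = 0" for i using t grid_le[of 0 i] by (auto simp: clip_def)
  then show ?thesis by (simp add: polygon_def)
qed

lemma polygon_T: "real N * \<delta> \<le> t \<Longrightarrow> polygon t x = euler_seq N x"
proof -
  assume t: "real N * \<delta> \<le> t"
  have "clip i t = \<delta>" if "i < N" for i using t grid_le[of "Suc i" N] \<delta> that by (auto simp: clip_def algebra_simps)
  then show ?thesis using sum_F_euler_seq[of x N] by (simp add: polygon_def)
qed

lemma slab_cases:
  obtains "t \<le> 0" | "real N * \<delta> \<le> t" | n where "n < N" "real n * \<delta> \<le> t" "t < real (Suc n) * \<delta>"
proof -
  have "\<exists>n<N. real n * \<delta> \<le> t \<and> t < real (Suc n) * \<delta>" if t: "0 < t" "t < real N * \<delta>"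
  proof -
    define n where "n = nat \<lfloor>t / \<delta>\<rfloor>"
    have "0 \<le> t / \<delta>" using t \<delta> by simp
    then have "real n \<le> t / \<delta>" "t / \<delta> < real n + 1" unfolding n_def by (auto simp: of_nat_nat)
    then have 1: "real n * \<delta> \<le> t" "t < real (Suc n) * \<delta>" using \<delta> by (auto simp: field_simps)
    then have "real n * \<delta> < real N * \<delta>" using t by linarith
    then have "n < N" using \<delta> by simp
    then show ?thesis using 1 by blast
  qed
  then show ?thesis using that by (meson not_le)
qed

text \<open>Linear interpolation inside a slab is itself an Euler step of a shorter length
  \<open>\<theta>\<close>, for which the CFL condition holds as well. Hence the \<open>bvc\<close>
  bound is available at every time and not just at the nodes.\<close>

lemma polygon_euler_step: "\<exists>n \<theta>. 0 \<le> \<theta> \<and> \<theta> \<le> \<delta> \<and> polygon t = euler_step h K \<theta> (euler_seq n)"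
proof (rule slab_cases[of t])
  assume "t \<le> 0"
  then show ?thesis using \<delta> by (intro exI[of _ 0]) (auto simp: fun_eq_iff polygon_0 euler_step_def euler_seq_def)
next
  assume "real N * \<delta> \<le> t"
  then show ?thesis using \<delta> by (intro exI[of _ N] exI[of _ 0]) (auto simp: fun_eq_iff polygon_T euler_step_def)
next
  fix n assume "n < N" "real n * \<delta> \<le> t" "t < real (Suc n) * \<delta>"
  then show ?thesis
    by (intro exI[of _ n] exI[of _ "t - real n * \<delta>"]) (auto simp: fun_eq_iff polygon_slab euler_step_def algebra_simps)
qed

lemma bvc_polygon: "bvc C (polygon t)"
  using polygon_euler_step[of t] bvc_euler_step[OF bvc_euler_seq] by auto

lemma measurable_polygon [measurable]: "(\<lambda>q. polygon (fst q) (snd q)) \<in> borel_measurable borel"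
proof -
  note [measurable] = bvcD(6)[OF w0]
  show ?thesis unfolding polygon_def clip_def by measurable
qed

lemma measurable_slope [measurable]: "(\<lambda>q. slope (fst q) (snd q)) \<in> borel_measurable borel"
  unfolding slope_def by measurable

lemma sum_clip: "(\<Sum>i<n. clip i t) = max 0 (min (real n * \<delta>) t)"
proof (induction n)
  case (Suc n)
  have "0 \<le> real n * \<delta>" using \<delta> by simp
  then have "max 0 (min (real n * \<delta>) t) + clip n t = max 0 (min (real n * \<delta> + \<delta>) t)"
    using \<delta> clip_add[of "real n * \<delta>" \<delta> t] by (simp add: clip_def)
  then show ?case using Suc by (simp add: algebra_simps)
qed simp

lemma polygon_lipschitz:
  assumes "a \<le> b"
  shows "(LINT x|lborel. \<bar>polygon b x - polygon a x\<bar>) \<le> D * (b - a)"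
proof -
  have mono: "clip i a \<le> clip i b" for i using assms by (auto simp: clip_def)
  have "(LINT x|lborel. \<bar>polygon b x - polygon a x\<bar>) \<le> (LINT x|lborel. (\<Sum>i<N. (clip i b - clip i a) * \<bar>F h K (euler_seq i) x\<bar>))"
  proof (intro integral_mono)
    fix x
    have "\<bar>polygon b x - polygon a x\<bar> = \<bar>\<Sum>i<N. (clip i b - clip i a) * F h K (euler_seq i) x\<bar>"
      by (simp add: polygon_def left_diff_distrib sum_subtractf)
    also have "\<dots> \<le> (\<Sum>i<N. \<bar>(clip i b - clip i a) * F h K (euler_seq i) x\<bar>)" by (rule sum_abs)
    also have "\<dots> = (\<Sum>i<N. (clip i b - clip i a) * \<bar>F h K (euler_seq i) x\<bar>)" using mono by (simp add: abs_mult)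
    finally show "\<bar>polygon b x - polygon a x\<bar> \<le> (\<Sum>i<N. (clip i b - clip i a) * \<bar>F h K (euler_seq i) x\<bar>)" .
  qed (use bvcD(1)[OF bvc_polygon] F_euler_seq in auto)
  also have "\<dots> = (\<Sum>i<N. (clip i b - clip i a) * (LINT x|lborel. \<bar>F h K (euler_seq i) x\<bar>))"
    using F_euler_seq by simp
  also have "\<dots> \<le> (\<Sum>i<N. (clip i b - clip i a) * D)"
    using mono F_euler_seq by (intro sum_mono mult_left_mono) auto
  also have "\<dots> = ((\<Sum>i<N. clip i b) - (\<Sum>i<N. clip i a)) * D" by (simp add: sum_distrib_right[symmetric] sum_subtractf)
  also have "\<dots> \<le> (b - a) * D"
    unfolding sum_clip using assms D_nonneg by (intro mult_right_mono) auto
  finally show ?thesis by (simp add: mult.commute)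
qed

lemma slope_slab:
  assumes n: "n < N" and t: "real n * \<delta> < t" "t < real (Suc n) * \<delta>"
  shows "slope t x = F h K (euler_seq n) x"
proof -
  have "indicator {real i * \<delta> <..< real (Suc i) * \<delta>} t = (if i = n then 1 else 0 :: real)" for i
  proof (cases i n rule: linorder_cases)
    case less then show ?thesis using grid_le[of "Suc i" n] t by (auto simp: indicator_def)
  next
    case greater then show ?thesis using grid_le[of "Suc n" i] t by (auto simp: indicator_def)
  qed (use t in auto)
  then have "slope t x = (\<Sum>i<N. if i = n then F h K (euler_seq i) x else 0)"
    unfolding slope_def by (intro sum.cong) auto
  then show ?thesis using n by simp
qed

lemma slope_integrable: "integrable lborel (slope t)"
  unfolding slope_def[abs_def] using F_euler_seq by simp

definition grid :: "real set" where "grid = (\<lambda>i. real i * \<delta>) ` {..N}"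

lemma off_grid:
  assumes "0 \<le> t" "t \<le> real N * \<delta>" "t \<notin> grid"
  obtains n where "n < N" "real n * \<delta> < t" "t < real (Suc n) * \<delta>"
proof (rule slab_cases[of t])
  have g: "t \<noteq> real i * \<delta>" if "i \<le> N" for i using assms(3) that by (auto simp: grid_def)
  show thesis if "t \<le> 0" using that assms g[of 0] by auto
  show thesis if "real N * \<delta> \<le> t" using that assms g[of N] by auto
  fix n assume n: "n < N" "real n * \<delta> \<le> t" "t < real (Suc n) * \<delta>"
  then show thesis using that[of n] g[of n] by auto
qed

text \<open>The polygon moves with the rate \<open>F\<close> of the last node instead of its own.
  Since then it has moved by at most \<open>\<delta> * D\<close> in \<open>L1\<close>, and
  \<open>F_lipschitz\<close> converts this distance into a defect of the rate.\<close>

lemma slope_error: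
  assumes "0 \<le> t" "t \<le> real N * \<delta>" "t \<notin> grid"
  shows "(LINT x|lborel. \<bar>slope t x - F h K (polygon t) x\<bar>) \<le> (4 * L / h + 2 * (LINT z|lborel. K z)) * (\<delta> * D)"
    and "(LINT x|lborel. \<bar>slope t x\<bar>) \<le> D"
proof -
  obtain n where n: "n < N" "real n * \<delta> < t" "t < real (Suc n) * \<delta>" using off_grid[OF assms] .
  show "(LINT x|lborel. \<bar>slope t x\<bar>) \<le> D" using F_euler_seq(2)[of n] by (simp add: slope_slab[OF n])
  have "(LINT x|lborel. \<bar>slope t x - F h K (polygon t) x\<bar>) \<le> (4 * L / h + 2 * (LINT z|lborel. K z)) * (LINT x|lborel. \<bar>euler_seq n x - polygon t x\<bar>)"
    unfolding slope_slab[OF n] by (intro F_lipschitz K h bvcD(1)[OF bvc_euler_seq] bvcD(1)[OF bvc_polygon])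
  also have "(LINT x|lborel. \<bar>euler_seq n x - polygon t x\<bar>) = (t - real n * \<delta>) * (LINT x|lborel. \<bar>F h K (euler_seq n) x\<bar>)"
    using n by (subst polygon_slab[OF n(1)]) (auto simp: abs_mult)
  also have "\<dots> \<le> \<delta> * D" using n F_euler_seq \<delta> by (intro mult_mono) (auto simp: algebra_simps)
  finally show "(LINT x|lborel. \<bar>slope t x - F h K (polygon t) x\<bar>) \<le> (4 * L / h + 2 * (LINT z|lborel. K z)) * (\<delta> * D)"
    using L_nonneg h bkernD[OF K] by (simp add: mult_left_mono)
qed

text \<open>For fixed \<open>x\<close> the polygon is piecewise affine in time, so
  \<open>|polygon - k|\<close> has the expected derivative outside a finite set, and the fundamental
  theorem tolerates a finite exceptional set for continuous functions. No entropy inequality is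
  involved at this stage: the time part is an equality.\<close>

lemma polygon_chain:
  fixes g g' :: "real \<Rightarrow> real"
  assumes g: "\<And>t. (g has_real_derivative g' t) (at t)" and g': "continuous_on UNIV g'"
    and ab: "0 \<le> a" "a \<le> b" "b \<le> real N * \<delta>"
  shows "set_integrable lborel {a..b} (\<lambda>t. sgn (polygon t x - k) * slope t x * g t + \<bar>polygon t x - k\<bar> * g' t)"
    and "(LINT t:{a..b}|lborel. sgn (polygon t x - k) * slope t x * g t + \<bar>polygon t x - k\<bar> * g' t) =
      \<bar>polygon b x - k\<bar> * g b - \<bar>polygon a x - k\<bar> * g a"
proof -
  let ?f = "\<lambda>t. sgn (polygon t x - k) * slope t x * g t + \<bar>polygon t x - k\<bar> * g' t"
  have cp: "continuous_on S (\<lambda>t. polygon t x)" for S unfolding polygon_def clip_def by (intro continuous_intros)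
  have cg: "continuous_on S g" for S using g by (meson DERIV_continuous_on has_field_derivative_at_within)
  \<comment> \<open>The nodes and, for each slab, the only time at which a nonconstant affine piece
    can cross the level \<open>k\<close>. For a constant piece the division by zero gives 0, which
    adds just a node again; there the absolute value is differentiable even if the piece equals
    \<open>k\<close>.\<close>
  define E where "E = grid \<union> (\<lambda>i. real i * \<delta> + (k - euler_seq i x) / F h K (euler_seq i) x) ` {..N}"
  have "finite E" unfolding E_def grid_def by auto
  have der: "((\<lambda>t. \<bar>polygon t x - k\<bar> * g t) has_vector_derivative ?f t) (at t)" if t: "t \<in> {a<..<b} - E" for t
  proof -
    have "0 \<le> t" "t \<le> real N * \<delta>" "t \<notin> grid" using t ab by (auto simp: E_def)
    then obtain n where n: "n < N" "real n * \<delta> < t" "t < real (Suc n) * \<delta>" by (rule off_grid)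
    let ?\<beta> = "F h K (euler_seq n) x"
    let ?\<alpha> = "euler_seq n x - real n * \<delta> * ?\<beta>"
    have ps: "polygon s x = ?\<alpha> + ?\<beta> * s" if "s \<in> {real n * \<delta> <..< real (Suc n) * \<delta>}" for s
      using polygon_slab[OF n(1), of s x] that by (simp add: algebra_simps)
    have "t \<noteq> real n * \<delta> + (k - euler_seq n x) / ?\<beta>" using t n(1) by (auto simp: E_def)
    have "?\<beta> = 0" if "?\<alpha> + ?\<beta> * t = k"
    proof (rule ccontr)
      assume "?\<beta> \<noteq> 0"
      moreover have "k - euler_seq n x = (t - real n * \<delta>) * ?\<beta>" using that by (simp add: algebra_simps)
      ultimately have "(k - euler_seq n x) / ?\<beta> = t - real n * \<delta>" by simp
      then show False using \<open>t \<noteq> _\<close> by simp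
    qed
    then have "?\<alpha> + ?\<beta> * t \<noteq> k \<or> ?\<beta> = 0" by blast
    from abs_linear_local[OF n(2,3) this]
    obtain S where S: "open S" "t \<in> S" "S \<subseteq> {real n * \<delta> <..< real (Suc n) * \<delta>}"
      and eq: "\<And>s. s \<in> S \<Longrightarrow> \<bar>?\<alpha> + ?\<beta> * s - k\<bar> = sgn (?\<alpha> + ?\<beta> * t - k) * (?\<alpha> + ?\<beta> * s - k)" by metis
    have pt: "polygon t x = ?\<alpha> + ?\<beta> * t" using ps n by auto
    have "((\<lambda>s. sgn (polygon t x - k) * (?\<alpha> + ?\<beta> * s - k) * g s) has_real_derivative
        (sgn (polygon t x - k) * ?\<beta> * g t + sgn (polygon t x - k) * (?\<alpha> + ?\<beta> * t - k) * g' t)) (at t)"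
      by (auto intro!: derivative_eq_intros g)
    also have "sgn (polygon t x - k) * (?\<alpha> + ?\<beta> * t - k) = \<bar>polygon t x - k\<bar>" unfolding pt by (metis abs_sgn mult.commute)
    also have "?\<beta> = slope t x" using slope_slab[OF n] by simp
    finally have "((\<lambda>s. sgn (polygon t x - k) * (?\<alpha> + ?\<beta> * s - k) * g s) has_real_derivative ?f t) (at t)"
      by (simp add: slope_slab[OF n])
    then have "((\<lambda>t. \<bar>polygon t x - k\<bar> * g t) has_real_derivative ?f t) (at t)"
      by (rule has_field_derivative_transform_within_open[OF _ S(1,2)])
         (use S(3) eq ps pt in \<open>auto simp: subset_eq\<close>)
    then show ?thesis by (simp add: has_real_derivative_iff_has_vector_derivative)
  qed
  have "(?f has_integral (\<bar>polygon b x - k\<bar> * g b - \<bar>polygon a x - k\<bar> * g a)) {a..b}"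
    by (rule fundamental_theorem_of_calculus_interior_strong[OF \<open>finite E\<close> ab(2) der])
       (auto intro!: continuous_intros cp cg)
  note hi = this
  have i1: "set_integrable lborel {a..b} (\<lambda>t. \<bar>polygon t x - k\<bar> * g' t)"
    by (intro borel_integrable_atLeastAtMost' continuous_intros cp continuous_on_subset[OF g']) auto
  have "set_integrable lborel {a..b} g" by (intro borel_integrable_atLeastAtMost' cg)
  then have ig: "integrable lborel (\<lambda>t. indicator {a..b} t * g t)" by (simp add: set_integrable_def)
  have [measurable]: "(\<lambda>t. polygon t x) \<in> borel_measurable borel" "(\<lambda>t. slope t x) \<in> borel_measurable borel"
    by (simp add: borel_measurable_continuous_onI cp) (unfold slope_def, measurable)
  have "\<bar>sgn (polygon t x - k) * slope t x\<bar> \<le> (\<Sum>i<N. \<bar>F h K (euler_seq i) x\<bar>)" for t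
  proof -
    have "\<bar>sgn (polygon t x - k) * slope t x\<bar> \<le> \<bar>slope t x\<bar>" by (simp add: abs_mult sgn_if)
    also have "\<dots> \<le> (\<Sum>i<N. \<bar>F h K (euler_seq i) x\<bar>)" unfolding slope_def
      by (intro order_trans[OF sum_abs] sum_mono) (auto simp: indicator_def)
    finally show ?thesis .
  qed
  from integrable_bounded_mult(2)[OF ig _ this]
  have i2: "set_integrable lborel {a..b} (\<lambda>t. sgn (polygon t x - k) * slope t x * g t)"
    by (simp add: set_integrable_def ac_simps)
  show si: "set_integrable lborel {a..b} ?f" using set_integral_add(1)[OF i2 i1] .
  show "(LINT t:{a..b}|lborel. ?f t) = \<bar>polygon b x - k\<bar> * g b - \<bar>polygon a x - k\<bar> * g a"
    using set_borel_integral_eq_integral(2)[OF si] integral_unique[OF hi] by simp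
qed

end

section \<open>Doubling of variables\<close>

lemma lborel_swap:
  fixes f :: "real \<times> real \<Rightarrow> real"
  assumes "f \<in> borel_measurable borel"
  shows "(LINT q|lborel. f (snd q, fst q)) = (LINT q|lborel. f q)"
  using lborel_pair.integral_product_swap[of f] assms by (simp add: lborel_prod case_prod_beta')

lemma AE_lborel_fst:
  assumes "AE x in lborel. P x"
  shows "AE q in (lborel :: ('a::euclidean_space \<times> 'b::euclidean_space) measure). P (fst q)"
proof -
  obtain N where N: "N \<in> null_sets lborel" "{x. \<not> P x} \<subseteq> N" using assms by (auto simp: eventually_ae_filter)
  have [measurable]: "N \<in> sets borel" using N(1) by auto
  have 1: "AE x in lborel. x \<notin> N" using N(1) by (rule AE_not_in)
  have "AE q in (lborel \<Otimes>\<^sub>M lborel :: ('a \<times> 'b) measure). fst q \<notin> N"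
  proof (rule lborel_pair.AE_pair_measure)
    show "{q \<in> space (lborel \<Otimes>\<^sub>M lborel). fst q \<notin> N} \<in> sets (lborel \<Otimes>\<^sub>M lborel :: ('a \<times> 'b) measure)" by measurable
    show "AE x in lborel. AE y in lborel. fst (x, y) \<notin> N" using 1 by eventually_elim simp
  qed
  then show ?thesis unfolding lborel_prod by (rule AE_mp) (use N(2) in auto)
qed

lemma AE_lborel_snd:
  assumes "AE x in lborel. P x"
  shows "AE q in (lborel :: ('a::euclidean_space \<times> 'b::euclidean_space) measure). P (snd q)"
proof -
  obtain N where N: "N \<in> null_sets lborel" "{x. \<not> P x} \<subseteq> N" using assms by (auto simp: eventually_ae_filter)
  have [measurable]: "N \<in> sets borel" using N(1) by auto
  have 1: "AE x in lborel. x \<notin> N" using N(1) by (rule AE_not_in)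
  have "AE q in (lborel \<Otimes>\<^sub>M lborel :: ('a \<times> 'b) measure). snd q \<notin> N"
  proof (rule lborel_pair.AE_pair_measure)
    show "{q \<in> space (lborel \<Otimes>\<^sub>M lborel). snd q \<notin> N} \<in> sets (lborel \<Otimes>\<^sub>M lborel :: ('a \<times> 'b) measure)" by measurable
  qed (use 1 in simp)
  then show ?thesis unfolding lborel_prod by (rule AE_mp) (use N(2) in auto)
qed

lemma measurable_param_integral:
  fixes f :: "'a::euclidean_space \<Rightarrow> 'b::euclidean_space \<Rightarrow> real"
  assumes "(\<lambda>p. f (fst p) (snd p)) \<in> borel_measurable borel"
  shows "(\<lambda>s. LINT x|lborel. f s x) \<in> borel_measurable borel"
proof -
  have "(\<lambda>(s,x). f s x) \<in> borel_measurable (borel \<Otimes>\<^sub>M lborel)"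
    using assms by (subst measurable_cong_sets[OF sets_pair_measure_cong[OF refl sets_lborel] refl])
       (simp add: borel_prod case_prod_beta')
  from sigma_finite_measure.borel_measurable_lebesgue_integral[OF _ this]
  show ?thesis by (simp add: sigma_finite_lborel)
qed

lemma measurable_param_compose:
  fixes v :: "'a::second_countable_topology \<Rightarrow> 'b::second_countable_topology \<Rightarrow> real"
  assumes v: "(\<lambda>q. v (fst q) (snd q)) \<in> borel_measurable borel"
    and "g \<in> borel_measurable M" "f \<in> borel_measurable M"
  shows "(\<lambda>p. v (g p) (f p)) \<in> borel_measurable M"
  using measurable_compose[OF borel_measurable_Pair[OF assms(2,3)] v] by simp

text \<open>A majorant that splits into one summand for each variable reduces the double integral to
  two convolutions. The integrands of the doubling are of this kind after the triangle inequality
  for the values of the two functions.\<close>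

lemma pair_dominated:
  fixes H :: "real \<times> real \<Rightarrow> real"
  assumes H: "H \<in> borel_measurable borel" and A: "integrable lborel A" and B: "integrable lborel B"
    and g: "integrable lborel g"
    and le: "\<And>q. \<bar>H q\<bar> \<le> (A (fst q) + B (snd q)) * \<bar>g (fst q - snd q)\<bar>"
  shows "integrable lborel H"
    and "\<bar>LINT q|lborel. H q\<bar> \<le> ((LINT x|lborel. A x) + (LINT x|lborel. B x)) * (LINT x|lborel. \<bar>g x\<bar>)"
    and "(LINT q|lborel. \<bar>H q\<bar>) \<le> ((LINT x|lborel. A x) + (LINT x|lborel. B x)) * (LINT x|lborel. \<bar>g x\<bar>)"
proof -
  have ga: "integrable lborel (\<lambda>x. \<bar>g x\<bar>)" using g by simp
  note cA = convolution_integrable[OF A ga] and cB = convolution_integrable[OF B ga]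
  have i: "integrable lborel (\<lambda>q. A (fst q) * \<bar>g (fst q - snd q)\<bar> + B (snd q) * \<bar>g (fst q - snd q)\<bar>)"
    using cA(1) cB(2) by simp
  show I: "integrable lborel H"
    by (rule Bochner_Integration.integrable_bound[OF i])
       (use H in simp, rule AE_I2, use le in \<open>simp add: distrib_right order_trans[OF _ abs_ge_self]\<close>)
  have "(LINT q|lborel. \<bar>H q\<bar>) \<le> (LINT q|lborel. A (fst q) * \<bar>g (fst q - snd q)\<bar> + B (snd q) * \<bar>g (fst q - snd q)\<bar>)"
    using I i le by (intro integral_mono) (auto simp: distrib_right)
  also have "\<dots> = ((LINT x|lborel. A x) + (LINT x|lborel. B x)) * (LINT x|lborel. \<bar>g x\<bar>)"
    using cA(1,3) cB(2,4) by (simp add: distrib_right)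
  finally show 3: "(LINT q|lborel. \<bar>H q\<bar>) \<le> ((LINT x|lborel. A x) + (LINT x|lborel. B x)) * (LINT x|lborel. \<bar>g x\<bar>)" .
  show "\<bar>LINT q|lborel. H q\<bar> \<le> ((LINT x|lborel. A x) + (LINT x|lborel. B x)) * (LINT x|lborel. \<bar>g x\<bar>)"
    using integral_abs_bound[of lborel H] 3 by linarith
qed

section \<open>The mollified distance and Kato's inequality\<close>

locale moll =
  fixes \<rho> \<rho>' :: "real \<Rightarrow> real" and R :: real
  assumes rho_nonneg: "\<And>x. 0 \<le> \<rho> x" and rho_even: "\<And>x. \<rho> (- x) = \<rho> x"
    and rho_deriv: "\<And>x. (\<rho> has_real_derivative \<rho>' x) (at x)" and rho'_cont: "continuous_on UNIV \<rho>'"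
    and rho_supp: "\<And>x. \<bar>x\<bar> > R \<Longrightarrow> \<rho> x = 0" and rho_int: "(LINT x|lborel. \<rho> x) = 1"
begin

lemma rho_bounds:
  obtains B where "0 \<le> B" "\<And>x. \<bar>\<rho>' x\<bar> \<le> B" "\<And>x h. \<bar>\<rho> (x + h) - \<rho> x\<bar> \<le> B * \<bar>h\<bar>" "\<And>x. \<bar>x\<bar> > R \<Longrightarrow> \<rho>' x = 0"
  using C1_compact_bounds[OF rho_deriv rho'_cont, of R] rho_supp by (metis real_norm_def)

lemma rho_cont: "continuous_on S \<rho>"
  using rho_deriv by (meson DERIV_continuous_on has_field_derivative_at_within)

lemma measurable_rho [measurable]: "\<rho> \<in> borel_measurable borel" "\<rho>' \<in> borel_measurable borel"
  by (simp_all add: borel_measurable_continuous_onI rho_cont rho'_cont)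

lemma integrable_compact_support:
  fixes g :: "real \<Rightarrow> real"
  assumes "continuous_on UNIV g" "\<And>x. \<bar>x\<bar> > S \<Longrightarrow> g x = 0"
  shows "integrable lborel g"
proof -
  have "set_integrable lborel {-S..S} g"
    by (intro borel_integrable_atLeastAtMost' continuous_on_subset[OF assms(1)]) auto
  then show ?thesis unfolding set_integrable_def
    by (rule back_subst[of "integrable lborel"]) (use assms(2) in \<open>force simp: indicator_def fun_eq_iff\<close>)
qed

lemma rho_integrable: "integrable lborel \<rho>"
  by (rule integrable_compact_support[OF rho_cont rho_supp])

lemma rho'_integrable: "integrable lborel \<rho>'"
proof -
  obtain B where "\<And>x. \<bar>x\<bar> > R \<Longrightarrow> \<rho>' x = 0" by (metis rho_bounds)
  then show ?thesis by (rule integrable_compact_support[OF rho'_cont])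
qed

lemma rho_abs_int: "(LINT x|lborel. \<bar>\<rho> x\<bar>) = 1"
  using rho_int rho_nonneg by simp

lemma rho'_odd: "\<rho>' (- x) = - \<rho>' x"
proof -
  have "((\<lambda>x. \<rho> (- x)) has_real_derivative - \<rho>' (- x)) (at x)"
    using DERIV_chain2[OF rho_deriv DERIV_minus[OF DERIV_ident], of x] by simp
  then have "(\<rho> has_real_derivative - \<rho>' (- x)) (at x)" by (simp add: rho_even)
  then show ?thesis using rho_deriv[of x] DERIV_unique by force
qed

lemma R_nonneg: "0 \<le> R"
proof (rule ccontr)
  assume "\<not> 0 \<le> R"
  then have "\<rho> x = 0" for x using rho_supp[of x] by auto
  then show False using rho_int by simp
qed

text \<open>Reading the mollifier as a jump kernel makes the bounds for \<open>G\<close> available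
  for smoothing errors; on its support the weight is at most \<open>R\<close>.\<close>

lemma kern_rho: "kern \<rho>" "kmass \<rho> \<le> R"
proof -
  have i: "integrable lborel (\<lambda>z. min 1 \<bar>z\<bar> * \<rho> z)"
    by (rule integrable_bounded_mult(2)[OF rho_integrable, where B=1]) auto
  show "kern \<rho>" unfolding kern_def using rho_nonneg i by auto
  have "kmass \<rho> \<le> (LINT z|lborel. R * \<rho> z)"
    unfolding kmass_def
  proof (intro integral_mono i integrable_mult_right rho_integrable)
    fix z show "min 1 \<bar>z\<bar> * \<rho> z \<le> R * \<rho> z"
      using rho_supp[of z] rho_nonneg[of z] R_nonneg
      by (cases "\<bar>z\<bar> > R") (auto intro!: mult_right_mono)
  qed
  then show "kmass \<rho> \<le> R" using rho_int by simp
qed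

text \<open>The \<open>L1\<close> distance with the second argument sampled at a nearby point. It is
  symmetric because the mollifier is even, and it can be differentiated in \<open>x\<close> without
  touching the functions.\<close>

definition doubled_dist :: "(real \<Rightarrow> real) \<Rightarrow> (real \<Rightarrow> real) \<Rightarrow> real" where
  "doubled_dist a b = (LINT q|lborel. \<bar>a (fst q) - b (snd q)\<bar> * \<rho> (fst q - snd q))"

lemma doubled_dist_integrable:
  assumes "integrable lborel a" "integrable lborel b"
  shows "integrable lborel (\<lambda>q. \<bar>a (fst q) - b (snd q)\<bar> * \<rho> (fst q - snd q))"
proof -
  note [measurable] = assms[THEN integrable_lborel_measurable]
  show ?thesis
    by (rule pair_dominated(1)[OF _ integrable_abs[OF assms(1)] integrable_abs[OF assms(2)] rho_integrable])
       (auto simp: abs_mult intro!: mult_right_mono)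
qed

lemma doubled_dist_swap:
  assumes "integrable lborel a" "integrable lborel b"
  shows "doubled_dist a b = doubled_dist b a"
proof -
  note [measurable] = assms[THEN integrable_lborel_measurable]
  have "doubled_dist b a = (LINT q|lborel. \<bar>b (snd q) - a (fst q)\<bar> * \<rho> (snd q - fst q))"
    unfolding doubled_dist_def by (subst lborel_swap[symmetric]) auto
  then show ?thesis unfolding doubled_dist_def
    by (metis (no_types, lifting) abs_minus_commute minus_diff_eq rho_even Bochner_Integration.integral_cong)
qed

lemma doubled_dist_lipschitz:
  assumes "integrable lborel a" "integrable lborel b" "integrable lborel a'" "integrable lborel b'"
  shows "\<bar>doubled_dist a b - doubled_dist a' b'\<bar> \<le> (LINT x|lborel. \<bar>a x - a' x\<bar>) + (LINT x|lborel. \<bar>b x - b' x\<bar>)"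
proof -
  note [measurable] = assms[THEN integrable_lborel_measurable]
  have "doubled_dist a b - doubled_dist a' b' = (LINT q|lborel. \<bar>a (fst q) - b (snd q)\<bar> * \<rho> (fst q - snd q) - \<bar>a' (fst q) - b' (snd q)\<bar> * \<rho> (fst q - snd q))"
    unfolding doubled_dist_def by (intro Bochner_Integration.integral_diff[symmetric] doubled_dist_integrable assms)
  also have "\<bar>\<dots>\<bar> \<le> ((LINT x|lborel. \<bar>a x - a' x\<bar>) + (LINT x|lborel. \<bar>b x - b' x\<bar>)) * (LINT x|lborel. \<bar>\<rho> x\<bar>)"
    by (rule pair_dominated(2)) (use assms rho_integrable in \<open>auto simp: abs_mult left_diff_distrib[symmetric] intro!: mult_right_mono\<close>)
  finally show ?thesis by (simp add: rho_abs_int)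
qed

lemma doubled_dist_self:
  assumes b: "bvc C b"
  shows "doubled_dist b b \<le> 2 * C * R"
proof -
  note B = bvcD[OF b]
  note pi = doubled_dist_integrable[OF B(1) B(1)]
  have gi: "integrable lborel (\<lambda>p. \<bar>(b (fst p + snd p) - b (fst p)) * \<rho> (snd p)\<bar>)"
    using G_pair_integrable[OF b kern_rho(1)] by (rule integrable_abs)
  have "doubled_dist b b = (LINT x|lborel. LINT y|lborel. \<bar>b x - b y\<bar> * \<rho> (x - y))"
    unfolding doubled_dist_def using lborel_fubini_fst[OF pi] by simp
  also have "\<dots> = (LINT x|lborel. LINT z|lborel. \<bar>(b (x + z) - b x) * \<rho> z\<bar>)"
  proof (rule Bochner_Integration.integral_cong[OF refl])
    fix x
    have "(LINT y|lborel. \<bar>b x - b y\<bar> * \<rho> (x - y)) = (LINT z|lborel. \<bar>b x - b (z + x)\<bar> * \<rho> (x - (z + x)))"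
      by (rule integral_shift[symmetric])
    then show "(LINT y|lborel. \<bar>b x - b y\<bar> * \<rho> (x - y)) = (LINT z|lborel. \<bar>(b (x + z) - b x) * \<rho> z\<bar>)"
      using rho_nonneg by (simp add: rho_even abs_mult abs_minus_commute add.commute)
  qed
  also have "\<dots> = (LINT z|lborel. LINT x|lborel. \<bar>(b (x + z) - b x) * \<rho> z\<bar>)"
    using lborel_fubini_swap[OF gi] by simp
  also have "\<dots> \<le> (LINT z|lborel. 2 * C * (min 1 \<bar>z\<bar> * \<rho> z))"
  proof (intro integral_mono)
    show "integrable lborel (\<lambda>z. LINT x|lborel. \<bar>(b (x + z) - b x) * \<rho> z\<bar>)"
      using lborel_integrable_snd[OF gi] by simp
    show "integrable lborel (\<lambda>z. 2 * C * (min 1 \<bar>z\<bar> * \<rho> z))" using kernD(3)[OF kern_rho(1)] by simp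
    fix z
    have "(LINT x|lborel. \<bar>(b (x + z) - b x) * \<rho> z\<bar>) = (LINT x|lborel. \<bar>b (x + z) - b x\<bar>) * \<rho> z"
      using rho_nonneg by (simp add: abs_mult)
    also have "\<dots> \<le> 2 * C * min 1 \<bar>z\<bar> * \<rho> z" by (intro mult_right_mono bvc_min b rho_nonneg)
    finally show "(LINT x|lborel. \<bar>(b (x + z) - b x) * \<rho> z\<bar>) \<le> 2 * C * (min 1 \<bar>z\<bar> * \<rho> z)" by simp
  qed
  also have "\<dots> = 2 * C * kmass \<rho>" by (simp add: kmass_def)
  also have "\<dots> \<le> 2 * C * R" using kern_rho(2) B(4) by (simp add: mult_left_mono)
  finally show ?thesis .
qed

text \<open>The values \<open>a x\<close> and \<open>b y\<close> are compared through
  \<open>b x\<close>, so the smoothing error is \<open>doubled_dist b b\<close> and only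
  \<open>b\<close> needs a translation modulus.\<close>

lemma doubled_dist_approx:
  assumes a: "integrable lborel a" and b: "bvc C b"
  shows "doubled_dist a b \<le> (LINT x|lborel. \<bar>a x - b x\<bar>) + 2 * C * R"
    and "(LINT x|lborel. \<bar>a x - b x\<bar>) \<le> doubled_dist a b + 2 * C * R"
proof -
  note B = bvcD[OF b]
  have "\<bar>doubled_dist a b - doubled_dist b b\<bar> \<le> (LINT x|lborel. \<bar>a x - b x\<bar>) + (LINT x|lborel. \<bar>b x - b x\<bar>)"
    by (intro doubled_dist_lipschitz a B)
  then show "doubled_dist a b \<le> (LINT x|lborel. \<bar>a x - b x\<bar>) + 2 * C * R"
    using doubled_dist_self[OF b] by simp
  have ab: "integrable lborel (\<lambda>x. \<bar>a x - b x\<bar>)" using a B by simp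
  note c = convolution_integrable[OF ab rho_integrable]
  have "(LINT x|lborel. \<bar>a x - b x\<bar>) = (LINT q|lborel. \<bar>a (fst q) - b (fst q)\<bar> * \<rho> (fst q - snd q))"
    using c(3) by (simp add: rho_int)
  also have "\<dots> \<le> (LINT q|lborel. \<bar>a (fst q) - b (snd q)\<bar> * \<rho> (fst q - snd q) + \<bar>b (fst q) - b (snd q)\<bar> * \<rho> (fst q - snd q))"
    by (intro integral_mono c Bochner_Integration.integrable_add doubled_dist_integrable a B)
       (auto simp: distrib_right[symmetric] rho_nonneg intro!: mult_right_mono)
  also have "\<dots> = doubled_dist a b + doubled_dist b b" unfolding doubled_dist_def by (intro Bochner_Integration.integral_add doubled_dist_integrable a B)
  finally show "(LINT x|lborel. \<bar>a x - b x\<bar>) \<le> doubled_dist a b + 2 * C * R" using doubled_dist_self[OF b] by simp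
qed

lemma doubled_dist_shift:
  assumes "integrable lborel a" "integrable lborel b"
  shows "doubled_dist (\<lambda>x. a (x + z)) (\<lambda>x. b (x + z)) = doubled_dist a b"
proof -
  have i: "integrable lborel (\<lambda>x. a (x + z))" "integrable lborel (\<lambda>x. b (x + z))" using assms integrable_shift by blast+
  define I where "I x = (LINT y|lborel. \<bar>a x - b y\<bar> * \<rho> (x - y))" for x
  have "doubled_dist (\<lambda>x. a (x + z)) (\<lambda>x. b (x + z)) = (LINT x|lborel. LINT y|lborel. \<bar>a (x + z) - b (y + z)\<bar> * \<rho> (x - y))"
    unfolding doubled_dist_def using lborel_fubini_fst[OF doubled_dist_integrable[OF i]] by simp
  also have "\<dots> = (LINT x|lborel. I (x + z))"
  proof (rule Bochner_Integration.integral_cong[OF refl])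
    fix x
    have "I (x + z) = (LINT y|lborel. \<bar>a (x + z) - b (y + z)\<bar> * \<rho> ((x + z) - (y + z)))"
      unfolding I_def by (rule integral_shift[symmetric])
    then show "(LINT y|lborel. \<bar>a (x + z) - b (y + z)\<bar> * \<rho> (x - y)) = I (x + z)" by simp
  qed
  also have "\<dots> = (LINT x|lborel. I x)" by (rule integral_shift)
  also have "\<dots> = doubled_dist a b" unfolding doubled_dist_def I_def using lborel_fubini_fst[OF doubled_dist_integrable[OF assms]] by simp
  finally show ?thesis .
qed

text \<open>
  Kato's inequality for the jump operator: jumping both variables by the same amount leaves the
  weight \<open>\<rho> (x - y)\<close> unchanged, so the contributions of the two end points of the jump cancel.
\<close>

lemma Kato:
  assumes a: "bvc C a" and b: "bvc C b" and K: "kern K"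
  shows "(LINT q|lborel. sgn (a (fst q) - b (snd q)) * (G K a (fst q) - G K b (snd q)) * \<rho> (fst q - snd q)) \<le> 0"
proof -
  note A = bvcD[OF a] and B = bvcD[OF b]
  note [measurable] = A(6) B(6) kernD(2)[OF K]
  \<comment> \<open>The jump size is made a third variable. Kato's inequality holds for each jump
    size separately, so the order of integration has to be exchanged, and for this the integrand on
    the triple space must be shown integrable.\<close>
  define Psi where "Psi = (\<lambda>r::(real\<times>real)\<times>real. sgn (a (fst (fst r)) - b (snd (fst r))) *
     ((a (fst (fst r) + snd r) - a (fst (fst r))) * K (snd r) - (b (snd (fst r) + snd r) - b (snd (fst r))) * K (snd r)) * \<rho> (fst (fst r) - snd (fst r)))"
  have [measurable]: "Psi \<in> borel_measurable borel" unfolding Psi_def by measurable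
  have aei: "AE q in (lborel :: (real\<times>real) measure). integrable lborel (\<lambda>z. (a (fst q + z) - a (fst q)) * K z)"
    "AE q in (lborel :: (real\<times>real) measure). integrable lborel (\<lambda>z. (b (snd q + z) - b (snd q)) * K z)"
    using AE_lborel_fst[OF G_AE_integrable[OF a K]] AE_lborel_snd[OF G_AE_integrable[OF b K]] by auto
  \<comment> \<open>The jump integrals with absolute values inside. They are in \<open>L1\<close> by
    \<open>G_pair_integrable\<close> and dominate the inner integral of \<open>Psi\<close>.\<close>
  define Aa where "Aa x = (LINT z|lborel. \<bar>(a (x + z) - a x) * K z\<bar>)" for x
  define Ab where "Ab x = (LINT z|lborel. \<bar>(b (x + z) - b x) * K z\<bar>)" for x
  have Ai: "integrable lborel Aa" "integrable lborel Ab"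
    using lborel_integrable_fst[OF integrable_abs[OF G_pair_integrable[OF a K]]] lborel_integrable_fst[OF integrable_abs[OF G_pair_integrable[OF b K]]]
    by (simp_all add: Aa_def[abs_def] Ab_def[abs_def])
  note [measurable] = Ai[THEN integrable_lborel_measurable]
  have An: "0 \<le> Aa x" "0 \<le> Ab x" for x by (simp_all add: Aa_def Ab_def)
  have dom: "integrable lborel (\<lambda>q. (Aa (fst q) + Ab (snd q)) * \<rho> (fst q - snd q))"
    by (rule pair_dominated(1)[OF _ Ai rho_integrable]) (use An in \<open>auto simp: abs_mult\<close>)
  have Pi: "integrable lborel Psi"
  proof (rule integrable_lborel_pairI)
    show "AE q in lborel. integrable lborel (\<lambda>z. Psi (q, z))"
      using aei by eventually_elim (auto simp: Psi_def)
    show "integrable lborel (\<lambda>q. LINT z|lborel. \<bar>Psi (q, z)\<bar>)"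
    proof (rule Bochner_Integration.integrable_bound[OF dom])
      show "(\<lambda>q. LINT z|lborel. \<bar>Psi (q, z)\<bar>) \<in> borel_measurable lborel"
        using measurable_param_integral[of "\<lambda>q z. \<bar>Psi (q, z)\<bar>"] by simp
      show "AE q in lborel. norm (LINT z|lborel. \<bar>Psi (q, z)\<bar>) \<le> norm ((Aa (fst q) + Ab (snd q)) * \<rho> (fst q - snd q))"
        using aei
      proof eventually_elim
        case (elim q)
        have "(LINT z|lborel. \<bar>Psi (q, z)\<bar>) \<le> (LINT z|lborel. (\<bar>(a (fst q + z) - a (fst q)) * K z\<bar> + \<bar>(b (snd q + z) - b (snd q)) * K z\<bar>) * \<rho> (fst q - snd q))"
        proof (intro integral_mono)
          show "integrable lborel (\<lambda>z. \<bar>Psi (q, z)\<bar>)" unfolding Psi_def using elim by auto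
          show "integrable lborel (\<lambda>z. (\<bar>(a (fst q + z) - a (fst q)) * K z\<bar> + \<bar>(b (snd q + z) - b (snd q)) * K z\<bar>) * \<rho> (fst q - snd q))"
            using elim by (intro integrable_mult_left Bochner_Integration.integrable_add integrable_abs)
          fix z
          have "\<bar>sgn s * (x - y)\<bar> \<le> \<bar>x\<bar> + \<bar>y\<bar>" for s x y :: real by (auto simp: sgn_if)
          then have "\<bar>Psi (q, z)\<bar> \<le> (\<bar>(a (fst q + z) - a (fst q)) * K z\<bar> + \<bar>(b (snd q + z) - b (snd q)) * K z\<bar>) * \<bar>\<rho> (fst q - snd q)\<bar>"
            unfolding Psi_def fst_conv snd_conv by (subst abs_mult[of _ "\<rho> _"]) (rule mult_right_mono, blast, simp)
          then show "\<bar>Psi (q, z)\<bar> \<le> (\<bar>(a (fst q + z) - a (fst q)) * K z\<bar> + \<bar>(b (snd q + z) - b (snd q)) * K z\<bar>) * \<rho> (fst q - snd q)"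
            by (simp add: rho_nonneg)
        qed
        also have "\<dots> = (Aa (fst q) + Ab (snd q)) * \<rho> (fst q - snd q)"
          unfolding Aa_def Ab_def using elim[THEN integrable_abs] by simp
        finally show ?case by simp
      qed
    qed
  qed measurable
  have "(LINT q|lborel. sgn (a (fst q) - b (snd q)) * (G K a (fst q) - G K b (snd q)) * \<rho> (fst q - snd q)) =
     (LINT q|lborel. LINT z|lborel. Psi (q, z))"
  proof (rule integral_cong_AE)
    note [measurable] = G_integrable[OF a K, THEN integrable_lborel_measurable] G_integrable[OF b K, THEN integrable_lborel_measurable]
    show "(\<lambda>q. sgn (a (fst q) - b (snd q)) * (G K a (fst q) - G K b (snd q)) * \<rho> (fst q - snd q)) \<in> borel_measurable lborel" by simp
    show "(\<lambda>q. LINT z|lborel. Psi (q, z)) \<in> borel_measurable lborel"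
      using measurable_param_integral[of "\<lambda>q z. Psi (q, z)"] by simp
    show "AE q in lborel. sgn (a (fst q) - b (snd q)) * (G K a (fst q) - G K b (snd q)) * \<rho> (fst q - snd q) = (LINT z|lborel. Psi (q, z))"
      using aei by eventually_elim (simp add: Psi_def G_def)
  qed
  also have "\<dots> = (LINT z|lborel. LINT q|lborel. Psi (q, z))" by (rule lborel_fubini_swap[OF Pi])
  also have "\<dots> \<le> integral\<^sup>L lborel (\<lambda>z::real. 0)"
  proof (rule integral_mono_AE)
    show "integrable lborel (\<lambda>z. LINT q|lborel. Psi (q, z))" by (rule lborel_integrable_snd[OF Pi])
    show "AE z in lborel. (LINT q|lborel. Psi (q, z)) \<le> 0"
      using lborel_AE_integrable_snd[OF Pi]
    proof eventually_elim
      case (elim z)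
      let ?a = "\<lambda>x. a (x + z)" and ?b = "\<lambda>x. b (x + z)"
      have "(LINT q|lborel. Psi (q, z)) \<le> (LINT q|lborel. K z * (\<bar>?a (fst q) - ?b (snd q)\<bar> * \<rho> (fst q - snd q) - \<bar>a (fst q) - b (snd q)\<bar> * \<rho> (fst q - snd q)))"
      proof (intro integral_mono elim integrable_mult_right Bochner_Integration.integrable_diff doubled_dist_integrable A B)
        fix q :: "real \<times> real"
        \<comment> \<open>Convexity: \<open>sgn (x - y)\<close> is a subgradient of the absolute
          value at \<open>x - y\<close>.\<close>
        have "sgn s * ((x' - x) - (y' - y)) \<le> \<bar>x' - y'\<bar> - \<bar>x - y\<bar>" if "s = x - y" for s x y x' y' :: real
          using that by (auto simp: sgn_if)
        from mult_right_mono[OF mult_right_mono[OF this[OF refl, of "a (fst q)" "b (snd q)" "?a (fst q)" "?b (snd q)"] kernD(1)[OF K, of z]] rho_nonneg[of "fst q - snd q"]]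
        show "Psi (q, z) \<le> K z * (\<bar>?a (fst q) - ?b (snd q)\<bar> * \<rho> (fst q - snd q) - \<bar>a (fst q) - b (snd q)\<bar> * \<rho> (fst q - snd q))"
          by (simp add: Psi_def algebra_simps)
      qed
      also have "\<dots> = K z * (doubled_dist ?a ?b - doubled_dist a b)"
        unfolding doubled_dist_def by (subst integral_mult_right_zero, subst Bochner_Integration.integral_diff) (intro refl doubled_dist_integrable A B)+
      also have "\<dots> = 0" using doubled_dist_shift[OF A(1) B(1), of z] by simp
      finally show ?case .
    qed
  qed simp
  finally show ?thesis by simp
qed

end

locale flux_moll = split_flux p m L + moll \<rho> \<rho>' R for p m L \<rho> \<rho>' R +
  fixes K :: "real \<Rightarrow> real"
  assumes K: "kern K"
begin

text \<open>By monotonicity of \<open>p\<close> and \<open>m\<close> this is the entropy flux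
  \<open>sgn (a - k) * (f a - f k)\<close>, see \<open>entropy_flux_split\<close>. In this form the
  symmetry in the two arguments and the Lipschitz bound are visible.\<close>

definition kruzkov_flux :: "real \<Rightarrow> real \<Rightarrow> real" where "kruzkov_flux a k = \<bar>p a - p k\<bar> - \<bar>m a - m k\<bar>"

lemma kruzkov_flux_sym: "kruzkov_flux a b = kruzkov_flux b a" by (simp add: kruzkov_flux_def abs_minus_commute)

lemma kruzkov_flux_bound: "\<bar>kruzkov_flux a b\<bar> \<le> L * (\<bar>a\<bar> + \<bar>b\<bar>)"
proof -
  have "\<bar>kruzkov_flux a b\<bar> \<le> L * \<bar>a - b\<bar>" using p_m_diff[of a b] by (simp add: kruzkov_flux_def)
  also have "\<dots> \<le> L * (\<bar>a\<bar> + \<bar>b\<bar>)" using L_nonneg by (intro mult_left_mono) auto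
  finally show ?thesis .
qed

lemma measurable_kruzkov_flux [measurable (raw)]:
  assumes [measurable]: "f \<in> borel_measurable M" "g \<in> borel_measurable M"
  shows "(\<lambda>x. kruzkov_flux (f x) (g x)) \<in> borel_measurable M"
  unfolding kruzkov_flux_def by measurable

text \<open>The upper bound for the rate of change of \<open>doubled_dist a b\<close> when
  \<open>a\<close> evolves and \<open>b\<close> is frozen; the derivative of the mollifier is taken
  in the variable of \<open>a\<close>.\<close>

definition doubled_flux :: "(real \<Rightarrow> real) \<Rightarrow> (real \<Rightarrow> real) \<Rightarrow> real" where
  "doubled_flux a b = (LINT q|lborel. kruzkov_flux (a (fst q)) (b (snd q)) * \<rho>' (fst q - snd q)
     + sgn (a (fst q) - b (snd q)) * G K a (fst q) * \<rho> (fst q - snd q))"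

lemma doubled_flux_integrable:
  assumes a: "bvc C a" and b: "bvc C b"
  shows doubled_flux_int1: "integrable lborel (\<lambda>q. kruzkov_flux (a (fst q)) (b (snd q)) * \<rho>' (fst q - snd q))"
    and doubled_flux_int2: "integrable lborel (\<lambda>q. sgn (a (fst q) - b (snd q)) * G K a (fst q) * \<rho> (fst q - snd q))"
    and doubled_flux_bound: "\<bar>doubled_flux a b\<bar> \<le> 2 * L * C * (LINT x|lborel. \<bar>\<rho>' x\<bar>) + 2 * C * kmass K"
proof -
  note A = bvcD[OF a] and B = bvcD[OF b]
  note Ga = G_integrable[OF a K]
  note [measurable] = A(6) B(6) Ga[THEN integrable_lborel_measurable]
  have i: "integrable lborel (\<lambda>x. L * \<bar>a x\<bar>)" "integrable lborel (\<lambda>x. L * \<bar>b x\<bar>)" using A(1) B(1) by auto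
  have le: "\<bar>kruzkov_flux (a (fst q)) (b (snd q)) * \<rho>' (fst q - snd q)\<bar> \<le> (L * \<bar>a (fst q)\<bar> + L * \<bar>b (snd q)\<bar>) * \<bar>\<rho>' (fst q - snd q)\<bar>" for q
    using kruzkov_flux_bound[of "a (fst q)" "b (snd q)"] by (auto simp: abs_mult distrib_left intro!: mult_right_mono)
  note 1 = pair_dominated[OF _ i rho'_integrable le]
  show I1: "integrable lborel (\<lambda>q. kruzkov_flux (a (fst q)) (b (snd q)) * \<rho>' (fst q - snd q))" by (rule 1) measurable
  have b1: "\<bar>LINT q|lborel. kruzkov_flux (a (fst q)) (b (snd q)) * \<rho>' (fst q - snd q)\<bar> \<le> ((LINT x|lborel. L * \<bar>a x\<bar>) + (LINT x|lborel. L * \<bar>b x\<bar>)) * (LINT x|lborel. \<bar>\<rho>' x\<bar>)"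
    by (rule 1) measurable
  also have "\<dots> \<le> (L * C + L * C) * (LINT x|lborel. \<bar>\<rho>' x\<bar>)"
    using A(2) B(2) L_nonneg by (intro mult_right_mono add_mono) (auto intro!: mult_left_mono)
  finally have b1: "\<bar>LINT q|lborel. kruzkov_flux (a (fst q)) (b (snd q)) * \<rho>' (fst q - snd q)\<bar> \<le> 2 * L * C * (LINT x|lborel. \<bar>\<rho>' x\<bar>)"
    by (simp add: ac_simps)
  have le2: "\<bar>sgn (a (fst q) - b (snd q)) * G K a (fst q) * \<rho> (fst q - snd q)\<bar> \<le> (\<bar>G K a (fst q)\<bar> + 0) * \<bar>\<rho> (fst q - snd q)\<bar>" for q
    by (auto simp: abs_mult sgn_if)
  note 2 = pair_dominated[OF _ integrable_abs[OF Ga] integrable_zero rho_integrable le2]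
  show I2: "integrable lborel (\<lambda>q. sgn (a (fst q) - b (snd q)) * G K a (fst q) * \<rho> (fst q - snd q))" by (rule 2) measurable
  have b2: "\<bar>LINT q|lborel. sgn (a (fst q) - b (snd q)) * G K a (fst q) * \<rho> (fst q - snd q)\<bar> \<le> ((LINT x|lborel. \<bar>G K a x\<bar>) + (LINT x::real|lborel. 0)) * (LINT x|lborel. \<bar>\<rho> x\<bar>)"
    by (rule 2) measurable
  also have "\<dots> \<le> 2 * C * kmass K" using G_bound[OF a K] by (simp add: rho_abs_int)
  finally have b2: "\<bar>LINT q|lborel. sgn (a (fst q) - b (snd q)) * G K a (fst q) * \<rho> (fst q - snd q)\<bar> \<le> 2 * C * kmass K" .
  have "doubled_flux a b = (LINT q|lborel. kruzkov_flux (a (fst q)) (b (snd q)) * \<rho>' (fst q - snd q)) + (LINT q|lborel. sgn (a (fst q) - b (snd q)) * G K a (fst q) * \<rho> (fst q - snd q))"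
    unfolding doubled_flux_def by (intro Bochner_Integration.integral_add I1 I2)
  then show "\<bar>doubled_flux a b\<bar> \<le> 2 * L * C * (LINT x|lborel. \<bar>\<rho>' x\<bar>) + 2 * C * kmass K" using b1 b2 by linarith
qed

text \<open>Exchanging the variables in the second term leaves \<open>kruzkov_flux\<close> unchanged
  but reverses the sign of the odd function \<open>\<rho>'\<close>, so the flux parts cancel. The
  signs in front of the jump parts also turn over, and what remains is the integral of
  \<open>Kato\<close>.\<close>

lemma doubled_flux_antisym:
  assumes a: "bvc C a" and b: "bvc C b"
  shows "doubled_flux a b + doubled_flux b a \<le> 0"
proof -
  note A = bvcD[OF a] and B = bvcD[OF b]
  note [measurable] = A(6) B(6) G_integrable[OF a K, THEN integrable_lborel_measurable] G_integrable[OF b K, THEN integrable_lborel_measurable]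
  let ?f = "\<lambda>q. kruzkov_flux (b (fst q)) (a (snd q)) * \<rho>' (fst q - snd q) + sgn (b (fst q) - a (snd q)) * G K b (fst q) * \<rho> (fst q - snd q)"
  have fi: "integrable lborel ?f" using doubled_flux_int1[OF b a] doubled_flux_int2[OF b a] by simp
  have fi': "integrable lborel (\<lambda>q. ?f (snd q, fst q))"
    using lborel_pair.integrable_product_swap[of ?f] fi by (simp add: lborel_prod case_prod_beta')
  have gi: "integrable lborel (\<lambda>q. kruzkov_flux (a (fst q)) (b (snd q)) * \<rho>' (fst q - snd q) + sgn (a (fst q) - b (snd q)) * G K a (fst q) * \<rho> (fst q - snd q))"
    using doubled_flux_int1[OF a b] doubled_flux_int2[OF a b] by simp
  have "doubled_flux b a = (LINT q|lborel. ?f (snd q, fst q))" unfolding doubled_flux_def by (rule lborel_swap[symmetric]) measurable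
  then have "doubled_flux a b + doubled_flux b a = (LINT q|lborel. kruzkov_flux (a (fst q)) (b (snd q)) * \<rho>' (fst q - snd q) + sgn (a (fst q) - b (snd q)) * G K a (fst q) * \<rho> (fst q - snd q) + ?f (snd q, fst q))"
    unfolding doubled_flux_def using Bochner_Integration.integral_add[OF gi fi'] by simp
  also have "\<dots> = (LINT q|lborel. sgn (a (fst q) - b (snd q)) * (G K a (fst q) - G K b (snd q)) * \<rho> (fst q - snd q))"
  proof (rule Bochner_Integration.integral_cong[OF refl])
    fix q :: "real \<times> real"
    have "\<rho> (snd q - fst q) = \<rho> (fst q - snd q)" "\<rho>' (snd q - fst q) = - \<rho>' (fst q - snd q)"
      using rho_even[of "fst q - snd q"] rho'_odd[of "fst q - snd q"] by simp_all
    moreover have "sgn (b (snd q) - a (fst q)) = - sgn (a (fst q) - b (snd q))" by (simp add: sgn_if)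
    ultimately show "kruzkov_flux (a (fst q)) (b (snd q)) * \<rho>' (fst q - snd q) + sgn (a (fst q) - b (snd q)) * G K a (fst q) * \<rho> (fst q - snd q) + ?f (snd q, fst q)
       = sgn (a (fst q) - b (snd q)) * (G K a (fst q) - G K b (snd q)) * \<rho> (fst q - snd q)"
      by (simp add: kruzkov_flux_sym[of "b _"] algebra_simps)
  qed
  also have "\<dots> \<le> 0" by (rule Kato[OF a b K])
  finally show ?thesis .
qed

end

section \<open>Joining two one-sided estimates along the diagonal\<close>

lemma deriv_sliding_average:
  fixes I :: "real \<Rightarrow> real"
  assumes c: "continuous_on UNIV I" and \<tau>: "0 \<le> \<tau>"
  shows "((\<lambda>a. integral {0..\<tau>} (\<lambda>\<alpha>. I (a + \<alpha>))) has_real_derivative I (a + \<tau>) - I a) (at a)"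
proof -
  have "\<exists>F. \<forall>x::real. -\<infinity> < ereal x \<longrightarrow> ereal x < \<infinity> \<longrightarrow> (F has_vector_derivative I x) (at x)"
    by (rule einterval_antiderivative) (use c in \<open>auto simp: continuous_on_eq_continuous_at\<close>)
  then obtain P where P: "\<And>x. (P has_real_derivative I x) (at x)"
    by (auto simp: has_real_derivative_iff_has_vector_derivative)
  have "integral {0..\<tau>} (\<lambda>\<alpha>. I (a + \<alpha>)) = P (a + \<tau>) - P a" for a
  proof -
    have "((\<lambda>\<alpha>. P (a + \<alpha>)) has_real_derivative I (a + x)) (at x)" for x
      using DERIV_chain2[OF P DERIV_add[OF DERIV_const DERIV_ident], of a x] by simp
    then have "((\<lambda>\<alpha>. P (a + \<alpha>)) has_vector_derivative I (a + x)) (at x within {0..\<tau>})" for x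
      unfolding has_real_derivative_iff_has_vector_derivative[symmetric] by (rule has_field_derivative_at_within)
    from fundamental_theorem_of_calculus[OF \<tau> this]
    show ?thesis by (simp add: integral_unique)
  qed
  moreover have "((\<lambda>a. P (a + \<tau>) - P a) has_real_derivative I (a + \<tau>) - I a) (at a)"
  proof (intro DERIV_diff P)
    have "((\<lambda>a. P (a + \<tau>)) has_real_derivative I (a + \<tau>) * 1) (at a)"
      by (rule DERIV_chain2[OF P]) (auto intro!: derivative_eq_intros)
    then show "((\<lambda>a. P (a + \<tau>)) has_real_derivative I (a + \<tau>)) (at a)" by simp
  qed
  ultimately show ?thesis by simp
qed

lemma integral_eq_LINT:
  fixes g :: "real \<Rightarrow> real"
  assumes "continuous_on {a..b} g"
  shows "integral {a..b} g = (LINT t|lborel. indicator {a..b} t * g t)"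
    and "integrable lborel (\<lambda>t. indicator {a..b} t * g t)"
  using set_borel_integral_eq_integral(2)[OF borel_integrable_atLeastAtMost'[OF assms]]
    borel_integrable_atLeastAtMost'[OF assms]
  by (simp_all add: set_lebesgue_integral_def set_integrable_def)

text \<open>
  The averages of \<open>\<Phi>\<close> over the squares of side \<open>\<tau>\<close> are differentiable along the diagonal, and
  after averaging the two one-sided bounds are evaluated over the same square.
\<close>

lemma diagonal_estimate:
  fixes \<Phi> A B :: "real \<Rightarrow> real \<Rightarrow> real"
  assumes cont: "continuous_on UNIV (\<lambda>q. \<Phi> (fst q) (snd q))"
    and A: "(\<lambda>q. A (fst q) (snd q)) \<in> borel_measurable borel" "\<And>t s. \<bar>A t s\<bar> \<le> M"
    and B: "(\<lambda>q. B (fst q) (snd q)) \<in> borel_measurable borel" "\<And>t s. \<bar>B t s\<bar> \<le> M"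
    and AB: "\<And>t s. A t s + B t s \<le> 0"
    and incA: "\<And>a b s. 0 \<le> a \<Longrightarrow> a \<le> b \<Longrightarrow> b \<le> T \<Longrightarrow> 0 \<le> s \<Longrightarrow> s \<le> T \<Longrightarrow>
        \<Phi> b s - \<Phi> a s \<le> (LINT t:{a..b}|lborel. A t s) + e1 * (b - a)"
    and incB: "\<And>a b s. 0 \<le> a \<Longrightarrow> a \<le> b \<Longrightarrow> b \<le> T \<Longrightarrow> 0 \<le> s \<Longrightarrow> s \<le> T \<Longrightarrow>
        \<Phi> s b - \<Phi> s a \<le> (LINT t:{a..b}|lborel. B s t) + e2 * (b - a)"
    and t: "0 \<le> t" "t \<le> T"
  shows "\<Phi> t t \<le> \<Phi> 0 0 + (e1 + e2) * t"
proof -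
  have cc: "continuous_on S (\<lambda>x. \<Phi> (f x) (g x))" if "continuous_on S f" "continuous_on S g" for S f g
    using continuous_on_compose2[OF cont continuous_on_Pair[OF that]] by simp
  have meas: "(\<lambda>x. A (f x) (g x)) \<in> borel_measurable N" "(\<lambda>x. B (f x) (g x)) \<in> borel_measurable N"
    if "f \<in> borel_measurable N" "g \<in> borel_measurable N" for f g and N :: "'z measure"
    using measurable_param_compose[OF A(1) that] measurable_param_compose[OF B(1) that] .
  note [measurable] = A(1) B(1)
  \<comment> \<open>A staircase along the diagonal would evaluate \<open>A\<close> and
    \<open>B\<close> at different points, and neither is continuous, so \<open>AB\<close> could not
    be applied. The average over a square is differentiable with both rates integrated over that
    same square.\<close>
  define av where "av \<tau> a b = integral {0..\<tau>} (\<lambda>\<alpha>. integral {0..\<tau>} (\<lambda>\<beta>. \<Phi> (a + \<alpha>) (b + \<beta>)))" for \<tau> a b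
  have step: "av \<tau> r r \<le> av \<tau> 0 0 + (e1 + e2) * \<tau>\<^sup>2 * r" if \<tau>: "0 < \<tau>" and r: "0 \<le> r" "r + \<tau> \<le> T" for \<tau> r
  proof -
    define Da where "Da a b = integral {0..\<tau>} (\<lambda>\<beta>. \<Phi> (a + \<tau>) (b + \<beta>)) - integral {0..\<tau>} (\<lambda>\<beta>. \<Phi> a (b + \<beta>))" for a b
    define Db where "Db a b = integral {0..\<tau>} (\<lambda>\<alpha>. \<Phi> (a + \<alpha>) (b + \<tau>)) - integral {0..\<tau>} (\<lambda>\<alpha>. \<Phi> (a + \<alpha>) b)" for a b
    have ci: "continuous_on UNIV (\<lambda>q. integral {0..\<tau>} (\<lambda>\<beta>. \<Phi> (f q) (g q + \<beta>)))"
      and ci': "continuous_on UNIV (\<lambda>q. integral {0..\<tau>} (\<lambda>\<beta>. \<Phi> (g q + \<beta>) (f q)))"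
      if fg: "continuous_on UNIV f" "continuous_on UNIV g" for f g :: "'z::real_normed_vector \<Rightarrow> real"
    proof -
      have c: "continuous_on (UNIV \<times> cbox 0 \<tau>) (\<lambda>q. f (fst q))" "continuous_on (UNIV \<times> cbox 0 \<tau>) (\<lambda>q. g (fst q) + snd q)"
        by (intro continuous_on_add continuous_on_compose2[OF fg(1)] continuous_on_compose2[OF fg(2)] continuous_intros; simp)+
      have "continuous_on (UNIV \<times> cbox 0 \<tau>) (\<lambda>(q, \<beta>). \<Phi> (f q) (g q + \<beta>))"
        using cc[OF c] by (simp add: case_prod_beta')
      from integral_continuous_on_param[OF this]
      show "continuous_on UNIV (\<lambda>q. integral {0..\<tau>} (\<lambda>\<beta>. \<Phi> (f q) (g q + \<beta>)))" by simp
      have "continuous_on (UNIV \<times> cbox 0 \<tau>) (\<lambda>(q, \<beta>). \<Phi> (g q + \<beta>) (f q))"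
        using cc[OF c(2,1)] by (simp add: case_prod_beta')
      from integral_continuous_on_param[OF this]
      show "continuous_on UNIV (\<lambda>q. integral {0..\<tau>} (\<lambda>\<beta>. \<Phi> (g q + \<beta>) (f q)))" by simp
    qed
    have da: "((\<lambda>a. av \<tau> a b) has_real_derivative Da a b) (at a)" for a b
      unfolding av_def Da_def
      by (rule deriv_sliding_average[where I="\<lambda>t. integral {0..\<tau>} (\<lambda>\<beta>. \<Phi> t (b + \<beta>))"])
         (use \<tau> in \<open>auto intro!: ci continuous_intros\<close>)
    have swap: "av \<tau> a b = integral {0..\<tau>} (\<lambda>\<beta>. integral {0..\<tau>} (\<lambda>\<alpha>. \<Phi> (a + \<alpha>) (b + \<beta>)))" for a b
    proof -
      have "continuous_on (cbox (0, 0) (\<tau>, \<tau>)) (\<lambda>(\<alpha>, \<beta>). \<Phi> (a + \<alpha>) (b + \<beta>))"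
        unfolding case_prod_beta' by (intro cc continuous_intros)
      from integral_swap_continuous[OF this] show ?thesis by (simp add: av_def)
    qed
    have db: "((\<lambda>b. av \<tau> a b) has_real_derivative Db a b) (at b)" for a b
      unfolding swap Db_def
      by (rule deriv_sliding_average[where I="\<lambda>t. integral {0..\<tau>} (\<lambda>\<alpha>. \<Phi> (a + \<alpha>) t)"])
         (use \<tau> in \<open>auto intro!: ci' continuous_intros\<close>)
    have dbc: "continuous_on UNIV (\<lambda>q. Db (fst q) (snd q))"
      unfolding Db_def by (intro continuous_on_diff ci' continuous_intros)
    \<comment> \<open>Two partial derivatives give a total derivative as soon as one of them is
      continuous; here it is \<open>Db\<close>. The chain rule along the diagonal then adds
      them.\<close>
    have tot: "((\<lambda>r. av \<tau> r r) has_real_derivative Da r r + Db r r) (at r)" for r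
    proof -
      have "((\<lambda>(x, y). av \<tau> x y) has_derivative (\<lambda>(tx, ty). Da r r * tx + blinfun_apply (blinfun_scaleR_left (Db r r)) ty)) (at (r, r) within UNIV \<times> UNIV)"
      proof (rule has_derivative_partialsI[where f="av \<tau>" and fx="(*) (Da r r)" and fy="\<lambda>x y. blinfun_scaleR_left (Db x y)"])
        show "((\<lambda>x. av \<tau> x r) has_derivative (*) (Da r r)) (at r within UNIV)"
          using da[of r r] by (simp add: has_field_derivative_def)
        show "((\<lambda>y. av \<tau> x y) has_derivative blinfun_apply (blinfun_scaleR_left (Db x y))) (at y within UNIV)" for x y
        proof -
          have "blinfun_apply (blinfun_scaleR_left (Db x y)) = (*) (Db x y)"
            by (auto simp: fun_eq_iff mult.commute)
          then show ?thesis using db[of x y] by (simp add: has_field_derivative_def)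
        qed
        have "continuous_on UNIV (\<lambda>q. blinfun_scaleR_left (Db (fst q) (snd q)) :: real \<Rightarrow>\<^sub>L real)"
          by (intro bounded_linear.continuous_on[OF bounded_linear_blinfun_scaleR_left] dbc)
        then show "continuous (at (r, r) within UNIV \<times> UNIV) (\<lambda>(x, y). blinfun_scaleR_left (Db x y) :: real \<Rightarrow>\<^sub>L real)"
          by (simp add: case_prod_beta' continuous_on_eq_continuous_within)
      qed auto
      then have 1: "((\<lambda>(x, y). av \<tau> x y) has_derivative (\<lambda>(tx, ty). Da r r * tx + ty * Db r r)) (at (r, r))" by simp
      have 2: "((\<lambda>r::real. (r, r)) has_derivative (\<lambda>h. (h, h))) (at r)" by (auto intro!: derivative_eq_intros)
      have "((\<lambda>r. av \<tau> r r) has_derivative (\<lambda>h. Da r r * h + h * Db r r)) (at r)"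
        using diff_chain_at[OF 2 1] by (simp add: o_def)
      then show ?thesis unfolding has_field_derivative_def by (rule has_derivative_eq_rhs) (auto simp: algebra_simps)
    qed
    \<comment> \<open>Each partial derivative is an integral of increments of \<open>\<Phi>\<close>
      over one side of the square; inserting the increment bounds gives integrals of
      \<open>A\<close> and \<open>B\<close> over the whole square plus the area times
      \<open>e1\<close> and \<open>e2\<close>. The condition \<open>r + \<tau> \<le> T\<close> keeps
      the square in the range of the bounds.\<close>
    have le: "Da x x + Db x x \<le> (e1 + e2) * \<tau>\<^sup>2" if x: "0 \<le> x" "x \<le> r" for x
    proof -
      let ?I = "{x..x + \<tau>}"
      have bx: "x + \<tau> \<le> T" using x r by simp
      have fin: "integrable lborel (\<lambda>q. indicator (?I \<times> ?I) q * g q)"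
        if "g \<in> borel_measurable borel" "\<And>q. \<bar>g q\<bar> \<le> M" for g :: "real \<times> real \<Rightarrow> real"
      proof (rule integrable_bounded_mult(1)[OF _ that])
        have eq: "?I \<times> ?I = cbox (x, x) (x + \<tau>, x + \<tau>)" by (simp add: cbox_Pair_eq)
        show "integrable lborel (indicator (?I \<times> ?I) :: real \<times> real \<Rightarrow> real)"
          unfolding eq by (intro integrable_real_indicator) (simp, rule emeasure_lborel_cbox_finite)
      qed
      have iA: "integrable lborel (\<lambda>q. indicator (?I \<times> ?I) q * A (snd q) (fst q))"
        and iA': "integrable lborel (\<lambda>q. indicator (?I \<times> ?I) q * A (fst q) (snd q))"
        and iB: "integrable lborel (\<lambda>q. indicator (?I \<times> ?I) q * B (fst q) (snd q))"
        by (intro fin meas A B; measurable)+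
      have shA: "(LINT \<beta>|lborel. indicator {0..\<tau>} \<beta> * g (x + \<beta>)) = (LINT s|lborel. indicator ?I s * g s)" for g :: "real \<Rightarrow> real"
      proof -
        have "(LINT s|lborel. indicator ?I s * g s) = (LINT \<beta>|lborel. indicator ?I (\<beta> + x) * g (\<beta> + x))"
          by (rule integral_shift[symmetric])
        also have "\<dots> = (LINT \<beta>|lborel. indicator {0..\<tau>} \<beta> * g (x + \<beta>))"
          by (intro Bochner_Integration.integral_cong) (auto simp: indicator_def add.commute)
        finally show ?thesis by simp
      qed
      have L: "(LINT t|lborel. indicator (?I \<times> ?I) (s, t) * g t) = indicator ?I s * (LINT t:?I|lborel. g t)" for s and g :: "real \<Rightarrow> real"
        unfolding set_lebesgue_integral_def by (simp add: indicator_times mult.assoc)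
      have const: "integrable lborel (\<lambda>s. indicator ?I s * c)" "(LINT s|lborel. indicator ?I s * c) = \<tau> * c" for c :: real
        using \<tau> by (auto intro!: integrable_mult_left)
      have "Da x x = integral {0..\<tau>} (\<lambda>\<beta>. \<Phi> (x + \<tau>) (x + \<beta>) - \<Phi> x (x + \<beta>))"
        unfolding Da_def by (intro integral_diff[symmetric] integrable_continuous_interval cc continuous_intros)
      also have "\<dots> = (LINT \<beta>|lborel. indicator {0..\<tau>} \<beta> * (\<Phi> (x + \<tau>) (x + \<beta>) - \<Phi> x (x + \<beta>)))"
        by (intro integral_eq_LINT cc continuous_intros)
      also have "\<dots> = (LINT s|lborel. indicator ?I s * (\<Phi> (x + \<tau>) s - \<Phi> x s))" by (rule shA)
      also have "\<dots> \<le> (LINT s|lborel. (LINT t|lborel. indicator (?I \<times> ?I) (s, t) * A t s) + indicator ?I s * (e1 * \<tau>))"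
      proof (intro integral_mono Bochner_Integration.integrable_add const integral_eq_LINT cc continuous_intros)
        show "integrable lborel (\<lambda>s. LINT t|lborel. indicator (?I \<times> ?I) (s, t) * A t s)"
          using lborel_integrable_fst[OF iA] by simp
        fix s
        show "indicator ?I s * (\<Phi> (x + \<tau>) s - \<Phi> x s) \<le> (LINT t|lborel. indicator (?I \<times> ?I) (s, t) * A t s) + indicator ?I s * (e1 * \<tau>)"
          unfolding L using incA[of x "x + \<tau>" s] x bx \<tau> by (auto simp: indicator_def)
      qed
      also have "\<dots> = (LINT s|lborel. LINT t|lborel. indicator (?I \<times> ?I) (s, t) * A t s) + \<tau> * (e1 * \<tau>)"
        using lborel_integrable_fst[OF iA] const by (subst Bochner_Integration.integral_add) auto
      also have "(LINT s|lborel. LINT t|lborel. indicator (?I \<times> ?I) (s, t) * A t s) = (LINT q|lborel. indicator (?I \<times> ?I) q * A (snd q) (fst q))"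
        using lborel_fubini_fst[OF iA] by simp
      also have "\<dots> = (LINT q|lborel. indicator (?I \<times> ?I) (snd q, fst q) * A (fst q) (snd q))"
        by (subst lborel_swap[symmetric]) (auto intro!: borel_measurable_times meas)
      also have "\<dots> = (LINT q|lborel. indicator (?I \<times> ?I) q * A (fst q) (snd q))"
        by (intro Bochner_Integration.integral_cong) (auto simp: indicator_def)
      finally have 1: "Da x x \<le> (LINT q|lborel. indicator (?I \<times> ?I) q * A (fst q) (snd q)) + \<tau> * (e1 * \<tau>)" .
      have "Db x x = integral {0..\<tau>} (\<lambda>\<alpha>. \<Phi> (x + \<alpha>) (x + \<tau>) - \<Phi> (x + \<alpha>) x)"
        unfolding Db_def by (intro integral_diff[symmetric] integrable_continuous_interval cc continuous_intros)
      also have "\<dots> = (LINT \<beta>|lborel. indicator {0..\<tau>} \<beta> * (\<Phi> (x + \<beta>) (x + \<tau>) - \<Phi> (x + \<beta>) x))"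
        by (intro integral_eq_LINT cc continuous_intros)
      also have "\<dots> = (LINT s|lborel. indicator ?I s * (\<Phi> s (x + \<tau>) - \<Phi> s x))" by (rule shA)
      also have "\<dots> \<le> (LINT s|lborel. (LINT t|lborel. indicator (?I \<times> ?I) (s, t) * B s t) + indicator ?I s * (e2 * \<tau>))"
      proof (intro integral_mono Bochner_Integration.integrable_add const integral_eq_LINT cc continuous_intros)
        show "integrable lborel (\<lambda>s. LINT t|lborel. indicator (?I \<times> ?I) (s, t) * B s t)"
          using lborel_integrable_fst[OF iB] by simp
        fix s
        show "indicator ?I s * (\<Phi> s (x + \<tau>) - \<Phi> s x) \<le> (LINT t|lborel. indicator (?I \<times> ?I) (s, t) * B s t) + indicator ?I s * (e2 * \<tau>)"
          unfolding L using incB[of x "x + \<tau>" s] x bx \<tau> by (auto simp: indicator_def)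
      qed
      also have "\<dots> = (LINT s|lborel. LINT t|lborel. indicator (?I \<times> ?I) (s, t) * B s t) + \<tau> * (e2 * \<tau>)"
        using lborel_integrable_fst[OF iB] const by (subst Bochner_Integration.integral_add) auto
      also have "(LINT s|lborel. LINT t|lborel. indicator (?I \<times> ?I) (s, t) * B s t) = (LINT q|lborel. indicator (?I \<times> ?I) q * B (fst q) (snd q))"
        using lborel_fubini_fst[OF iB] by simp
      finally have 2: "Db x x \<le> (LINT q|lborel. indicator (?I \<times> ?I) q * B (fst q) (snd q)) + \<tau> * (e2 * \<tau>)" .
      have "(LINT q|lborel. indicator (?I \<times> ?I) q * A (fst q) (snd q)) + (LINT q|lborel. indicator (?I \<times> ?I) q * B (fst q) (snd q))
        = (LINT q|lborel. indicator (?I \<times> ?I) q * A (fst q) (snd q) + indicator (?I \<times> ?I) q * B (fst q) (snd q))"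
        by (intro Bochner_Integration.integral_add[symmetric] iA' iB)
      also have "\<dots> \<le> integral\<^sup>L lborel (\<lambda>q :: real \<times> real. 0)"
        by (intro integral_mono Bochner_Integration.integrable_add iA' iB) (use AB in \<open>auto simp: indicator_def\<close>)
      finally show ?thesis using 1 2 by (simp add: power2_eq_square algebra_simps)
    qed
    have "av \<tau> r r - (e1 + e2) * \<tau>\<^sup>2 * r \<le> av \<tau> 0 0 - (e1 + e2) * \<tau>\<^sup>2 * 0"
    proof (rule DERIV_nonpos_imp_nonincreasing[OF r(1)])
      fix x assume x: "0 \<le> x" "x \<le> r"
      have "((\<lambda>x. av \<tau> x x - (e1 + e2) * \<tau>\<^sup>2 * x) has_real_derivative (Da x x + Db x x) - (e1 + e2) * \<tau>\<^sup>2) (at x)"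
        by (rule DERIV_diff[OF tot]) (auto intro!: derivative_eq_intros)
      then show "\<exists>y. ((\<lambda>x. av \<tau> x x - (e1 + e2) * \<tau>\<^sup>2 * x) has_real_derivative y) (at x) \<and> y \<le> 0"
        using le[OF x] by force
    qed
    then show ?thesis by simp
  qed
  have main: "\<Phi> r r \<le> \<Phi> 0 0 + (e1 + e2) * r" if r: "0 \<le> r" "r < T" for r
  proof (rule field_le_epsilon)
    fix \<epsilon> :: real assume \<epsilon>: "0 < \<epsilon>"
    \<comment> \<open>The averages are not normalized, so they behave like
      \<open>\<tau>\<^sup>2\<close> times the diagonal value; the factor is divided out at the
      end.\<close>
    have near: "\<exists>d>0. \<forall>\<tau>. 0 < \<tau> \<and> \<tau> < d \<longrightarrow> \<bar>av \<tau> a a - \<tau>\<^sup>2 * \<Phi> a a\<bar> \<le> \<tau>\<^sup>2 * (\<epsilon> / 2)" for a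
    proof -
      have "continuous (at (a, a)) (\<lambda>q. \<Phi> (fst q) (snd q))"
        using cont by (simp add: continuous_on_eq_continuous_at)
      then obtain d where d: "d > 0" "\<And>q. dist q (a, a) < d \<Longrightarrow> \<bar>\<Phi> (fst q) (snd q) - \<Phi> a a\<bar> < \<epsilon> / 2"
        unfolding continuous_at_eps_delta using \<epsilon> by (force simp: dist_real_def dest: spec[of _ "\<epsilon>/2"])
      have "\<bar>av \<tau> a a - \<tau>\<^sup>2 * \<Phi> a a\<bar> \<le> \<tau>\<^sup>2 * (\<epsilon> / 2)" if \<tau>: "0 < \<tau>" "\<tau> < d / 2" for \<tau>
      proof -
        have pt: "\<bar>\<Phi> (a + \<alpha>) (a + \<beta>) - \<Phi> a a\<bar> \<le> \<epsilon> / 2" if "\<alpha> \<in> {0..\<tau>}" "\<beta> \<in> {0..\<tau>}" for \<alpha> \<beta>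
        proof -
          have "dist (a + \<alpha>, a + \<beta>) (a, a) \<le> \<alpha> + \<beta>"
            unfolding dist_Pair_Pair using that sqrt_sum_squares_le_sum_abs[of \<alpha> \<beta>] by (simp add: dist_real_def)
          then show ?thesis using d(2)[of "(a + \<alpha>, a + \<beta>)"] that \<tau> by auto
        qed
        have i1: "\<bar>integral {0..\<tau>} (\<lambda>\<beta>. \<Phi> (a + \<alpha>) (a + \<beta>)) - \<tau> * \<Phi> a a\<bar> \<le> \<tau> * (\<epsilon> / 2)" if al: "\<alpha> \<in> {0..\<tau>}" for \<alpha>
        proof -
          have "integral {0..\<tau>} (\<lambda>\<beta>. \<Phi> (a + \<alpha>) (a + \<beta>)) - \<tau> * \<Phi> a a = integral {0..\<tau>} (\<lambda>\<beta>. \<Phi> (a + \<alpha>) (a + \<beta>) - \<Phi> a a)"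
            using \<tau> by (subst Henstock_Kurzweil_Integration.integral_diff) (auto intro!: integrable_continuous_interval cc continuous_intros)
          also have "norm \<dots> \<le> (\<epsilon> / 2) * (\<tau> - 0)"
            using \<tau> pt[OF al] by (intro integral_bound) (auto intro!: cc continuous_intros)
          finally show ?thesis by (simp add: mult.commute)
        qed
        have ci: "continuous_on UNIV (\<lambda>\<alpha>. integral {0..\<tau>} (\<lambda>\<beta>. \<Phi> (a + \<alpha>) (a + \<beta>)))"
        proof -
          have "continuous_on (UNIV \<times> cbox 0 \<tau>) (\<lambda>(\<alpha>, \<beta>). \<Phi> (a + \<alpha>) (a + \<beta>))"
            unfolding case_prod_beta' by (intro cc continuous_intros)
          from integral_continuous_on_param[OF this] show ?thesis by simp
        qed
        have "av \<tau> a a - \<tau>\<^sup>2 * \<Phi> a a = integral {0..\<tau>} (\<lambda>\<alpha>. integral {0..\<tau>} (\<lambda>\<beta>. \<Phi> (a + \<alpha>) (a + \<beta>)) - \<tau> * \<Phi> a a)"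
          unfolding av_def using \<tau>
          by (subst Henstock_Kurzweil_Integration.integral_diff)
             (auto intro!: integrable_continuous_interval continuous_on_subset[OF ci] simp: power2_eq_square)
        also have "norm \<dots> \<le> (\<tau> * (\<epsilon> / 2)) * (\<tau> - 0)"
          using \<tau> i1 by (intro integral_bound) (auto intro!: continuous_intros continuous_on_subset[OF ci])
        finally show ?thesis by (simp add: power2_eq_square algebra_simps)
      qed
      then show ?thesis using d(1) by (intro exI[of _ "d/2"]) auto
    qed
    obtain d1 where d1: "d1 > 0" "\<And>\<tau>. 0 < \<tau> \<Longrightarrow> \<tau> < d1 \<Longrightarrow> \<bar>av \<tau> r r - \<tau>\<^sup>2 * \<Phi> r r\<bar> \<le> \<tau>\<^sup>2 * (\<epsilon> / 2)" using near[of r] by auto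
    obtain d2 where d2: "d2 > 0" "\<And>\<tau>. 0 < \<tau> \<Longrightarrow> \<tau> < d2 \<Longrightarrow> \<bar>av \<tau> 0 0 - \<tau>\<^sup>2 * \<Phi> 0 0\<bar> \<le> \<tau>\<^sup>2 * (\<epsilon> / 2)" using near[of 0] by auto
    define \<tau> where "\<tau> = min (min d1 d2) (T - r) / 2"
    have \<tau>: "0 < \<tau>" "\<tau> < d1" "\<tau> < d2" "r + \<tau> \<le> T"
      using d1(1) d2(1) r min.cobounded1[of "min d1 d2" "T - r"] min.cobounded2[of "min d1 d2" "T - r"]
        min.cobounded1[of d1 d2] min.cobounded2[of d1 d2]
      by (auto simp: \<tau>_def simp del: min.cobounded1 min.cobounded2 min.bounded_iff)
    have "\<tau>\<^sup>2 * \<Phi> r r \<le> \<tau>\<^sup>2 * (\<Phi> 0 0 + (e1 + e2) * r + \<epsilon>)"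
    proof -
      have "\<tau>\<^sup>2 * \<Phi> r r - \<tau>\<^sup>2 * (\<epsilon> / 2) \<le> av \<tau> r r" "av \<tau> 0 0 \<le> \<tau>\<^sup>2 * \<Phi> 0 0 + \<tau>\<^sup>2 * (\<epsilon> / 2)"
        using d1(2)[OF \<tau>(1,2)] d2(2)[OF \<tau>(1,3)] by linarith+
      then show ?thesis using step[OF \<tau>(1) r(1) \<tau>(4)] by (simp add: algebra_simps)
    qed
    then show "\<Phi> r r \<le> \<Phi> 0 0 + (e1 + e2) * r + \<epsilon>" using \<tau>(1) by simp
  qed
  show ?thesis
  proof (cases "t < T")
    case False
    then have tT: "t = T" using t by simp
    show ?thesis
    proof (cases "T = 0")
      case False
      then have T: "0 < T" using t by simp
      \<comment> \<open>At the final time no square fits to the right of the diagonal point; the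
        bound is extended there by continuity.\<close>
      have "\<Phi> T T - (e1 + e2) * T \<le> \<Phi> 0 0"
      proof (rule continuous_le_on_closure[where S="{0..<T}" and f="\<lambda>r. \<Phi> r r - (e1 + e2) * r"])
        show "continuous_on (closure {0..<T}) (\<lambda>r. \<Phi> r r - (e1 + e2) * r)" by (intro continuous_intros cc)
      qed (use T main in \<open>auto simp: algebra_simps\<close>)
      then show ?thesis using tT by simp
    qed (use tT in simp)
  qed (use main t in auto)
qed

text \<open>Time runs over the whole line, which spares one-sided limits at the ends: polygons are
  constant outside their interval, and entropy solutions are extended by their end values.\<close>

definition L1_curve :: "real \<Rightarrow> (real \<Rightarrow> real \<Rightarrow> real) \<Rightarrow> bool" where
  "L1_curve C v \<longleftrightarrow> (\<lambda>q. v (fst q) (snd q)) \<in> borel_measurable borel \<and> (\<forall>t. bvc C (v t)) \<and>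
     (\<forall>t. ((\<lambda>s. LINT x|lborel. \<bar>v s x - v t x\<bar>) \<longlongrightarrow> 0) (at t))"

lemma niceD:
  assumes "L1_curve C v"
  shows "(\<lambda>q. v (fst q) (snd q)) \<in> borel_measurable borel" "bvc C (v t)" "integrable lborel (v t)"
    "((\<lambda>s. LINT x|lborel. \<bar>v s x - v t x\<bar>) \<longlongrightarrow> 0) (at t)"
  using assms bvcD(1) by (auto simp: L1_curve_def)

context flux_moll
begin

text \<open>
  The entropy inequality tested with \<open>k = w y\<close> and \<open>\<rho> (x - y)\<close>, up to an error rate \<open>e\<close>. Exact
  entropy solutions satisfy it with \<open>e = 0\<close>, Euler polygons with a small \<open>e\<close>.
\<close>

definition approx_sol :: "real \<Rightarrow> real \<Rightarrow> (real \<Rightarrow> real \<Rightarrow> real) \<Rightarrow> real \<Rightarrow> bool" where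
  "approx_sol C T v e \<longleftrightarrow> (\<forall>w. bvc C w \<longrightarrow> (\<forall>a b. 0 \<le> a \<longrightarrow> a \<le> b \<longrightarrow> b \<le> T \<longrightarrow>
     doubled_dist (v b) w - doubled_dist (v a) w \<le> (LINT t:{a..b}|lborel. doubled_flux (v t) w) + e * (b - a)))"

lemma measurable_doubled_flux:
  fixes v1 v2 :: "real \<Rightarrow> real \<Rightarrow> real"
  assumes v: "(\<lambda>q. v1 (fst q) (snd q)) \<in> borel_measurable borel" "(\<lambda>q. v2 (fst q) (snd q)) \<in> borel_measurable borel"
  shows "(\<lambda>q. doubled_flux (v1 (fst q)) (v2 (snd q))) \<in> borel_measurable borel"
  unfolding doubled_flux_def
proof (rule measurable_param_integral)
  note [measurable] = kernD(2)[OF K]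
  have [measurable]: "(\<lambda>r. v1 (fst (fst r)) (fst (snd r))) \<in> borel_measurable (borel :: ((real\<times>real)\<times>(real\<times>real)) measure)"
    "(\<lambda>r. v2 (snd (fst r)) (snd (snd r))) \<in> borel_measurable (borel :: ((real\<times>real)\<times>(real\<times>real)) measure)"
    by (rule measurable_param_compose[OF v(1)] measurable_param_compose[OF v(2)]; measurable)+
  have "(\<lambda>r. v1 (fst (fst (fst r))) (snd r)) \<in> borel_measurable (borel :: (((real\<times>real)\<times>(real\<times>real))\<times>real) measure)"
    by (rule measurable_param_compose[OF v(1)]; measurable)
  then have [measurable]: "(\<lambda>r. G K (v1 (fst (fst r))) (fst (snd r))) \<in> borel_measurable (borel :: ((real\<times>real)\<times>(real\<times>real)) measure)"
    by (rule measurable_G[OF _ kernD(2)[OF K]]; measurable)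
  show "(\<lambda>r. kruzkov_flux (v1 (fst (fst r)) (fst (snd r))) (v2 (snd (fst r)) (snd (snd r))) * \<rho>' (fst (snd r) - snd (snd r)) +
         sgn (v1 (fst (fst r)) (fst (snd r)) - v2 (snd (fst r)) (snd (snd r))) * G K (v1 (fst (fst r))) (fst (snd r)) * \<rho> (fst (snd r) - snd (snd r)))
    \<in> borel_measurable (borel :: ((real\<times>real)\<times>(real\<times>real)) measure)" by measurable
qed

text \<open>The diagonal estimate is applied to the mollified distance between \<open>v1 t\<close>
  and \<open>v2 s\<close>, each curve evolving in its own time. Passing from the distance to the
  mollified one and back costs \<open>2 * C * R\<close> each, at time 0 and at time
  \<open>t\<close>.\<close>

theorem comparison:
  assumes v1: "L1_curve C v1" and v2: "L1_curve C v2" and A1: "approx_sol C T v1 e1" and A2: "approx_sol C T v2 e2"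
    and t: "0 \<le> t" "t \<le> T"
  shows "(LINT x|lborel. \<bar>v1 t x - v2 t x\<bar>) \<le> (LINT x|lborel. \<bar>v1 0 x - v2 0 x\<bar>) + (e1 + e2) * t + 4 * C * R"
proof -
  note N1 = niceD[OF v1] and N2 = niceD[OF v2]
  have "doubled_dist (v1 t) (v2 t) \<le> doubled_dist (v1 0) (v2 0) + (e1 + e2) * t"
  proof (rule diagonal_estimate[where \<Phi>="\<lambda>t s. doubled_dist (v1 t) (v2 s)" and A="\<lambda>t s. doubled_flux (v1 t) (v2 s)" and B="\<lambda>t s. doubled_flux (v2 s) (v1 t)"
        and M="2 * L * C * (LINT x|lborel. \<bar>\<rho>' x\<bar>) + 2 * C * kmass K" and T=T])
    show "continuous_on UNIV (\<lambda>q. doubled_dist (v1 (fst q)) (v2 (snd q)))"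
      unfolding continuous_on_eq_continuous_at[OF open_UNIV]
    proof (intro ballI)
      fix q :: "real \<times> real"
      have f1: "((\<lambda>q'. LINT x|lborel. \<bar>v1 (fst q') x - v1 (fst q) x\<bar>) \<longlongrightarrow> 0) (at q)"
      proof -
        have "isCont (\<lambda>s. LINT x|lborel. \<bar>v1 s x - v1 (fst q) x\<bar>) (fst q)"
          using N1(4)[of "fst q"] by (simp add: isCont_def)
        then have "isCont (\<lambda>q'. LINT x|lborel. \<bar>v1 (fst q') x - v1 (fst q) x\<bar>) q"
          by (intro isCont_o2[where f=fst and g="\<lambda>s. LINT x|lborel. \<bar>v1 s x - v1 (fst q) x\<bar>"] continuous_intros)
        then show ?thesis by (simp add: isCont_def)
      qed
      have f2: "((\<lambda>q'. LINT x|lborel. \<bar>v2 (snd q') x - v2 (snd q) x\<bar>) \<longlongrightarrow> 0) (at q)"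
      proof -
        have "isCont (\<lambda>s. LINT x|lborel. \<bar>v2 s x - v2 (snd q) x\<bar>) (snd q)"
          using N2(4)[of "snd q"] by (simp add: isCont_def)
        then have "isCont (\<lambda>q'. LINT x|lborel. \<bar>v2 (snd q') x - v2 (snd q) x\<bar>) q"
          by (intro isCont_o2[where f=snd and g="\<lambda>s. LINT x|lborel. \<bar>v2 s x - v2 (snd q) x\<bar>"] continuous_intros)
        then show ?thesis by (simp add: isCont_def)
      qed
      show "isCont (\<lambda>q. doubled_dist (v1 (fst q)) (v2 (snd q))) q"
        unfolding isCont_def
      proof (rule LIM_zero_cancel, rule Lim_null_comparison)
        show "\<forall>\<^sub>F q' in at q. norm (doubled_dist (v1 (fst q')) (v2 (snd q')) - doubled_dist (v1 (fst q)) (v2 (snd q)))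
            \<le> (LINT x|lborel. \<bar>v1 (fst q') x - v1 (fst q) x\<bar>) + (LINT x|lborel. \<bar>v2 (snd q') x - v2 (snd q) x\<bar>)"
          unfolding real_norm_def by (intro always_eventually allI doubled_dist_lipschitz N1(3) N2(3))
        show "((\<lambda>q'. (LINT x|lborel. \<bar>v1 (fst q') x - v1 (fst q) x\<bar>) + (LINT x|lborel. \<bar>v2 (snd q') x - v2 (snd q) x\<bar>)) \<longlongrightarrow> 0) (at q)"
          using tendsto_add[OF f1 f2] by simp
      qed
    qed
    show "(\<lambda>q. doubled_flux (v1 (fst q)) (v2 (snd q))) \<in> borel_measurable borel" by (rule measurable_doubled_flux[OF N1(1) N2(1)])
    have "(\<lambda>q. doubled_flux (v2 (fst q)) (v1 (snd q))) \<circ> (\<lambda>q. (snd q, fst q)) \<in> borel_measurable borel"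
      by (rule measurable_comp[OF _ measurable_doubled_flux[OF N2(1) N1(1)]]) measurable
    then show "(\<lambda>q. doubled_flux (v2 (snd q)) (v1 (fst q))) \<in> borel_measurable borel" by (simp add: o_def)
    show "\<bar>doubled_flux (v1 t) (v2 s)\<bar> \<le> 2 * L * C * (LINT x|lborel. \<bar>\<rho>' x\<bar>) + 2 * C * kmass K" for t s
      by (rule doubled_flux_bound[OF N1(2) N2(2)])
    show "\<bar>doubled_flux (v2 s) (v1 t)\<bar> \<le> 2 * L * C * (LINT x|lborel. \<bar>\<rho>' x\<bar>) + 2 * C * kmass K" for t s
      by (rule doubled_flux_bound[OF N2(2) N1(2)])
    show "doubled_flux (v1 t) (v2 s) + doubled_flux (v2 s) (v1 t) \<le> 0" for t s by (rule doubled_flux_antisym[OF N1(2) N2(2)])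
    show "doubled_dist (v1 b) (v2 s) - doubled_dist (v1 a) (v2 s) \<le> (LINT t:{a..b}|lborel. doubled_flux (v1 t) (v2 s)) + e1 * (b - a)"
      if "0 \<le> a" "a \<le> b" "b \<le> T" for a b s using A1 N2(2)[of s] that unfolding approx_sol_def by blast
    show "doubled_dist (v1 s) (v2 b) - doubled_dist (v1 s) (v2 a) \<le> (LINT t:{a..b}|lborel. doubled_flux (v2 t) (v1 s)) + e2 * (b - a)"
      if "0 \<le> a" "a \<le> b" "b \<le> T" for a b s
      unfolding doubled_dist_swap[OF N1(3) N2(3)] using A2 N1(2)[of s] that unfolding approx_sol_def by blast
  qed (use t in auto)
  moreover have "doubled_dist (v1 0) (v2 0) \<le> (LINT x|lborel. \<bar>v1 0 x - v2 0 x\<bar>) + 2 * C * R"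
    by (rule doubled_dist_approx(1)[OF N1(3) N2(2)])
  moreover have "(LINT x|lborel. \<bar>v1 t x - v2 t x\<bar>) \<le> doubled_dist (v1 t) (v2 t) + 2 * C * R"
    by (rule doubled_dist_approx(2)[OF N1(3) N2(2)])
  ultimately show ?thesis by linarith
qed

end

lemma bvc_mono: "bvc C w \<Longrightarrow> C \<le> C' \<Longrightarrow> bvc C' w"
  unfolding bvc_def by (meson abs_ge_zero mult_right_mono order_trans)

lemma L1_curve_mono: "L1_curve C v \<Longrightarrow> C \<le> C' \<Longrightarrow> L1_curve C' v"
  unfolding L1_curve_def using bvc_mono by blast

lemma integrable_indicator_Icc:
  fixes a b c :: real
  shows "integrable lborel (\<lambda>t. indicator {a..b} t * c)"
  by (intro integrable_mult_left integrable_real_indicator) (auto simp: emeasure_lborel_Icc_eq)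

section \<open>Consistency of the upwind scheme\<close>

context moll
begin

text \<open>After summation by parts the difference quotients act on the mollifier, so this is the
  entire consistency error of the transport part, whatever the regularity of the solution.\<close>

definition quot_err :: "real \<Rightarrow> real" where
  "quot_err h = (LINT x|lborel. \<bar>(\<rho> (x + h) - \<rho> x) / h - \<rho>' x\<bar>)"

lemma rho_le:
  obtains B where "0 \<le> B" "\<And>x. \<rho> x \<le> B"
proof -
  obtain B where B: "0 \<le> B" "\<And>x h. \<bar>\<rho> (x + h) - \<rho> x\<bar> \<le> B * \<bar>h\<bar>" by (metis rho_bounds)
  have "\<rho> x \<le> B * (2 * R + 1)" for x
  proof (cases "\<bar>x\<bar> > R")
    case True
    then show ?thesis using rho_supp[OF True] B R_nonneg by simp
  next
    case False
    have "\<rho> (R + 1) = 0" using R_nonneg by (intro rho_supp) auto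
    then have "\<bar>\<rho> x\<bar> \<le> B * \<bar>x - (R + 1)\<bar>" using B(2)[of "R + 1" "x - (R + 1)"] by simp
    also have "\<dots> \<le> B * (2 * R + 1)" using False B by (intro mult_left_mono) auto
    finally show ?thesis by linarith
  qed
  moreover have "0 \<le> B * (2 * R + 1)" using B R_nonneg by simp
  ultimately show ?thesis using that by blast
qed

lemma quot_err_minus: "(LINT x|lborel. \<bar>(\<rho> (x - h) - \<rho> x) / h + \<rho>' x\<bar>) = quot_err h"
proof -
  have "quot_err h = (LINT x|lborel. \<bar>(\<rho> (0 - x + h) - \<rho> (0 - x)) / h - \<rho>' (0 - x)\<bar>)"
    unfolding quot_err_def by (rule integral_reflect[symmetric])
  also have "\<dots> = (LINT x|lborel. \<bar>(\<rho> (x - h) - \<rho> x) / h + \<rho>' x\<bar>)"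
    using rho_even[of "x - h" for x] by (simp add: rho_even rho'_odd)
  finally show ?thesis by simp
qed

lemma quot_err_tendsto:
  assumes h: "h \<longlonglongrightarrow> 0" "\<And>n. 0 < h n" "\<And>n. h n \<le> 1"
  shows "(\<lambda>n. quot_err (h n)) \<longlonglongrightarrow> 0"
proof -
  obtain B where B: "0 \<le> B" "\<And>x. \<bar>\<rho>' x\<bar> \<le> B" "\<And>x h. \<bar>\<rho> (x + h) - \<rho> x\<bar> \<le> B * \<bar>h\<bar>" "\<And>x. \<bar>x\<bar> > R \<Longrightarrow> \<rho>' x = 0"
    by (metis rho_bounds)
  have "(\<lambda>n. LINT x|lborel. \<bar>(\<rho> (x + h n) - \<rho> x) / h n - \<rho>' x\<bar>) \<longlonglongrightarrow> integral\<^sup>L lborel (\<lambda>x::real. 0)"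
  proof (rule integral_dominated_convergence[where w="\<lambda>x. indicator {- (R + 1)..R + 1} x * (2 * B)"])
    show "integrable lborel (\<lambda>x. indicator {- (R + 1)..R + 1} x * (2 * B))" by (rule integrable_indicator_Icc)
    show "AE x in lborel. (\<lambda>n. \<bar>(\<rho> (x + h n) - \<rho> x) / h n - \<rho>' x\<bar>) \<longlonglongrightarrow> 0"
    proof (intro AE_I2 tendsto_rabs_zero)
      fix x
      have "((\<lambda>h. (\<rho> (x + h) - \<rho> x) / h) \<longlongrightarrow> \<rho>' x) (at 0)" using rho_deriv[of x] by (simp add: DERIV_def)
      moreover have "filterlim h (at 0) sequentially"
        using h(1) h(2)[THEN less_imp_neq, symmetric] by (simp add: filterlim_at always_eventually)
      ultimately have "(\<lambda>n. (\<rho> (x + h n) - \<rho> x) / h n) \<longlonglongrightarrow> \<rho>' x"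
        by (rule filterlim_compose)
      then show "(\<lambda>n. (\<rho> (x + h n) - \<rho> x) / h n - \<rho>' x) \<longlonglongrightarrow> 0" by (rule LIM_zero)
    qed
    show "AE x in lborel. norm \<bar>(\<rho> (x + h n) - \<rho> x) / h n - \<rho>' x\<bar> \<le> indicator {- (R + 1)..R + 1} x * (2 * B)" for n
    proof (rule AE_I2)
      fix x
      show "norm \<bar>(\<rho> (x + h n) - \<rho> x) / h n - \<rho>' x\<bar> \<le> indicator {- (R + 1)..R + 1} x * (2 * B)"
      proof (cases "\<bar>x\<bar> \<le> R + 1")
        case True
        have "\<bar>(\<rho> (x + h n) - \<rho> x) / h n\<bar> \<le> B" using B(3)[of x "h n"] h(2)[of n] by (simp add: divide_le_eq)
        then have "\<bar>(\<rho> (x + h n) - \<rho> x) / h n - \<rho>' x\<bar> \<le> 2 * B" using B(2)[of x] by linarith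
        then show ?thesis using True by (auto simp: indicator_def abs_le_iff)
      next
        case False
        then have "\<rho> (x + h n) = 0" "\<rho> x = 0" "\<rho>' x = 0" using h(2,3)[of n] by (auto intro!: rho_supp B)
        then show ?thesis using B by (simp add: indicator_def)
      qed
    qed
  qed measurable
  then show ?thesis by (simp add: quot_err_def)
qed

end

context flux_moll
begin

text \<open>The scheme at a frozen time against the exact doubled rate. Replacing the quotients of
  the mollifier by its derivative costs \<open>2 * L * C * quot_err h\<close> for \<open>p\<close>
  and the same for \<open>m\<close>; restoring the jumps below \<open>r\<close> costs the near mass.
  For each \<open>y\<close> the discrete entropy inequality is used with
  \<open>k = b y\<close>.\<close>

lemma static_entropy:
  assumes a: "bvc C a" and b: "bvc C b" and r: "bkern (far_part r K)" and h: "0 < h"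
  shows "integrable lborel (\<lambda>q. sgn (a (fst q) - b (snd q)) * F h (far_part r K) a (fst q) * \<rho> (fst q - snd q))"
    and "(LINT q|lborel. sgn (a (fst q) - b (snd q)) * F h (far_part r K) a (fst q) * \<rho> (fst q - snd q)) \<le>
      doubled_flux a b + 4 * L * C * quot_err h + 2 * C * kmass (near_part r K)"
proof -
  note A = bvcD[OF a] and B = bvcD[OF b]
  note Fi = integrable_flux_diff[OF A(1), of h] and Gr = G_integrable[OF a bkernD(1)[OF r]] and Ga = G_integrable[OF a K]
  note [measurable] = A(6) B(6) Fi[THEN integrable_lborel_measurable] Gr[THEN integrable_lborel_measurable] Ga[THEN integrable_lborel_measurable]
  have sd: "integrable lborel (\<lambda>q. sgn (a (fst q) - b (snd q)) * g (fst q) * \<rho> (fst q - snd q))"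
    if g: "integrable lborel g" for g
  proof (rule pair_dominated(1)[OF _ integrable_abs[OF g] integrable_zero rho_integrable])
    show "(\<lambda>q. sgn (a (fst q) - b (snd q)) * g (fst q) * \<rho> (fst q - snd q)) \<in> borel_measurable borel"
      using g[THEN integrable_lborel_measurable] by measurable
  qed (auto simp: abs_mult sgn_if)
  have FF: "F h (far_part r K) a x = flux_diff h a x + G (far_part r K) a x" for x by (simp add: F_def)
  show "integrable lborel (\<lambda>q. sgn (a (fst q) - b (snd q)) * F h (far_part r K) a (fst q) * \<rho> (fst q - snd q))"
    by (rule sd[OF integrable_F[OF A(1) r]])
  define Dp where "Dp u = (\<rho> (u + h) - \<rho> u) / h" for u
  define Dm where "Dm u = (\<rho> (u - h) - \<rho> u) / h" for u
  have Di: "integrable lborel Dp" "integrable lborel Dm"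
    unfolding Dp_def Dm_def using integrable_shift[OF rho_integrable, of h] integrable_shift[OF rho_integrable, of "-h"] rho_integrable by auto
  note [measurable] = Di[THEN integrable_lborel_measurable]
  have Li: "integrable lborel (\<lambda>x. L * \<bar>a x\<bar>)" "integrable lborel (\<lambda>x. L * \<bar>b x\<bar>)" using A(1) B(1) by auto
  have pl: "\<bar>p (a x) - p (b y)\<bar> \<le> L * \<bar>a x\<bar> + L * \<bar>b y\<bar>" and ml: "\<bar>m (a x) - m (b y)\<bar> \<le> L * \<bar>a x\<bar> + L * \<bar>b y\<bar>" for x y
  proof -
    have "L * \<bar>a x - b y\<bar> \<le> L * (\<bar>a x\<bar> + \<bar>b y\<bar>)" using L_nonneg by (intro mult_left_mono) auto
    then show "\<bar>p (a x) - p (b y)\<bar> \<le> L * \<bar>a x\<bar> + L * \<bar>b y\<bar>" "\<bar>m (a x) - m (b y)\<bar> \<le> L * \<bar>a x\<bar> + L * \<bar>b y\<bar>"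
      using p_lip[of "a x" "b y"] m_lip[of "a x" "b y"] by (auto simp: distrib_left)
  qed
  have dp: "integrable lborel (\<lambda>q. \<bar>p (a (fst q)) - p (b (snd q))\<bar> * g (fst q - snd q))"
       "integrable lborel (\<lambda>q. \<bar>m (a (fst q)) - m (b (snd q))\<bar> * g (fst q - snd q))"
       "\<bar>LINT q|lborel. \<bar>p (a (fst q)) - p (b (snd q))\<bar> * g (fst q - snd q)\<bar> \<le> 2 * L * C * (LINT x|lborel. \<bar>g x\<bar>)"
       "\<bar>LINT q|lborel. \<bar>m (a (fst q)) - m (b (snd q))\<bar> * g (fst q - snd q)\<bar> \<le> 2 * L * C * (LINT x|lborel. \<bar>g x\<bar>)"
    if g: "integrable lborel g" for g :: "real \<Rightarrow> real"
  proof -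
    note [measurable] = g[THEN integrable_lborel_measurable]
    have le1: "\<bar>\<bar>p (a (fst q)) - p (b (snd q))\<bar> * g (fst q - snd q)\<bar> \<le> (L * \<bar>a (fst q)\<bar> + L * \<bar>b (snd q)\<bar>) * \<bar>g (fst q - snd q)\<bar>" for q
      using pl by (auto simp: abs_mult intro!: mult_right_mono)
    have le2: "\<bar>\<bar>m (a (fst q)) - m (b (snd q))\<bar> * g (fst q - snd q)\<bar> \<le> (L * \<bar>a (fst q)\<bar> + L * \<bar>b (snd q)\<bar>) * \<bar>g (fst q - snd q)\<bar>" for q
      using ml by (auto simp: abs_mult intro!: mult_right_mono)
    note 1 = pair_dominated[OF _ Li g le1] and 2 = pair_dominated[OF _ Li g le2]
    have "L * (LINT x|lborel. \<bar>a x\<bar>) + L * (LINT x|lborel. \<bar>b x\<bar>) \<le> L * C + L * C"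
      using A(2) B(2) L_nonneg by (intro add_mono mult_left_mono)
    then have c: "((LINT x|lborel. L * \<bar>a x\<bar>) + (LINT x|lborel. L * \<bar>b x\<bar>)) * (LINT x|lborel. \<bar>g x\<bar>) \<le> 2 * L * C * (LINT x|lborel. \<bar>g x\<bar>)"
      by (intro mult_right_mono) (auto simp: ac_simps)
    show "integrable lborel (\<lambda>q. \<bar>p (a (fst q)) - p (b (snd q))\<bar> * g (fst q - snd q))" by (rule 1(1)) measurable
    show "integrable lborel (\<lambda>q. \<bar>m (a (fst q)) - m (b (snd q))\<bar> * g (fst q - snd q))" by (rule 2(1)) measurable
    show "\<bar>LINT q|lborel. \<bar>p (a (fst q)) - p (b (snd q))\<bar> * g (fst q - snd q)\<bar> \<le> 2 * L * C * (LINT x|lborel. \<bar>g x\<bar>)"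
      by (rule order_trans[OF 1(2) c]) measurable
    show "\<bar>LINT q|lborel. \<bar>m (a (fst q)) - m (b (snd q))\<bar> * g (fst q - snd q)\<bar> \<le> 2 * L * C * (LINT x|lborel. \<bar>g x\<bar>)"
      by (rule order_trans[OF 2(2) c]) measurable
  qed
  let ?X = "\<lambda>q. \<bar>p (a (fst q)) - p (b (snd q))\<bar> * Dp (fst q - snd q) + \<bar>m (a (fst q)) - m (b (snd q))\<bar> * Dm (fst q - snd q)"
  have Xi: "integrable lborel ?X" using dp(1)[OF Di(1)] dp(2)[OF Di(2)] by simp
  obtain Br where Br: "\<And>x. \<rho> x \<le> Br" by (metis rho_le)
  have "(LINT q|lborel. sgn (a (fst q) - b (snd q)) * flux_diff h a (fst q) * \<rho> (fst q - snd q)) =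
      (LINT y|lborel. LINT x|lborel. sgn (a x - b y) * flux_diff h a x * \<rho> (x - y))"
    using lborel_fubini_snd[OF sd[OF Fi]] by simp
  also have "\<dots> \<le> (LINT y|lborel. LINT x|lborel. ?X (x, y))"
  proof (rule integral_mono)
    show "integrable lborel (\<lambda>y. LINT x|lborel. sgn (a x - b y) * flux_diff h a x * \<rho> (x - y))"
      using lborel_integrable_snd[OF sd[OF Fi]] by simp
    show "integrable lborel (\<lambda>y. LINT x|lborel. ?X (x, y))" by (rule lborel_integrable_snd[OF Xi])
    fix y
    have i: "integrable lborel (\<lambda>x. \<rho> (x - y))" using integrable_shift[OF rho_integrable, of "-y"] by simp
    have eq: "\<rho> (x - y + h) = \<rho> (x + h - y)" "\<rho> (x - y - h) = \<rho> (x - h - y)" for x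
      by (rule arg_cong[of _ _ \<rho>], simp)+
    show "(LINT x|lborel. sgn (a x - b y) * flux_diff h a x * \<rho> (x - y)) \<le> (LINT x|lborel. ?X (x, y))"
      using flux_diff_entropy(3)[OF A(1) h i rho_nonneg Br, of "b y"] by (simp add: Dp_def Dm_def eq)
  qed
  also have "\<dots> = (LINT q|lborel. ?X q)" by (rule lborel_fubini_snd[OF Xi])
  also have "\<dots> = (LINT q|lborel. kruzkov_flux (a (fst q)) (b (snd q)) * \<rho>' (fst q - snd q)
       + (\<bar>p (a (fst q)) - p (b (snd q))\<bar> * (Dp (fst q - snd q) - \<rho>' (fst q - snd q))
       + \<bar>m (a (fst q)) - m (b (snd q))\<bar> * (Dm (fst q - snd q) + \<rho>' (fst q - snd q))))"
    by (intro Bochner_Integration.integral_cong refl) (simp add: kruzkov_flux_def algebra_simps)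
  also have "\<dots> = (LINT q|lborel. kruzkov_flux (a (fst q)) (b (snd q)) * \<rho>' (fst q - snd q))
       + ((LINT q|lborel. \<bar>p (a (fst q)) - p (b (snd q))\<bar> * (Dp (fst q - snd q) - \<rho>' (fst q - snd q)))
       + (LINT q|lborel. \<bar>m (a (fst q)) - m (b (snd q))\<bar> * (Dm (fst q - snd q) + \<rho>' (fst q - snd q))))"
    using dp(1)[OF Bochner_Integration.integrable_diff[OF Di(1) rho'_integrable]] dp(2)[OF Bochner_Integration.integrable_add[OF Di(2) rho'_integrable]] doubled_flux_int1[OF a b]
    by simp
  also have "\<dots> \<le> (LINT q|lborel. kruzkov_flux (a (fst q)) (b (snd q)) * \<rho>' (fst q - snd q)) + (2 * L * C * quot_err h + 2 * L * C * quot_err h)"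
    using dp(3)[OF Bochner_Integration.integrable_diff[OF Di(1) rho'_integrable]] dp(4)[OF Bochner_Integration.integrable_add[OF Di(2) rho'_integrable]]
    unfolding Dp_def Dm_def quot_err_minus quot_err_def[symmetric] by linarith
  finally have 1: "(LINT q|lborel. sgn (a (fst q) - b (snd q)) * flux_diff h a (fst q) * \<rho> (fst q - snd q)) \<le>
     (LINT q|lborel. kruzkov_flux (a (fst q)) (b (snd q)) * \<rho>' (fst q - snd q)) + 4 * L * C * quot_err h" by (simp add: ac_simps)
  have Gd: "integrable lborel (\<lambda>x. \<bar>G K a x - G (far_part r K) a x\<bar>)" using Ga Gr by simp
  have "(LINT q|lborel. sgn (a (fst q) - b (snd q)) * G (far_part r K) a (fst q) * \<rho> (fst q - snd q)) \<le>
     (LINT q|lborel. sgn (a (fst q) - b (snd q)) * G K a (fst q) * \<rho> (fst q - snd q) + \<bar>G K a (fst q) - G (far_part r K) a (fst q)\<bar> * \<rho> (fst q - snd q))"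
  proof (intro integral_mono Bochner_Integration.integrable_add sd Ga Gr convolution_integrable(1) Gd rho_integrable)
    fix q :: "real \<times> real"
    have "sgn s * y \<le> sgn s * x + \<bar>x - y\<bar>" for s x y :: real by (auto simp: sgn_if)
    from mult_right_mono[OF this[of "a (fst q) - b (snd q)" "G (far_part r K) a (fst q)" "G K a (fst q)"] rho_nonneg[of "fst q - snd q"]]
    show "sgn (a (fst q) - b (snd q)) * G (far_part r K) a (fst q) * \<rho> (fst q - snd q)
      \<le> sgn (a (fst q) - b (snd q)) * G K a (fst q) * \<rho> (fst q - snd q) + \<bar>G K a (fst q) - G (far_part r K) a (fst q)\<bar> * \<rho> (fst q - snd q)"
      by (simp add: distrib_right)
  qed
  also have "\<dots> = (LINT q|lborel. sgn (a (fst q) - b (snd q)) * G K a (fst q) * \<rho> (fst q - snd q)) + (LINT x|lborel. \<bar>G K a x - G (far_part r K) a x\<bar>)"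
    using convolution_integrable(1,3)[OF Gd rho_integrable] sd[OF Ga] by (simp add: rho_int)
  also have "\<dots> \<le> (LINT q|lborel. sgn (a (fst q) - b (snd q)) * G K a (fst q) * \<rho> (fst q - snd q)) + 2 * C * kmass (near_part r K)"
    using G_far_part_error[OF a K] by simp
  finally have 2: "(LINT q|lborel. sgn (a (fst q) - b (snd q)) * G (far_part r K) a (fst q) * \<rho> (fst q - snd q)) \<le>
     (LINT q|lborel. sgn (a (fst q) - b (snd q)) * G K a (fst q) * \<rho> (fst q - snd q)) + 2 * C * kmass (near_part r K)" .
  have "(LINT q|lborel. sgn (a (fst q) - b (snd q)) * F h (far_part r K) a (fst q) * \<rho> (fst q - snd q)) =
     (LINT q|lborel. sgn (a (fst q) - b (snd q)) * flux_diff h a (fst q) * \<rho> (fst q - snd q)) + (LINT q|lborel. sgn (a (fst q) - b (snd q)) * G (far_part r K) a (fst q) * \<rho> (fst q - snd q))"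
    using Bochner_Integration.integral_add[OF sd[OF Fi] sd[OF Gr]] by (simp add: FF distrib_left distrib_right)
  moreover have "doubled_flux a b = (LINT q|lborel. kruzkov_flux (a (fst q)) (b (snd q)) * \<rho>' (fst q - snd q)) + (LINT q|lborel. sgn (a (fst q) - b (snd q)) * G K a (fst q) * \<rho> (fst q - snd q))"
    unfolding doubled_flux_def by (intro Bochner_Integration.integral_add doubled_flux_int1[OF a b] doubled_flux_int2[OF a b])
  ultimately show "(LINT q|lborel. sgn (a (fst q) - b (snd q)) * F h (far_part r K) a (fst q) * \<rho> (fst q - snd q)) \<le>
      doubled_flux a b + 4 * L * C * quot_err h + 2 * C * kmass (near_part r K)" using 1 2 by linarith
qed

end

context euler
begin

lemma L1_curve_polygon: "L1_curve C polygon"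
  unfolding L1_curve_def
proof (intro conjI allI measurable_polygon bvc_polygon)
  fix t
  show "((\<lambda>s. LINT x|lborel. \<bar>polygon s x - polygon t x\<bar>) \<longlongrightarrow> 0) (at t)"
  proof (rule Lim_null_comparison)
    show "\<forall>\<^sub>F s in at t. norm (LINT x|lborel. \<bar>polygon s x - polygon t x\<bar>) \<le> D * \<bar>s - t\<bar>"
    proof (intro always_eventually allI)
      fix s
      show "norm (LINT x|lborel. \<bar>polygon s x - polygon t x\<bar>) \<le> D * \<bar>s - t\<bar>"
        using polygon_lipschitz[of s t] polygon_lipschitz[of t s] by (cases "s \<le> t") (auto simp: abs_minus_commute)
    qed
    have "((\<lambda>s. D * \<bar>s - t\<bar>) \<longlongrightarrow> D * \<bar>t - t\<bar>) (at t)" by (intro tendsto_intros)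
    then show "((\<lambda>s. D * \<bar>s - t\<bar>) \<longlongrightarrow> 0) (at t)" by simp
  qed
qed

end

locale euler_moll = flux_moll p m L \<rho> \<rho>' R K + E: euler p m L h "far_part r K" \<delta> N w0 C
  for p m L \<rho> \<rho>' R K h r \<delta> N w0 C
begin

definition err :: real where
  "err = (4 * L / h + 2 * (LINT z|lborel. far_part r K z)) * (\<delta> * E.D)"

lemma AE_not_grid: "AE t in lborel. t \<notin> E.grid"
proof -
  have "finite E.grid" unfolding E.grid_def by simp
  then have "E.grid \<in> null_sets lborel" by (rule finite_imp_null_set_lborel)
  then show ?thesis by (rule AE_not_in)
qed

text \<open>The increment of the doubled distance is an exact time integral by
  \<open>polygon_chain\<close> with \<open>g = 1\<close>. At times off the nodes the slope is
  exchanged for \<open>F\<close> of the polygon, which costs \<open>err\<close>, and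
  \<open>static_entropy\<close> does the rest.\<close>

lemma polygon_approx_sol: "approx_sol C (real N * \<delta>) E.polygon (4 * L * C * quot_err h + 2 * C * kmass (near_part r K) + err)"
  unfolding approx_sol_def
proof (intro allI impI)
  fix w a b
  assume w: "bvc C w" and ab: "0 \<le> a" "a \<le> b" "b \<le> real N * \<delta>"
  note W = bvcD[OF w]
  note P = bvcD[OF E.bvc_polygon]
  note [measurable] = W(6)
  have pm [measurable]: "(\<lambda>r. E.polygon (g r) (f r)) \<in> borel_measurable M" "(\<lambda>r. E.slope (g r) (f r)) \<in> borel_measurable M"
    if "g \<in> borel_measurable M" "f \<in> borel_measurable M" for g f and M :: "'z measure"
    using measurable_param_compose[OF E.measurable_polygon that] measurable_param_compose[OF E.measurable_slope that] .
  let ?Z = "\<lambda>q t. sgn (E.polygon t (fst q) - w (snd q)) * E.slope t (fst q) * \<rho> (fst q - snd q)"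
  let ?Y = "\<lambda>s::real\<times>(real\<times>real). indicator {a..b} (fst s) * ?Z (snd s) (fst s)"
  have Ym: "?Y \<in> borel_measurable borel" by measurable
  have Zi: "integrable lborel (\<lambda>q. ?Z q t)" "(LINT q|lborel. \<bar>?Z q t\<bar>) \<le> (LINT x|lborel. \<bar>E.slope t x\<bar>)" for t
  proof -
    have le: "\<bar>?Z q t\<bar> \<le> (\<bar>E.slope t (fst q)\<bar> + 0) * \<bar>\<rho> (fst q - snd q)\<bar>" for q by (auto simp: abs_mult sgn_if)
    note pd = pair_dominated[OF _ integrable_abs[OF E.slope_integrable[of t]] integrable_zero rho_integrable le]
    show "integrable lborel (\<lambda>q. ?Z q t)" by (rule pd(1)) measurable
    have "(LINT q|lborel. \<bar>?Z q t\<bar>) \<le> ((LINT x|lborel. \<bar>E.slope t x\<bar>) + (LINT x::real|lborel. 0)) * (LINT x|lborel. \<bar>\<rho> x\<bar>)" by (rule pd(3)) measurable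
    then show "(LINT q|lborel. \<bar>?Z q t\<bar>) \<le> (LINT x|lborel. \<bar>E.slope t x\<bar>)" by (simp add: rho_abs_int)
  qed
  have Iint: "integrable lborel (\<lambda>t. indicator {a..b} t * c)" for c :: real by (rule integrable_indicator_Icc)
  have Yi: "integrable lborel ?Y"
  proof (rule integrable_lborel_pairI[OF Ym])
    show "AE t in lborel. integrable lborel (\<lambda>q. ?Y (t, q))" using Zi by (auto intro!: AE_I2 integrable_mult_right)
    show "integrable lborel (\<lambda>t. LINT q|lborel. \<bar>?Y (t, q)\<bar>)"
    proof (rule Bochner_Integration.integrable_bound[OF Iint[of E.D]])
      show "(\<lambda>t. LINT q|lborel. \<bar>?Y (t, q)\<bar>) \<in> borel_measurable lborel"
        using measurable_param_integral[of "\<lambda>t q. \<bar>?Y (t, q)\<bar>"] Ym by simp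
      show "AE t in lborel. norm (LINT q|lborel. \<bar>?Y (t, q)\<bar>) \<le> norm (indicator {a..b} t * E.D)"
        using AE_not_grid
      proof eventually_elim
        case (elim t)
        have "(LINT q|lborel. \<bar>?Z q t\<bar>) \<le> E.D" if "t \<in> {a..b}"
          using Zi(2)[of t] E.slope_error(2)[of t] that ab elim by auto
        then show ?case using E.D_nonneg by (auto simp: indicator_def)
      qed
    qed
  qed
  have Am: "(\<lambda>t. doubled_flux (E.polygon t) w) \<in> borel_measurable borel"
    using measurable_compose[OF _ measurable_doubled_flux[OF E.measurable_polygon, of "\<lambda>_. w"], of "\<lambda>t. (t, 0)"] by simp
  have Ai: "integrable lborel (\<lambda>t. indicator {a..b} t * doubled_flux (E.polygon t) w)"
    by (rule integrable_bounded_mult(1)[OF _ Am doubled_flux_bound[OF E.bvc_polygon w]]) (use integrable_indicator_Icc[of a b 1] in simp)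
  show "doubled_dist (E.polygon b) w - doubled_dist (E.polygon a) w \<le> (LINT t:{a..b}|lborel. doubled_flux (E.polygon t) w) + (4 * L * C * quot_err h + 2 * C * kmass (near_part r K) + err) * (b - a)"
  proof -
    let ?e = "4 * L * C * quot_err h + 2 * C * kmass (near_part r K) + err"
    have chain: "\<bar>E.polygon b x - k\<bar> - \<bar>E.polygon a x - k\<bar> = (LINT t|lborel. indicator {a..b} t * (sgn (E.polygon t x - k) * E.slope t x))" for x k
      using E.polygon_chain(2)[of "\<lambda>_. 1" "\<lambda>_. 0" a b x k] ab by (simp add: set_lebesgue_integral_def)
    have "doubled_dist (E.polygon b) w - doubled_dist (E.polygon a) w =
       (LINT q|lborel. \<bar>E.polygon b (fst q) - w (snd q)\<bar> * \<rho> (fst q - snd q) - \<bar>E.polygon a (fst q) - w (snd q)\<bar> * \<rho> (fst q - snd q))"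
      unfolding doubled_dist_def by (intro Bochner_Integration.integral_diff[symmetric] doubled_dist_integrable P(1) W(1))
    also have "\<dots> = (LINT q|lborel. LINT t|lborel. ?Y (t, q))"
    proof (intro Bochner_Integration.integral_cong refl)
      fix q
      have "\<bar>E.polygon b (fst q) - w (snd q)\<bar> * \<rho> (fst q - snd q) - \<bar>E.polygon a (fst q) - w (snd q)\<bar> * \<rho> (fst q - snd q)
        = (\<bar>E.polygon b (fst q) - w (snd q)\<bar> - \<bar>E.polygon a (fst q) - w (snd q)\<bar>) * \<rho> (fst q - snd q)" by (simp add: left_diff_distrib)
      also have "\<dots> = (LINT t|lborel. indicator {a..b} t * (sgn (E.polygon t (fst q) - w (snd q)) * E.slope t (fst q)) * \<rho> (fst q - snd q))"
        unfolding chain by simp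
      finally show "\<bar>E.polygon b (fst q) - w (snd q)\<bar> * \<rho> (fst q - snd q) - \<bar>E.polygon a (fst q) - w (snd q)\<bar> * \<rho> (fst q - snd q)
        = (LINT t|lborel. ?Y (t, q))" by (simp add: mult.assoc)
    qed
    also have "\<dots> = (LINT t|lborel. LINT q|lborel. ?Y (t, q))" by (rule lborel_fubini_swap[OF Yi, symmetric])
    also have "\<dots> \<le> (LINT t|lborel. indicator {a..b} t * doubled_flux (E.polygon t) w + indicator {a..b} t * ?e)"
    proof (rule integral_mono_AE)
      show "integrable lborel (\<lambda>t. LINT q|lborel. ?Y (t, q))" by (rule lborel_integrable_fst[OF Yi])
      show "integrable lborel (\<lambda>t. indicator {a..b} t * doubled_flux (E.polygon t) w + indicator {a..b} t * ?e)"
        by (intro Bochner_Integration.integrable_add Ai Iint)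
      show "AE t in lborel. (LINT q|lborel. ?Y (t, q)) \<le> indicator {a..b} t * doubled_flux (E.polygon t) w + indicator {a..b} t * ?e"
        using AE_not_grid
      proof eventually_elim
        case (elim t)
        show ?case
        proof (cases "t \<in> {a..b}")
          case True
          have t: "0 \<le> t" "t \<le> real N * \<delta>" using True ab by auto
          note st = static_entropy[OF E.bvc_polygon[of t] w E.K E.h]
          have di: "integrable lborel (\<lambda>x. \<bar>E.slope t x - F h (far_part r K) (E.polygon t) x\<bar>)"
            using E.slope_integrable integrable_F[OF P(1) E.K] by simp
          have "(LINT q|lborel. ?Z q t) \<le> (LINT q|lborel. sgn (E.polygon t (fst q) - w (snd q)) * F h (far_part r K) (E.polygon t) (fst q) * \<rho> (fst q - snd q)
              + \<bar>E.slope t (fst q) - F h (far_part r K) (E.polygon t) (fst q)\<bar> * \<rho> (fst q - snd q))"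
          proof (intro integral_mono Zi Bochner_Integration.integrable_add st(1) convolution_integrable(1) di rho_integrable)
            fix q :: "real \<times> real"
            have "sgn s * y \<le> sgn s * x + \<bar>y - x\<bar>" for s x y :: real by (auto simp: sgn_if)
            from mult_right_mono[OF this rho_nonneg]
            show "?Z q t \<le> sgn (E.polygon t (fst q) - w (snd q)) * F h (far_part r K) (E.polygon t) (fst q) * \<rho> (fst q - snd q)
              + \<bar>E.slope t (fst q) - F h (far_part r K) (E.polygon t) (fst q)\<bar> * \<rho> (fst q - snd q)"
              by (simp add: distrib_right)
          qed
          also have "\<dots> = (LINT q|lborel. sgn (E.polygon t (fst q) - w (snd q)) * F h (far_part r K) (E.polygon t) (fst q) * \<rho> (fst q - snd q))
              + (LINT x|lborel. \<bar>E.slope t x - F h (far_part r K) (E.polygon t) x\<bar>)"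
            using convolution_integrable(1,3)[OF di rho_integrable] st(1) by (simp add: rho_int)
          also have "\<dots> \<le> doubled_flux (E.polygon t) w + ?e"
            using st(2) E.slope_error(1)[OF t elim] unfolding err_def by linarith
          finally show ?thesis using True by simp
        qed simp
      qed
    qed
    also have "\<dots> = (LINT t|lborel. indicator {a..b} t * doubled_flux (E.polygon t) w) + (LINT t|lborel. indicator {a..b} t * ?e)"
      by (intro Bochner_Integration.integral_add Ai Iint)
    also have "(LINT t|lborel. indicator {a..b} t * ?e) = ?e * (b - a)" using ab by simp
    finally show ?thesis by (simp add: set_lebesgue_integral_def)
  qed
qed

end

section \<open>Smooth test functions\<close>

text \<open>The uniqueness argument tests only with products of a function of \<open>x\<close> and a
  function of \<open>t\<close>; for these \<open>Ck\<close> reduces to one-variable smoothness. The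
  derivative is existentially quantified so that the closure rules can name it directly.\<close>

primrec Cn :: "nat \<Rightarrow> (real \<Rightarrow> real) \<Rightarrow> bool" where
  "Cn 0 f \<longleftrightarrow> continuous_on UNIV f"
| "Cn (Suc n) f \<longleftrightarrow> (\<exists>f'. (\<forall>x. (f has_real_derivative f' x) (at x)) \<and> Cn n f')"

lemma Cn_Suc_imp: "Cn (Suc n) f \<Longrightarrow> Cn n f"
proof (induction n arbitrary: f)
  case 0
  then show ?case by (auto intro!: continuous_at_imp_continuous_on dest!: spec DERIV_isCont)
next
  case (Suc n)
  then show ?case by (metis Cn.simps(2))
qed

lemma Cn_continuous: "Cn n f \<Longrightarrow> continuous_on UNIV f"
  by (induction n) (auto dest: Cn_Suc_imp simp del: Cn.simps(2))

lemma Cn_const: "Cn n (\<lambda>x. c)"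
proof (induction n arbitrary: c)
  case (Suc n)
  have "\<forall>x. ((\<lambda>x. c) has_real_derivative 0) (at x)" by auto
  then show ?case using Suc[of 0] by (auto intro!: exI[of _ "\<lambda>x. 0"])
qed auto

lemma Cn_add: "Cn n f \<Longrightarrow> Cn n g \<Longrightarrow> Cn n (\<lambda>x. f x + g x)"
proof (induction n arbitrary: f g)
  case 0
  then show ?case by (auto intro: continuous_intros)
next
  case (Suc n)
  then obtain f' g' where d: "\<forall>x. (f has_real_derivative f' x) (at x)" "Cn n f'" "\<forall>x. (g has_real_derivative g' x) (at x)" "Cn n g'" by auto
  have "\<forall>x. ((\<lambda>x. f x + g x) has_real_derivative f' x + g' x) (at x)" using d by (auto intro: DERIV_add)
  then show ?case using Suc.IH[OF d(2,4)] by (auto intro!: exI[of _ "\<lambda>x. f' x + g' x"])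
qed

lemma Cn_mult: "Cn n f \<Longrightarrow> Cn n g \<Longrightarrow> Cn n (\<lambda>x. f x * g x)"
proof (induction n arbitrary: f g)
  case 0
  then show ?case by (auto intro: continuous_intros)
next
  case (Suc n)
  then obtain f' g' where d: "\<forall>x. (f has_real_derivative f' x) (at x)" "Cn n f'" "\<forall>x. (g has_real_derivative g' x) (at x)" "Cn n g'" by auto
  have "\<forall>x. ((\<lambda>x. f x * g x) has_real_derivative f' x * g x + g' x * f x) (at x)" using d by (auto intro!: DERIV_mult)
  moreover have "Cn n (\<lambda>x. f' x * g x + g' x * f x)"
    using Suc.prems[THEN Cn_Suc_imp] d by (intro Cn_add Suc.IH) auto
  ultimately show ?case by (auto intro!: exI[of _ "\<lambda>x. f' x * g x + g' x * f x"])
qed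

lemma Cn_affine: "Cn n f \<Longrightarrow> Cn n (\<lambda>x. f (c * x + d))"
proof (induction n arbitrary: f)
  case 0
  then show ?case by (auto intro!: continuous_intros continuous_on_compose2[of UNIV f])
next
  case (Suc n)
  then obtain f' where d: "\<forall>x. (f has_real_derivative f' x) (at x)" "Cn n f'" by auto
  have "((\<lambda>x. f (c * x + d)) has_real_derivative c * f' (c * x + d)) (at x)" for x
  proof -
    have "((\<lambda>x. c * x + d) has_real_derivative c) (at x)" by (auto intro!: derivative_eq_intros)
    from DERIV_chain2[OF d(1)[rule_format] this] show ?thesis by (simp add: mult.commute)
  qed
  moreover have "Cn n (\<lambda>x. c * f' (c * x + d))" using Cn_mult[OF Cn_const Suc.IH[OF d(2)]] .
  ultimately show ?case by (auto intro!: exI[of _ "\<lambda>x. c * f' (c * x + d)"])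
qed

definition smooth :: "(real \<Rightarrow> real) \<Rightarrow> bool" where "smooth f \<longleftrightarrow> (\<forall>n. Cn n f)"

lemma smooth_deriv:
  assumes "smooth f"
  shows "(f has_real_derivative deriv f x) (at x)" "smooth (deriv f)" "continuous_on UNIV f"
proof -
  show "(f has_real_derivative deriv f x) (at x)"
    using assms unfolding smooth_def by (metis Cn.simps(2) DERIV_imp_deriv)
  show "smooth (deriv f)" unfolding smooth_def
  proof
    fix n
    have "Cn (Suc n) f" using assms smooth_def by blast
    then obtain f' where f': "\<forall>x. (f has_real_derivative f' x) (at x)" "Cn n f'" by auto
    have "deriv f x = f' x" for x using f'(1) by (intro DERIV_imp_deriv) auto
    then have "f' = deriv f" by auto
    then show "Cn n (deriv f)" using f' by simp
  qed
  show "continuous_on UNIV f" using assms unfolding smooth_def by (metis Cn.simps(1))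
qed

lemma smooth_antideriv:
  assumes "\<And>x. (f has_real_derivative f' x) (at x)" "smooth f'"
  shows "smooth f"
  unfolding smooth_def
proof
  fix n
  have "Cn (Suc n) f" using assms by (auto simp: smooth_def)
  then show "Cn n f" by (rule Cn_Suc_imp)
qed

lemma continuous_on_product_fun:
  fixes a b :: "real \<Rightarrow> real"
  assumes "continuous_on UNIV a" "continuous_on UNIV b"
  shows "continuous_on UNIV (\<lambda>(x, t). a x * b t)"
proof -
  have "continuous_on UNIV (\<lambda>q::real\<times>real. a (fst q))" "continuous_on UNIV (\<lambda>q::real\<times>real. b (snd q))"
    by (rule continuous_on_compose2[OF assms(1)] continuous_on_compose2[OF assms(2)]; auto intro: continuous_intros)+
  then show ?thesis unfolding case_prod_beta' by (rule continuous_on_mult)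
qed

lemma Ck_product: "Cn k a \<Longrightarrow> Cn k b \<Longrightarrow> Ck k (\<lambda>(x, t). a x * b t)"
proof (induction k arbitrary: a b)
  case 0
  then show ?case unfolding Ck.simps Cn.simps by (rule continuous_on_product_fun)
next
  case (Suc k)
  then obtain a' b' where d: "\<forall>x. (a has_real_derivative a' x) (at x)" "Cn k a'" "\<forall>x. (b has_real_derivative b' x) (at x)" "Cn k b'" by auto
  have c: "continuous_on UNIV a" "continuous_on UNIV b"
    using Suc.prems by (blast intro: Cn_continuous)+
  have da: "((\<lambda>y. a y * b t) has_real_derivative a' x * b t) (at x)" for x t
    using d(1) by (intro DERIV_cmult_right) auto
  have db: "((\<lambda>s. a x * b s) has_real_derivative a x * b' t) (at t)" for x t
    using d(3) by (intro DERIV_cmult) auto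
  have "dx (\<lambda>(x, t). a x * b t) = (\<lambda>(x, t). a' x * b t)"
    unfolding dx_def using DERIV_imp_deriv[OF da] by (auto simp: fun_eq_iff)
  moreover have "dt (\<lambda>(x, t). a x * b t) = (\<lambda>(x, t). a x * b' t)"
    unfolding dt_def using DERIV_imp_deriv[OF db] by (auto simp: fun_eq_iff)
  moreover have "continuous_on UNIV (\<lambda>(x, t). a x * b t)"
    by (rule continuous_on_product_fun[OF c])
  moreover have dad: "(\<lambda>y. a y * b t) differentiable at x" and dbd: "(\<lambda>s. a x * b s) differentiable at t" for x t
    using da db real_differentiable_def by blast+
  ultimately show ?case unfolding Ck.simps
    using Suc.IH[OF d(2) Cn_Suc_imp[OF Suc.prems(2)]] Suc.IH[OF Cn_Suc_imp[OF Suc.prems(1)] d(4)]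
      dad dbd by simp
qed

lemma product_test_function:
  assumes a: "smooth a" "\<And>x. \<bar>x\<bar> > R \<Longrightarrow> a x = 0" and b: "smooth b" "\<And>x. \<bar>x\<bar> > R \<Longrightarrow> b x = 0"
  shows "(\<lambda>(x, t). a x * b t) \<in> test_functions"
    and "dx (\<lambda>(x, t). a x * b t) (x, t) = deriv a x * b t"
    and "dt (\<lambda>(x, t). a x * b t) (x, t) = a x * deriv b t"
proof -
  have "compact (closure {p. (\<lambda>(x, t). a x * b t) p \<noteq> 0})"
  proof (rule compact_supportI[of "\<bar>R\<bar> + \<bar>R\<bar>"])
    fix p :: "real \<times> real" assume p: "norm p > \<bar>R\<bar> + \<bar>R\<bar>"
    have "norm p \<le> \<bar>fst p\<bar> + \<bar>snd p\<bar>" using norm_Pair_le[of "fst p" "snd p"] by simp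
    then have "\<bar>fst p\<bar> > R \<or> \<bar>snd p\<bar> > R" using p by linarith
    then show "(\<lambda>(x, t). a x * b t) p = 0" using a(2) b(2) by (auto simp: case_prod_beta')
  qed
  then show "(\<lambda>(x, t). a x * b t) \<in> test_functions"
    using Ck_product a(1) b(1) by (auto simp: test_functions_def smooth_def)
  show "dx (\<lambda>(x, t). a x * b t) (x, t) = deriv a x * b t"
    unfolding dx_def prod.case using smooth_deriv(1)[OF a(1)] by (intro DERIV_imp_deriv DERIV_cmult_right)
  show "dt (\<lambda>(x, t). a x * b t) (x, t) = a x * deriv b t"
    unfolding dt_def prod.case using smooth_deriv(1)[OF b(1)] by (intro DERIV_imp_deriv DERIV_cmult)
qed

section \<open>A smooth bump, its mollifiers and smooth steps\<close>

definition fexp :: "real poly \<Rightarrow> real \<Rightarrow> real" where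
  "fexp P x = (if x > 0 then poly P (inverse x) * exp (- inverse x) else 0)"

lemma poly_exp_tendsto: "((\<lambda>y. poly P y * exp (- y)) \<longlongrightarrow> (0::real)) at_top"
proof -
  have "((\<lambda>y. \<Sum>i\<le>degree P. coeff P i * (y ^ i / exp y)) \<longlongrightarrow> (\<Sum>i\<le>degree P. coeff P i * 0)) at_top"
    by (intro tendsto_sum tendsto_mult tendsto_const tendsto_power_div_exp_0)
  moreover have "(\<lambda>y. \<Sum>i\<le>degree P. coeff P i * (y ^ i / exp y)) = (\<lambda>y. poly P y * exp (- y))"
    by (simp add: fun_eq_iff poly_altdef sum_distrib_right exp_minus divide_inverse mult.assoc)
  ultimately show ?thesis by simp
qed

text \<open>In the variable \<open>y = 1 / x\<close>, differentiation in \<open>x\<close> takes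
  \<open>P y * exp (- y)\<close> to \<open>y\<^sup>2 * (P y - P' y) * exp (- y)\<close>, and the
  coefficient list is the polynomial \<open>y\<^sup>2\<close>. The family is therefore closed under
  differentiation, and smoothness follows by induction with \<open>P\<close> arbitrary. At the
  origin the exponential beats every polynomial.\<close>

lemma fexp_deriv: "(fexp P has_real_derivative fexp ([:0, 0, 1:] * (P - pderiv P)) x) (at x)"
proof -
  let ?Q = "[:0, 0, 1:] * (P - pderiv P)"
  consider "x > 0" | "x < 0" | "x = 0" by linarith
  then show ?thesis
  proof cases
    case 1
    have i: "(inverse has_real_derivative - (inverse x)\<^sup>2) (at x)"
      using 1 DERIV_inverse[of x UNIV] by (simp add: power2_eq_square numeral_2_eq_2)
    have "((\<lambda>x. poly P (inverse x)) has_real_derivative poly (pderiv P) (inverse x) * - (inverse x)\<^sup>2) (at x)"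
      by (rule DERIV_chain2[OF poly_DERIV i])
    moreover have "((\<lambda>x. exp (- inverse x)) has_real_derivative exp (- inverse x) * - (- (inverse x)\<^sup>2)) (at x)"
      by (rule DERIV_chain2[OF DERIV_exp DERIV_minus[OF i]])
    ultimately have "((\<lambda>x. poly P (inverse x) * exp (- inverse x)) has_real_derivative
        poly (pderiv P) (inverse x) * - (inverse x)\<^sup>2 * exp (- inverse x) + exp (- inverse x) * - (- (inverse x)\<^sup>2) * poly P (inverse x)) (at x)"
      by (rule DERIV_mult)
    also have "poly (pderiv P) (inverse x) * - (inverse x)\<^sup>2 * exp (- inverse x) + exp (- inverse x) * - (- (inverse x)\<^sup>2) * poly P (inverse x) = fexp ?Q x"
      using 1 by (simp add: fexp_def power2_eq_square algebra_simps)
    finally show ?thesis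
      by (rule has_field_derivative_transform_within_open[of _ _ _ "{0<..}"]) (use 1 in \<open>auto simp: fexp_def\<close>)
  next
    case 2
    have "((\<lambda>x. 0) has_real_derivative fexp ?Q x) (at x)" using 2 by (simp add: fexp_def)
    then show ?thesis
      by (rule has_field_derivative_transform_within_open[of _ _ _ "{..<0}"]) (use 2 in \<open>auto simp: fexp_def\<close>)
  next
    case 3
    have "((\<lambda>h. fexp P h / h) \<longlongrightarrow> 0) (at_right 0)"
    proof -
      have "((\<lambda>h. poly ([:0, 1:] * P) (inverse h) * exp (- inverse h)) \<longlongrightarrow> 0) (at_right (0::real))"
        by (rule filterlim_compose[OF poly_exp_tendsto filterlim_inverse_at_top_right])
      then show ?thesis
        by (rule Lim_transform_eventually) (auto simp: eventually_at_filter fexp_def divide_inverse mult.commute mult.left_commute)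
    qed
    moreover have "((\<lambda>h. fexp P h / h) \<longlongrightarrow> 0) (at_left 0)"
      by (rule tendsto_eventually) (auto simp: eventually_at_filter fexp_def)
    ultimately have "((\<lambda>h. fexp P h / h) \<longlongrightarrow> 0) (at 0)" by (simp add: filterlim_split_at)
    then show ?thesis using 3 by (simp add: DERIV_def fexp_def)
  qed
qed

lemma smooth_fexp: "smooth (fexp P)"
  unfolding smooth_def
proof
  fix n show "Cn n (fexp P)"
  proof (induction n arbitrary: P)
    case 0
    then show ?case using DERIV_isCont[OF fexp_deriv] by (simp add: continuous_at_imp_continuous_on)
  next
    case (Suc n)
    then show ?case using fexp_deriv by (auto intro!: exI[of _ "fexp ([:0, 0, 1:] * (P - pderiv P))"])
  qed
qed

definition bump :: "real \<Rightarrow> real" where "bump x = fexp 1 (1 + x) * fexp 1 (1 - x)"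

lemma bump: "smooth bump" "0 \<le> bump x" "bump (- x) = bump x" "\<bar>x\<bar> > 1 \<Longrightarrow> bump x = 0"
proof -
  have "Cn n (\<lambda>x. fexp 1 (1 * x + 1) * fexp 1 ((-1) * x + 1))" for n
    using smooth_fexp[of 1] unfolding smooth_def by (intro Cn_mult[OF Cn_affine Cn_affine]) auto
  moreover have "bump = (\<lambda>x. fexp 1 (1 * x + 1) * fexp 1 ((-1) * x + 1))"
    by (simp add: fun_eq_iff bump_def add.commute)
  ultimately show "smooth bump" by (simp add: smooth_def)
qed (auto simp: bump_def fexp_def mult.commute)

lemma bump_integral: "integrable lborel bump" "0 < (LINT x|lborel. bump x)"
proof -
  have c: "continuous_on S bump" for S using smooth_deriv(3)[OF bump(1)] continuous_on_subset by blast
  have "set_integrable lborel {-1..1} bump" by (intro borel_integrable_atLeastAtMost' c)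
  then show i: "integrable lborel bump" unfolding set_integrable_def
    by (rule back_subst[of "integrable lborel"]) (use bump(4) in \<open>force simp: indicator_def fun_eq_iff\<close>)
  define e where "e = exp (- 2 :: real)"
  have f: "e \<le> fexp 1 y" if "1 / 2 \<le> y" for y :: real
  proof -
    have "inverse y \<le> inverse (1/2)" using that by (intro le_imp_inverse_le) auto
    then show ?thesis using that by (simp add: e_def fexp_def)
  qed
  have "e * e * 1 = (LINT x|lborel. indicator {-1/2..1/2::real} x * (e * e))" by simp
  also have "\<dots> \<le> (LINT x|lborel. bump x)"
  proof (intro integral_mono i integrable_indicator_Icc)
    fix x :: real
    show "indicator {-1/2..1/2} x * (e * e) \<le> bump x"
    proof (cases "x \<in> {-1/2..1/2}")
      case True
      have "e * e \<le> bump x" unfolding bump_def using True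
        by (intro mult_mono f) (auto simp: e_def fexp_def)
      then show ?thesis using True by simp
    qed (use bump(2) in simp)
  qed
  finally have "e * e \<le> (LINT x|lborel. bump x)" by simp
  moreover have "0 < e * e" by (simp add: e_def)
  ultimately show "0 < (LINT x|lborel. bump x)" by linarith
qed

definition mollifier :: "real \<Rightarrow> real \<Rightarrow> real" where
  "mollifier R x = bump (x / R) / (R * (LINT x|lborel. bump x))"

lemma smooth_mollifier: "smooth (mollifier R)"
  unfolding smooth_def
proof
  fix n
  have "Cn n (\<lambda>x. inverse (R * (LINT x|lborel. bump x)) * bump (inverse R * x + 0))"
    using bump(1) unfolding smooth_def by (intro Cn_mult[OF Cn_const Cn_affine]) auto
  then show "Cn n (mollifier R)"
    by (rule back_subst[of "Cn n"]) (simp add: mollifier_def fun_eq_iff divide_inverse mult.commute)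
qed

lemma moll_mollifier:
  assumes R: "0 < R"
  shows "moll (mollifier R) (deriv (mollifier R)) R"
proof
  show "0 \<le> mollifier R x" for x unfolding mollifier_def using bump(2) bump_integral(2) R by auto
  show "mollifier R (- x) = mollifier R x" for x unfolding mollifier_def using bump(3)[of "x / R"] by simp
  show "(mollifier R has_real_derivative deriv (mollifier R) x) (at x)" for x by (rule smooth_deriv[OF smooth_mollifier])
  show "continuous_on UNIV (deriv (mollifier R))" using smooth_deriv[OF smooth_deriv(2)[OF smooth_mollifier]] by blast
  show "mollifier R x = 0" if "\<bar>x\<bar> > R" for x
    unfolding mollifier_def using that R by (subst bump(4)) (auto simp: less_divide_eq)
  have "(LINT x|lborel. bump (x / R)) = R * (LINT x|lborel. bump x)"
  proof -
    have "(LINT x|lborel. bump x) = \<bar>1/R\<bar> *\<^sub>R (LINT x|lborel. bump (0 + (1/R) * x))"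
      using R by (intro lborel_integral_real_affine) auto
    then show ?thesis using R by simp
  qed
  then show "(LINT x|lborel. mollifier R x) = 1" unfolding mollifier_def using R bump_integral(2) by simp
qed

text \<open>The smoothed indicator of the interval from \<open>a\<close> to \<open>b\<close>: the
  difference of two translates of a primitive of the mollifier. Its derivative is a positive bump at
  \<open>a\<close> and a negative one at \<open>b\<close>, which in the limit read off the values at
  the two end points.\<close>

lemma smooth_step:
  assumes R: "0 < R" and ab: "a \<le> b"
  obtains \<theta> where "smooth \<theta>" "\<And>t. (\<theta> has_real_derivative mollifier R (t - a) - mollifier R (t - b)) (at t)"
    "\<And>t. 0 \<le> \<theta> t" "\<And>t. \<theta> t \<le> 1" "\<And>t. t \<le> a - R \<Longrightarrow> \<theta> t = 0" "\<And>t. b + R \<le> t \<Longrightarrow> \<theta> t = 0"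
    "\<And>t. a + R \<le> t \<Longrightarrow> t \<le> b - R \<Longrightarrow> \<theta> t = 1"
proof -
  interpret moll "mollifier R" "deriv (mollifier R)" R by (rule moll_mollifier[OF R])
  have "\<exists>F. \<forall>x::real. -\<infinity> < ereal x \<longrightarrow> ereal x < \<infinity> \<longrightarrow> (F has_vector_derivative mollifier R x) (at x)"
    by (rule einterval_antiderivative) (use rho_cont[of UNIV] in \<open>auto simp: continuous_on_eq_continuous_at\<close>)
  then obtain P where P: "\<And>x. (P has_real_derivative mollifier R x) (at x)"
    by (auto simp: has_real_derivative_iff_has_vector_derivative)
  have mono: "P x \<le> P y" if "x \<le> y" for x y
    using that P rho_nonneg by (metis DERIV_nonneg_imp_nondecreasing)
  have eqP: "P x = P y" if xy: "x < y" "\<And>z. x < z \<Longrightarrow> z < y \<Longrightarrow> \<bar>z\<bar> > R" for x y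
  proof -
    obtain \<xi> where "x < \<xi>" "\<xi> < y" "P y - P x = (y - x) * mollifier R \<xi>" using MVT2[OF xy(1), of P "mollifier R"] P by blast
    then show ?thesis using xy(2)[of \<xi>] rho_supp[of \<xi>] by simp
  qed
  have lo: "P t = P (- R)" if "t \<le> - R" for t using eqP[of t "- R"] that R by (cases "t = - R") auto
  have hi: "P t = P R" if "R \<le> t" for t using eqP[of R t] that R by (cases "t = R") auto
  have one: "P R - P (- R) = 1"
  proof -
    have "(mollifier R has_integral (P R - P (- R))) {-R..R}"
      by (rule fundamental_theorem_of_calculus) (use R P in \<open>auto simp: has_real_derivative_iff_has_vector_derivative[symmetric] has_field_derivative_at_within\<close>)
    then have "integral {-R..R} (mollifier R) = P R - P (- R)" by (rule integral_unique)
    moreover have "integral {-R..R} (mollifier R) = (LINT t|lborel. indicator {-R..R} t * mollifier R t)" by (rule integral_eq_LINT(1)[OF rho_cont])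
    moreover have "\<dots> = (LINT t|lborel. mollifier R t)"
      by (intro Bochner_Integration.integral_cong) (use rho_supp in \<open>force simp: indicator_def\<close>)+
    ultimately show ?thesis using rho_int by simp
  qed
  have bd: "P (- R) \<le> P t" "P t \<le> P R" for t
  proof -
    show "P (- R) \<le> P t" using mono[of "- R" t] lo[of t] by (metis order_refl nle_le)
    show "P t \<le> P R" using mono[of t R] hi[of t] by (metis order_refl nle_le)
  qed
  define \<theta> where "\<theta> t = P (t - a) - P (t - b)" for t
  have d: "(\<theta> has_real_derivative mollifier R (t - a) - mollifier R (t - b)) (at t)" for t
  proof -
    have "((\<lambda>t. P (t - c)) has_real_derivative mollifier R (t - c) * 1) (at t)" for c
      by (rule DERIV_chain2[OF P]) (auto intro!: derivative_eq_intros)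
    then show ?thesis unfolding \<theta>_def by (intro DERIV_diff) auto
  qed
  show ?thesis
  proof (rule that[of \<theta>])
    show "smooth \<theta>"
    proof (rule smooth_antideriv[OF d])
      have "Cn n (\<lambda>t. mollifier R (1 * t + (- a)) + (- 1) * mollifier R (1 * t + (- b)))" for n
        using smooth_mollifier[of R] unfolding smooth_def by (intro Cn_add[OF Cn_affine Cn_mult[OF Cn_const Cn_affine]]) auto
      then show "smooth (\<lambda>t. mollifier R (t - a) - mollifier R (t - b))" by (simp add: smooth_def)
    qed
    show "0 \<le> \<theta> t" for t unfolding \<theta>_def using mono[of "t - b" "t - a"] ab by simp
    show "\<theta> t \<le> 1" for t unfolding \<theta>_def using bd(2)[of "t - a"] bd(1)[of "t - b"] one by linarith
    show "\<theta> t = 0" if "t \<le> a - R" for t unfolding \<theta>_def using lo[of "t - a"] lo[of "t - b"] that ab by simp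
    show "\<theta> t = 0" if "b + R \<le> t" for t unfolding \<theta>_def using hi[of "t - a"] hi[of "t - b"] that ab by simp
    show "\<theta> t = 1" if "a + R \<le> t" "t \<le> b - R" for t unfolding \<theta>_def using hi[of "t - a"] lo[of "t - b"] that one by simp
  qed (rule d)
qed

lemma mollifier_concentration:
  fixes E :: "real \<Rightarrow> real"
  assumes E: "continuous_on {0..T} E" and c: "0 < c" "c < T" and R: "\<And>n. 0 < R n" "R \<longlonglongrightarrow> 0"
  shows "(\<lambda>n. LINT t|lborel. indicator {0..T} t * E t * mollifier (R n) (t - c)) \<longlonglongrightarrow> E c"
proof (rule LIMSEQ_I)
  fix e :: real assume e: "0 < e"
  define g where "g t = indicator {0..T} t * E t" for t
  have gi: "integrable lborel g" unfolding g_def by (rule integral_eq_LINT(2)[OF E])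
  have "continuous (at c within {0..T}) E" using E c by (auto simp: continuous_on_eq_continuous_within)
  then obtain d where d: "d > 0" "\<And>t. t \<in> {0..T} \<Longrightarrow> dist t c < d \<Longrightarrow> dist (E t) (E c) < e / 2"
    unfolding continuous_within_eps_delta using e by (meson half_gt_zero)
  define d' where "d' = min d (min c (T - c))"
  have d': "0 < d'" using d c by (simp add: d'_def)
  have near: "\<bar>g t - E c\<bar> \<le> e / 2" if "\<bar>t - c\<bar> < d'" for t
    using d(2)[of t] that by (auto simp: d'_def g_def dist_real_def indicator_def)
  obtain n0 where n0: "\<And>n. n \<ge> n0 \<Longrightarrow> R n < d'"
    using order_tendstoD(2)[OF R(2) d'] by (auto simp: eventually_sequentially)
  have "norm ((LINT t|lborel. indicator {0..T} t * E t * mollifier (R n) (t - c)) - E c) < e" if n: "n \<ge> n0" for n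
  proof -
    interpret moll "mollifier (R n)" "deriv (mollifier (R n))" "R n" by (rule moll_mollifier[OF R(1)])
    have mi: "integrable lborel (\<lambda>t. mollifier (R n) (t - c))" using integrable_shift[OF rho_integrable, of "-c"] by simp
    have m1: "(LINT t|lborel. mollifier (R n) (t - c)) = 1" using integral_shift[of "mollifier (R n)" "-c"] rho_int by simp
    obtain B where B: "0 \<le> B" "\<And>x. mollifier (R n) x \<le> B" by (metis rho_le)
    have i: "integrable lborel (\<lambda>t. g t * mollifier (R n) (t - c))"
      by (rule integrable_bounded_mult(1)[OF gi, where B=B]) (use B rho_nonneg in auto)
    have "(LINT t|lborel. g t * mollifier (R n) (t - c)) - E c = (LINT t|lborel. g t * mollifier (R n) (t - c)) - (LINT t|lborel. E c * mollifier (R n) (t - c))"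
      using m1 by simp
    also have "\<dots> = (LINT t|lborel. g t * mollifier (R n) (t - c) - E c * mollifier (R n) (t - c))"
      by (intro Bochner_Integration.integral_diff[symmetric] i integrable_mult_right mi)
    also have "\<bar>\<dots>\<bar> \<le> (LINT t|lborel. e / 2 * mollifier (R n) (t - c))"
    proof (intro order_trans[OF integral_abs_bound] integral_mono integrable_abs Bochner_Integration.integrable_diff i integrable_mult_right mi)
      fix t
      show "\<bar>g t * mollifier (R n) (t - c) - E c * mollifier (R n) (t - c)\<bar> \<le> e / 2 * mollifier (R n) (t - c)"
      proof (cases "\<bar>t - c\<bar> > R n")
        case True
        then show ?thesis using rho_supp by simp
      next
        case False
        then have "\<bar>g t - E c\<bar> * mollifier (R n) (t - c) \<le> e / 2 * mollifier (R n) (t - c)"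
          using n0[OF n] rho_nonneg by (intro mult_right_mono near) auto
        then show ?thesis using rho_nonneg[of "t - c"] by (simp add: left_diff_distrib[symmetric] abs_mult)
      qed
    qed
    also have "\<dots> = e / 2" using m1 by simp
    finally show ?thesis using e by (simp add: g_def)
  qed
  then show "\<exists>n0. \<forall>n\<ge>n0. norm ((LINT t|lborel. indicator {0..T} t * E t * mollifier (R n) (t - c)) - E c) < e" by blast
qed

section \<open>From the weak to the pointwise-in-time inequality\<close>

text \<open>Testing with the smoothed indicator of \<open>{a..b}\<close> and shrinking the smoothing
  radius: the derivative concentrates at the end points, where \<open>E\<close> is continuous, and
  the function itself tends to the indicator. Since \<open>b < T\<close>, the test functions vanish
  at \<open>T\<close>.\<close>

lemma weak_inequality:
  fixes E A :: "real \<Rightarrow> real"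
  assumes E: "continuous_on {0..T} E" and A: "integrable lborel (\<lambda>t. indicator {0..T} t * A t)"
    and weak: "\<And>\<theta> S. smooth \<theta> \<Longrightarrow> (\<And>t. \<bar>t\<bar> > S \<Longrightarrow> \<theta> t = 0) \<Longrightarrow> (\<And>t. 0 \<le> \<theta> t) \<Longrightarrow>
      0 \<le> (LINT t|lborel. indicator {0..T} t * (E t * deriv \<theta> t + A t * \<theta> t)) + E0 * \<theta> 0 - ET * \<theta> T"
    and b: "0 < b" "b < T"
  shows weak_inequality_initial: "E b - E0 \<le> (LINT t:{0..b}|lborel. A t)"
    and weak_inequality_interior: "\<And>a. 0 < a \<Longrightarrow> a < b \<Longrightarrow> E b - E a \<le> (LINT t:{a..b}|lborel. A t)"
proof -
  \<comment> \<open>Both cases at once: \<open>c\<close> is the value of the test functions at time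
    0, and \<open>l\<close> is what the bump at the left end contributes in the limit. An interior
    left end gives \<open>c = 0\<close> and \<open>l = E a\<close>; a left end before time 0 gives
    \<open>c = 1\<close> and \<open>l = 0\<close>.\<close>
  have key: "0 \<le> l - E b + (LINT t|lborel. indicator {0..T} t * A t * indicator {a..b} t) + E0 * c"
    if ab: "a < b" and e0: "0 < e0" "b + e0 \<le> T"
      and l: "\<And>R. (\<And>n. 0 < R n) \<Longrightarrow> (\<And>n. R n \<le> e0) \<Longrightarrow> R \<longlonglongrightarrow> 0 \<Longrightarrow> (\<lambda>n. LINT t|lborel. indicator {0..T} t * E t * mollifier (R n) (t - a)) \<longlonglongrightarrow> l"
      and c: "(0 \<le> a - e0 \<and> c = 0) \<or> (a + e0 \<le> 0 \<and> 0 \<le> b - e0 \<and> c = 1)" for a l e0 c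
  proof -
    define R where "R n = e0 / real (Suc n)" for n
    have R: "0 < R n" "R n \<le> e0" for n using e0 by (auto simp: R_def divide_le_eq)
    have Rl: "R \<longlonglongrightarrow> 0" unfolding R_def using tendsto_mult_right_zero[OF LIMSEQ_inverse_real_of_nat, of e0] by (simp add: divide_inverse)
    have "\<forall>n. \<exists>\<theta>. smooth \<theta> \<and> (\<forall>t. (\<theta> has_real_derivative mollifier (R n) (t - a) - mollifier (R n) (t - b)) (at t)) \<and> (\<forall>t. 0 \<le> \<theta> t) \<and>
      (\<forall>t. \<theta> t \<le> 1) \<and> (\<forall>t. t \<le> a - R n \<longrightarrow> \<theta> t = 0) \<and> (\<forall>t. b + R n \<le> t \<longrightarrow> \<theta> t = 0) \<and> (\<forall>t. a + R n \<le> t \<longrightarrow> t \<le> b - R n \<longrightarrow> \<theta> t = 1)"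
      using smooth_step[OF R(1) less_imp_le[OF ab]] by metis
    then obtain \<theta> where \<theta>: "\<And>n. smooth (\<theta> n)" "\<And>n t. (\<theta> n has_real_derivative mollifier (R n) (t - a) - mollifier (R n) (t - b)) (at t)"
      "\<And>n t. 0 \<le> \<theta> n t" "\<And>n t. \<theta> n t \<le> 1" "\<And>n t. t \<le> a - R n \<Longrightarrow> \<theta> n t = 0" "\<And>n t. b + R n \<le> t \<Longrightarrow> \<theta> n t = 0"
      "\<And>n t. a + R n \<le> t \<Longrightarrow> t \<le> b - R n \<Longrightarrow> \<theta> n t = 1" by metis
    have dth: "deriv (\<theta> n) t = mollifier (R n) (t - a) - mollifier (R n) (t - b)" for n t using \<theta>(2) by (rule DERIV_imp_deriv)
    have [measurable]: "\<theta> n \<in> borel_measurable borel" for n using smooth_deriv(3)[OF \<theta>(1)] by (rule borel_measurable_continuous_onI)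
    have gi: "integrable lborel (\<lambda>t. indicator {0..T} t * E t)" by (rule integral_eq_LINT(2)[OF E])
    have mi: "integrable lborel (\<lambda>t. indicator {0..T} t * E t * mollifier (R n) (t - c))" for n c
    proof -
      interpret moll "mollifier (R n)" "deriv (mollifier (R n))" "R n" by (rule moll_mollifier[OF R(1)])
      obtain B where B: "0 \<le> B" "\<And>x. mollifier (R n) x \<le> B" by (metis rho_le)
      show ?thesis by (rule integrable_bounded_mult(1)[OF gi, where B=B]) (use B rho_nonneg in auto)
    qed
    have Ai: "integrable lborel (\<lambda>t. indicator {0..T} t * A t * \<theta> n t)" for n
      by (rule integrable_bounded_mult(1)[OF A, where B=1]) (use \<theta>(3,4) in auto)
    have th0: "\<theta> n 0 = c" for n
      using c R(2)[of n] \<theta>(5)[of 0 n] \<theta>(7)[of n 0] by auto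
    have thT: "\<theta> n T = 0" for n using \<theta>(6)[of n T] R(2)[of n] e0 by simp
    have ge: "0 \<le> (LINT t|lborel. indicator {0..T} t * E t * mollifier (R n) (t - a)) - (LINT t|lborel. indicator {0..T} t * E t * mollifier (R n) (t - b))
        + (LINT t|lborel. indicator {0..T} t * A t * \<theta> n t) + E0 * c" for n
    proof -
      have supp: "\<theta> n t = 0" if "\<bar>t\<bar> > \<bar>a\<bar> + \<bar>b\<bar> + e0" for t
        using that \<theta>(5)[of t n] \<theta>(6)[of n t] R[of n] by (cases "t \<ge> 0") (auto simp: abs_if split: if_splits)
      have "0 \<le> (LINT t|lborel. indicator {0..T} t * (E t * deriv (\<theta> n) t + A t * \<theta> n t)) + E0 * \<theta> n 0 - ET * \<theta> n T"
        by (rule weak[OF \<theta>(1) supp \<theta>(3)])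
      also have "(LINT t|lborel. indicator {0..T} t * (E t * deriv (\<theta> n) t + A t * \<theta> n t)) =
         (LINT t|lborel. indicator {0..T} t * E t * mollifier (R n) (t - a) - indicator {0..T} t * E t * mollifier (R n) (t - b) + indicator {0..T} t * A t * \<theta> n t)"
        by (intro Bochner_Integration.integral_cong refl) (simp add: dth algebra_simps)
      also have "\<dots> = (LINT t|lborel. indicator {0..T} t * E t * mollifier (R n) (t - a)) - (LINT t|lborel. indicator {0..T} t * E t * mollifier (R n) (t - b))
        + (LINT t|lborel. indicator {0..T} t * A t * \<theta> n t)"
        using mi[of n a] mi[of n b] Ai[of n] by simp
      finally show ?thesis by (simp add: th0 thT)
    qed
    have "(\<lambda>n. LINT t|lborel. indicator {0..T} t * A t * \<theta> n t) \<longlonglongrightarrow> (LINT t|lborel. indicator {0..T} t * A t * indicator {a..b} t)"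
    proof (rule integral_dominated_convergence[where w="\<lambda>t. \<bar>indicator {0..T} t * A t\<bar>"])
      have "AE t in lborel. t \<noteq> a \<and> t \<noteq> b" using AE_lborel_singleton[of a] AE_lborel_singleton[of b] by eventually_elim auto
      then show "AE t in lborel. (\<lambda>n. indicator {0..T} t * A t * \<theta> n t) \<longlonglongrightarrow> indicator {0..T} t * A t * indicator {a..b} t"
      proof eventually_elim
        case (elim t)
        have "\<forall>\<^sub>F n in sequentially. \<theta> n t = indicator {a..b} t"
        proof -
          consider "t < a" | "a < t" "t < b" | "b < t" using elim by linarith
          then show ?thesis
          proof cases
            case 1
            have "\<forall>\<^sub>F n in sequentially. R n < a - t" using order_tendstoD(2)[OF Rl, of "a - t"] 1 by simp
            then show ?thesis by eventually_elim (use 1 \<theta>(5) in auto)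
          next
            case 2
            have "\<forall>\<^sub>F n in sequentially. R n < t - a" "\<forall>\<^sub>F n in sequentially. R n < b - t"
              using order_tendstoD(2)[OF Rl] 2 by simp_all
            then show ?thesis by eventually_elim (use 2 \<theta>(7) in auto)
          next
            case 3
            have "\<forall>\<^sub>F n in sequentially. R n < t - b" using order_tendstoD(2)[OF Rl, of "t - b"] 3 by simp
            then show ?thesis by eventually_elim (use 3 \<theta>(6) in auto)
          qed
        qed
        then show ?case by (intro tendsto_mult tendsto_const tendsto_eventually)
      qed
      show "AE t in lborel. norm (indicator {0..T} t * A t * \<theta> n t) \<le> \<bar>indicator {0..T} t * A t\<bar>" for n
        using \<theta>(3,4)[of n] by (intro AE_I2) (simp add: abs_mult mult_left_le)
    qed (use A Ai in \<open>auto intro!: borel_measurable_integrable integrable_bounded_mult(1)[OF A, where B=1] simp: indicator_def\<close>)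
    moreover have "(\<lambda>n. LINT t|lborel. indicator {0..T} t * E t * mollifier (R n) (t - b)) \<longlonglongrightarrow> E b"
      by (rule mollifier_concentration[OF E b R(1) Rl])
    ultimately have "(\<lambda>n. (LINT t|lborel. indicator {0..T} t * E t * mollifier (R n) (t - a)) - (LINT t|lborel. indicator {0..T} t * E t * mollifier (R n) (t - b))
        + (LINT t|lborel. indicator {0..T} t * A t * \<theta> n t) + E0 * c) \<longlonglongrightarrow> l - E b + (LINT t|lborel. indicator {0..T} t * A t * indicator {a..b} t) + E0 * c"
      using l[OF R Rl] by (intro tendsto_intros)
    then show ?thesis using ge by (intro LIMSEQ_le_const[where a=0]) auto
  qed
  have S: "(LINT t|lborel. indicator {0..T} t * A t * indicator {a..b} t) = (LINT t:{max 0 a..b}|lborel. A t)" for a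
    unfolding set_lebesgue_integral_def using b by (intro Bochner_Integration.integral_cong) (auto simp: indicator_def)
  show "E b - E0 \<le> (LINT t:{0..b}|lborel. A t)"
  proof -
    \<comment> \<open>For the initial inequality the left end is placed at \<open>-1\<close>. A
      radius of at most \<open>1/2\<close> keeps the bump there away from the nonnegative times and
      the plateau over time 0.\<close>
    define e0 where "e0 = min (1/2) (min b (T - b))"
    have e0: "0 < e0" "b + e0 \<le> T" "e0 \<le> b" using b by (auto simp: e0_def min_le_iff_disj)
    have "e0 \<le> 1/2" unfolding e0_def by (rule min.cobounded1)
    note e0 = e0 this
    have "0 \<le> 0 - E b + (LINT t|lborel. indicator {0..T} t * A t * indicator {-1..b} t) + E0 * 1"
    proof (rule key)
      fix R :: "nat \<Rightarrow> real" assume R: "\<And>n. 0 < R n" "\<And>n. R n \<le> e0"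
      have z: "indicator {0..T} t * E t * mollifier (R n) (t - - 1) = 0" for n t
      proof (cases "t \<in> {0..T}")
        case True
        interpret moll "mollifier (R n)" "deriv (mollifier (R n))" "R n" by (rule moll_mollifier[OF R(1)])
        have "mollifier (R n) (t - - 1) = 0" using True R(2)[of n] e0 by (intro rho_supp) auto
        then show ?thesis by simp
      qed simp
      show "(\<lambda>n. LINT t|lborel. indicator {0..T} t * E t * mollifier (R n) (t - - 1)) \<longlonglongrightarrow> 0"
        by (simp only: z) simp
    qed (use b e0 in auto)
    then show ?thesis unfolding S by simp
  qed
  fix a assume a: "0 < a" "a < b"
  define e0 where "e0 = min a (T - b)"
  have e0: "0 < e0" "b + e0 \<le> T" "e0 \<le> a" using a b by (auto simp: e0_def min_le_iff_disj)
  have "0 \<le> E a - E b + (LINT t|lborel. indicator {0..T} t * A t * indicator {a..b} t) + E0 * 0"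
    by (rule key[OF a(2) e0(1,2)]) (use a b e0 in \<open>auto intro!: mollifier_concentration[OF E]\<close>)
  then show "E b - E a \<le> (LINT t:{a..b}|lborel. A t)" unfolding S using a by simp
qed

lemma integrable_swap_pair:
  fixes f :: "'a::euclidean_space \<times> 'b::euclidean_space \<Rightarrow> real"
  assumes "integrable lborel f"
  shows "integrable lborel (\<lambda>q. f (snd q, fst q))"
  using lborel_pair.integrable_product_swap[of f] assms by (simp add: lborel_prod case_prod_beta')

lemma strip_integral:
  fixes H :: "real \<Rightarrow> 'a::euclidean_space \<Rightarrow> real"
  assumes Hm: "(\<lambda>q. H (fst q) (snd q)) \<in> borel_measurable borel"
    and i: "\<And>t. t \<in> {a..b} \<Longrightarrow> integrable lborel (H t)" and M: "\<And>t. t \<in> {a..b} \<Longrightarrow> (LINT x|lborel. \<bar>H t x\<bar>) \<le> M"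
  shows "integrable lborel (\<lambda>q. indicator {a..b} (fst q) * H (fst q) (snd q))"
proof (rule integrable_lborel_pairI)
  show m: "(\<lambda>q. indicator {a..b} (fst q) * H (fst q) (snd q)) \<in> borel_measurable borel"
    using Hm by measurable
  show "AE t in lborel. integrable lborel (\<lambda>x. indicator {a..b} (fst (t, x)) * H (fst (t, x)) (snd (t, x)))"
    using i by (auto intro!: AE_I2 simp: indicator_def)
  show "integrable lborel (\<lambda>t. LINT x|lborel. \<bar>indicator {a..b} (fst (t, x)) * H (fst (t, x)) (snd (t, x))\<bar>)"
  proof (rule Bochner_Integration.integrable_bound[OF integrable_indicator_Icc[of a b M]])
    show "(\<lambda>t. LINT x|lborel. \<bar>indicator {a..b} (fst (t, x)) * H (fst (t, x)) (snd (t, x))\<bar>) \<in> borel_measurable lborel"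
      using measurable_param_integral[of "\<lambda>t x. \<bar>indicator {a..b} t * H t x\<bar>"] m by simp
    show "AE t in lborel. norm (LINT x|lborel. \<bar>indicator {a..b} (fst (t, x)) * H (fst (t, x)) (snd (t, x))\<bar>) \<le> norm (indicator {a..b} t * M)"
      using M by (intro AE_I2) (auto simp: indicator_def intro: order_trans[OF _ abs_ge_self])
  qed
qed

lemma strip_integral_Q:
  fixes H :: "real \<Rightarrow> real \<Rightarrow> real"
  assumes Hm: "(\<lambda>q. H (fst q) (snd q)) \<in> borel_measurable borel"
    and i: "\<And>t. t \<in> {0..T} \<Longrightarrow> integrable lborel (H t)" and M: "\<And>t. t \<in> {0..T} \<Longrightarrow> (LINT x|lborel. \<bar>H t x\<bar>) \<le> M"
  shows "set_integrable lborel (Q T) (\<lambda>q. H (snd q) (fst q))"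
    and "(LINT q:Q T|lborel. H (snd q) (fst q)) = (LINT t|lborel. indicator {0..T} t * (LINT x|lborel. H t x))"
    and "integrable lborel (\<lambda>t. indicator {0..T} t * (LINT x|lborel. H t x))"
proof -
  note s = strip_integral[OF Hm i M]
  have s': "integrable lborel (\<lambda>q. indicator {0..T} (snd q) * H (snd q) (fst q))" using integrable_swap_pair[OF s] by simp
  have Qm: "Q T \<in> sets borel" unfolding Q_def by (intro borel_open open_Times) auto
  have eqi: "indicator (Q T) q * H (snd q) (fst q) = indicator (Q T) q * (indicator {0..T} (snd q) * H (snd q) (fst q))" for q
    by (auto simp: Q_def indicator_def)
  show qi: "set_integrable lborel (Q T) (\<lambda>q. H (snd q) (fst q))"
    unfolding set_integrable_def real_scaleR_def eqi
    by (rule integrable_bounded_mult(2)[OF s', where B=1]) (use Qm in \<open>auto simp: indicator_def\<close>)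
  have "AE t in lborel. t \<noteq> 0 \<and> t \<noteq> T" using AE_lborel_singleton[of 0] AE_lborel_singleton[of T] by eventually_elim auto
  from AE_lborel_snd[OF this]
  have "AE q in (lborel :: (real\<times>real) measure). indicator (Q T) q * H (snd q) (fst q) = indicator {0..T} (snd q) * H (snd q) (fst q)"
    by eventually_elim (auto simp: Q_def indicator_def)
  then have "(LINT q:Q T|lborel. H (snd q) (fst q)) = (LINT q|lborel. indicator {0..T} (snd q) * H (snd q) (fst q))"
    unfolding set_lebesgue_integral_def real_scaleR_def using qi s'
    by (intro integral_cong_AE) (auto simp: set_integrable_def)
  also have "\<dots> = (LINT t|lborel. LINT x|lborel. indicator {0..T} t * H t x)"
    using lborel_fubini_snd[OF s'] by simp
  finally show "(LINT q:Q T|lborel. H (snd q) (fst q)) = (LINT t|lborel. indicator {0..T} t * (LINT x|lborel. H t x))" by simp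
  show "integrable lborel (\<lambda>t. indicator {0..T} t * (LINT x|lborel. H t x))"
    using lborel_integrable_fst[OF s] by simp
qed

text \<open>
  Members of \<open>C_L1\<close> are arbitrary outside \<open>[0, T]\<close>, and are extended there by their end values.
\<close>

definition clamp :: "real \<Rightarrow> real \<Rightarrow> real" where "clamp T t = max 0 (min T t)"

definition slices :: "real \<Rightarrow> (real \<times> real \<Rightarrow> real) \<Rightarrow> real \<Rightarrow> real \<Rightarrow> real" where
  "slices T u t x = u (x, clamp T t)"

lemma AE_interval_witness:
  fixes a b T :: real
  assumes "AE t in lborel. t \<in> {0<..<T} \<longrightarrow> P t" and "0 \<le> a" "a < b" "b \<le> T"
  obtains s where "a < s" "s < b" "P s"
proof (rule ccontr)
  assume c: "\<not> thesis"
  have "AE t in lborel. t \<notin> {a<..<b}" using assms(1)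
  proof eventually_elim
    case (elim t)
    show ?case
    proof
      assume t: "t \<in> {a<..<b}"
      then have "0 < t" "t < T" using assms(2-4) by auto
      then have "P t" using elim by auto
      then show False using c that[of t] t by auto
    qed
  qed
  then have "{a<..<b} \<in> null_sets lborel" by (subst (asm) AE_iff_null_sets[symmetric]) auto
  then have "emeasure lborel {a<..<b} = 0" by auto
  then show False using assms by simp
qed

text \<open>The BV bound holds for almost every time, and every time is an \<open>L1\<close> limit
  of such times, so \<open>bvc_limit\<close> gives it everywhere. Measurability is assembled from
  three pieces: \<open>Linf_Q\<close> covers the open strip only, and the slices at 0 and
  \<open>T\<close> come from \<open>C_L1\<close>.\<close>

lemma L1_curve_of_spaces:
  assumes T: "0 < T" and 1: "u \<in> Linf_Q T" and 2: "u \<in> C_L1 T" and 3: "u \<in> Linf_BV T"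
  obtains C where "L1_curve C (slices T u)"
proof -
  have clamp: "clamp T t \<in> {0..T}" for t using T by (auto simp: clamp_def)
  have i: "integrable lborel (\<lambda>x. u (x, t))" if "t \<in> {0..T}" for t using 2 that by (auto simp: C_L1_def)
  have lim: "((\<lambda>s. LINT x|lborel. \<bar>u (x, s) - u (x, t)\<bar>) \<longlongrightarrow> 0) (at t within {0..T})" if "t \<in> {0..T}" for t
    using 2 that by (auto simp: C_L1_def)
  obtain C where C: "AE t in lborel. t \<in> {0<..<T} \<longrightarrow> (\<lambda>x. u (x, t)) \<in> BV \<and> bv_norm (\<lambda>x. u (x, t)) \<le> ereal C"
    using 3 by (auto simp: Linf_BV_def)
  have b: "bvc C (\<lambda>x. u (x, t))" if t: "t \<in> {0..T}" for t
  proof (rule bvc_limit[OF i[OF t]])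
    fix e :: real assume e: "0 < e"
    then obtain d where d: "0 < d" "\<And>s. s \<in> {0..T} \<Longrightarrow> s \<noteq> t \<Longrightarrow> dist s t < d \<Longrightarrow> \<bar>LINT x|lborel. \<bar>u (x, s) - u (x, t)\<bar>\<bar> < e"
      using lim[OF t] unfolding tendsto_iff eventually_at dist_real_def by force
    \<comment> \<open>A nonempty open interval within distance \<open>d\<close> of \<open>t\<close>,
      inside the time range and avoiding \<open>t\<close> itself; it is taken to the right of
      \<open>t\<close> unless \<open>t = T\<close>.\<close>
    obtain a b where ab: "0 \<le> a" "a < b" "b \<le> T" "t - d \<le> a" "b \<le> t + d" "t \<notin> {a<..<b}"
    proof (cases "t < T")
      case True
      then show ?thesis using that[of t "min T (t + d)"] t d(1) by auto
    next
      case False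
      then show ?thesis using that[of "max 0 (t - d)" t] t d(1) T by auto
    qed
    obtain s where s: "a < s" "s < b" "(\<lambda>x. u (x, s)) \<in> BV \<and> bv_norm (\<lambda>x. u (x, s)) \<le> ereal C"
      using AE_interval_witness[OF C ab(1-3)] by blast
    have "\<bar>LINT x|lborel. \<bar>u (x, s) - u (x, t)\<bar>\<bar> < e" using s ab by (intro d(2)) (auto simp: dist_real_def)
    then show "\<exists>g. bvc C g \<and> (LINT x|lborel. \<bar>u (x, t) - g x\<bar>) < e"
      using bv_norm_imp_bvc[of "\<lambda>x. u (x, s)" C] s(3) by (intro exI[of _ "\<lambda>x. u (x, s)"]) (auto simp: abs_minus_commute)
  qed
  have meas: "(\<lambda>q. slices T u (fst q) (snd q)) \<in> borel_measurable borel"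
  proof -
    have [measurable]: "(\<lambda>x. u (x, 0)) \<in> borel_measurable borel" "(\<lambda>x. u (x, T)) \<in> borel_measurable borel"
      using i T by (auto intro!: integrable_lborel_measurable)
    have um: "(\<lambda>p. indicator (Q T) p *\<^sub>R u p) \<in> borel_measurable borel"
      using 1 by (auto simp: Linf_Q_def set_borel_measurable_def)
    have [measurable]: "(\<lambda>q. indicator (Q T) (snd q, fst q) *\<^sub>R u (snd q, fst q)) \<in> borel_measurable borel"
      by (rule measurable_compose[OF _ um]) measurable
    have "(\<lambda>q. slices T u (fst q) (snd q)) = (\<lambda>q. if fst q \<le> 0 then u (snd q, 0) else if T \<le> fst q then u (snd q, T)
        else indicator (Q T) (snd q, fst q) *\<^sub>R u (snd q, fst q))"
      using T by (auto simp: fun_eq_iff slices_def clamp_def Q_def)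
    moreover have "\<dots> \<in> borel_measurable borel" by measurable
    ultimately show ?thesis by simp
  qed
  have "L1_curve C (slices T u)" unfolding L1_curve_def
  proof (intro conjI allI meas)
    fix t
    show "bvc C (slices T u t)" unfolding slices_def by (rule b[OF clamp])
    have c: "continuous (at (clamp T t) within {0..T}) (\<lambda>s. LINT x|lborel. \<bar>u (x, s) - u (x, clamp T t)\<bar>)"
      unfolding continuous_within using lim[OF clamp[of t]] by simp
    have "(clamp T \<longlongrightarrow> clamp T t) (at t)" unfolding clamp_def by (intro tendsto_intros)
    from continuous_within_tendsto_compose'[OF c _ this] clamp
    show "((\<lambda>s. LINT x|lborel. \<bar>slices T u s x - slices T u t x\<bar>) \<longlongrightarrow> 0) (at t)"
      by (simp add: slices_def)
  qed
  then show ?thesis by (rule that)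
qed

section \<open>Entropy solutions satisfy the doubled inequality\<close>

lemma (in split_flux) entropy_flux_split:
  assumes pm: "\<And>u. p u - m u = f u - f 0"
  shows "entropy_flux f k u = \<bar>p u - p k\<bar> - \<bar>m u - m k\<bar>"
proof -
  have "\<bar>p u - p k\<bar> = sgn (u - k) * (p u - p k)" "\<bar>m u - m k\<bar> = sgn (u - k) * (m u - m k)"
    using monoD[OF mono_p, of u k] monoD[OF mono_p, of k u] monoD[OF mono_m, of u k] monoD[OF mono_m, of k u]
    by (auto simp: sgn_if)
  then show ?thesis using pm[of u] pm[of k] unfolding entropy_flux_def \<eta>'_def
    by (simp add: right_diff_distrib[symmetric])
qed

context flux_moll
begin

text \<open>Here \<open>k\<close> and \<open>y\<close> are independent constants, as the entropy
  inequality requires; they are linked by \<open>k = w y\<close> only after the time integration.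
  \<open>AH\<close> is the matching rate.\<close>

definition EH :: "real \<Rightarrow> real \<Rightarrow> (real \<Rightarrow> real) \<Rightarrow> real \<Rightarrow> real" where
  "EH k y a x = \<bar>a x - k\<bar> * \<rho> (x - y)"

definition AH :: "real \<Rightarrow> real \<Rightarrow> (real \<Rightarrow> real) \<Rightarrow> real \<Rightarrow> real" where
  "AH k y a x = kruzkov_flux (a x) k * \<rho>' (x - y) + sgn (a x - k) * G K a x * \<rho> (x - y)"

text \<open>The bound may depend on \<open>k\<close> but not on \<open>a\<close> or
  \<open>y\<close>: uniformity over all time slices of a curve is what the integrals over the strip
  need.\<close>

lemma EH_AH:
  obtains M where "\<And>a y. bvc C a \<Longrightarrow> integrable lborel (EH k y a) \<and> (LINT x|lborel. \<bar>EH k y a x\<bar>) \<le> M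
     \<and> integrable lborel (AH k y a) \<and> (LINT x|lborel. \<bar>AH k y a x\<bar>) \<le> M"
proof -
  obtain B where B: "0 \<le> B" "\<And>x. \<rho> x \<le> B" by (metis rho_le)
  obtain B' where B': "0 \<le> B'" "\<And>x. \<bar>\<rho>' x\<bar> \<le> B'" by (metis rho_bounds)
  define I' where "I' = (LINT x|lborel. \<bar>\<rho>' x\<bar>)"
  define M1 where "M1 = B * C + \<bar>k\<bar>"
  define M2 where "M2 = L * (B' * C + \<bar>k\<bar> * I') + B * (2 * C * kmass K)"
  have "integrable lborel (EH k y a) \<and> (LINT x|lborel. \<bar>EH k y a x\<bar>) \<le> max M1 M2
     \<and> integrable lborel (AH k y a) \<and> (LINT x|lborel. \<bar>AH k y a x\<bar>) \<le> max M1 M2" if a: "bvc C a" for a y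
  proof -
    note A = bvcD[OF a]
    note Ga = G_integrable[OF a K]
    note [measurable] = A(6) Ga[THEN integrable_lborel_measurable]
    have ri: "integrable lborel (\<lambda>x. \<rho> (x - y))" "integrable lborel (\<lambda>x. \<bar>\<rho>' (x - y)\<bar>)"
      using integrable_shift[OF rho_integrable, of "-y"] integrable_shift[OF rho'_integrable, of "-y"] by simp_all
    have rI: "(LINT x|lborel. \<rho> (x - y)) = 1" "(LINT x|lborel. \<bar>\<rho>' (x - y)\<bar>) = I'"
      using integral_shift[of \<rho> "-y"] integral_shift[of "\<lambda>x. \<bar>\<rho>' x\<bar>" "-y"] rho_int by (simp_all add: I'_def)
    have d1: "integrable lborel (\<lambda>x. B * \<bar>a x\<bar> + \<bar>k\<bar> * \<rho> (x - y))" using A(1) ri by simp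
    have e1: "\<bar>EH k y a x\<bar> \<le> B * \<bar>a x\<bar> + \<bar>k\<bar> * \<rho> (x - y)" for x
    proof -
      have "\<bar>EH k y a x\<bar> \<le> (\<bar>a x\<bar> + \<bar>k\<bar>) * \<rho> (x - y)" unfolding EH_def using rho_nonneg by (auto simp: abs_mult intro!: mult_right_mono)
      also have "\<dots> = \<bar>a x\<bar> * \<rho> (x - y) + \<bar>k\<bar> * \<rho> (x - y)" by (simp add: distrib_right)
      also have "\<bar>a x\<bar> * \<rho> (x - y) \<le> \<bar>a x\<bar> * B" using B by (intro mult_left_mono) auto
      finally show ?thesis by (simp add: mult.commute)
    qed
    have i1: "integrable lborel (EH k y a)"
    proof (rule Bochner_Integration.integrable_bound[OF d1])
      show "EH k y a \<in> borel_measurable lborel" unfolding EH_def[abs_def] by measurable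
      show "AE x in lborel. norm (EH k y a x) \<le> norm (B * \<bar>a x\<bar> + \<bar>k\<bar> * \<rho> (x - y))"
        using e1 by (intro AE_I2) (simp add: order_trans[OF _ abs_ge_self])
    qed
    have "(LINT x|lborel. \<bar>EH k y a x\<bar>) \<le> (LINT x|lborel. B * \<bar>a x\<bar> + \<bar>k\<bar> * \<rho> (x - y))"
      by (intro integral_mono integrable_abs i1 d1 e1)
    also have "\<dots> = B * (LINT x|lborel. \<bar>a x\<bar>) + \<bar>k\<bar>" using A(1) ri rI by simp
    also have "\<dots> \<le> M1" unfolding M1_def using A(2) B by (intro add_right_mono mult_left_mono)
    finally have b1: "(LINT x|lborel. \<bar>EH k y a x\<bar>) \<le> M1" .
    have d2: "integrable lborel (\<lambda>x. L * (B' * \<bar>a x\<bar> + \<bar>k\<bar> * \<bar>\<rho>' (x - y)\<bar>) + B * \<bar>G K a x\<bar>)" using A(1) ri Ga by simp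
    have e2: "\<bar>AH k y a x\<bar> \<le> L * (B' * \<bar>a x\<bar> + \<bar>k\<bar> * \<bar>\<rho>' (x - y)\<bar>) + B * \<bar>G K a x\<bar>" for x
    proof -
      have "\<bar>kruzkov_flux (a x) k * \<rho>' (x - y)\<bar> \<le> L * (\<bar>a x\<bar> + \<bar>k\<bar>) * \<bar>\<rho>' (x - y)\<bar>"
        using kruzkov_flux_bound by (auto simp: abs_mult intro!: mult_right_mono)
      also have "\<dots> = L * (\<bar>a x\<bar> * \<bar>\<rho>' (x - y)\<bar> + \<bar>k\<bar> * \<bar>\<rho>' (x - y)\<bar>)" by (simp add: algebra_simps)
      also have "\<dots> \<le> L * (\<bar>a x\<bar> * B' + \<bar>k\<bar> * \<bar>\<rho>' (x - y)\<bar>)" using B' L_nonneg by (intro mult_left_mono add_right_mono) auto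
      finally have 1: "\<bar>kruzkov_flux (a x) k * \<rho>' (x - y)\<bar> \<le> L * (B' * \<bar>a x\<bar> + \<bar>k\<bar> * \<bar>\<rho>' (x - y)\<bar>)" by (simp add: mult.commute)
      have "\<bar>sgn (a x - k) * G K a x * \<rho> (x - y)\<bar> \<le> \<bar>G K a x\<bar> * \<rho> (x - y)"
        using rho_nonneg by (auto simp: abs_mult sgn_if)
      also have "\<dots> \<le> \<bar>G K a x\<bar> * B" using B by (intro mult_left_mono) auto
      also have "\<dots> = B * \<bar>G K a x\<bar>" by (rule mult.commute)
      finally show ?thesis using 1 unfolding AH_def by linarith
    qed
    have i2: "integrable lborel (AH k y a)"
    proof (rule Bochner_Integration.integrable_bound[OF d2])
      show "AH k y a \<in> borel_measurable lborel" unfolding AH_def[abs_def] by measurable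
      show "AE x in lborel. norm (AH k y a x) \<le> norm (L * (B' * \<bar>a x\<bar> + \<bar>k\<bar> * \<bar>\<rho>' (x - y)\<bar>) + B * \<bar>G K a x\<bar>)"
        using e2 by (intro AE_I2) (simp add: order_trans[OF _ abs_ge_self])
    qed
    have "(LINT x|lborel. \<bar>AH k y a x\<bar>) \<le> (LINT x|lborel. L * (B' * \<bar>a x\<bar> + \<bar>k\<bar> * \<bar>\<rho>' (x - y)\<bar>) + B * \<bar>G K a x\<bar>)"
      by (intro integral_mono integrable_abs i2 d2 e2)
    also have "\<dots> = L * (B' * (LINT x|lborel. \<bar>a x\<bar>) + \<bar>k\<bar> * I') + B * (LINT x|lborel. \<bar>G K a x\<bar>)" using A(1) ri rI Ga by simp
    also have "\<dots> \<le> M2" unfolding M2_def using A(2) B(1) B'(1) G_bound[OF a K] L_nonneg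
      by (intro add_mono mult_left_mono) auto
    finally have b2: "(LINT x|lborel. \<bar>AH k y a x\<bar>) \<le> M2" .
    show ?thesis using i1 b1 i2 b2 by auto
  qed
  then show ?thesis using that by blast
qed

lemma EH_continuous:
  assumes v: "L1_curve C v"
  shows "continuous_on S (\<lambda>t. LINT x|lborel. EH k y (v t) x)"
proof (rule continuous_at_imp_continuous_on, intro ballI)
  fix t
  note N = niceD[OF v]
  obtain B where B: "0 \<le> B" "\<And>x. \<rho> x \<le> B" by (metis rho_le)
  obtain M where M: "\<And>t. integrable lborel (EH k y (v t))" using EH_AH[of C k] N(2) by metis
  show "isCont (\<lambda>t. LINT x|lborel. EH k y (v t) x) t" unfolding isCont_def
  proof (rule LIM_zero_cancel, rule Lim_null_comparison)
    show "\<forall>\<^sub>F s in at t. norm ((LINT x|lborel. EH k y (v s) x) - (LINT x|lborel. EH k y (v t) x)) \<le> B * (LINT x|lborel. \<bar>v s x - v t x\<bar>)"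
    proof (intro always_eventually allI)
      fix s
      have vi: "integrable lborel (\<lambda>x. \<bar>v s x - v t x\<bar>)" using N(3) by simp
      have "(LINT x|lborel. EH k y (v s) x) - (LINT x|lborel. EH k y (v t) x) = (LINT x|lborel. EH k y (v s) x - EH k y (v t) x)"
        by (intro Bochner_Integration.integral_diff[symmetric] M)
      also have "\<bar>\<dots>\<bar> \<le> (LINT x|lborel. B * \<bar>v s x - v t x\<bar>)"
      proof (intro order_trans[OF integral_abs_bound] integral_mono integrable_abs Bochner_Integration.integrable_diff M integrable_mult_right vi)
        fix x
        have "EH k y (v s) x - EH k y (v t) x = (\<bar>v s x - k\<bar> - \<bar>v t x - k\<bar>) * \<rho> (x - y)" by (simp add: EH_def left_diff_distrib)
        also have "\<bar>\<dots>\<bar> = \<bar>\<bar>v s x - k\<bar> - \<bar>v t x - k\<bar>\<bar> * \<rho> (x - y)" using rho_nonneg by (simp add: abs_mult)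
        also have "\<dots> \<le> \<bar>v s x - v t x\<bar> * B" using B rho_nonneg by (intro mult_mono) auto
        finally show "\<bar>EH k y (v s) x - EH k y (v t) x\<bar> \<le> B * \<bar>v s x - v t x\<bar>" by (simp add: mult.commute)
      qed (use N(3) in auto)
      finally show "norm ((LINT x|lborel. EH k y (v s) x) - (LINT x|lborel. EH k y (v t) x)) \<le> B * (LINT x|lborel. \<bar>v s x - v t x\<bar>)" by simp
    qed
    show "((\<lambda>s. B * (LINT x|lborel. \<bar>v s x - v t x\<bar>)) \<longlongrightarrow> 0) (at t)" using tendsto_mult_right_zero[OF N(4)] .
  qed
qed

lemma measurable_EH_AH:
  fixes v :: "real \<Rightarrow> real \<Rightarrow> real"
  assumes v: "(\<lambda>q. v (fst q) (snd q)) \<in> borel_measurable borel"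
    and w [measurable]: "w \<in> borel_measurable borel"
  shows "(\<lambda>q. EH k y (v (fst q)) (snd q)) \<in> borel_measurable borel"
    and "(\<lambda>q. AH k y (v (fst q)) (snd q)) \<in> borel_measurable borel"
    and "(\<lambda>r. AH (w (snd (snd r))) (snd (snd r)) (v (fst r)) (fst (snd r))) \<in> borel_measurable (borel :: (real \<times> (real \<times> real)) measure)"
proof -
  note [measurable] = v
  have "(\<lambda>r. v (fst (fst r)) (snd r)) \<in> borel_measurable (borel :: ((real\<times>real)\<times>real) measure)"
    by (rule measurable_param_compose[OF v]; measurable)
  then have [measurable]: "(\<lambda>q. G K (v (fst q)) (snd q)) \<in> borel_measurable (borel :: (real\<times>real) measure)"
    by (rule measurable_G[OF _ kernD(2)[OF K]]; measurable)
  show "(\<lambda>q. EH k y (v (fst q)) (snd q)) \<in> borel_measurable borel" unfolding EH_def by measurable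
  show "(\<lambda>q. AH k y (v (fst q)) (snd q)) \<in> borel_measurable borel" unfolding AH_def by measurable
  have "(\<lambda>r. v (fst (fst r)) (snd r)) \<in> borel_measurable (borel :: ((real\<times>(real\<times>real))\<times>real) measure)"
    by (rule measurable_param_compose[OF v]; measurable)
  then have [measurable]: "(\<lambda>r. G K (v (fst r)) (fst (snd r))) \<in> borel_measurable (borel :: (real\<times>(real\<times>real)) measure)"
    by (rule measurable_G[OF _ kernD(2)[OF K]]; measurable)
  have [measurable]: "(\<lambda>r. v (fst r) (fst (snd r))) \<in> borel_measurable (borel :: (real\<times>(real\<times>real)) measure)"
    by (rule measurable_param_compose[OF v]; measurable)
  show "(\<lambda>r. AH (w (snd (snd r))) (snd (snd r)) (v (fst r)) (fst (snd r))) \<in> borel_measurable (borel :: (real \<times> (real \<times> real)) measure)"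
    unfolding AH_def by measurable
qed

text \<open>
  The choice \<open>k = w y\<close>, which makes the constant of the entropy inequality depend on the second
  variable, turns the inequalities at fixed \<open>y\<close> into one for the doubled functional.
\<close>

lemma integrate_inequality:
  assumes v: "L1_curve C v" and g: "integrable lborel g" and w: "bvc C w"
    and y: "\<And>y. (LINT x|lborel. EH (w y) y (v b) x) - (LINT x|lborel. EH (w y) y g x) \<le> (LINT t:{a..b}|lborel. LINT x|lborel. AH (w y) y (v t) x)"
  shows "doubled_dist (v b) w - doubled_dist g w \<le> (LINT t:{a..b}|lborel. doubled_flux (v t) w)"
proof -
  note N = niceD[OF v] and W = bvcD[OF w]
  note mz = measurable_EH_AH[OF N(1) W(6)]
  note P1 = doubled_dist_integrable[OF N(3) W(1)] and P2 = doubled_dist_integrable[OF g W(1)]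
  let ?Z = "\<lambda>t q. AH (w (snd q)) (snd q) (v t) (fst q)"
  have Zi: "integrable lborel (?Z t)" for t unfolding AH_def using doubled_flux_int1[OF N(2) w] doubled_flux_int2[OF N(2) w] by simp
  have ZAS: "(LINT q|lborel. ?Z t q) = doubled_flux (v t) w" for t by (simp add: AH_def doubled_flux_def)
  \<comment> \<open>The constants of \<open>EH_AH\<close> grow with the level, here
    \<open>w y\<close>, so they do not integrate over \<open>y\<close>. A bound on the plane that is
    uniform in time is derived from the convolution estimate instead.\<close>
  obtain M where M: "(LINT q|lborel. \<bar>?Z t q\<bar>) \<le> M" for t
  proof -
    have "(LINT q|lborel. \<bar>?Z t q\<bar>) \<le> ((LINT x|lborel. L * \<bar>v t x\<bar>) + (LINT x|lborel. L * \<bar>w x\<bar>)) * (LINT x|lborel. \<bar>\<rho>' x\<bar>)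
      + ((LINT x|lborel. \<bar>G K (v t) x\<bar>) + (LINT x::real|lborel. 0)) * (LINT x|lborel. \<bar>\<rho> x\<bar>)" for t
    proof -
      note A = bvcD[OF N(2)[of t]]
      note Ga = G_integrable[OF N(2)[of t] K]
      note [measurable] = A(6) W(6) Ga[THEN integrable_lborel_measurable]
      have i: "integrable lborel (\<lambda>x. L * \<bar>v t x\<bar>)" "integrable lborel (\<lambda>x. L * \<bar>w x\<bar>)" using A(1) W(1) by auto
      have le: "\<bar>kruzkov_flux (v t (fst q)) (w (snd q)) * \<rho>' (fst q - snd q)\<bar> \<le> (L * \<bar>v t (fst q)\<bar> + L * \<bar>w (snd q)\<bar>) * \<bar>\<rho>' (fst q - snd q)\<bar>" for q
        using kruzkov_flux_bound[of "v t (fst q)" "w (snd q)"] by (auto simp: abs_mult distrib_left intro!: mult_right_mono)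
      have le2: "\<bar>sgn (v t (fst q) - w (snd q)) * G K (v t) (fst q) * \<rho> (fst q - snd q)\<bar> \<le> (\<bar>G K (v t) (fst q)\<bar> + 0) * \<bar>\<rho> (fst q - snd q)\<bar>" for q
        by (auto simp: abs_mult sgn_if)
      have "(LINT q|lborel. \<bar>?Z t q\<bar>) \<le> (LINT q|lborel. \<bar>kruzkov_flux (v t (fst q)) (w (snd q)) * \<rho>' (fst q - snd q)\<bar> + \<bar>sgn (v t (fst q) - w (snd q)) * G K (v t) (fst q) * \<rho> (fst q - snd q)\<bar>)"
        using Zi[of t] doubled_flux_int1[OF N(2)[of t] w] doubled_flux_int2[OF N(2)[of t] w]
        by (intro integral_mono integrable_abs Bochner_Integration.integrable_add) (auto simp: AH_def)
      also have "\<dots> = (LINT q|lborel. \<bar>kruzkov_flux (v t (fst q)) (w (snd q)) * \<rho>' (fst q - snd q)\<bar>) + (LINT q|lborel. \<bar>sgn (v t (fst q) - w (snd q)) * G K (v t) (fst q) * \<rho> (fst q - snd q)\<bar>)"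
        by (intro Bochner_Integration.integral_add integrable_abs doubled_flux_int1[OF N(2)[of t] w] doubled_flux_int2[OF N(2)[of t] w])
      also have "\<dots> \<le> ((LINT x|lborel. L * \<bar>v t x\<bar>) + (LINT x|lborel. L * \<bar>w x\<bar>)) * (LINT x|lborel. \<bar>\<rho>' x\<bar>)
        + ((LINT x|lborel. \<bar>G K (v t) x\<bar>) + (LINT x::real|lborel. 0)) * (LINT x|lborel. \<bar>\<rho> x\<bar>)"
        by (intro add_mono pair_dominated(3)[OF _ i rho'_integrable le] pair_dominated(3)[OF _ integrable_abs[OF Ga] integrable_zero rho_integrable le2]; measurable)
      finally show ?thesis .
    qed
    moreover have "((LINT x|lborel. L * \<bar>v t x\<bar>) + (LINT x|lborel. L * \<bar>w x\<bar>)) * (LINT x|lborel. \<bar>\<rho>' x\<bar>)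
      + ((LINT x|lborel. \<bar>G K (v t) x\<bar>) + (LINT x::real|lborel. 0)) * (LINT x|lborel. \<bar>\<rho> x\<bar>) \<le>
      (L * C + L * C) * (LINT x|lborel. \<bar>\<rho>' x\<bar>) + (2 * C * kmass K + 0) * 1" for t
      using bvcD(2)[OF N(2)[of t]] W(2) G_bound[OF N(2)[of t] K] L_nonneg
      by (intro add_mono mult_mono mult_right_mono) (auto simp: rho_abs_int intro!: mult_left_mono mult_nonneg_nonneg bvcD(4)[OF w] kernD(4)[OF K])
    ultimately show ?thesis using that order_trans by blast
  qed
  have S: "integrable lborel (\<lambda>r. indicator {a..b} (fst r) * ?Z (fst r) (snd r))"
    by (rule strip_integral[OF mz(3) Zi M])
  have Wi: "integrable lborel (\<lambda>q. LINT t|lborel. indicator {a..b} t * ?Z t q)"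
    using lborel_integrable_snd[OF S] by simp
  \<comment> \<open>For a single \<open>y\<close> the level is a number and \<open>EH_AH\<close>
    applies; its constant may depend on \<open>y\<close> since Fubini is used for each
    \<open>y\<close> separately.\<close>
  have eq: "(LINT x|lborel. LINT t|lborel. indicator {a..b} t * ?Z t (x, y)) = (LINT t:{a..b}|lborel. LINT x|lborel. AH (w y) y (v t) x)" for y
  proof -
    obtain M' where M': "\<And>t. integrable lborel (AH (w y) y (v t)) \<and> (LINT x|lborel. \<bar>AH (w y) y (v t) x\<bar>) \<le> M'"
      using EH_AH[of C "w y"] N(2) by metis
    have "integrable lborel (\<lambda>q. indicator {a..b} (fst q) * AH (w y) y (v (fst q)) (snd q))"
      by (rule strip_integral[OF mz(2)]) (use M' in auto)
    from lborel_fubini_swap[OF this] show ?thesis by (simp add: set_lebesgue_integral_def)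
  qed
  have "doubled_dist (v b) w - doubled_dist g w = (LINT y|lborel. LINT x|lborel. EH (w y) y (v b) x) - (LINT y|lborel. LINT x|lborel. EH (w y) y g x)"
    unfolding doubled_dist_def EH_def using lborel_fubini_snd[OF P1] lborel_fubini_snd[OF P2] by simp
  also have "\<dots> = (LINT y|lborel. (LINT x|lborel. EH (w y) y (v b) x) - (LINT x|lborel. EH (w y) y g x))"
    using lborel_integrable_snd[OF P1] lborel_integrable_snd[OF P2]
    by (intro Bochner_Integration.integral_diff[symmetric]) (simp_all add: EH_def)
  also have "\<dots> \<le> (LINT y|lborel. LINT x|lborel. LINT t|lborel. indicator {a..b} t * ?Z t (x, y))"
  proof (rule integral_mono)
    show "integrable lborel (\<lambda>y. (LINT x|lborel. EH (w y) y (v b) x) - (LINT x|lborel. EH (w y) y g x))"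
      using lborel_integrable_snd[OF P1] lborel_integrable_snd[OF P2] by (simp add: EH_def)
    show "integrable lborel (\<lambda>y. LINT x|lborel. LINT t|lborel. indicator {a..b} t * ?Z t (x, y))"
      by (rule lborel_integrable_snd[OF Wi])
  qed (use y eq in simp)
  also have "\<dots> = (LINT q|lborel. LINT t|lborel. indicator {a..b} t * ?Z t q)"
    by (rule lborel_fubini_snd[OF Wi])
  also have "\<dots> = (LINT t|lborel. LINT q|lborel. indicator {a..b} t * ?Z t q)"
    using lborel_fubini_swap[OF S] by simp
  also have "\<dots> = (LINT t:{a..b}|lborel. doubled_flux (v t) w)"
    by (simp add: set_lebesgue_integral_def ZAS)
  finally show ?thesis .
qed

end

locale flux_mollifier = flux_moll p m L "mollifier R" "deriv (mollifier R)" R "J lam" for p m L R lam +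
  fixes f :: "real \<Rightarrow> real"
  assumes pm: "\<And>u. p u - m u = f u - f 0" and Rpos: "0 < R"
begin

lemma flux_kruzkov_flux: "entropy_flux f k u = kruzkov_flux u k"
  unfolding kruzkov_flux_def by (rule entropy_flux_split[OF pm])

text \<open>The entropy inequality is tested with \<open>mollifier R (x - y) * \<theta> t\<close> at
  a fixed level. \<open>weak_inequality\<close> removes \<open>\<theta>\<close>, and integrating
  over \<open>y\<close> with level \<open>w y\<close> produces the doubled functional. Starting from
  time 0 the datum \<open>u0\<close> appears, not the trace of the solution.\<close>

lemma exact_step:
  assumes T: "0 < T" and sol: "BV_entropy_solution lam T f u0 u" and v: "L1_curve C (slices T u)"
    and u0: "bvc C u0" and w: "bvc C w" and b: "0 < b" "b < T"
  shows "doubled_dist (slices T u b) w - doubled_dist u0 w \<le> (LINT t:{0..b}|lborel. doubled_flux (slices T u t) w)"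
    and "0 < a \<Longrightarrow> a < b \<Longrightarrow> doubled_dist (slices T u b) w - doubled_dist (slices T u a) w \<le> (LINT t:{a..b}|lborel. doubled_flux (slices T u t) w)"
proof -
  define v where "v = slices T u"
  have v: "L1_curve C v" using v by (simp add: v_def)
  note N = niceD[OF v] and W = bvcD[OF w]
  have vu: "v t x = u (x, t)" if "t \<in> {0..T}" for t x using that by (simp add: v_def slices_def clamp_def)
  have ent: "\<And>k \<phi>. \<phi> \<in> test_functions \<Longrightarrow> (\<forall>x. \<forall>t\<in>{0..T}. \<phi> (x, t) \<ge> 0) \<Longrightarrow>
      (LINT (x, t):Q T|lborel.
            \<eta> k (u (x, t)) * dt \<phi> (x, t) + entropy_flux f k (u (x, t)) * dx \<phi> (x, t)
            + \<eta>' k (u (x, t)) * frac_laplace lam (\<lambda>y. u (y, t)) x * \<phi> (x, t))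
        + (LINT x|lborel. \<eta> k (u0 x) * \<phi> (x, 0))
        - (LINT x|lborel. \<eta> k (u (x, T)) * \<phi> (x, T)) \<ge> 0"
    using sol unfolding BV_entropy_solution_def by blast
  have weak: "0 \<le> (LINT t|lborel. indicator {0..T} t * ((LINT x|lborel. EH k y (v t) x) * deriv \<theta> t + (LINT x|lborel. AH k y (v t) x) * \<theta> t))
     + (LINT x|lborel. EH k y u0 x) * \<theta> 0 - (LINT x|lborel. EH k y (v T) x) * \<theta> T"
    and Aint: "integrable lborel (\<lambda>t. indicator {0..T} t * (LINT x|lborel. AH k y (v t) x))"
    if th: "smooth \<theta>" "\<And>t. \<bar>t\<bar> > S \<Longrightarrow> \<theta> t = 0" "\<And>t. 0 \<le> \<theta> t" for \<theta> S k y
  proof -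
    obtain M where M: "\<And>a y. bvc C a \<Longrightarrow> integrable lborel (EH k y a) \<and> (LINT x|lborel. \<bar>EH k y a x\<bar>) \<le> M
     \<and> integrable lborel (AH k y a) \<and> (LINT x|lborel. \<bar>AH k y a x\<bar>) \<le> M" by (metis EH_AH)
    note mz = measurable_EH_AH[OF N(1) W(6)]
    show Aint: "integrable lborel (\<lambda>t. indicator {0..T} t * (LINT x|lborel. AH k y (v t) x))"
      by (rule strip_integral_Q(3)[OF mz(2)]) (use M N(2) in auto)
    define a where "a x = mollifier R (x - y)" for x
    have sa: "smooth a"
    proof -
      have "Cn n (\<lambda>x. mollifier R (1 * x + (- y)))" for n using smooth_mollifier[of R] unfolding smooth_def by (intro Cn_affine) auto
      then show ?thesis by (simp add: smooth_def a_def[abs_def])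
    qed
    have da: "deriv a x = deriv (mollifier R) (x - y)" for x
    proof -
      have "((\<lambda>x. mollifier R (x - y)) has_real_derivative deriv (mollifier R) (x - y) * 1) (at x)"
        by (rule DERIV_chain2[OF rho_deriv]) (auto intro!: derivative_eq_intros)
      then show ?thesis unfolding a_def[abs_def] by (intro DERIV_imp_deriv) simp
    qed
    define S' where "S' = max S (R + \<bar>y\<bar>)"
    have s1: "a x = 0" if "\<bar>x\<bar> > S'" for x unfolding a_def using that by (intro rho_supp) (auto simp: S'_def)
    have s2: "\<theta> t = 0" if "\<bar>t\<bar> > S'" for t using that th(2) by (auto simp: S'_def)
    have tf: "(\<lambda>(x, t). a x * \<theta> t) \<in> test_functions" "\<And>x t. dx (\<lambda>(x, t). a x * \<theta> t) (x, t) = deriv a x * \<theta> t"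
      "\<And>x t. dt (\<lambda>(x, t). a x * \<theta> t) (x, t) = a x * deriv \<theta> t"
      by (rule product_test_function[where R=S']; use sa s1 th(1) s2 in blast)+
    let ?H = "\<lambda>t x. EH k y (v t) x * deriv \<theta> t + AH k y (v t) x * \<theta> t"
    note sd = smooth_deriv[OF th(1)] and sd2 = smooth_deriv[OF smooth_deriv(2)[OF th(1)]]
    have [measurable]: "\<theta> \<in> borel_measurable borel" "deriv \<theta> \<in> borel_measurable borel"
      using sd(3) sd2(3) by (auto intro: borel_measurable_continuous_onI)
    obtain B where B: "0 \<le> B" "\<And>x. \<bar>deriv \<theta> x\<bar> \<le> B"
      using C1_compact_bounds[OF sd(1) sd2(3), of S] th(2) by (metis real_norm_def)
    obtain B2 where B2: "0 \<le> B2" "\<And>t. t \<in> {0..T} \<Longrightarrow> \<bar>\<theta> t\<bar> \<le> B2"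
    proof -
      have "bounded (\<theta> ` {0..T})" by (intro compact_imp_bounded compact_continuous_image continuous_on_subset[OF sd(3)]) auto
      then show ?thesis using that unfolding bounded_pos by (metis imageI less_imp_le real_norm_def)
    qed
    have Hm: "(\<lambda>q. ?H (fst q) (snd q)) \<in> borel_measurable borel" using mz(1,2) by measurable
    have Hi: "integrable lborel (?H t)" for t using M[OF N(2)] by simp
    have HM: "(LINT x|lborel. \<bar>?H t x\<bar>) \<le> M * B + M * B2" if t: "t \<in> {0..T}" for t
    proof -
      have e: "integrable lborel (EH k y (v t))" "integrable lborel (AH k y (v t))" using M[OF N(2)] by auto
      have "(LINT x|lborel. \<bar>?H t x\<bar>) \<le> (LINT x|lborel. \<bar>EH k y (v t) x\<bar> * B + \<bar>AH k y (v t) x\<bar> * B2)"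
      proof (intro integral_mono integrable_abs Hi Bochner_Integration.integrable_add integrable_mult_left e)
        fix x
        have "\<bar>?H t x\<bar> \<le> \<bar>EH k y (v t) x\<bar> * \<bar>deriv \<theta> t\<bar> + \<bar>AH k y (v t) x\<bar> * \<bar>\<theta> t\<bar>"
          by (metis abs_mult abs_triangle_ineq)
        also have "\<dots> \<le> \<bar>EH k y (v t) x\<bar> * B + \<bar>AH k y (v t) x\<bar> * B2"
          using B B2(2)[OF t] by (intro add_mono mult_left_mono) auto
        finally show "\<bar>?H t x\<bar> \<le> \<bar>EH k y (v t) x\<bar> * B + \<bar>AH k y (v t) x\<bar> * B2" .
      qed
      also have "\<dots> = (LINT x|lborel. \<bar>EH k y (v t) x\<bar>) * B + (LINT x|lborel. \<bar>AH k y (v t) x\<bar>) * B2" using e by simp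
      also have "\<dots> \<le> M * B + M * B2" using M[OF N(2)] B B2 by (intro add_mono mult_right_mono) auto
      finally show ?thesis .
    qed
    have "0 \<le> (LINT (x, t):Q T|lborel.
            \<eta> k (u (x, t)) * dt (\<lambda>(x, t). a x * \<theta> t) (x, t) + entropy_flux f k (u (x, t)) * dx (\<lambda>(x, t). a x * \<theta> t) (x, t)
            + \<eta>' k (u (x, t)) * frac_laplace lam (\<lambda>y. u (y, t)) x * (\<lambda>(x, t). a x * \<theta> t) (x, t))
        + (LINT x|lborel. \<eta> k (u0 x) * (\<lambda>(x, t). a x * \<theta> t) (x, 0))
        - (LINT x|lborel. \<eta> k (u (x, T)) * (\<lambda>(x, t). a x * \<theta> t) (x, T))"
      by (rule ent[OF tf(1)]) (use th(3) rho_nonneg in \<open>auto simp: a_def\<close>)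
    also have "(LINT x|lborel. \<eta> k (u0 x) * (\<lambda>(x, t). a x * \<theta> t) (x, 0)) = (LINT x|lborel. EH k y u0 x) * \<theta> 0"
      by (simp add: \<eta>_def EH_def a_def mult.assoc[symmetric])
    also have "(LINT x|lborel. \<eta> k (u (x, T)) * (\<lambda>(x, t). a x * \<theta> t) (x, T)) = (LINT x|lborel. EH k y (v T) x) * \<theta> T"
      using T by (simp add: \<eta>_def EH_def a_def mult.assoc[symmetric] vu)
    also have "(LINT (x, t):Q T|lborel.
            \<eta> k (u (x, t)) * dt (\<lambda>(x, t). a x * \<theta> t) (x, t) + entropy_flux f k (u (x, t)) * dx (\<lambda>(x, t). a x * \<theta> t) (x, t)
            + \<eta>' k (u (x, t)) * frac_laplace lam (\<lambda>y. u (y, t)) x * (\<lambda>(x, t). a x * \<theta> t) (x, t))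
       = (LINT q:Q T|lborel. ?H (snd q) (fst q))"
      unfolding set_lebesgue_integral_def
    proof (rule Bochner_Integration.integral_cong[OF refl], clarify)
      fix x t
      show "indicator (Q T) (x, t) *\<^sub>R (\<eta> k (u (x, t)) * dt (\<lambda>(x, t). a x * \<theta> t) (x, t) + entropy_flux f k (u (x, t)) * dx (\<lambda>(x, t). a x * \<theta> t) (x, t)
            + \<eta>' k (u (x, t)) * frac_laplace lam (\<lambda>y. u (y, t)) x * (a x * \<theta> t)) =
         indicator (Q T) (x, t) *\<^sub>R (?H (snd (x, t)) (fst (x, t)))"
      proof (cases "(x, t) \<in> Q T")
        case True
        then have t: "t \<in> {0..T}" by (auto simp: Q_def)
        have "v t = (\<lambda>y. u (y, t))" using vu[OF t] by auto
        then show ?thesis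
          by (simp only: prod.case fst_conv snd_conv tf) (simp add: flux_kruzkov_flux frac_laplace_eq_G EH_def AH_def \<eta>_def \<eta>'_def da a_def algebra_simps)
      qed simp
    qed
    also have "\<dots> = (LINT t|lborel. indicator {0..T} t * (LINT x|lborel. ?H t x))"
      by (rule strip_integral_Q(2)[OF Hm Hi HM])
    also have "\<dots> = (LINT t|lborel. indicator {0..T} t * ((LINT x|lborel. EH k y (v t) x) * deriv \<theta> t + (LINT x|lborel. AH k y (v t) x) * \<theta> t))"
      using M[OF N(2)] by simp
    finally show "0 \<le> (LINT t|lborel. indicator {0..T} t * ((LINT x|lborel. EH k y (v t) x) * deriv \<theta> t + (LINT x|lborel. AH k y (v t) x) * \<theta> t))
     + (LINT x|lborel. EH k y u0 x) * \<theta> 0 - (LINT x|lborel. EH k y (v T) x) * \<theta> T" .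
  qed
  \<comment> \<open>The integrability of the rate was proved in a block that assumes an arbitrary
    test function in time; the zero function discharges these assumptions.\<close>
  have sz: "smooth (\<lambda>t. 0)" by (simp add: smooth_def Cn_const)
  have Aint': "integrable lborel (\<lambda>t. indicator {0..T} t * (LINT x|lborel. AH k y (v t) x))" for k y
    by (rule Aint[OF sz]) auto
  show "doubled_dist (slices T u b) w - doubled_dist u0 w \<le> (LINT t:{0..b}|lborel. doubled_flux (slices T u t) w)"
    unfolding v_def[symmetric]
    by (rule integrate_inequality[OF v bvcD(1)[OF u0] w], rule weak_inequality_initial[OF EH_continuous[OF v] Aint' weak b])
  show "doubled_dist (slices T u b) w - doubled_dist (slices T u a) w \<le> (LINT t:{a..b}|lborel. doubled_flux (slices T u t) w)" if a: "0 < a" "a < b"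
    unfolding v_def[symmetric]
    by (rule integrate_inequality[OF v N(3) w], rule weak_inequality_interior[OF EH_continuous[OF v] Aint' weak b a])
qed

end

context flux_moll
begin

lemma doubled_dist_isCont:
  assumes v: "L1_curve C v" and w: "integrable lborel w"
  shows "isCont (\<lambda>t. doubled_dist (v t) w) t"
  unfolding isCont_def
proof (rule LIM_zero_cancel, rule Lim_null_comparison)
  note N = niceD[OF v]
  show "\<forall>\<^sub>F s in at t. norm (doubled_dist (v s) w - doubled_dist (v t) w) \<le> (LINT x|lborel. \<bar>v s x - v t x\<bar>)"
    using doubled_dist_lipschitz[OF N(3) w N(3) w] by simp
  show "((\<lambda>s. LINT x|lborel. \<bar>v s x - v t x\<bar>) \<longlongrightarrow> 0) (at t)" by (rule N(4))
qed

lemma doubled_flux_time: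
  assumes v: "L1_curve C v" and w: "bvc C w"
  shows "(\<lambda>t. doubled_flux (v t) w) \<in> borel_measurable borel" "integrable lborel (\<lambda>t. indicator {a..b} t * doubled_flux (v t) w)"
proof -
  note N = niceD[OF v] and W = bvcD[OF w]
  have "(\<lambda>q. (\<lambda>_. w) (fst q) (snd q)) \<in> borel_measurable (borel :: (real\<times>real) measure)" using W(6) by measurable
  from measurable_compose[OF _ measurable_doubled_flux[OF N(1) this], of "\<lambda>t. (t, 0)" borel]
  show m: "(\<lambda>t. doubled_flux (v t) w) \<in> borel_measurable borel" by simp
  show "integrable lborel (\<lambda>t. indicator {a..b} t * doubled_flux (v t) w)"
    by (rule integrable_bounded_mult(1)[OF _ m doubled_flux_bound[OF N(2) w]]) (use integrable_indicator_Icc[of a b 1] in simp)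
qed

end

context flux_mollifier
begin

text \<open>The first claim extends the interior inequality to closed intervals by continuity in
  \<open>L1\<close>. For the second, no initial trace is part of the notion of solution, so it is
  extracted from the inequality: with \<open>w = u0\<close> and the upper time tending to 0, the
  doubled distance of the trace to \<open>u0\<close> is at most that of \<open>u0\<close> to itself,
  hence at most \<open>2 * C * R\<close>, and removing the mollification costs as much
  again.\<close>

lemma exact_approx_sol:
  assumes T: "0 < T" and sol: "BV_entropy_solution lam T f u0 u" and v: "L1_curve C (slices T u)"
    and u0: "bvc C u0"
  shows "approx_sol C T (slices T u) 0" and "(LINT x|lborel. \<bar>slices T u 0 x - u0 x\<bar>) \<le> 4 * C * R"
proof -
  note N = niceD[OF v]
  note step = exact_step[OF T sol v u0]
  define MA where "MA = 2 * L * C * (LINT x|lborel. \<bar>deriv (mollifier R) x\<bar>) + 2 * C * kmass (J lam)"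
  have MA: "\<bar>doubled_flux (slices T u t) w\<bar> \<le> MA" if "bvc C w" for t w unfolding MA_def by (rule doubled_flux_bound[OF N(2) that])
  show "approx_sol C T (slices T u) 0" unfolding approx_sol_def
  proof (intro allI impI)
    fix w a b assume w: "bvc C w" and ab: "0 \<le> a" "a \<le> b" "b \<le> T"
    note W = bvcD[OF w]
    have "doubled_dist (slices T u b) w - doubled_dist (slices T u a) w \<le> (LINT t:{a..b}|lborel. doubled_flux (slices T u t) w)"
    proof (cases "a = b")
      case True
      have "(LINT t:{a..b}|lborel. doubled_flux (slices T u t) w) = 0"
        unfolding set_lebesgue_integral_def
        by (intro integral_eq_zero_AE) (use AE_lborel_singleton[of a] True in \<open>auto elim!: eventually_mono\<close>)
      then show ?thesis using True by simp
    next
      case False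
      then have ab': "a < b" using ab by simp
      \<comment> \<open>The offset 3 keeps \<open>e n\<close> below half the length, so
        \<open>a + e n < b - e n\<close> already for \<open>n = 0\<close>; both shifted times lie
        strictly between 0 and \<open>T\<close>.\<close>
      define e where "e n = (b - a) / real (n + 3)" for n
      have e: "0 < e n" "e n < (b - a) / 2" for n
        unfolding e_def using ab' by (simp, intro divide_strict_left_mono) auto
      have el: "e \<longlonglongrightarrow> 0"
      proof -
        have "(\<lambda>n. (b - a) * inverse (real (n + 3))) \<longlonglongrightarrow> (b - a) * 0"
          by (intro tendsto_mult tendsto_const LIMSEQ_ignore_initial_segment[OF lim_inverse_n])
        then show ?thesis by (simp add: e_def[abs_def] divide_inverse)
      qed
      have le: "doubled_dist (slices T u (b - e n)) w - doubled_dist (slices T u (a + e n)) w \<le> (LINT t|lborel. indicator {a + e n..b - e n} t * doubled_flux (slices T u t) w)" for n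
        using step(2)[OF w, of "b - e n" "a + e n"] e[of n] ab ab' by (simp add: set_lebesgue_integral_def field_simps)
      have be: "(\<lambda>n. b - e n) \<longlonglongrightarrow> b" "(\<lambda>n. a + e n) \<longlonglongrightarrow> a"
        using tendsto_diff[OF tendsto_const el, of b] tendsto_add[OF tendsto_const el, of a] by simp_all
      have l1: "(\<lambda>n. doubled_dist (slices T u (b - e n)) w - doubled_dist (slices T u (a + e n)) w) \<longlonglongrightarrow> doubled_dist (slices T u b) w - doubled_dist (slices T u a) w"
        by (intro tendsto_diff isCont_tendsto_compose[OF doubled_dist_isCont[OF v W(1)]] be)
      have l2: "(\<lambda>n. LINT t|lborel. indicator {a + e n..b - e n} t * doubled_flux (slices T u t) w) \<longlonglongrightarrow> (LINT t|lborel. indicator {a..b} t * doubled_flux (slices T u t) w)"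
      proof (rule integral_dominated_convergence[where w="\<lambda>t. \<bar>indicator {a..b} t * doubled_flux (slices T u t) w\<bar>"])
        have "AE t in lborel. t \<noteq> a \<and> t \<noteq> b" using AE_lborel_singleton[of a] AE_lborel_singleton[of b] by eventually_elim auto
        then show "AE t in lborel. (\<lambda>n. indicator {a + e n..b - e n} t * doubled_flux (slices T u t) w) \<longlonglongrightarrow> indicator {a..b} t * doubled_flux (slices T u t) w"
        proof eventually_elim
          case (elim t)
          have "\<forall>\<^sub>F n in sequentially. indicator {a + e n..b - e n} t = (indicator {a..b} t :: real)"
          proof (cases "a < t \<and> t < b")
            case True
            then have "\<forall>\<^sub>F n in sequentially. e n < t - a" "\<forall>\<^sub>F n in sequentially. e n < b - t"
              using order_tendstoD(2)[OF el] by simp_all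
            then show ?thesis by eventually_elim (use True in \<open>auto simp: indicator_def\<close>)
          next
            case False
            then show ?thesis using elim e by (intro always_eventually) (auto simp: indicator_def; smt (verit) e)
          qed
          then show ?case by (intro tendsto_mult tendsto_const tendsto_eventually)
        qed
        show "AE t in lborel. norm (indicator {a + e n..b - e n} t * doubled_flux (slices T u t) w) \<le> \<bar>indicator {a..b} t * doubled_flux (slices T u t) w\<bar>" for n
          using e[of n] by (intro AE_I2) (auto simp: indicator_def)
      qed (use doubled_flux_time[OF v w] in auto)
      have "doubled_dist (slices T u b) w - doubled_dist (slices T u a) w \<le> (LINT t|lborel. indicator {a..b} t * doubled_flux (slices T u t) w)"
        using le by (intro LIMSEQ_le[OF l1 l2]) auto
      then show ?thesis by (simp add: set_lebesgue_integral_def)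
    qed
    then show "doubled_dist (slices T u b) w - doubled_dist (slices T u a) w \<le> (LINT t:{a..b}|lborel. doubled_flux (slices T u t) w) + 0 * (b - a)" by simp
  qed
  have "doubled_dist (slices T u 0) u0 - doubled_dist u0 u0 \<le> 0"
  proof -
    define e where "e n = T / real (n + 2)" for n
    have e: "0 < e n" "e n < T" for n
      using T divide_strict_left_mono[of 1 "real (n + 2)" T] by (simp_all add: e_def)
    have el: "e \<longlonglongrightarrow> 0"
    proof -
      have "(\<lambda>n. T * inverse (real (n + 2))) \<longlonglongrightarrow> T * 0"
        by (intro tendsto_mult tendsto_const LIMSEQ_ignore_initial_segment[OF lim_inverse_n])
      then show ?thesis by (simp add: e_def[abs_def] divide_inverse)
    qed
    have le: "doubled_dist (slices T u (e n)) u0 - doubled_dist u0 u0 \<le> MA * e n" for n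
    proof -
      have "doubled_dist (slices T u (e n)) u0 - doubled_dist u0 u0 \<le> (LINT t|lborel. indicator {0..e n} t * doubled_flux (slices T u t) u0)"
        using step(1)[OF u0 e] by (simp add: set_lebesgue_integral_def)
      also have "\<dots> \<le> (LINT t|lborel. indicator {0..e n} t * MA)"
        by (intro integral_mono doubled_flux_time[OF v u0] integrable_indicator_Icc) (use MA[OF u0] in \<open>auto simp: indicator_def abs_le_iff\<close>)
      also have "\<dots> = MA * e n" using e[of n] by simp
      finally show ?thesis .
    qed
    have "(\<lambda>n. doubled_dist (slices T u (e n)) u0 - doubled_dist u0 u0) \<longlonglongrightarrow> doubled_dist (slices T u 0) u0 - doubled_dist u0 u0"
      by (intro tendsto_diff tendsto_const isCont_tendsto_compose[OF doubled_dist_isCont[OF v bvcD(1)[OF u0]]] el)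
    moreover have "(\<lambda>n. MA * e n) \<longlonglongrightarrow> 0" using tendsto_mult_right_zero[OF el] .
    ultimately show ?thesis by (rule LIMSEQ_le) (use le in auto)
  qed
  then show "(LINT x|lborel. \<bar>slices T u 0 x - u0 x\<bar>) \<le> 4 * C * R"
    using doubled_dist_self[OF u0] doubled_dist_approx(2)[OF N(3) u0, of 0] by simp
qed

end

section \<open>The entropy inequality for Euler polygons\<close>

lemma measurable_param_fix:
  fixes v :: "real \<Rightarrow> real \<Rightarrow> real"
  assumes "(\<lambda>q. v (fst q) (snd q)) \<in> borel_measurable borel"
  shows "v t \<in> borel_measurable borel"
proof -
  have "(\<lambda>x. v t x) \<in> borel_measurable borel" by (rule measurable_param_compose[OF assms]; simp)
  then show ?thesis by simp
qed

lemma abs_sum4: "\<bar>a + b + c + d\<bar> \<le> \<bar>a\<bar> + \<bar>b\<bar> + \<bar>c\<bar> + \<bar>d\<bar>" for a b c d :: real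
  by linarith

text \<open>What the limit passage uses of a test function, with time as the first argument. The
  support is controlled in space uniformly in time, and the sign is imposed on the strip
  only.\<close>

locale testfun =
  fixes T S B :: real and \<psi> \<psi>x \<psi>t :: "real \<Rightarrow> real \<Rightarrow> real"
  assumes psi_cont: "continuous_on UNIV (\<lambda>q. \<psi> (fst q) (snd q))" "continuous_on UNIV (\<lambda>q. \<psi>x (fst q) (snd q))"
      "continuous_on UNIV (\<lambda>q. \<psi>t (fst q) (snd q))"
    and psi_supp: "\<And>t x. \<bar>x\<bar> > S \<Longrightarrow> \<psi> t x = 0" "\<And>t x. \<bar>x\<bar> > S \<Longrightarrow> \<psi>x t x = 0" "\<And>t x. \<bar>x\<bar> > S \<Longrightarrow> \<psi>t t x = 0"
    and psi_bound: "\<And>t x. \<bar>\<psi> t x\<bar> \<le> B" "\<And>t x. \<bar>\<psi>x t x\<bar> \<le> B" "\<And>t x. \<bar>\<psi>t t x\<bar> \<le> B"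
    and psi_lip: "\<And>t x h. \<bar>\<psi> t (x + h) - \<psi> t x\<bar> \<le> B * \<bar>h\<bar>"
    and psi_deriv: "\<And>t x. ((\<lambda>y. \<psi> t y) has_real_derivative \<psi>x t x) (at x)" "\<And>t x. ((\<lambda>s. \<psi> s x) has_real_derivative \<psi>t t x) (at t)"
    and psi_nonneg: "\<And>t x. t \<in> {0..T} \<Longrightarrow> 0 \<le> \<psi> t x"
    and T_pos: "0 < T" and S_pos: "0 \<le> S"
begin

lemma B_nonneg: "0 \<le> B" using psi_bound(1)[of 0 0] by linarith

lemma measurable_psi [measurable]: "(\<lambda>q. \<psi> (fst q) (snd q)) \<in> borel_measurable borel"
  "(\<lambda>q. \<psi>x (fst q) (snd q)) \<in> borel_measurable borel" "(\<lambda>q. \<psi>t (fst q) (snd q)) \<in> borel_measurable borel"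
  using psi_cont by (auto intro: borel_measurable_continuous_onI)

lemma measurable_psi_t [measurable]: "\<psi> t \<in> borel_measurable borel" "\<psi>x t \<in> borel_measurable borel" "\<psi>t t \<in> borel_measurable borel"
  using measurable_psi by (auto intro: measurable_param_fix)

text \<open>The region of width 1 around the support accommodates difference quotients of the test
  function with steps up to 1. Constants \<open>k\<close> are not integrable on the line, so the
  summand with \<open>k\<close> is paired with the indicator of the support.\<close>

lemma slice:
  fixes r :: "real \<Rightarrow> real"
  assumes a: "bvc C a" and r: "\<And>u v. \<bar>r u - r v\<bar> \<le> L' * \<bar>u - v\<bar>" "r \<in> borel_measurable borel" and L': "0 \<le> L'"
    and g: "g \<in> borel_measurable borel" "\<And>x. \<bar>g x\<bar> \<le> B'" "\<And>x. \<bar>x\<bar> > S + 1 \<Longrightarrow> g x = 0"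
  shows "integrable lborel (\<lambda>x. \<bar>r (a x) - r k\<bar> * g x)"
    and "(LINT x|lborel. \<bar>\<bar>r (a x) - r k\<bar> * g x\<bar>) \<le> L' * B' * C + L' * B' * \<bar>k\<bar> * (2 * S + 2)"
    and "\<bar>\<bar>r (a x) - r k\<bar> * g x\<bar> \<le> L' * B' * \<bar>a x\<bar> + indicator {-(S+1)..S+1} x * (L' * B' * \<bar>k\<bar>)"
proof -
  note A = bvcD[OF a]
  note [measurable] = A(6) r(2) g(1)
  have B': "0 \<le> B'" using g(2)[of 0] by linarith
  have di: "integrable lborel (\<lambda>x. L' * B' * \<bar>a x\<bar> + indicator {-(S+1)..S+1} x * (L' * B' * \<bar>k\<bar>))"
    using A(1) by (intro Bochner_Integration.integrable_add integrable_indicator_Icc) auto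
  show le: "\<bar>\<bar>r (a x) - r k\<bar> * g x\<bar> \<le> L' * B' * \<bar>a x\<bar> + indicator {-(S+1)..S+1} x * (L' * B' * \<bar>k\<bar>)" for x
  proof (cases "\<bar>x\<bar> > S + 1")
    case True
    have "0 \<le> L' * B' * \<bar>a x\<bar> + indicator {-(S+1)..S+1} x * (L' * B' * \<bar>k\<bar>)" using L' B' by simp
    then show ?thesis using g(3)[OF True] by simp
  next
    case False
    have "\<bar>r (a x) - r k\<bar> \<le> L' * (\<bar>a x\<bar> + \<bar>k\<bar>)"
      using L' by (intro order_trans[OF r(1)] mult_left_mono) auto
    then have "\<bar>r (a x) - r k\<bar> * \<bar>g x\<bar> \<le> (L' * (\<bar>a x\<bar> + \<bar>k\<bar>)) * B'"
      using g(2) L' by (intro mult_mono) auto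
    then show ?thesis using False by (auto simp: abs_mult indicator_def algebra_simps)
  qed
  show i: "integrable lborel (\<lambda>x. \<bar>r (a x) - r k\<bar> * g x)"
    by (rule Bochner_Integration.integrable_bound[OF di]) (use le in \<open>auto simp: order_trans[OF _ abs_ge_self]\<close>)
  have "(LINT x|lborel. \<bar>\<bar>r (a x) - r k\<bar> * g x\<bar>) \<le> (LINT x|lborel. L' * B' * \<bar>a x\<bar> + indicator {-(S+1)..S+1} x * (L' * B' * \<bar>k\<bar>))"
    by (intro integral_mono integrable_abs i di le)
  also have "\<dots> = L' * B' * (LINT x|lborel. \<bar>a x\<bar>) + (LINT x|lborel. indicator {-(S+1)..S+1} x * (L' * B' * \<bar>k\<bar>))"
    using A(1) integrable_indicator_Icc[of "-(S+1)" "S+1" "L' * B' * \<bar>k\<bar>"] by (subst Bochner_Integration.integral_add) auto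
  also have "(LINT x|lborel. indicator {-(S+1)..S+1} x * (L' * B' * \<bar>k\<bar>)) = L' * B' * \<bar>k\<bar> * (2 * S + 2)"
    using S_pos by (simp add: algebra_simps)
  also have "L' * B' * (LINT x|lborel. \<bar>a x\<bar>) \<le> L' * B' * C" using A(2) L' B' by (intro mult_left_mono) auto
  finally show "(LINT x|lborel. \<bar>\<bar>r (a x) - r k\<bar> * g x\<bar>) \<le> L' * B' * C + L' * B' * \<bar>k\<bar> * (2 * S + 2)" by simp
qed

lemma psi_quot:
  assumes h: "0 < \<bar>h\<bar>" "\<bar>h\<bar> \<le> 1"
  shows "\<bar>(\<psi> t (x + h) - \<psi> t x) / h\<bar> \<le> B" "\<bar>x\<bar> > S + 1 \<Longrightarrow> (\<psi> t (x + h) - \<psi> t x) / h = 0"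
    "\<bar>(\<psi> t (x + h) - \<psi> t x) / \<bar>h\<bar>\<bar> \<le> B" "\<bar>x\<bar> > S + 1 \<Longrightarrow> (\<psi> t (x + h) - \<psi> t x) / \<bar>h\<bar> = 0"
proof -
  show "\<bar>(\<psi> t (x + h) - \<psi> t x) / h\<bar> \<le> B" "\<bar>(\<psi> t (x + h) - \<psi> t x) / \<bar>h\<bar>\<bar> \<le> B"
    using psi_lip[of t x h] h by (simp_all add: divide_le_eq)
  show "\<bar>x\<bar> > S + 1 \<Longrightarrow> (\<psi> t (x + h) - \<psi> t x) / h = 0" "\<bar>x\<bar> > S + 1 \<Longrightarrow> (\<psi> t (x + h) - \<psi> t x) / \<bar>h\<bar> = 0"
    using psi_supp(1)[of x t] psi_supp(1)[of "x + h" t] h by auto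
qed

lemma psi_integrable: "integrable lborel (\<psi> t)"
proof (rule Bochner_Integration.integrable_bound[OF integrable_indicator_Icc[of "-S" S B]])
  show "AE x in lborel. norm (\<psi> t x) \<le> norm (indicator {- S..S} x * B)"
    using psi_bound(1) psi_supp(1) B_nonneg by (intro AE_I2) (force simp: indicator_def)
qed simp

end

locale euler_test = euler p m L h K \<delta> N w0 C + testfun "real N * \<delta>" S B \<psi> \<psi>x \<psi>t
  for p m L h K \<delta> N w0 C S B \<psi> \<psi>x \<psi>t +
  assumes h1: "h \<le> 1"
begin

definition X :: "real \<Rightarrow> real \<Rightarrow> real \<Rightarrow> real" where
  "X k t x = \<bar>polygon t x - k\<bar> * \<psi>t t x + \<bar>p (polygon t x) - p k\<bar> * ((\<psi> t (x + h) - \<psi> t x) / h)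
     + \<bar>m (polygon t x) - m k\<bar> * ((\<psi> t (x - h) - \<psi> t x) / h) + sgn (polygon t x - k) * G K (polygon t) x * \<psi> t x"

text \<open>The factor \<open>N\<close> is crude; the bound holds at every time and serves to
  justify Fubini, without entering any error term.\<close>

lemma slope_bound: "(LINT x|lborel. \<bar>slope t x\<bar>) \<le> real N * D"
proof -
  have "(LINT x|lborel. \<bar>slope t x\<bar>) \<le> (LINT x|lborel. (\<Sum>i<N. \<bar>F h K (euler_seq i) x\<bar>))"
  proof (intro integral_mono)
    fix x show "\<bar>slope t x\<bar> \<le> (\<Sum>i<N. \<bar>F h K (euler_seq i) x\<bar>)"
      unfolding slope_def by (intro order_trans[OF sum_abs] sum_mono) (auto simp: indicator_def)
  qed (use slope_integrable F_euler_seq in auto)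
  also have "\<dots> = (\<Sum>i<N. LINT x|lborel. \<bar>F h K (euler_seq i) x\<bar>)" using F_euler_seq by simp
  also have "\<dots> \<le> (\<Sum>i<N. D)" by (intro sum_mono F_euler_seq)
  finally show ?thesis by simp
qed

lemma X_parts:
  shows "integrable lborel (\<lambda>x. \<bar>polygon t x - k\<bar> * \<psi>t t x)"
    "(LINT x|lborel. \<bar>\<bar>polygon t x - k\<bar> * \<psi>t t x\<bar>) \<le> B * C + B * \<bar>k\<bar> * (2 * S + 2)"
    "integrable lborel (\<lambda>x. \<bar>p (polygon t x) - p k\<bar> * ((\<psi> t (x + h) - \<psi> t x) / h))"
    "(LINT x|lborel. \<bar>\<bar>p (polygon t x) - p k\<bar> * ((\<psi> t (x + h) - \<psi> t x) / h)\<bar>) \<le> L * B * C + L * B * \<bar>k\<bar> * (2 * S + 2)"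
    "integrable lborel (\<lambda>x. \<bar>m (polygon t x) - m k\<bar> * ((\<psi> t (x - h) - \<psi> t x) / h))"
    "(LINT x|lborel. \<bar>\<bar>m (polygon t x) - m k\<bar> * ((\<psi> t (x - h) - \<psi> t x) / h)\<bar>) \<le> L * B * C + L * B * \<bar>k\<bar> * (2 * S + 2)"
    "integrable lborel (\<lambda>x. sgn (polygon t x - k) * G K (polygon t) x * \<psi> t x)"
    "(LINT x|lborel. \<bar>sgn (polygon t x - k) * G K (polygon t) x * \<psi> t x\<bar>) \<le> 2 * C * kmass K * B"
proof -
  note b = bvc_polygon[of t]
  note Ga = G_integrable[OF b bkernD(1)[OF K]]
  note [measurable] = bvcD(6)[OF b] Ga[THEN integrable_lborel_measurable]
  have i1: "\<bar>u - v\<bar> \<le> 1 * \<bar>u - v\<bar>" for u v :: real by simp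
  note s1 = slice[OF b i1, of "\<psi>t t" B k]
  show "integrable lborel (\<lambda>x. \<bar>polygon t x - k\<bar> * \<psi>t t x)" by (rule s1(1)) (auto intro: psi_bound psi_supp)
  have "(LINT x|lborel. \<bar>\<bar>polygon t x - k\<bar> * \<psi>t t x\<bar>) \<le> 1 * B * C + 1 * B * \<bar>k\<bar> * (2 * S + 2)" by (rule s1(2)) (auto intro: psi_bound psi_supp)
  then show "(LINT x|lborel. \<bar>\<bar>polygon t x - k\<bar> * \<psi>t t x\<bar>) \<le> B * C + B * \<bar>k\<bar> * (2 * S + 2)" by simp
  have q: "(\<lambda>x. (\<psi> t (x + h) - \<psi> t x) / h) \<in> borel_measurable borel" "(\<lambda>x. (\<psi> t (x - h) - \<psi> t x) / h) \<in> borel_measurable borel" by measurable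
  have q1: "\<bar>(\<psi> t (x + h) - \<psi> t x) / h\<bar> \<le> B" "\<bar>x\<bar> > S + 1 \<Longrightarrow> (\<psi> t (x + h) - \<psi> t x) / h = 0"
    "\<bar>(\<psi> t (x - h) - \<psi> t x) / h\<bar> \<le> B" "\<bar>x\<bar> > S + 1 \<Longrightarrow> (\<psi> t (x - h) - \<psi> t x) / h = 0" for x
    using psi_quot[where h=h and t=t and x=x] psi_quot[where h="-h" and t=t and x=x] h h1 by auto
  show "integrable lborel (\<lambda>x. \<bar>p (polygon t x) - p k\<bar> * ((\<psi> t (x + h) - \<psi> t x) / h))"
    "(LINT x|lborel. \<bar>\<bar>p (polygon t x) - p k\<bar> * ((\<psi> t (x + h) - \<psi> t x) / h)\<bar>) \<le> L * B * C + L * B * \<bar>k\<bar> * (2 * S + 2)"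
    by (rule slice[OF b p_lip measurable_p L_nonneg q(1) q1(1,2)]; assumption?)+
  show "integrable lborel (\<lambda>x. \<bar>m (polygon t x) - m k\<bar> * ((\<psi> t (x - h) - \<psi> t x) / h))"
    "(LINT x|lborel. \<bar>\<bar>m (polygon t x) - m k\<bar> * ((\<psi> t (x - h) - \<psi> t x) / h)\<bar>) \<le> L * B * C + L * B * \<bar>k\<bar> * (2 * S + 2)"
    by (rule slice[OF b m_lip measurable_m L_nonneg q(2) q1(3,4)]; assumption?)+
  have "integrable lborel (\<lambda>x. G K (polygon t) x * (sgn (polygon t x - k) * \<psi> t x))"
    by (rule integrable_bounded_mult(1)[OF Ga, where B=B]) (use psi_bound(1) B_nonneg in \<open>auto simp: sgn_if\<close>)
  then show I: "integrable lborel (\<lambda>x. sgn (polygon t x - k) * G K (polygon t) x * \<psi> t x)" by (simp add: ac_simps)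
  have "(LINT x|lborel. \<bar>sgn (polygon t x - k) * G K (polygon t) x * \<psi> t x\<bar>) \<le> (LINT x|lborel. \<bar>G K (polygon t) x\<bar> * B)"
  proof (intro integral_mono integrable_abs I integrable_mult_left Ga)
    fix x
    have "\<bar>sgn (polygon t x - k) * G K (polygon t) x * \<psi> t x\<bar> \<le> \<bar>G K (polygon t) x\<bar> * \<bar>\<psi> t x\<bar>" by (auto simp: abs_mult sgn_if)
    also have "\<dots> \<le> \<bar>G K (polygon t) x\<bar> * B" by (intro mult_left_mono psi_bound) auto
    finally show "\<bar>sgn (polygon t x - k) * G K (polygon t) x * \<psi> t x\<bar> \<le> \<bar>G K (polygon t) x\<bar> * B" .
  qed
  also have "\<dots> \<le> 2 * C * kmass K * B" using G_bound[OF b bkernD(1)[OF K]] B_nonneg by (simp add: mult_right_mono)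
  finally show "(LINT x|lborel. \<bar>sgn (polygon t x - k) * G K (polygon t) x * \<psi> t x\<bar>) \<le> 2 * C * kmass K * B" .
qed

lemma X_integrable: "integrable lborel (X k t)"
  unfolding X_def[abs_def] by (intro Bochner_Integration.integrable_add X_parts)

lemma X_bound:
  obtains M where "\<And>t. (LINT x|lborel. \<bar>X k t x\<bar>) \<le> M"
proof -
  have "(LINT x|lborel. \<bar>X k t x\<bar>) \<le> (B * C + B * \<bar>k\<bar> * (2 * S + 2)) + (L * B * C + L * B * \<bar>k\<bar> * (2 * S + 2)) + (L * B * C + L * B * \<bar>k\<bar> * (2 * S + 2)) + 2 * C * kmass K * B" for t
  proof -
    note xp = X_parts[of t k]
    have "(LINT x|lborel. \<bar>X k t x\<bar>) \<le> (LINT x|lborel. \<bar>\<bar>polygon t x - k\<bar> * \<psi>t t x\<bar> + \<bar>\<bar>p (polygon t x) - p k\<bar> * ((\<psi> t (x + h) - \<psi> t x) / h)\<bar>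
     + \<bar>\<bar>m (polygon t x) - m k\<bar> * ((\<psi> t (x - h) - \<psi> t x) / h)\<bar> + \<bar>sgn (polygon t x - k) * G K (polygon t) x * \<psi> t x\<bar>)"
      by (intro integral_mono integrable_abs X_integrable Bochner_Integration.integrable_add xp) (unfold X_def, rule abs_sum4)
    also have "\<dots> = (LINT x|lborel. \<bar>\<bar>polygon t x - k\<bar> * \<psi>t t x\<bar>) + (LINT x|lborel. \<bar>\<bar>p (polygon t x) - p k\<bar> * ((\<psi> t (x + h) - \<psi> t x) / h)\<bar>)
     + (LINT x|lborel. \<bar>\<bar>m (polygon t x) - m k\<bar> * ((\<psi> t (x - h) - \<psi> t x) / h)\<bar>) + (LINT x|lborel. \<bar>sgn (polygon t x - k) * G K (polygon t) x * \<psi> t x\<bar>)"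
      using xp(1,3,5,7)[THEN integrable_abs]
      by (simp only: Bochner_Integration.integral_add Bochner_Integration.integrable_add)
    finally show ?thesis using xp(2,4,6,8) by linarith
  qed
  then show ?thesis by (rule that)
qed

lemma measurable_X: "(\<lambda>q. X k (fst q) (snd q)) \<in> borel_measurable borel"
proof -
  have "(\<lambda>r. polygon (fst (fst r)) (snd r)) \<in> borel_measurable (borel :: ((real\<times>real)\<times>real) measure)"
    by (rule measurable_param_compose[OF measurable_polygon]; measurable)
  then have [measurable]: "(\<lambda>q. G K (polygon (fst q)) (snd q)) \<in> borel_measurable (borel :: (real\<times>real) measure)"
    by (rule measurable_G[OF _ bkernD(4)[OF K]]; measurable)
  have [measurable]: "(\<lambda>q. \<psi> (fst q) (snd q + h)) \<in> borel_measurable (borel :: (real\<times>real) measure)" "(\<lambda>q. \<psi> (fst q) (snd q - h)) \<in> borel_measurable (borel :: (real\<times>real) measure)"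
    by (rule measurable_param_compose[OF measurable_psi(1)]; measurable)+
  show ?thesis unfolding X_def by measurable
qed

text \<open>The argument of \<open>polygon_approx_sol\<close> with a genuine test function: exact
  chain rule in time, slope exchanged for \<open>F\<close>, and \<open>flux_diff_entropy\<close> for
  the transport part. The jump term stays as it is, so no inequality is spent on it.\<close>

lemma polygon_entropy:
  "(LINT x|lborel. \<bar>polygon (real N * \<delta>) x - k\<bar> * \<psi> (real N * \<delta>) x) - (LINT x|lborel. \<bar>w0 x - k\<bar> * \<psi> 0 x)
    \<le> (LINT t|lborel. indicator {0..real N * \<delta>} t * (LINT x|lborel. X k t x))
      + (4 * L / h + 2 * (LINT z|lborel. K z)) * (\<delta> * D) * B * (real N * \<delta>)"
proof -
  let ?T = "real N * \<delta>" and ?e = "(4 * L / h + 2 * (LINT z|lborel. K z)) * (\<delta> * D)"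
  let ?Z = "\<lambda>t x. sgn (polygon t x - k) * slope t x * \<psi> t x + \<bar>polygon t x - k\<bar> * \<psi>t t x"
  have Zm: "(\<lambda>q. ?Z (fst q) (snd q)) \<in> borel_measurable borel" by measurable
  have m1 [measurable]: "(\<lambda>x. polygon t x) \<in> borel_measurable borel" "(\<lambda>x. slope t x) \<in> borel_measurable borel" for t
    using bvcD(6)[OF bvc_polygon] slope_integrable[THEN integrable_lborel_measurable] by simp_all
  have sgi: "integrable lborel (\<lambda>x. sgn (polygon t x - k) * g x * \<psi> t x)" if g: "integrable lborel g" for g t
  proof -
    note [measurable] = g[THEN integrable_lborel_measurable]
    have "integrable lborel (\<lambda>x. g x * (sgn (polygon t x - k) * \<psi> t x))"
      by (rule integrable_bounded_mult(1)[OF g, where B=B]) (use psi_bound(1) B_nonneg in \<open>auto simp: sgn_if\<close>)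
    then show ?thesis by (simp add: ac_simps)
  qed
  have Zi: "integrable lborel (?Z t)" for t
    by (intro Bochner_Integration.integrable_add sgi slope_integrable X_parts)
  have ZM: "(LINT x|lborel. \<bar>?Z t x\<bar>) \<le> real N * D * B + (B * C + B * \<bar>k\<bar> * (2 * S + 2))" for t
  proof -
    have "(LINT x|lborel. \<bar>?Z t x\<bar>) \<le> (LINT x|lborel. \<bar>slope t x\<bar> * B + \<bar>\<bar>polygon t x - k\<bar> * \<psi>t t x\<bar>)"
    proof (intro integral_mono integrable_abs Zi Bochner_Integration.integrable_add integrable_mult_left slope_integrable X_parts)
      fix x
      have "\<bar>sgn (polygon t x - k) * slope t x * \<psi> t x\<bar> \<le> \<bar>slope t x\<bar> * \<bar>\<psi> t x\<bar>" by (auto simp: abs_mult sgn_if)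
      also have "\<dots> \<le> \<bar>slope t x\<bar> * B" by (intro mult_left_mono psi_bound) auto
      finally show "\<bar>?Z t x\<bar> \<le> \<bar>slope t x\<bar> * B + \<bar>\<bar>polygon t x - k\<bar> * \<psi>t t x\<bar>" by linarith
    qed
    also have "\<dots> = (LINT x|lborel. \<bar>slope t x\<bar>) * B + (LINT x|lborel. \<bar>\<bar>polygon t x - k\<bar> * \<psi>t t x\<bar>)"
      using slope_integrable[of t] X_parts(1)[of t k, THEN integrable_abs] by (subst Bochner_Integration.integral_add) auto
    also have "\<dots> \<le> real N * D * B + (B * C + B * \<bar>k\<bar> * (2 * S + 2))"
      using slope_bound B_nonneg X_parts(2)[of t k] by (intro add_mono mult_right_mono) auto
    finally show ?thesis .
  qed
  note SI = strip_integral[OF Zm Zi ZM, of 0 ?T]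
  obtain M where M: "\<And>t. (LINT x|lborel. \<bar>X k t x\<bar>) \<le> M" using X_bound by metis
  note SX = strip_integral[OF measurable_X X_integrable M, of 0 ?T]
  have ct: "continuous_on UNIV (\<lambda>t. \<psi>t t x)" for x
  proof -
    have "continuous_on UNIV (\<lambda>t::real. (t, x))" by (intro continuous_intros)
    from continuous_on_compose2[OF psi_cont(3) this] show ?thesis by simp
  qed
  have chain: "\<bar>polygon ?T x - k\<bar> * \<psi> ?T x - \<bar>w0 x - k\<bar> * \<psi> 0 x = (LINT t|lborel. indicator {0..?T} t * ?Z t x)" for x
    using polygon_chain(2)[of "\<lambda>t. \<psi> t x" "\<lambda>t. \<psi>t t x" 0 ?T x k, OF psi_deriv(2) ct] T_pos
    by (simp add: set_lebesgue_integral_def polygon_0)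
  have "\<bar>u - v\<bar> \<le> 1 * \<bar>u - v\<bar>" for u v :: real by simp
  note sl1 = slice[where r="\<lambda>u. u" and L'=1 and B'=B, OF _ this, of _ _ "\<psi> t" k for t]
  have i2: "integrable lborel (\<lambda>x. \<bar>polygon ?T x - k\<bar> * \<psi> ?T x)" by (rule sl1(1)[OF bvc_polygon]) (auto intro: psi_bound psi_supp)
  have i3: "integrable lborel (\<lambda>x. \<bar>w0 x - k\<bar> * \<psi> 0 x)" by (rule sl1(1)[OF w0]) (auto intro: psi_bound psi_supp)
  have "(LINT x|lborel. \<bar>polygon ?T x - k\<bar> * \<psi> ?T x) - (LINT x|lborel. \<bar>w0 x - k\<bar> * \<psi> 0 x)
    = (LINT x|lborel. \<bar>polygon ?T x - k\<bar> * \<psi> ?T x - \<bar>w0 x - k\<bar> * \<psi> 0 x)"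
    by (intro Bochner_Integration.integral_diff[symmetric] i2 i3)
  also have "\<dots> = (LINT x|lborel. LINT t|lborel. indicator {0..?T} t * ?Z t x)" unfolding chain ..
  also have "\<dots> = (LINT t|lborel. LINT x|lborel. indicator {0..?T} t * ?Z t x)"
    using lborel_fubini_swap[OF SI] by simp
  also have "\<dots> \<le> (LINT t|lborel. indicator {0..?T} t * (LINT x|lborel. X k t x) + indicator {0..?T} t * (?e * B))"
  proof (rule integral_mono_AE)
    show "integrable lborel (\<lambda>t. LINT x|lborel. indicator {0..?T} t * ?Z t x)" using lborel_integrable_fst[OF SI] by simp
    show "integrable lborel (\<lambda>t. indicator {0..?T} t * (LINT x|lborel. X k t x) + indicator {0..?T} t * (?e * B))"
      using lborel_integrable_fst[OF SX] by (intro Bochner_Integration.integrable_add integrable_indicator_Icc) simp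
    have "finite grid" unfolding grid_def by simp
    then have "AE t in lborel. t \<notin> grid" by (intro AE_not_in finite_imp_null_set_lborel)
    then show "AE t in lborel. (LINT x|lborel. indicator {0..?T} t * ?Z t x) \<le> indicator {0..?T} t * (LINT x|lborel. X k t x) + indicator {0..?T} t * (?e * B)"
    proof eventually_elim
      case (elim t)
      show ?case
      proof (cases "t \<in> {0..?T}")
        case True
        note P = bvcD[OF bvc_polygon[of t]]
        note ne = psi_nonneg[OF True]
        have Bu: "\<psi> t x \<le> B" for x using psi_bound(1)[of t x] by linarith
        note fe = flux_diff_entropy[OF P(1) h psi_integrable ne Bu, of k]
        note Gi = G_bkern_integrable[OF K P(1)] and Fi = integrable_F[OF P(1) K, of h] and Fli = integrable_flux_diff[OF P(1), of h]
        have di: "integrable lborel (\<lambda>x. \<bar>slope t x - F h K (polygon t) x\<bar> * B)" using slope_integrable Fi by simp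
        have "(LINT x|lborel. ?Z t x) \<le> (LINT x|lborel. (sgn (polygon t x - k) * flux_diff h (polygon t) x * \<psi> t x + sgn (polygon t x - k) * G K (polygon t) x * \<psi> t x)
            + \<bar>slope t x - F h K (polygon t) x\<bar> * B + \<bar>polygon t x - k\<bar> * \<psi>t t x)"
        proof (intro integral_mono Zi Bochner_Integration.integrable_add sgi Fli Gi di X_parts)
          fix x
          have "sgn s * y \<le> sgn s * z + \<bar>y - z\<bar>" for s y z :: real by (auto simp: sgn_if)
          then have "sgn (polygon t x - k) * slope t x \<le> sgn (polygon t x - k) * F h K (polygon t) x + \<bar>slope t x - F h K (polygon t) x\<bar>" .
          from mult_right_mono[OF this ne[of x]]
          have "sgn (polygon t x - k) * slope t x * \<psi> t x \<le> sgn (polygon t x - k) * F h K (polygon t) x * \<psi> t x + \<bar>slope t x - F h K (polygon t) x\<bar> * \<psi> t x"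
            by (simp add: distrib_right)
          also have "\<bar>slope t x - F h K (polygon t) x\<bar> * \<psi> t x \<le> \<bar>slope t x - F h K (polygon t) x\<bar> * B" by (intro mult_left_mono Bu) auto
          finally show "?Z t x \<le> (sgn (polygon t x - k) * flux_diff h (polygon t) x * \<psi> t x + sgn (polygon t x - k) * G K (polygon t) x * \<psi> t x)
            + \<bar>slope t x - F h K (polygon t) x\<bar> * B + \<bar>polygon t x - k\<bar> * \<psi>t t x"
            by (simp add: F_def distrib_left distrib_right)
        qed
        also have "\<dots> = ((LINT x|lborel. sgn (polygon t x - k) * flux_diff h (polygon t) x * \<psi> t x) + (LINT x|lborel. sgn (polygon t x - k) * G K (polygon t) x * \<psi> t x))
            + (LINT x|lborel. \<bar>slope t x - F h K (polygon t) x\<bar> * B) + (LINT x|lborel. \<bar>polygon t x - k\<bar> * \<psi>t t x)"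
          using sgi[OF Fli, of t] sgi[OF Gi, of t] di X_parts(1)[of t k]
          by (simp only: Bochner_Integration.integral_add Bochner_Integration.integrable_add)
        also have "\<dots> \<le> ((LINT x|lborel. \<bar>p (polygon t x) - p k\<bar> * ((\<psi> t (x + h) - \<psi> t x) / h) + \<bar>m (polygon t x) - m k\<bar> * ((\<psi> t (x - h) - \<psi> t x) / h))
             + (LINT x|lborel. sgn (polygon t x - k) * G K (polygon t) x * \<psi> t x)) + ?e * B + (LINT x|lborel. \<bar>polygon t x - k\<bar> * \<psi>t t x)"
          using fe(3) slope_error(1)[of t] True elim B_nonneg by (intro add_mono) (auto intro: mult_right_mono)
        also have "\<dots> = (LINT x|lborel. X k t x) + ?e * B"
          unfolding X_def using X_parts[of t k]
          by (simp only: Bochner_Integration.integral_add Bochner_Integration.integrable_add)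
        finally show ?thesis using True by simp
      qed simp
    qed
  qed
  also have "\<dots> = (LINT t|lborel. indicator {0..?T} t * (LINT x|lborel. X k t x)) + (LINT t|lborel. indicator {0..?T} t * (?e * B))"
    using lborel_integrable_fst[OF SX] by (intro Bochner_Integration.integral_add integrable_indicator_Icc) simp
  also have "(LINT t|lborel. indicator {0..?T} t * (?e * B)) = ?e * B * ?T" using T_pos by simp
  finally show ?thesis .
qed

end

section \<open>Passage to the limit\<close>

lemma integrable_suminf_L1:
  fixes d :: "nat \<Rightarrow> real \<Rightarrow> real"
  assumes d: "\<And>n. integrable lborel (d n)" "\<And>n x. 0 \<le> d n x" "\<And>n. (LINT x|lborel. d n x) \<le> (1/2) ^ n"
  shows "AE x in lborel. summable (\<lambda>n. d n x)" "integrable lborel (\<lambda>x. \<Sum>n. d n x)"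
proof -
  note [measurable] = d(1)[THEN integrable_lborel_measurable]
  have "(\<integral>\<^sup>+x. (\<Sum>n. ennreal (d n x)) \<partial>lborel) = (\<Sum>n. \<integral>\<^sup>+x. ennreal (d n x) \<partial>lborel)"
    by (rule nn_integral_suminf) measurable
  also have "\<dots> \<le> (\<Sum>n. ennreal ((1/2) ^ n))"
    using d by (intro suminf_le) (auto simp: nn_integral_eq_integral intro!: ennreal_leI)
  also have "\<dots> = ennreal (\<Sum>n. (1/2) ^ n)" by (intro suminf_ennreal2) (auto intro: summable_geometric)
  also have "\<dots> < \<infinity>" by simp
  finally have fin: "(\<integral>\<^sup>+x. (\<Sum>n. ennreal (d n x)) \<partial>lborel) < \<infinity>" .
  have "AE x in lborel. (\<Sum>n. ennreal (d n x)) \<noteq> \<infinity>" using fin by (intro nn_integral_PInf_AE) auto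
  then show s: "AE x in lborel. summable (\<lambda>n. d n x)"
    by eventually_elim (use d(2) in \<open>auto intro: summable_suminf_not_top\<close>)
  show "integrable lborel (\<lambda>x. \<Sum>n. d n x)"
  proof (rule integrableI_nonneg)
    show "AE x in lborel. 0 \<le> (\<Sum>n. d n x)" using s by eventually_elim (use d(2) in \<open>auto intro: suminf_nonneg\<close>)
    have "(\<integral>\<^sup>+x. ennreal (\<Sum>n. d n x) \<partial>lborel) = (\<integral>\<^sup>+x. (\<Sum>n. ennreal (d n x)) \<partial>lborel)"
    proof (rule nn_integral_cong_AE)
      show "AE x in lborel. ennreal (\<Sum>n. d n x) = (\<Sum>n. ennreal (d n x))"
        using s by eventually_elim (use d(2) in \<open>simp add: suminf_ennreal2\<close>)
    qed
    then show "(\<integral>\<^sup>+x. ennreal (\<Sum>n. d n x) \<partial>lborel) < \<infinity>" using fin by simp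
  qed measurable
qed

text \<open>The Cauchy condition is uniform in time, so one rapidly converging subsequence works for
  all times: its increments are summable in \<open>L1\<close>, which gives an integrable majorant
  and convergence almost everywhere in each slice.\<close>

lemma L1_uniform_limit:
  fixes V :: "nat \<Rightarrow> real \<Rightarrow> real \<Rightarrow> real"
  assumes V: "\<And>n. L1_curve C (V n)"
    and cau: "\<And>e. 0 < e \<Longrightarrow> \<exists>n0. \<forall>n\<ge>n0. \<forall>k\<ge>n0. \<forall>t. (LINT x|lborel. \<bar>V n t x - V k t x\<bar>) \<le> e"
  obtains v s where "L1_curve C v" "strict_mono (s :: nat \<Rightarrow> nat)" "\<And>n t. (LINT x|lborel. \<bar>V (s n) t x - v t x\<bar>) \<le> 2 * (1/2) ^ n"
    "\<And>t. AE x in lborel. (\<lambda>n. V (s n) t x) \<longlonglongrightarrow> v t x"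
proof -
  note N = niceD[OF V]
  have "\<forall>n. \<exists>n0. \<forall>j\<ge>n0. \<forall>k\<ge>n0. \<forall>t. (LINT x|lborel. \<bar>V j t x - V k t x\<bar>) \<le> (1/2) ^ n" using cau by simp
  then obtain n0 where n0: "\<And>n j k t. j \<ge> n0 n \<Longrightarrow> k \<ge> n0 n \<Longrightarrow> (LINT x|lborel. \<bar>V j t x - V k t x\<bar>) \<le> (1/2) ^ n" by metis
  define s where "s n = (\<Sum>i\<le>n. Suc (n0 i))" for n
  have sm: "strict_mono s" by (rule strict_monoI_Suc) (simp add: s_def)
  have sge: "n0 n \<le> s n" for n unfolding s_def
    using member_le_sum[of n "{..n}" "\<lambda>i. Suc (n0 i)"] by simp
  have mono: "s j \<le> s k" if "j \<le> k" for j k using sm that by (simp add: strict_mono_less_eq)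
  have close: "(LINT x|lborel. \<bar>V (s j) t x - V (s k) t x\<bar>) \<le> (1/2) ^ n" if "n \<le> j" "n \<le> k" for j k n t
    using n0[of n "s j" "s k" t] sge[of n] mono[OF that(1)] mono[OF that(2)] by simp
  \<comment> \<open>Completeness of \<open>L1\<close> slice by slice would choose representatives
    independently and lose joint measurability in \<open>(t, x)\<close>. A pointwise limit of
    jointly measurable functions keeps it.\<close>
  define v where "v t x = lim (\<lambda>n. V (s n) t x)" for t x
  have Vm [measurable]: "(\<lambda>q. V n (fst q) (snd q)) \<in> borel_measurable borel" for n by (rule N)
  have vm: "(\<lambda>q. v (fst q) (snd q)) \<in> borel_measurable borel" unfolding v_def by (rule borel_measurable_lim_metric) measurable
  define d where "d t n x = \<bar>V (s (Suc n)) t x - V (s n) t x\<bar>" for t n x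
  have di: "integrable lborel (d t n)" for t n unfolding d_def[abs_def] using N(3) by simp
  have db: "(LINT x|lborel. d t n x) \<le> (1/2) ^ n" for t n unfolding d_def by (rule close) auto
  note su = integrable_suminf_L1[of "d t" for t, OF di _ db]
  have dn: "0 \<le> d t n x" for t n x by (simp add: d_def)
  have tele: "\<bar>V (s k) t x - V (s 0) t x\<bar> \<le> (\<Sum>n<k. d t n x)" for k t x
  proof (induction k)
    case (Suc k)
    then show ?case unfolding d_def by simp
  qed simp
  have conv: "AE x in lborel. (\<lambda>n. V (s n) t x) \<longlonglongrightarrow> v t x" for t
    using su(1)[of t, OF dn]
  proof eventually_elim
    case (elim x)
    have "summable (\<lambda>n. V (s (Suc n)) t x - V (s n) t x)"
      by (rule summable_rabs_cancel) (use elim in \<open>simp add: d_def\<close>)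
    then have "convergent (\<lambda>n. \<Sum>i<n. V (s (Suc i)) t x - V (s i) t x)" by (simp add: summable_iff_convergent)
    then have "convergent (\<lambda>n. V (s n) t x - V (s 0) t x)"
      by (simp only: sum_lessThan_telescope[of "\<lambda>n. V (s n) t x"])
    then obtain l where "(\<lambda>n. V (s n) t x - V (s 0) t x) \<longlonglongrightarrow> l" by (auto simp: convergent_def)
    from tendsto_add[OF this tendsto_const[of "V (s 0) t x"]]
    have "convergent (\<lambda>n. V (s n) t x)" by (auto simp: convergent_def)
    then show ?case by (simp add: v_def convergent_LIMSEQ_iff)
  qed
  have dom: "AE x in lborel. norm (V (s k) t x) \<le> \<bar>V (s 0) t x\<bar> + (\<Sum>n. d t n x)" for k t
    using su(1)[of t, OF dn]
  proof eventually_elim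
    case (elim x)
    have "(\<Sum>n<k. d t n x) \<le> (\<Sum>n. d t n x)" by (rule sum_le_suminf[OF elim]) (auto simp: dn)
    then show ?case using tele[of k t x] by simp
  qed
  have vt: "v t \<in> borel_measurable borel" for t by (rule measurable_param_fix[OF vm])
  have di': "integrable lborel (\<lambda>x. \<bar>V (s 0) t x\<bar> + (\<Sum>n. d t n x))" for t using su(2)[of t, OF dn] N(3) by simp
  have vi: "integrable lborel (v t)" for t
    by (rule integrable_dominated_convergence[OF _ _ di' conv dom]) (use N(3) vt in auto)
  have lim: "(LINT x|lborel. \<bar>V (s n) t x - v t x\<bar>) \<le> (1/2) ^ n" for n t
  proof (rule LIMSEQ_le_const2)
    show "(\<lambda>k. LINT x|lborel. \<bar>V (s n) t x - V (s k) t x\<bar>) \<longlonglongrightarrow> (LINT x|lborel. \<bar>V (s n) t x - v t x\<bar>)"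
    proof (rule integral_dominated_convergence[where w="\<lambda>x. \<bar>V (s n) t x\<bar> + (\<bar>V (s 0) t x\<bar> + (\<Sum>n. d t n x))"])
      show "AE x in lborel. (\<lambda>k. \<bar>V (s n) t x - V (s k) t x\<bar>) \<longlonglongrightarrow> \<bar>V (s n) t x - v t x\<bar>"
        using conv[of t] by eventually_elim (intro tendsto_intros)
      show "AE x in lborel. norm \<bar>V (s n) t x - V (s k) t x\<bar> \<le> \<bar>V (s n) t x\<bar> + (\<bar>V (s 0) t x\<bar> + (\<Sum>n. d t n x))" for k
        using dom[of k t] by eventually_elim auto
    qed (use di' N(3) vi in auto)
    show "\<exists>N. \<forall>k\<ge>N. (LINT x|lborel. \<bar>V (s n) t x - V (s k) t x\<bar>) \<le> (1/2) ^ n" using close[of n n] by blast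
  qed
  have L1_curve: "L1_curve C v" unfolding L1_curve_def
  proof (intro conjI allI vm)
    fix t
    have small: "\<exists>n. (1/2) ^ n < e" if "0 < e" for e :: real using real_arch_pow_inv[of e "1/2"] that by auto
    show "bvc C (v t)"
    proof (rule bvc_limit[OF vi])
      fix e :: real assume "0 < e"
      then obtain n where "(1/2) ^ n < e" using small by blast
      then show "\<exists>g. bvc C g \<and> (LINT x|lborel. \<bar>v t x - g x\<bar>) < e"
        using lim[of n t] N(2)[of "s n" t] by (intro exI[of _ "V (s n) t"]) (auto simp: abs_minus_commute)
    qed
    show "((\<lambda>r. LINT x|lborel. \<bar>v r x - v t x\<bar>) \<longlongrightarrow> 0) (at t)"
    proof (rule tendstoI)
      fix e :: real assume e: "0 < e"
      then obtain n where n: "(1/2) ^ n < e / 3" using small[of "e/3"] by auto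
      have "\<forall>\<^sub>F r in at t. dist (LINT x|lborel. \<bar>V (s n) r x - V (s n) t x\<bar>) 0 < e / 3"
        using tendstoD[OF N(4)[of "s n" t], of "e/3"] e by simp
      then show "\<forall>\<^sub>F r in at t. dist (LINT x|lborel. \<bar>v r x - v t x\<bar>) 0 < e"
      proof eventually_elim
        case (elim r)
        have "(LINT x|lborel. \<bar>v r x - v t x\<bar>) \<le> (LINT x|lborel. \<bar>v r x - V (s n) r x\<bar>) + (LINT x|lborel. \<bar>V (s n) r x - v t x\<bar>)"
          by (rule L1_diff_triangle[OF vi N(3) vi])
        moreover have "(LINT x|lborel. \<bar>V (s n) r x - v t x\<bar>) \<le> (LINT x|lborel. \<bar>V (s n) r x - V (s n) t x\<bar>) + (LINT x|lborel. \<bar>V (s n) t x - v t x\<bar>)"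
          by (rule L1_diff_triangle[OF N(3) N(3) vi])
        ultimately show ?case using lim[of n r] lim[of n t] n elim by (simp add: dist_real_def abs_minus_commute)
      qed
    qed
  qed
  show ?thesis
  proof (rule that[OF L1_curve sm])
    fix n t
    have "(LINT x|lborel. \<bar>V (s n) t x - v t x\<bar>) \<le> (1/2) ^ n" by (rule lim)
    also have "\<dots> \<le> 2 * (1/2) ^ n" by simp
    finally show "(LINT x|lborel. \<bar>V (s n) t x - v t x\<bar>) \<le> 2 * (1/2) ^ n" .
  qed (rule conv)
qed

section \<open>Test functions, levels and dominating functions\<close>

lemma continuous_compact_bounded:
  fixes g :: "real \<times> real \<Rightarrow> real"
  assumes "continuous_on UNIV g" "\<And>p. norm p > S \<Longrightarrow> g p = 0"
  obtains B where "0 \<le> B" "\<And>p. \<bar>g p\<bar> \<le> B"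
proof -
  have "bounded (g ` cball 0 S)"
    by (intro compact_imp_bounded compact_continuous_image continuous_on_subset[OF assms(1)]) auto
  then obtain B where B: "B > 0" "\<forall>p\<in>cball 0 S. \<bar>g p\<bar> \<le> B" unfolding bounded_pos by auto
  then have "\<bar>g p\<bar> \<le> B" for p using assms(2)[of p] by (cases "norm p > S") auto
  then show ?thesis using that[of B] B by auto
qed

lemma testfun_of_test_function:
  assumes T: "0 < T" and \<phi>: "\<phi> \<in> test_functions" and nn: "\<forall>x. \<forall>t\<in>{0..T}. \<phi> (x, t) \<ge> 0"
  obtains S B where "testfun T S B (\<lambda>t x. \<phi> (x, t)) (\<lambda>t x. dx \<phi> (x, t)) (\<lambda>t x. dt \<phi> (x, t))"
proof -
  have "Ck (Suc 0) \<phi>" using \<phi> by (auto simp: test_functions_def)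
  then have c: "continuous_on UNIV \<phi>" "continuous_on UNIV (dx \<phi>)" "continuous_on UNIV (dt \<phi>)"
    and df: "\<And>x t. (\<lambda>y. \<phi> (y, t)) differentiable at x" "\<And>x t. (\<lambda>s. \<phi> (x, s)) differentiable at t" by auto
  have dX: "((\<lambda>y. \<phi> (y, t)) has_real_derivative dx \<phi> (x, t)) (at x)" for x t
    using df(1)[of t x] DERIV_imp_deriv by (auto simp: dx_def real_differentiable_def)
  have dT: "((\<lambda>s. \<phi> (x, s)) has_real_derivative dt \<phi> (x, t)) (at t)" for x t
    using df(2)[of x t] DERIV_imp_deriv by (auto simp: dt_def real_differentiable_def)
  obtain S where S: "S > 0" "\<And>p. norm p > S \<Longrightarrow> \<phi> p = 0"
    using compact_supportE[of \<phi>] \<phi> by (auto simp: test_functions_def)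
  have zx: "dx \<phi> p = 0" if "norm p > S" for p
  proof -
    have "open {y. norm (y, snd p) > S}" by (intro open_Collect_less continuous_intros)
    then have "((\<lambda>y. \<phi> (y, snd p)) has_real_derivative 0) (at (fst p))"
      by (rule has_field_derivative_transform_within_open[OF DERIV_const[of 0]]) (use that S in auto)
    then show ?thesis using dX[of "snd p" "fst p"] DERIV_unique by force
  qed
  have zt: "dt \<phi> p = 0" if "norm p > S" for p
  proof -
    have "open {s. norm (fst p, s) > S}" by (intro open_Collect_less continuous_intros)
    then have "((\<lambda>s. \<phi> (fst p, s)) has_real_derivative 0) (at (snd p))"
      by (rule has_field_derivative_transform_within_open[OF DERIV_const[of 0]]) (use that S in auto)
    then show ?thesis using dT[of "fst p" "snd p"] DERIV_unique by force
  qed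
  obtain B1 where B1: "0 \<le> B1" "\<And>p. \<bar>\<phi> p\<bar> \<le> B1" using continuous_compact_bounded[OF c(1) S(2)] by metis
  obtain B2 where B2: "0 \<le> B2" "\<And>p. \<bar>dx \<phi> p\<bar> \<le> B2" using continuous_compact_bounded[OF c(2) zx] by metis
  obtain B3 where B3: "0 \<le> B3" "\<And>p. \<bar>dt \<phi> p\<bar> \<le> B3" using continuous_compact_bounded[OF c(3) zt] by metis
  define B where "B = B1 + B2 + B3"
  have BB: "B1 \<le> B" "B2 \<le> B" "B3 \<le> B" using B1(1) B2(1) B3(1) by (auto simp: B_def)
  have nS: "norm (x, t) > S" if "\<bar>x\<bar> > S" for x t :: real using that norm_fst_le[of x t] by simp
  have cc: "continuous_on UNIV (\<lambda>q::real\<times>real. g (snd q, fst q))" if "continuous_on UNIV g" for g :: "real \<times> real \<Rightarrow> real"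
    by (rule continuous_on_compose2[OF that]) (auto intro!: continuous_intros)
  show ?thesis
  proof (rule that[of S B], unfold_locales)
    show "continuous_on UNIV (\<lambda>q. \<phi> (snd q, fst q))" "continuous_on UNIV (\<lambda>q. dx \<phi> (snd q, fst q))" "continuous_on UNIV (\<lambda>q. dt \<phi> (snd q, fst q))"
      by (rule cc, rule c)+
    show "\<phi> (x, t) = 0" "dx \<phi> (x, t) = 0" "dt \<phi> (x, t) = 0" if "\<bar>x\<bar> > S" for t x
      using nS[OF that, of t] S zx zt by auto
    show "\<bar>\<phi> (x, t)\<bar> \<le> B" "\<bar>dx \<phi> (x, t)\<bar> \<le> B" "\<bar>dt \<phi> (x, t)\<bar> \<le> B" for t x
      using B1(2)[of "(x, t)"] B2(2)[of "(x, t)"] B3(2)[of "(x, t)"] BB by linarith+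
    show "\<bar>\<phi> (x + h, t) - \<phi> (x, t)\<bar> \<le> B * \<bar>h\<bar>" for t x h
      using field_differentiable_bound[of UNIV "\<lambda>y. \<phi> (y, t)" "\<lambda>y. dx \<phi> (y, t)" B "x + h" x] dX order_trans[OF B2(2) BB(2)]
      by (simp add: has_field_derivative_at_within)
    show "((\<lambda>y. \<phi> (y, t)) has_real_derivative dx \<phi> (x, t)) (at x)" for t x by (rule dX)
    show "((\<lambda>s. \<phi> (x, s)) has_real_derivative dt \<phi> (x, t)) (at t)" for t x by (rule dT)
  qed (use T S nn in auto)
qed

text \<open>Each point \<open>q\<close> excludes the single level \<open>v q\<close>, a null set;
  exchanging the two almost-everywhere quantifiers gives the claim.\<close>

lemma AE_good_level:
  fixes v :: "real \<times> real \<Rightarrow> real"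
  assumes [measurable]: "v \<in> borel_measurable borel"
  shows "AE k in lborel. AE q in lborel. v q \<noteq> k"
proof -
  have m: "{r \<in> space (lborel \<Otimes>\<^sub>M lborel). v (snd r) \<noteq> fst r} \<in> sets (lborel \<Otimes>\<^sub>M lborel :: (real \<times> (real \<times> real)) measure)"
    by measurable
  have "AE q in lborel. AE k in lborel. v q \<noteq> k"
  proof (rule AE_I2)
    fix q
    have "AE k in lborel. k \<noteq> v q" by (rule AE_lborel_singleton)
    then show "AE k in lborel. v q \<noteq> k" by eventually_elim auto
  qed
  then show ?thesis using lborel_pair.AE_commute[of "\<lambda>k q. v q \<noteq> k"] m by simp
qed

lemma AE_dense:
  fixes a b :: real
  assumes "AE t in lborel. P t" and "a < b"
  obtains s where "a < s" "s < b" "P s"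
proof (rule ccontr)
  assume c: "\<not> thesis"
  have "AE t in lborel. t \<notin> {a<..<b}" using assms(1)
    by eventually_elim (use c that in auto)
  then have "{a<..<b} \<in> null_sets lborel" by (subst (asm) AE_iff_null_sets[symmetric]) auto
  then have "emeasure lborel {a<..<b} = 0" by auto
  then show False using assms by simp
qed

locale flux_test = split_flux p m L + testfun T S B \<psi> \<psi>x \<psi>t
  for p m L T S B \<psi> \<psi>x \<psi>t +
  fixes J :: "real \<Rightarrow> real" and C :: real and v :: "real \<Rightarrow> real \<Rightarrow> real"
  assumes J: "kern J" and Jr: "\<And>r. 0 < r \<Longrightarrow> bkern (far_part r J)" and v: "L1_curve C v"
begin

lemmas nv = niceD[OF v]

definition Xg :: "real \<Rightarrow> (real \<Rightarrow> real) \<Rightarrow> (real \<Rightarrow> real) \<Rightarrow> real \<Rightarrow> real \<Rightarrow> real \<Rightarrow> real" where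
  "Xg h K a k t x = \<bar>a x - k\<bar> * \<psi>t t x + \<bar>p (a x) - p k\<bar> * ((\<psi> t (x + h) - \<psi> t x) / h)
     + \<bar>m (a x) - m k\<bar> * ((\<psi> t (x - h) - \<psi> t x) / h) + sgn (a x - k) * G K a x * \<psi> t x"

definition Xi :: "real \<Rightarrow> real \<Rightarrow> real \<Rightarrow> real" where
  "Xi k t x = \<bar>v t x - k\<bar> * \<psi>t t x + (\<bar>p (v t x) - p k\<bar> - \<bar>m (v t x) - m k\<bar>) * \<psi>x t x
     + sgn (v t x - k) * G J (v t) x * \<psi> t x"

text \<open>One majorant for all levels with \<open>|k| \<le> \<kappa>\<close>. In the factor
  \<open>1 + 2 * L\<close> the entropy itself contributes 1 and each of \<open>p\<close> and
  \<open>m\<close> contributes \<open>L\<close>.\<close>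

definition Dom :: "real \<Rightarrow> real \<Rightarrow> real \<Rightarrow> real" where
  "Dom \<kappa> t x = B * (1 + 2 * L) * \<bar>v t x\<bar> + indicator {-(S+1)..S+1} x * (B * (1 + 2 * L) * \<kappa>) + B * \<bar>G J (v t) x\<bar>"

lemma measurable_Gv: "(\<lambda>q. G J (v (fst q)) (snd q)) \<in> borel_measurable (borel :: (real\<times>real) measure)"
proof -
  have "(\<lambda>r. v (fst (fst r)) (snd r)) \<in> borel_measurable (borel :: ((real\<times>real)\<times>real) measure)"
    by (rule measurable_param_compose[OF nv(1)]; measurable)
  then show ?thesis by (rule measurable_G[OF _ kernD(2)[OF J]]; measurable)
qed

lemma measurable_Xi: "(\<lambda>q. Xi k (fst q) (snd q)) \<in> borel_measurable borel"
  and measurable_Dom: "(\<lambda>q. Dom \<kappa> (fst q) (snd q)) \<in> borel_measurable borel"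
proof -
  note [measurable] = nv(1) measurable_Gv
  show "(\<lambda>q. Xi k (fst q) (snd q)) \<in> borel_measurable borel" unfolding Xi_def by measurable
  show "(\<lambda>q. Dom \<kappa> (fst q) (snd q)) \<in> borel_measurable borel" unfolding Dom_def by measurable
qed

lemma Dom_integrable: "integrable lborel (Dom \<kappa> t)"
  unfolding Dom_def[abs_def]
  by (intro Bochner_Integration.integrable_add integrable_indicator_Icc integrable_mult_right integrable_abs nv(3) G_integrable[OF nv(2) J])

lemma Dom_bound:
  assumes "0 \<le> \<kappa>"
  shows "(LINT x|lborel. \<bar>Dom \<kappa> t x\<bar>) \<le> B * (1 + 2 * L) * C + B * (1 + 2 * L) * \<kappa> * (2 * S + 2) + B * (2 * C * kmass J)"
proof -
  have BL: "0 \<le> B * (1 + 2 * L)" using B_nonneg L_nonneg by simp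
  have nn: "0 \<le> Dom \<kappa> t x" for x unfolding Dom_def using BL assms B_nonneg L_nonneg by (intro add_nonneg_nonneg mult_nonneg_nonneg) auto
  have "(LINT x|lborel. \<bar>Dom \<kappa> t x\<bar>) = (LINT x|lborel. Dom \<kappa> t x)" using nn by simp
  also have "\<dots> = B * (1 + 2 * L) * (LINT x|lborel. \<bar>v t x\<bar>) + (LINT x|lborel. indicator {-(S+1)..S+1} x * (B * (1 + 2 * L) * \<kappa>)) + B * (LINT x|lborel. \<bar>G J (v t) x\<bar>)"
    unfolding Dom_def using nv(3)[of t] G_integrable[OF nv(2)[of t] J] integrable_indicator_Icc[of "-(S+1)" "S+1" "B * (1 + 2 * L) * \<kappa>"] by simp
  also have "(LINT x|lborel. indicator {-(S+1)..S+1} x * (B * (1 + 2 * L) * \<kappa>)) = B * (1 + 2 * L) * \<kappa> * (2 * S + 2)"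
    using S_pos by (simp add: algebra_simps)
  also have "B * (1 + 2 * L) * (LINT x|lborel. \<bar>v t x\<bar>) \<le> B * (1 + 2 * L) * C" using bvcD(2)[OF nv(2)[of t]] BL by (rule mult_left_mono)
  also have "B * (LINT x|lborel. \<bar>G J (v t) x\<bar>) \<le> B * (2 * C * kmass J)" using G_bound[OF nv(2) J] B_nonneg by (rule mult_left_mono)
  finally show ?thesis by simp
qed

lemma Dom_strip:
  assumes "0 \<le> \<kappa>"
  shows "integrable lborel (\<lambda>q. indicator {0..T} (fst q) * Dom \<kappa> (fst q) (snd q))"
  by (rule strip_integral[OF measurable_Dom Dom_integrable Dom_bound[OF assms]])

text \<open>The weights and the sign are left arbitrary so that the same estimate covers the limit
  integrand, with derivatives, and the discrete one, with difference quotients and the sign of an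
  approximation.\<close>

lemma Dom_dominates:
  assumes g: "\<bar>g1\<bar> \<le> B" "\<bar>g2\<bar> \<le> B" "\<bar>g3\<bar> \<le> B" "\<bar>g4\<bar> \<le> B" "\<bar>sg\<bar> \<le> 1"
    and z: "\<bar>x\<bar> > S + 1 \<Longrightarrow> g1 = 0" "\<bar>x\<bar> > S + 1 \<Longrightarrow> g2 = 0" "\<bar>x\<bar> > S + 1 \<Longrightarrow> g3 = 0" and k: "\<bar>k\<bar> \<le> \<kappa>"
  shows "\<bar>\<bar>v t x - k\<bar> * g1 + \<bar>p (v t x) - p k\<bar> * g2 + \<bar>m (v t x) - m k\<bar> * g3 + sg * G J (v t) x * g4\<bar> \<le> Dom \<kappa> t x"
proof -
  have BL: "0 \<le> B * (1 + 2 * L)" using B_nonneg L_nonneg by simp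
  have "\<bar>sg * G J (v t) x * g4\<bar> \<le> 1 * \<bar>G J (v t) x\<bar> * B" unfolding abs_mult using g B_nonneg by (intro mult_mono) auto
  then have 4: "\<bar>sg * G J (v t) x * g4\<bar> \<le> B * \<bar>G J (v t) x\<bar>" by (simp add: mult.commute)
  show ?thesis
  proof (cases "\<bar>x\<bar> > S + 1")
    case True
    have "0 \<le> B * (1 + 2 * L) * \<bar>v t x\<bar> + indicator {-(S+1)..S+1} x * (B * (1 + 2 * L) * \<kappa>)"
      using BL k B_nonneg L_nonneg by (intro add_nonneg_nonneg mult_nonneg_nonneg) auto
    then show ?thesis using 4 z True by (simp add: Dom_def)
  next
    case False
    have d: "\<bar>v t x - k\<bar> \<le> \<bar>v t x\<bar> + \<kappa>" using k by linarith
    have nn: "0 \<le> L * (\<bar>v t x\<bar> + \<kappa>)" using L_nonneg k by (intro mult_nonneg_nonneg) auto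
    have dL: "L * \<bar>v t x - k\<bar> \<le> L * (\<bar>v t x\<bar> + \<kappa>)" using d L_nonneg by (rule mult_left_mono)
    have 1: "\<bar>\<bar>v t x - k\<bar> * g1\<bar> \<le> (\<bar>v t x\<bar> + \<kappa>) * B" unfolding abs_mult using g d by (intro mult_mono) auto
    have 2: "\<bar>\<bar>p (v t x) - p k\<bar> * g2\<bar> \<le> L * (\<bar>v t x\<bar> + \<kappa>) * B" unfolding abs_mult using g dL p_lip[of "v t x" k] nn by (intro mult_mono) auto
    have 3: "\<bar>\<bar>m (v t x) - m k\<bar> * g3\<bar> \<le> L * (\<bar>v t x\<bar> + \<kappa>) * B" unfolding abs_mult using g dL m_lip[of "v t x" k] nn by (intro mult_mono) auto
    have "\<bar>\<bar>v t x - k\<bar> * g1 + \<bar>p (v t x) - p k\<bar> * g2 + \<bar>m (v t x) - m k\<bar> * g3 + sg * G J (v t) x * g4\<bar>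
      \<le> (\<bar>v t x\<bar> + \<kappa>) * B + L * (\<bar>v t x\<bar> + \<kappa>) * B + L * (\<bar>v t x\<bar> + \<kappa>) * B + B * \<bar>G J (v t) x\<bar>"
      by (rule order_trans[OF abs_sum4 add_mono[OF add_mono[OF add_mono[OF 1 2] 3] 4]])
    also have "\<dots> = Dom \<kappa> t x"
    proof -
      have "x \<in> {-(S+1)..S+1}" using False by auto
      then have "indicator {-(S+1)..S+1} x = (1 :: real)" by (rule indicator_simps)
      then show ?thesis unfolding Dom_def by (simp only:) (simp add: algebra_simps)
    qed
    finally show ?thesis .
  qed
qed

lemma Xi_Dom: "\<bar>k\<bar> \<le> \<kappa> \<Longrightarrow> \<bar>Xi k t x\<bar> \<le> Dom \<kappa> t x"
proof -
  assume k: "\<bar>k\<bar> \<le> \<kappa>"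
  have "\<bar>\<bar>v t x - k\<bar> * \<psi>t t x + \<bar>p (v t x) - p k\<bar> * \<psi>x t x + \<bar>m (v t x) - m k\<bar> * (- \<psi>x t x) + sgn (v t x - k) * G J (v t) x * \<psi> t x\<bar> \<le> Dom \<kappa> t x"
    using psi_bound[of t x] psi_supp[of x t] k by (intro Dom_dominates) (auto simp: sgn_if)
  then show ?thesis by (simp add: Xi_def algebra_simps)
qed

lemma Xi_integrable: "integrable lborel (Xi k t)"
proof (rule Bochner_Integration.integrable_bound[OF Dom_integrable])
  show "Xi k t \<in> borel_measurable lborel" using measurable_param_fix[OF measurable_Xi] by simp
  show "AE x in lborel. norm (Xi k t x) \<le> norm (Dom \<bar>k\<bar> t x)" using Xi_Dom[OF order_refl] by (simp add: order_trans[OF _ abs_ge_self])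
qed

lemma Xi_bound: "(LINT x|lborel. \<bar>Xi k t x\<bar>) \<le> B * (1 + 2 * L) * C + B * (1 + 2 * L) * \<bar>k\<bar> * (2 * S + 2) + B * (2 * C * kmass J)"
proof -
  have "(LINT x|lborel. \<bar>Xi k t x\<bar>) \<le> (LINT x|lborel. \<bar>Dom \<bar>k\<bar> t x\<bar>)"
    by (intro integral_mono integrable_abs Xi_integrable Dom_integrable) (use Xi_Dom[OF order_refl] in \<open>simp add: order_trans[OF _ abs_ge_self]\<close>)
  then show ?thesis using Dom_bound[of "\<bar>k\<bar>" t] by simp
qed

definition I :: "real \<Rightarrow> real" where
  "I k = (LINT q|lborel. indicator {0..T} (fst q) * Xi k (fst q) (snd q))"

text \<open>
  Levels that are attained on a null set only are harmless; the others are approached from both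
  sides, where the two one-sided limits of the sign average to \<open>sgn 0 = 0\<close>.
\<close>

lemma all_levels:
  assumes good: "\<And>k. AE q in lborel. v (fst q) (snd q) \<noteq> k \<Longrightarrow> b k \<le> I k"
    and cont: "\<And>k. isCont b k"
  shows "b k \<le> I k"
proof -
  have ae: "AE k in lborel. AE q in lborel. v (fst q) (snd q) \<noteq> k" by (rule AE_good_level[OF nv(1)])
  have pn: "0 < 1 / real (Suc n)" for n by simp
  have "\<forall>n. \<exists>k'. k < k' \<and> k' < k + 1 / real (Suc n) \<and> (AE q in lborel. v (fst q) (snd q) \<noteq> k')"
    using AE_dense[OF ae, of k "k + 1 / real (Suc n)" for n] pn by (metis less_add_same_cancel1)
  then obtain kp where kp: "\<And>n. k < kp n" "\<And>n. kp n < k + 1 / real (Suc n)" "\<And>n. AE q in lborel. v (fst q) (snd q) \<noteq> kp n" by metis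
  have "\<forall>n. \<exists>k'. k - 1 / real (Suc n) < k' \<and> k' < k \<and> (AE q in lborel. v (fst q) (snd q) \<noteq> k')"
    using AE_dense[OF ae, of "k - 1 / real (Suc n)" k for n] pn by (metis diff_less_eq less_add_same_cancel1)
  then obtain km where km: "\<And>n. k - 1 / real (Suc n) < km n" "\<And>n. km n < k" "\<And>n. AE q in lborel. v (fst q) (snd q) \<noteq> km n" by metis
  have s0: "(\<lambda>n. 1 / real (Suc n)) \<longlonglongrightarrow> 0" using LIMSEQ_inverse_real_of_nat by (simp add: inverse_eq_divide)
  have kpl: "kp \<longlonglongrightarrow> k"
    by (rule tendsto_sandwich[of "\<lambda>_. k" _ _ "\<lambda>n. k + 1 / real (Suc n)"]) (use kp tendsto_add[OF tendsto_const s0, of k] in \<open>auto intro: always_eventually less_imp_le\<close>)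
  have kml: "km \<longlonglongrightarrow> k"
    by (rule tendsto_sandwich[of "\<lambda>n. k - 1 / real (Suc n)" _ _ "\<lambda>_. k"]) (use km tendsto_diff[OF tendsto_const s0, of k] in \<open>auto intro: always_eventually less_imp_le\<close>)
  have kb: "\<bar>kp n\<bar> \<le> \<bar>k\<bar> + 1" "\<bar>km n\<bar> \<le> \<bar>k\<bar> + 1" for n
  proof -
    have "1 / real (Suc n) \<le> 1" by simp
    then show "\<bar>kp n\<bar> \<le> \<bar>k\<bar> + 1" "\<bar>km n\<bar> \<le> \<bar>k\<bar> + 1" using kp(1,2)[of n] km(1,2)[of n] by linarith+
  qed
  have ip: "isCont p u" "isCont m u" for u
  proof -
    have l: "((\<lambda>x. L * \<bar>x - u\<bar>) \<longlongrightarrow> 0) (at u)"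
    proof -
      have "((\<lambda>x. L * \<bar>x - u\<bar>) \<longlongrightarrow> L * \<bar>u - u\<bar>) (at u)" by (intro tendsto_intros)
      then show ?thesis by simp
    qed
    show "isCont p u" unfolding isCont_def by (rule LIM_zero_cancel, rule Lim_null_comparison[OF _ l]) (use p_lip in auto)
    show "isCont m u" unfolding isCont_def by (rule LIM_zero_cancel, rule Lim_null_comparison[OF _ l]) (use m_lip in auto)
  qed
  have Xs: "integrable lborel (\<lambda>q. indicator {0..T} (fst q) * Xi k' (fst q) (snd q))" for k'
    by (rule strip_integral[OF measurable_Xi Xi_integrable Xi_bound])
  have lim: "(\<lambda>n. LINT q|lborel. indicator {0..T} (fst q) * (Xi (kp n) (fst q) (snd q) + Xi (km n) (fst q) (snd q)))
     \<longlonglongrightarrow> (LINT q|lborel. indicator {0..T} (fst q) * (2 * Xi k (fst q) (snd q)))"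
  proof (rule integral_dominated_convergence[where w="\<lambda>q. 2 * (indicator {0..T} (fst q) * Dom (\<bar>k\<bar> + 1) (fst q) (snd q))"])
    show "integrable lborel (\<lambda>q. 2 * (indicator {0..T} (fst q) * Dom (\<bar>k\<bar> + 1) (fst q) (snd q)))"
      by (intro integrable_mult_right Dom_strip) simp
    show "AE q in lborel. (\<lambda>n. indicator {0..T} (fst q) * (Xi (kp n) (fst q) (snd q) + Xi (km n) (fst q) (snd q))) \<longlonglongrightarrow> indicator {0..T} (fst q) * (2 * Xi k (fst q) (snd q))"
    proof (intro AE_I2 tendsto_mult[OF tendsto_const])
      fix q :: "real \<times> real"
      define t x where "t = fst q" and "x = snd q"
      have s: "(\<lambda>n. sgn (v t x - kp n) + sgn (v t x - km n)) \<longlonglongrightarrow> 2 * sgn (v t x - k)"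
      proof (cases "v t x = k")
        case True
        then have "sgn (v t x - kp n) + sgn (v t x - km n) = 0" for n using kp(1)[of n] km(2)[of n] by simp
        then show ?thesis using True by simp
      next
        case False
        then have "isCont sgn (v t x - k)" by (intro continuous_intros) auto
        then have "(\<lambda>n. sgn (v t x - kp n) + sgn (v t x - km n)) \<longlonglongrightarrow> sgn (v t x - k) + sgn (v t x - k)"
          by (intro tendsto_add isCont_tendsto_compose[of _ sgn] tendsto_diff tendsto_const kpl kml)
        then show ?thesis by simp
      qed
      have c: "(\<lambda>n. \<bar>v t x - g n\<bar> * \<psi>t t x + (\<bar>p (v t x) - p (g n)\<bar> - \<bar>m (v t x) - m (g n)\<bar>) * \<psi>x t x) \<longlonglongrightarrow>
         \<bar>v t x - k\<bar> * \<psi>t t x + (\<bar>p (v t x) - p k\<bar> - \<bar>m (v t x) - m k\<bar>) * \<psi>x t x" if "g \<longlonglongrightarrow> k" for g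
        by (intro tendsto_intros that isCont_tendsto_compose[OF ip(1)] isCont_tendsto_compose[OF ip(2)])
      have "(\<lambda>n. (\<bar>v t x - kp n\<bar> * \<psi>t t x + (\<bar>p (v t x) - p (kp n)\<bar> - \<bar>m (v t x) - m (kp n)\<bar>) * \<psi>x t x)
         + (\<bar>v t x - km n\<bar> * \<psi>t t x + (\<bar>p (v t x) - p (km n)\<bar> - \<bar>m (v t x) - m (km n)\<bar>) * \<psi>x t x)
         + (sgn (v t x - kp n) + sgn (v t x - km n)) * (G J (v t) x * \<psi> t x)) \<longlonglongrightarrow>
         (\<bar>v t x - k\<bar> * \<psi>t t x + (\<bar>p (v t x) - p k\<bar> - \<bar>m (v t x) - m k\<bar>) * \<psi>x t x)
         + (\<bar>v t x - k\<bar> * \<psi>t t x + (\<bar>p (v t x) - p k\<bar> - \<bar>m (v t x) - m k\<bar>) * \<psi>x t x)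
         + (2 * sgn (v t x - k)) * (G J (v t) x * \<psi> t x)"
        by (intro tendsto_add c[OF kpl] c[OF kml] tendsto_mult[OF s tendsto_const])
      then have "(\<lambda>n. Xi (kp n) t x + Xi (km n) t x) \<longlonglongrightarrow> 2 * Xi k t x"
        by (simp add: Xi_def algebra_simps)
      then show "(\<lambda>n. Xi (kp n) (fst q) (snd q) + Xi (km n) (fst q) (snd q)) \<longlonglongrightarrow> 2 * Xi k (fst q) (snd q)" by (simp add: t_def x_def)
    qed
    show "AE q in lborel. norm (indicator {0..T} (fst q) * (Xi (kp n) (fst q) (snd q) + Xi (km n) (fst q) (snd q))) \<le> 2 * (indicator {0..T} (fst q) * Dom (\<bar>k\<bar> + 1) (fst q) (snd q))" for n
    proof (rule AE_I2)
      fix q :: "real \<times> real"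
      have "\<bar>Xi (kp n) (fst q) (snd q) + Xi (km n) (fst q) (snd q)\<bar> \<le> 2 * Dom (\<bar>k\<bar> + 1) (fst q) (snd q)"
        using Xi_Dom[OF kb(1)[of n], of "fst q" "snd q"] Xi_Dom[OF kb(2)[of n], of "fst q" "snd q"] by linarith
      then show "norm (indicator {0..T} (fst q) * (Xi (kp n) (fst q) (snd q) + Xi (km n) (fst q) (snd q))) \<le> 2 * (indicator {0..T} (fst q) * Dom (\<bar>k\<bar> + 1) (fst q) (snd q))"
        by (auto simp: indicator_def)
    qed
  qed (use measurable_Xi in measurable)
  have eq: "(LINT q|lborel. indicator {0..T} (fst q) * (Xi (kp n) (fst q) (snd q) + Xi (km n) (fst q) (snd q))) = I (kp n) + I (km n)" for n
    unfolding I_def distrib_left by (intro Bochner_Integration.integral_add Xs)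
  have eq2: "(LINT q|lborel. indicator {0..T} (fst q) * (2 * Xi k (fst q) (snd q))) = 2 * I k"
    unfolding I_def integral_mult_right_zero[symmetric] by (intro Bochner_Integration.integral_cong) auto
  have "(\<lambda>n. b (kp n) + b (km n)) \<longlonglongrightarrow> b k + b k"
    by (intro tendsto_add isCont_tendsto_compose[OF cont] kpl kml)
  moreover have "(\<lambda>n. I (kp n) + I (km n)) \<longlonglongrightarrow> 2 * I k" using lim by (simp only: eq eq2)
  moreover have "b (kp n) + b (km n) \<le> I (kp n) + I (km n)" for n
    by (intro add_mono good kp(3) km(3))
  ultimately have "b k + b k \<le> 2 * I k" by (intro LIMSEQ_le) auto
  then show ?thesis by simp
qed

end

section \<open>Convergence of the discrete entropy inequality\<close>

context flux_test
begin

text \<open>The operator with the singular kernel is not \<open>L1\<close>-Lipschitz, so a second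
  truncation at a fixed radius \<open>r\<close> is inserted. The near jumps of \<open>a\<close> and
  of \<open>v t\<close> cost \<open>2 * C\<close> times the near mass each, the far ones are handled
  by \<open>G_diff_w\<close>.\<close>

lemma G_limit_bound:
  assumes a: "bvc C a" and h: "0 < h" and r: "0 < r"
  shows "(LINT x|lborel. \<bar>G (far_part h J) a x - G J (v t) x\<bar>) \<le>
     2 * C * kmass (near_part h J) + 4 * C * kmass (near_part r J) + 2 * (LINT z|lborel. far_part r J z) * (LINT x|lborel. \<bar>a x - v t x\<bar>)"
proof -
  note A = bvcD[OF a]
  note i = G_integrable[OF a kern_far_part(1)[OF J, of h]] G_integrable[OF a J] G_integrable[OF a kern_far_part(1)[OF J, of r]]
    G_integrable[OF nv(2)[of t] kern_far_part(1)[OF J, of r]] G_integrable[OF nv(2)[of t] J]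
  have "(LINT x|lborel. \<bar>G (far_part h J) a x - G J (v t) x\<bar>) \<le> (LINT x|lborel. \<bar>G (far_part h J) a x - G J a x\<bar>) + (LINT x|lborel. \<bar>G J a x - G J (v t) x\<bar>)"
    by (intro L1_diff_triangle i)
  moreover have "(LINT x|lborel. \<bar>G J a x - G J (v t) x\<bar>) \<le> (LINT x|lborel. \<bar>G J a x - G (far_part r J) a x\<bar>) + (LINT x|lborel. \<bar>G (far_part r J) a x - G J (v t) x\<bar>)"
    by (intro L1_diff_triangle i)
  moreover have "(LINT x|lborel. \<bar>G (far_part r J) a x - G J (v t) x\<bar>) \<le> (LINT x|lborel. \<bar>G (far_part r J) a x - G (far_part r J) (v t) x\<bar>) + (LINT x|lborel. \<bar>G (far_part r J) (v t) x - G J (v t) x\<bar>)"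
    by (intro L1_diff_triangle i)
  moreover have "(LINT x|lborel. \<bar>G (far_part h J) a x - G J a x\<bar>) \<le> 2 * C * kmass (near_part h J)" "(LINT x|lborel. \<bar>G J a x - G (far_part r J) a x\<bar>) \<le> 2 * C * kmass (near_part r J)"
    "(LINT x|lborel. \<bar>G (far_part r J) (v t) x - G J (v t) x\<bar>) \<le> 2 * C * kmass (near_part r J)"
    using G_far_part_error[OF a J] G_far_part_error[OF nv(2) J] by (simp_all add: abs_minus_commute)
  moreover have "(LINT x|lborel. \<bar>G (far_part r J) a x - G (far_part r J) (v t) x\<bar>) \<le> 2 * (LINT z|lborel. far_part r J z) * (LINT x|lborel. \<bar>a x - v t x\<bar>)"
    by (intro G_diff_w A nv(3) bkernD[OF Jr[OF r]] bkern_integrable_pt[OF Jr[OF r]])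
  ultimately show ?thesis by linarith
qed

text \<open>The jump term \<open>G\<close> of the approximation converges in \<open>L1\<close>,
  whereas its sign converges only almost everywhere and only off the level set. The two convergences
  are used one after the other, through the intermediate integrand \<open>P\<close>.\<close>

lemma good_limit:
  assumes V: "\<And>n. L1_curve C (V n)" and h: "h \<longlonglongrightarrow> 0" "\<And>n. 0 < h n" "\<And>n. h n \<le> 1"
    and c: "\<And>n t. (LINT x|lborel. \<bar>V n t x - v t x\<bar>) \<le> c n" "c \<longlonglongrightarrow> 0"
    and ae: "\<And>t. AE x in lborel. (\<lambda>n. V n t x) \<longlonglongrightarrow> v t x"
    and k: "AE q in lborel. v (fst q) (snd q) \<noteq> k"
  shows "(\<lambda>n. LINT t|lborel. indicator {0..T} t * (LINT x|lborel. Xg (h n) (far_part (h n) J) (V n t) k t x)) \<longlonglongrightarrow> I k"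
proof -
  note NV = niceD[OF V]
  \<comment> \<open>Everything is already at the limit \<open>v\<close> except the difference
    quotients and the sign, which still belong to the approximation. Thus the difference to the
    discrete integrand is small in \<open>L1\<close>, and \<open>P\<close> itself has a majorant
    independent of \<open>n\<close>.\<close>
  define P where "P n t x = \<bar>v t x - k\<bar> * \<psi>t t x + \<bar>p (v t x) - p k\<bar> * ((\<psi> t (x + h n) - \<psi> t x) / h n)
     + \<bar>m (v t x) - m k\<bar> * ((\<psi> t (x - h n) - \<psi> t x) / h n) + sgn (V n t x - k) * G J (v t) x * \<psi> t x" for n t x
  have q: "\<bar>(\<psi> t (x + h n) - \<psi> t x) / h n\<bar> \<le> B" "\<bar>x\<bar> > S + 1 \<Longrightarrow> (\<psi> t (x + h n) - \<psi> t x) / h n = 0"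
    "\<bar>(\<psi> t (x - h n) - \<psi> t x) / h n\<bar> \<le> B" "\<bar>x\<bar> > S + 1 \<Longrightarrow> (\<psi> t (x - h n) - \<psi> t x) / h n = 0" for n t x
    using psi_quot[where h="h n" and t=t and x=x] psi_quot[where h="- h n" and t=t and x=x] h(2,3)[of n] by auto
  have PD: "\<bar>P n t x\<bar> \<le> Dom \<bar>k\<bar> t x" for n t x
    unfolding P_def by (intro Dom_dominates psi_bound q) (use psi_supp(3)[of x t] in \<open>auto simp: sgn_if\<close>)
  have [measurable]: "(\<lambda>q. V n (fst q) (snd q)) \<in> borel_measurable borel" for n by (rule NV)
  have mG [measurable]: "(\<lambda>q. G (far_part (h n) J) (V n (fst q)) (snd q)) \<in> borel_measurable (borel :: (real\<times>real) measure)" for n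
  proof -
    have "(\<lambda>r. V n (fst (fst r)) (snd r)) \<in> borel_measurable (borel :: ((real\<times>real)\<times>real) measure)"
      by (rule measurable_param_compose[OF NV(1)]; measurable)
    then show ?thesis by (rule measurable_G[OF _ measurable_far_part_near_part(1)[OF kernD(2)[OF J]]]; measurable)
  qed
  note [measurable] = nv(1) measurable_Gv
  have [measurable]: "(\<lambda>q. \<psi> (fst q) (snd q + h n)) \<in> borel_measurable (borel :: (real\<times>real) measure)" "(\<lambda>q. \<psi> (fst q) (snd q - h n)) \<in> borel_measurable (borel :: (real\<times>real) measure)" for n
    by (rule measurable_param_compose[OF measurable_psi(1)]; measurable)+
  have Pm: "(\<lambda>q. P n (fst q) (snd q)) \<in> borel_measurable borel" for n unfolding P_def by measurable
  define Xn where "Xn n t x = Xg (h n) (far_part (h n) J) (V n t) k t x" for n t x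
  have Xm: "(\<lambda>q. Xn n (fst q) (snd q)) \<in> borel_measurable borel" for n unfolding Xn_def Xg_def by measurable
  have Pmt: "P n t \<in> borel_measurable borel" "Xn n t \<in> borel_measurable borel" for n t
    using measurable_param_fix[OF Pm] measurable_param_fix[OF Xm] .
  have Pi: "integrable lborel (P n t)" for n t
    by (rule Bochner_Integration.integrable_bound[OF Dom_integrable[of "\<bar>k\<bar>" t]])
       (use Pmt PD in \<open>auto simp: order_trans[OF _ abs_ge_self]\<close>)
  define MD where "MD = B * (1 + 2 * L) * C + B * (1 + 2 * L) * \<bar>k\<bar> * (2 * S + 2) + B * (2 * C * kmass J)"
  have PM: "(LINT x|lborel. \<bar>P n t x\<bar>) \<le> MD" for n t
  proof -
    have "(LINT x|lborel. \<bar>P n t x\<bar>) \<le> (LINT x|lborel. \<bar>Dom \<bar>k\<bar> t x\<bar>)"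
      by (intro integral_mono integrable_abs Pi Dom_integrable) (use PD in \<open>simp add: order_trans[OF _ abs_ge_self]\<close>)
    then show ?thesis using Dom_bound[of "\<bar>k\<bar>" t] by (simp add: MD_def)
  qed
  have diff: "\<bar>Xn n t x - P n t x\<bar> \<le> B * (1 + 2 * L) * \<bar>V n t x - v t x\<bar> + B * \<bar>G (far_part (h n) J) (V n t) x - G J (v t) x\<bar>" for n t x
  proof -
    have e: "Xn n t x - P n t x = (\<bar>V n t x - k\<bar> - \<bar>v t x - k\<bar>) * \<psi>t t x + (\<bar>p (V n t x) - p k\<bar> - \<bar>p (v t x) - p k\<bar>) * ((\<psi> t (x + h n) - \<psi> t x) / h n)
      + (\<bar>m (V n t x) - m k\<bar> - \<bar>m (v t x) - m k\<bar>) * ((\<psi> t (x - h n) - \<psi> t x) / h n) + (sgn (V n t x - k) * (G (far_part (h n) J) (V n t) x - G J (v t) x)) * \<psi> t x"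
      by (simp add: Xn_def Xg_def P_def algebra_simps)
    have ab: "\<bar>y * g\<bar> \<le> z * B" if "\<bar>y\<bar> \<le> z" "\<bar>g\<bar> \<le> B" for y z g :: real
      unfolding abs_mult using that by (intro mult_mono) auto
    have "\<bar>Xn n t x - P n t x\<bar> \<le> \<bar>V n t x - v t x\<bar> * B + (L * \<bar>V n t x - v t x\<bar>) * B + (L * \<bar>V n t x - v t x\<bar>) * B + \<bar>G (far_part (h n) J) (V n t) x - G J (v t) x\<bar> * B"
      unfolding e using p_lip[of "V n t x" "v t x"] m_lip[of "V n t x" "v t x"]
      by (intro order_trans[OF abs_sum4] add_mono ab psi_bound q) (auto simp: abs_mult sgn_if)
    then show ?thesis by (simp add: algebra_simps)
  qed
  note gi = G_integrable[OF NV(2) kern_far_part(1)[OF J]] G_integrable[OF nv(2) J]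
  have di: "integrable lborel (\<lambda>x. B * (1 + 2 * L) * \<bar>V n t x - v t x\<bar> + B * \<bar>G (far_part (h n) J) (V n t) x - G J (v t) x\<bar>)" for n t
    by (intro Bochner_Integration.integrable_add integrable_mult_right integrable_abs Bochner_Integration.integrable_diff NV(3) nv(3) gi)
  have XPi: "integrable lborel (\<lambda>x. Xn n t x - P n t x)" for n t
    by (rule Bochner_Integration.integrable_bound[OF di[of n t]])
       (use Pmt diff[of n t] in \<open>auto simp: order_trans[OF _ abs_ge_self]\<close>)
  \<comment> \<open>For fixed \<open>r\<close> the limit in \<open>n\<close> leaves only the near
    mass at \<open>r\<close>, which is small for small \<open>r\<close>.\<close>
  define \<gamma> where "\<gamma> r n = B * (1 + 2 * L) * c n + B * (2 * C * kmass (near_part (h n) J) + 4 * C * kmass (near_part r J) + 2 * (LINT z|lborel. far_part r J z) * c n)" for r n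
  have XPb: "(LINT x|lborel. \<bar>Xn n t x - P n t x\<bar>) \<le> \<gamma> r n" if r: "0 < r" for r n t
  proof -
    have "(LINT x|lborel. \<bar>Xn n t x - P n t x\<bar>) \<le> (LINT x|lborel. B * (1 + 2 * L) * \<bar>V n t x - v t x\<bar> + B * \<bar>G (far_part (h n) J) (V n t) x - G J (v t) x\<bar>)"
      by (intro integral_mono integrable_abs XPi di diff)
    also have "\<dots> = B * (1 + 2 * L) * (LINT x|lborel. \<bar>V n t x - v t x\<bar>) + B * (LINT x|lborel. \<bar>G (far_part (h n) J) (V n t) x - G J (v t) x\<bar>)"
    proof -
      have "integrable lborel (\<lambda>x. \<bar>V n t x - v t x\<bar>)" "integrable lborel (\<lambda>x. \<bar>G (far_part (h n) J) (V n t) x - G J (v t) x\<bar>)"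
        by (intro integrable_abs Bochner_Integration.integrable_diff NV(3) nv(3) gi)+
      then show ?thesis by simp
    qed
    also have "\<dots> \<le> \<gamma> r n" unfolding \<gamma>_def
    proof (intro add_mono mult_left_mono c)
      have "2 * (LINT z|lborel. far_part r J z) * (LINT x|lborel. \<bar>V n t x - v t x\<bar>) \<le> 2 * (LINT z|lborel. far_part r J z) * c n"
        using c(1)[of n t] bkernD(5)[OF Jr[OF r]] by (intro mult_left_mono) auto
      then show "(LINT x|lborel. \<bar>G (far_part (h n) J) (V n t) x - G J (v t) x\<bar>) \<le> 2 * C * kmass (near_part (h n) J) + 4 * C * kmass (near_part r J) + 2 * (LINT z|lborel. far_part r J z) * c n"
        using G_limit_bound[OF NV(2)[of n t] h(2)[of n] r, of t] by linarith
    qed (use B_nonneg L_nonneg in auto)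
    finally show ?thesis .
  qed
  have XPm: "(\<lambda>q. Xn n (fst q) (snd q) - P n (fst q) (snd q)) \<in> borel_measurable borel" for n using Xm Pm by measurable
  have it: "integrable lborel (\<lambda>t. indicator {0..T} t * (LINT x|lborel. P n t x))"
    "integrable lborel (\<lambda>t. indicator {0..T} t * (LINT x|lborel. Xn n t x - P n t x))" for n
    by (rule strip_integral_Q(3)[OF Pm Pi PM], rule strip_integral_Q(3)[OF XPm XPi XPb[OF zero_less_one]])
  have Xsplit: "(LINT t|lborel. indicator {0..T} t * (LINT x|lborel. Xn n t x)) =
     (LINT t|lborel. indicator {0..T} t * (LINT x|lborel. Xn n t x - P n t x)) + (LINT t|lborel. indicator {0..T} t * (LINT x|lborel. P n t x))" for n
  proof -
    have "(LINT x|lborel. Xn n t x) = (LINT x|lborel. Xn n t x - P n t x) + (LINT x|lborel. P n t x)" for t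
      using Bochner_Integration.integral_add[OF XPi[of n t] Pi[of n t]] by simp
    then show ?thesis using it[of n] by (simp add: distrib_left)
  qed
  have s1: "(\<lambda>n. LINT t|lborel. indicator {0..T} t * (LINT x|lborel. Xn n t x - P n t x)) \<longlonglongrightarrow> 0"
  proof (rule LIMSEQ_I)
    fix e :: real assume e: "0 < e"
    have le: "\<bar>LINT t|lborel. indicator {0..T} t * (LINT x|lborel. Xn n t x - P n t x)\<bar> \<le> T * \<gamma> r n" if r: "0 < r" for r n
    proof -
      have "\<bar>LINT t|lborel. indicator {0..T} t * (LINT x|lborel. Xn n t x - P n t x)\<bar> \<le> (LINT t|lborel. indicator {0..T} t * \<gamma> r n)"
      proof (intro order_trans[OF integral_abs_bound] integral_mono integrable_abs it integrable_indicator_Icc)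
        fix t
        have "\<bar>LINT x|lborel. Xn n t x - P n t x\<bar> \<le> \<gamma> r n" using integral_abs_bound XPb[OF r] by (rule order_trans)
        then show "\<bar>indicator {0..T} t * (LINT x|lborel. Xn n t x - P n t x)\<bar> \<le> indicator {0..T} t * \<gamma> r n" by (auto simp: indicator_def)
      qed
      also have "\<dots> = T * \<gamma> r n" using T_pos by simp
      finally show ?thesis .
    qed
    have hk: "(\<lambda>n. kmass (near_part (h n) J)) \<longlonglongrightarrow> 0" by (rule kmass_near_part_tendsto[OF J h(1)])
    have "(\<lambda>n. T * (B * (4 * C * kmass (near_part (h n) J)))) \<longlonglongrightarrow> T * (B * (4 * C * 0))" by (intro tendsto_intros hk)
    then have "(\<lambda>n. T * (B * (4 * C * kmass (near_part (h n) J)))) \<longlonglongrightarrow> 0" by simp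
    \<comment> \<open>The auxiliary radius is picked among the values of \<open>h\<close>, which
      reuses the convergence of the near masses along \<open>h\<close>; it is frozen before
      \<open>n\<close> tends to infinity.\<close>
    from order_tendstoD(2)[OF this e] obtain n1 where n1: "T * (B * (4 * C * kmass (near_part (h n1) J))) < e" by (auto simp: eventually_sequentially)
    let ?r = "h n1"
    have "(\<lambda>n. T * \<gamma> ?r n) \<longlonglongrightarrow> T * (B * (1 + 2 * L) * 0 + B * (2 * C * 0 + 4 * C * kmass (near_part ?r J) + 2 * (LINT z|lborel. far_part ?r J z) * 0))"
      unfolding \<gamma>_def by (intro tendsto_intros hk c)
    then have "(\<lambda>n. T * \<gamma> ?r n) \<longlonglongrightarrow> T * (B * (4 * C * kmass (near_part ?r J)))" by simp
    from order_tendstoD(2)[OF this n1] obtain n0 where "\<And>n. n \<ge> n0 \<Longrightarrow> T * \<gamma> ?r n < e" by (auto simp: eventually_sequentially)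
    then show "\<exists>n0. \<forall>n\<ge>n0. norm ((LINT t|lborel. indicator {0..T} t * (LINT x|lborel. Xn n t x - P n t x)) - 0) < e"
      using le[OF h(2)[of n1]] by (intro exI[of _ n0]) (auto intro: le_less_trans)
  qed
  have filt: "filterlim h (at 0) sequentially" "filterlim (\<lambda>n. - h n) (at 0) sequentially"
    using h(1) h(2)[THEN less_imp_neq, symmetric] tendsto_minus[OF h(1)] by (simp_all add: filterlim_at always_eventually)
  have quot: "(\<lambda>n. (\<psi> t (x + h n) - \<psi> t x) / h n) \<longlonglongrightarrow> \<psi>x t x" "(\<lambda>n. (\<psi> t (x - h n) - \<psi> t x) / h n) \<longlonglongrightarrow> - \<psi>x t x" for t x
  proof -
    have d: "((\<lambda>h. (\<psi> t (x + h) - \<psi> t x) / h) \<longlongrightarrow> \<psi>x t x) (at 0)" using psi_deriv(1)[where t=t and x=x] by (simp add: DERIV_def)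
    show "(\<lambda>n. (\<psi> t (x + h n) - \<psi> t x) / h n) \<longlonglongrightarrow> \<psi>x t x" by (rule filterlim_compose[OF d filt(1)])
    have "(\<lambda>n. - ((\<psi> t (x + - h n) - \<psi> t x) / - h n)) \<longlonglongrightarrow> - \<psi>x t x" by (intro tendsto_minus filterlim_compose[OF d filt(2)])
    then show "(\<lambda>n. (\<psi> t (x - h n) - \<psi> t x) / h n) \<longlonglongrightarrow> - \<psi>x t x" by simp
  qed
  have k': "AE t in lborel. AE x in lborel. v t x \<noteq> k"
  proof -
    have "AE q in (lborel \<Otimes>\<^sub>M lborel :: (real \<times> real) measure). v (fst q) (snd q) \<noteq> k"
      unfolding lborel_prod by (rule k)
    from lborel_pair.AE_pair[OF this] show ?thesis by simp
  qed
  have s2: "(\<lambda>n. LINT t|lborel. indicator {0..T} t * (LINT x|lborel. P n t x)) \<longlonglongrightarrow> (LINT t|lborel. indicator {0..T} t * (LINT x|lborel. Xi k t x))"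
  proof (rule integral_dominated_convergence[where w="\<lambda>t. indicator {0..T} t * MD"])
    show "AE t in lborel. (\<lambda>n. indicator {0..T} t * (LINT x|lborel. P n t x)) \<longlonglongrightarrow> indicator {0..T} t * (LINT x|lborel. Xi k t x)"
      using k'
    proof eventually_elim
      case (elim t)
      have "(\<lambda>n. LINT x|lborel. P n t x) \<longlonglongrightarrow> (LINT x|lborel. Xi k t x)"
      proof (rule integral_dominated_convergence[where w="Dom \<bar>k\<bar> t"])
        show "AE x in lborel. (\<lambda>n. P n t x) \<longlonglongrightarrow> Xi k t x"
          using elim ae[of t]
        proof eventually_elim
          case (elim x)
          then have "isCont sgn (v t x - k)" by (intro continuous_intros) auto
          then have s: "(\<lambda>n. sgn (V n t x - k)) \<longlonglongrightarrow> sgn (v t x - k)"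
            by (intro isCont_tendsto_compose[of _ sgn] tendsto_diff tendsto_const elim)
          have "(\<lambda>n. P n t x) \<longlonglongrightarrow> \<bar>v t x - k\<bar> * \<psi>t t x + \<bar>p (v t x) - p k\<bar> * \<psi>x t x + \<bar>m (v t x) - m k\<bar> * (- \<psi>x t x) + sgn (v t x - k) * G J (v t) x * \<psi> t x"
            unfolding P_def by (intro tendsto_intros quot s)
          then show ?case by (simp add: Xi_def algebra_simps)
        qed
        show "AE x in lborel. norm (P n t x) \<le> Dom \<bar>k\<bar> t x" for n using PD by simp
      qed (use Pmt Xi_integrable Dom_integrable in auto)
      then show ?case by (intro tendsto_mult tendsto_const)
    qed
    show "AE t in lborel. norm (indicator {0..T} t * (LINT x|lborel. P n t x)) \<le> indicator {0..T} t * MD" for n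
    proof (rule AE_I2)
      fix t
      have "\<bar>LINT x|lborel. P n t x\<bar> \<le> MD" using integral_abs_bound PM by (rule order_trans)
      then show "norm (indicator {0..T} t * (LINT x|lborel. P n t x)) \<le> indicator {0..T} t * MD" by (auto simp: indicator_def)
    qed
  qed (use it strip_integral_Q(3)[OF measurable_Xi Xi_integrable Xi_bound] integrable_indicator_Icc[of 0 T MD] in auto)
  have "(LINT t|lborel. indicator {0..T} t * (LINT x|lborel. Xi k t x)) = I k"
    using lborel_fubini_fst[OF strip_integral[OF measurable_Xi Xi_integrable Xi_bound, of 0 T k]] by (simp add: I_def)
  then have "(\<lambda>n. LINT t|lborel. indicator {0..T} t * (LINT x|lborel. Xn n t x)) \<longlonglongrightarrow> 0 + I k"
    unfolding Xsplit using s1 s2 by (intro tendsto_add) auto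
  then show ?thesis by (simp add: Xn_def)
qed

lemma boundary_isCont:
  assumes a: "bvc C a"
  shows "isCont (\<lambda>k. LINT x|lborel. \<bar>a x - k\<bar> * \<psi> t x) k"
  unfolding isCont_def
proof (rule LIM_zero_cancel, rule Lim_null_comparison)
  have "\<bar>u - v\<bar> \<le> 1 * \<bar>u - v\<bar>" for u v :: real by simp
  note sl1 = slice[where r="\<lambda>u. u" and L'=1 and B'=B, OF a this, of "\<psi> t"]
  have i: "integrable lborel (\<lambda>x. \<bar>a x - k\<bar> * \<psi> t x)" for k by (rule sl1(1)) (auto intro: psi_bound psi_supp)
  show "\<forall>\<^sub>F k' in at k. norm ((LINT x|lborel. \<bar>a x - k'\<bar> * \<psi> t x) - (LINT x|lborel. \<bar>a x - k\<bar> * \<psi> t x)) \<le> \<bar>k' - k\<bar> * (LINT x|lborel. \<bar>\<psi> t x\<bar>)"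
  proof (intro always_eventually allI)
    fix k'
    have "(LINT x|lborel. \<bar>a x - k'\<bar> * \<psi> t x) - (LINT x|lborel. \<bar>a x - k\<bar> * \<psi> t x) = (LINT x|lborel. \<bar>a x - k'\<bar> * \<psi> t x - \<bar>a x - k\<bar> * \<psi> t x)"
      by (intro Bochner_Integration.integral_diff[symmetric] i)
    also have "\<bar>\<dots>\<bar> \<le> (LINT x|lborel. \<bar>k' - k\<bar> * \<bar>\<psi> t x\<bar>)"
      by (intro order_trans[OF integral_abs_bound] integral_mono integrable_abs Bochner_Integration.integrable_diff i integrable_mult_right psi_integrable)
         (auto simp: left_diff_distrib[symmetric] abs_mult intro!: mult_right_mono)
    finally show "norm ((LINT x|lborel. \<bar>a x - k'\<bar> * \<psi> t x) - (LINT x|lborel. \<bar>a x - k\<bar> * \<psi> t x)) \<le> \<bar>k' - k\<bar> * (LINT x|lborel. \<bar>\<psi> t x\<bar>)" by simp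
  qed
  have "((\<lambda>k'. \<bar>k' - k\<bar> * (LINT x|lborel. \<bar>\<psi> t x\<bar>)) \<longlongrightarrow> \<bar>k - k\<bar> * (LINT x|lborel. \<bar>\<psi> t x\<bar>)) (at k)" by (intro tendsto_intros)
  then show "((\<lambda>k'. \<bar>k' - k\<bar> * (LINT x|lborel. \<bar>\<psi> t x\<bar>)) \<longlongrightarrow> 0) (at k)" by simp
qed

lemma boundary_limit:
  assumes V: "\<And>n. bvc C (V n)" and c: "\<And>n. (LINT x|lborel. \<bar>V n x - v t x\<bar>) \<le> c n" "c \<longlonglongrightarrow> 0"
  shows "(\<lambda>n. LINT x|lborel. \<bar>V n x - k\<bar> * \<psi> t x) \<longlonglongrightarrow> (LINT x|lborel. \<bar>v t x - k\<bar> * \<psi> t x)"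
proof (rule LIM_zero_cancel, rule Lim_null_comparison)
  have e: "\<bar>u - v\<bar> \<le> 1 * \<bar>u - v\<bar>" for u v :: real by simp
  have i: "integrable lborel (\<lambda>x. \<bar>a x - k\<bar> * \<psi> t x)" if "bvc C a" for a
    by (rule slice(1)[where r="\<lambda>u. u" and L'=1 and B'=B, OF that e]) (auto intro: psi_bound psi_supp)
  note iv = i[OF V] i[OF nv(2)]
  show "\<forall>\<^sub>F n in sequentially. norm ((LINT x|lborel. \<bar>V n x - k\<bar> * \<psi> t x) - (LINT x|lborel. \<bar>v t x - k\<bar> * \<psi> t x)) \<le> B * c n"
  proof (intro always_eventually allI)
    fix n
    have di: "integrable lborel (\<lambda>x. \<bar>V n x - v t x\<bar>)" using bvcD(1)[OF V] nv(3) by simp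
    have "(LINT x|lborel. \<bar>V n x - k\<bar> * \<psi> t x) - (LINT x|lborel. \<bar>v t x - k\<bar> * \<psi> t x) = (LINT x|lborel. \<bar>V n x - k\<bar> * \<psi> t x - \<bar>v t x - k\<bar> * \<psi> t x)"
      by (intro Bochner_Integration.integral_diff[symmetric] iv)
    also have "\<bar>\<dots>\<bar> \<le> (LINT x|lborel. B * \<bar>V n x - v t x\<bar>)"
    proof (intro order_trans[OF integral_abs_bound] integral_mono integrable_abs Bochner_Integration.integrable_diff iv integrable_mult_right di)
      fix x
      have "\<bar>\<bar>V n x - k\<bar> - \<bar>v t x - k\<bar>\<bar> * \<bar>\<psi> t x\<bar> \<le> \<bar>V n x - v t x\<bar> * B" by (intro mult_mono psi_bound) auto
      then show "\<bar>\<bar>V n x - k\<bar> * \<psi> t x - \<bar>v t x - k\<bar> * \<psi> t x\<bar> \<le> B * \<bar>V n x - v t x\<bar>"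
        by (simp only: left_diff_distrib[symmetric] abs_mult mult.commute[of B])
    qed (use bvcD(1)[OF V] nv(3) in auto)
    also have "\<dots> = B * (LINT x|lborel. \<bar>V n x - v t x\<bar>)" by simp
    also have "\<dots> \<le> B * c n" using c(1) B_nonneg by (rule mult_left_mono)
    finally show "norm ((LINT x|lborel. \<bar>V n x - k\<bar> * \<psi> t x) - (LINT x|lborel. \<bar>v t x - k\<bar> * \<psi> t x)) \<le> B * c n" by simp
  qed
  show "(\<lambda>n. B * c n) \<longlonglongrightarrow> 0" using tendsto_mult_right_zero[OF c(2)] .
qed

end

section \<open>Well-posedness\<close>

text \<open>Of the constant \<open>12 * C * R\<close>, a third comes from \<open>comparison\<close>
  and a third from the initial trace of each solution. One \<open>C\<close> must serve both
  solutions and the datum, hence the maximum. The mollifier radius is arbitrary, so the distance is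
  zero.\<close>

lemma uniqueness:
  assumes lam: "0 < lam" "lam < 1" and T: "0 < T" and sf: "split_flux p m L" and pm: "\<And>u. p u - m u = f u - f 0"
    and u0: "bvc C0 u0" and s1: "BV_entropy_solution lam T f u0 u1" and s2: "BV_entropy_solution lam T f u0 u2"
    and t: "t \<in> {0..T}"
  shows "AE x in lborel. u1 (x, t) = u2 (x, t)"
proof -
  obtain C1 where C1: "L1_curve C1 (slices T u1)" using s1 L1_curve_of_spaces[OF T] unfolding BV_entropy_solution_def by metis
  obtain C2 where C2: "L1_curve C2 (slices T u2)" using s2 L1_curve_of_spaces[OF T] unfolding BV_entropy_solution_def by metis
  define C where "C = max C0 (max C1 C2)"
  have n1: "L1_curve C (slices T u1)" and n2: "L1_curve C (slices T u2)" and b: "bvc C u0"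
    using L1_curve_mono[OF C1] L1_curve_mono[OF C2] bvc_mono[OF u0] by (auto simp: C_def)
  note N1 = niceD[OF n1] and N2 = niceD[OF n2]
  have le: "(LINT x|lborel. \<bar>slices T u1 t x - slices T u2 t x\<bar>) \<le> 12 * C * R" if R: "0 < R" for R
  proof -
    interpret split_flux p m L by fact
    interpret moll "mollifier R" "deriv (mollifier R)" R by (rule moll_mollifier[OF R])
    interpret flux_mollifier p m L R lam f by unfold_locales (use kern_J[OF lam] pm R in auto)
    note e1 = exact_approx_sol[OF T s1 n1 b] and e2 = exact_approx_sol[OF T s2 n2 b]
    have "(LINT x|lborel. \<bar>slices T u1 t x - slices T u2 t x\<bar>) \<le> (LINT x|lborel. \<bar>slices T u1 0 x - slices T u2 0 x\<bar>) + (0 + 0) * t + 4 * C * R"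
      by (rule comparison[OF n1 n2 e1(1) e2(1)]) (use t in auto)
    moreover have "(LINT x|lborel. \<bar>slices T u1 0 x - slices T u2 0 x\<bar>) \<le> (LINT x|lborel. \<bar>slices T u1 0 x - u0 x\<bar>) + (LINT x|lborel. \<bar>u0 x - slices T u2 0 x\<bar>)"
      by (intro L1_diff_triangle N1(3) N2(3) bvcD(1)[OF b])
    ultimately show ?thesis using e1(2) e2(2) by (simp add: abs_minus_commute)
  qed
  have "(LINT x|lborel. \<bar>slices T u1 t x - slices T u2 t x\<bar>) \<le> 0"
  proof (rule field_le_epsilon)
    fix e :: real assume e: "0 < e"
    have C: "0 \<le> C" using bvcD(4)[OF b] .
    have "12 * C * (e / (12 * C + 1)) \<le> e" using e C by (simp add: field_simps)
    moreover have "0 < e / (12 * C + 1)" using e C by simp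
    ultimately show "(LINT x|lborel. \<bar>slices T u1 t x - slices T u2 t x\<bar>) \<le> 0 + e" using le[of "e / (12 * C + 1)"] by linarith
  qed
  moreover have "0 \<le> (LINT x|lborel. \<bar>slices T u1 t x - slices T u2 t x\<bar>)" by simp
  ultimately have z: "(LINT x|lborel. \<bar>slices T u1 t x - slices T u2 t x\<bar>) = 0" by linarith
  have "integrable lborel (\<lambda>x. \<bar>slices T u1 t x - slices T u2 t x\<bar>)" using N1(3) N2(3) by simp
  from integral_nonneg_eq_0_iff_AE[OF this] z
  have "AE x in lborel. \<bar>slices T u1 t x - slices T u2 t x\<bar> = 0" by simp
  then show ?thesis by eventually_elim (use t in \<open>simp add: slices_def clamp_def\<close>)
qed

text \<open>\<open>comparison\<close> is used on pairs of approximations with zero initial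
  difference, which makes the polygons Cauchy in \<open>L1\<close> uniformly in time without any
  compactness argument. The entropy inequality then passes to the limit along the
  subsequence.\<close>

lemma existence:
  assumes lam: "0 < lam" "lam < 1" and T: "0 < T" and sf: "split_flux p m L" and pm: "\<And>u. p u - m u = f u - f 0"
    and u0: "bvc C u0"
  shows "\<exists>u. BV_entropy_solution lam T f u0 u"
proof -
  interpret split_flux p m L by fact
  let ?J = "J lam"
  have kJ: "kern ?J" by (rule kern_J[OF lam])
  have bJ: "bkern (far_part r ?J)" if "0 < r" for r by (rule bkern_far_part_J[OF lam that])
  define h where "h n = 1 / real (Suc n)" for n
  have h: "0 < h n" "h n \<le> 1" for n by (auto simp: h_def)
  have hl: "h \<longlonglongrightarrow> 0" unfolding h_def[abs_def] using LIMSEQ_inverse_real_of_nat by (simp add: inverse_eq_divide)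
  define \<mu> where "\<mu> n = (LINT z|lborel. far_part (h n) ?J z)" for n
  define DD where "DD n = 2 * L * C + 2 * C * kmass (far_part (h n) ?J)" for n
  define \<Lambda> where "\<Lambda> n = 4 * L / h n + 2 * \<mu> n" for n
  \<comment> \<open>The number of time steps depends on \<open>h n\<close>: it enforces the CFL
    condition and makes the defect of \<open>slope_error\<close>, whose Lipschitz constant is
    \<open>\<Lambda> n\<close>, at most \<open>1 / real (Suc n)\<close>. The step divides
    \<open>T\<close>, so the last node is the final time.\<close>
  have "\<exists>N>0. T / real N * (L / h n + \<mu> n) \<le> 1 \<and> \<Lambda> n * (T / real N * DD n) \<le> 1 / real (Suc n)" for n
  proof -
    obtain N where N: "max (T * (L / h n + \<mu> n)) (max 1 (real (Suc n) * (\<Lambda> n * T * DD n))) < real N"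
      using reals_Archimedean2 by blast
    then have pos: "0 < real N" by simp
    have "T * (L / h n + \<mu> n) \<le> real N" "\<Lambda> n * T * DD n * real (Suc n) \<le> real N" using N by (auto simp: mult.commute)
    then have "T / real N * (L / h n + \<mu> n) \<le> 1" "\<Lambda> n * (T / real N * DD n) \<le> 1 / real (Suc n)"
      using pos by (auto simp: divide_le_eq le_divide_eq mult.assoc)
    then show ?thesis using pos by (intro exI[of _ N]) auto
  qed
  then obtain N where N: "\<And>n. 0 < N n" "\<And>n. T / real (N n) * (L / h n + \<mu> n) \<le> 1"
    "\<And>n. \<Lambda> n * (T / real (N n) * DD n) \<le> 1 / real (Suc n)" by metis
  define \<delta> where "\<delta> n = T / real (N n)" for n
  have N\<delta>: "real (N n) * \<delta> n = T" for n using N(1)[of n] by (simp add: \<delta>_def)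
  have \<delta>0: "0 < \<delta> n" for n using N(1)[of n] T by (simp add: \<delta>_def)
  interpret E: euler p m L "h n" "far_part (h n) ?J" "\<delta> n" "N n" u0 C for n
    by unfold_locales (use bJ h \<delta>0 N(2) u0 in \<open>auto simp: \<delta>_def \<mu>_def\<close>)
  have DD: "E.D n = DD n" for n by (simp add: E.D_def DD_def)
  have errb: "(4 * L / h n + 2 * (LINT z|lborel. far_part (h n) ?J z)) * (\<delta> n * E.D n) \<le> 1 / real (Suc n)" for n
    using N(3)[of n] by (simp add: DD \<delta>_def \<Lambda>_def \<mu>_def)
  have cauchy: "\<exists>n0. \<forall>n\<ge>n0. \<forall>k\<ge>n0. \<forall>t. (LINT x|lborel. \<bar>E.polygon n t x - E.polygon k t x\<bar>) \<le> e" if e: "0 < e" for e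
  proof -
    \<comment> \<open>The mollification error \<open>4 * C * R\<close> takes half of
      \<open>e\<close>; the summand 1 covers \<open>C = 0\<close>. The consistency errors of the two
      approximations take a quarter each.\<close>
    define R where "R = e / (2 * (4 * C + 1))"
    have C: "0 \<le> C" using bvcD(4)[OF u0] .
    have R: "0 < R" using e C by (simp add: R_def)
    have R4: "4 * C * R \<le> e / 2" using e C by (simp add: R_def field_simps)
    interpret FM: moll "mollifier R" "deriv (mollifier R)" R by (rule moll_mollifier[OF R])
    interpret FM: flux_moll p m L "mollifier R" "deriv (mollifier R)" R ?J by unfold_locales (rule kJ)
    interpret EM: euler_moll p m L "mollifier R" "deriv (mollifier R)" R ?J "h n" "h n" "\<delta> n" "N n" u0 C for n
      by unfold_locales
    define \<epsilon> where "\<epsilon> n = 4 * L * C * FM.quot_err (h n) + 2 * C * kmass (near_part (h n) ?J) + 1 / real (Suc n)" for n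
    have approx_sol: "FM.approx_sol C T (E.polygon n) (\<epsilon> n)" for n
    proof -
      have "FM.approx_sol C T (E.polygon n) (4 * L * C * FM.quot_err (h n) + 2 * C * kmass (near_part (h n) ?J) + EM.err n)"
        using EM.polygon_approx_sol[of n] by (simp add: N\<delta>)
      moreover have "4 * L * C * FM.quot_err (h n) + 2 * C * kmass (near_part (h n) ?J) + EM.err n \<le> \<epsilon> n"
        unfolding \<epsilon>_def EM.err_def using errb[of n] by simp
      ultimately show ?thesis unfolding FM.approx_sol_def
        by (meson add_left_mono diff_ge_0_iff_ge mult_right_mono order_trans)
    qed
    have "\<epsilon> \<longlonglongrightarrow> 4 * L * C * 0 + 2 * C * 0 + 0"
      unfolding \<epsilon>_def[abs_def] using LIMSEQ_inverse_real_of_nat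
      by (intro tendsto_intros FM.quot_err_tendsto[OF hl h] kmass_near_part_tendsto[OF kJ hl]) (simp add: inverse_eq_divide)
    then have el: "(\<lambda>n. \<epsilon> n * T) \<longlonglongrightarrow> 0" using tendsto_mult_left_zero[of \<epsilon> sequentially T] by simp
    obtain n0 where n0: "\<And>n. n \<ge> n0 \<Longrightarrow> \<epsilon> n * T < e / 4"
      using order_tendstoD(2)[OF el, of "e/4"] e by (auto simp: eventually_sequentially)
    have \<epsilon>0: "0 \<le> \<epsilon> n" for n
      unfolding \<epsilon>_def FM.quot_err_def using L_nonneg C kernD(4)[OF kern_far_part(2)[OF kJ]] by (intro add_nonneg_nonneg mult_nonneg_nonneg) auto
    have in_T: "(LINT x|lborel. \<bar>E.polygon n t x - E.polygon k t x\<bar>) \<le> e" if nk: "n \<ge> n0" "k \<ge> n0" and t: "t \<in> {0..T}" for n k t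
    proof -
      have z: "(LINT x|lborel. \<bar>E.polygon n 0 x - E.polygon k 0 x\<bar>) = 0" by (simp add: E.polygon_0)
      have "(LINT x|lborel. \<bar>E.polygon n t x - E.polygon k t x\<bar>) \<le> (LINT x|lborel. \<bar>E.polygon n 0 x - E.polygon k 0 x\<bar>) + (\<epsilon> n + \<epsilon> k) * t + 4 * C * R"
        by (rule FM.comparison[OF E.L1_curve_polygon E.L1_curve_polygon approx_sol approx_sol]) (use t in auto)
      also have "(\<epsilon> n + \<epsilon> k) * t \<le> (\<epsilon> n + \<epsilon> k) * T" using t \<epsilon>0[of n] \<epsilon>0[of k] by (intro mult_left_mono) auto
      also have "\<dots> \<le> e / 2" using n0[OF nk(1)] n0[OF nk(2)] by (simp add: distrib_right)
      finally show ?thesis using R4 z by simp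
    qed
    \<comment> \<open>\<open>L1_uniform_limit\<close> asks for all real times. Before 0 all polygons
      equal \<open>u0\<close>, and after \<open>T\<close> each keeps its value at
      \<open>T\<close>.\<close>
    have "(LINT x|lborel. \<bar>E.polygon n t x - E.polygon k t x\<bar>) \<le> e" if nk: "n \<ge> n0" "k \<ge> n0" for n k t
    proof -
      consider "t \<in> {0..T}" | "t < 0" | "T < t" by fastforce
      then show ?thesis
      proof cases
        case 2
        then show ?thesis using e by (simp add: E.polygon_0)
      next
        case 3
        have "E.polygon n t = E.polygon n T" for n
          using E.polygon_T[of n t] E.polygon_T[of n T] 3 by (simp add: N\<delta> ext)
        then show ?thesis using in_T[OF nk, of T] T by simp
      qed (rule in_T[OF nk])
    qed
    then show ?thesis by blast
  qed
  obtain v s where nv: "L1_curve C v" and s: "strict_mono s" and vs: "\<And>n t. (LINT x|lborel. \<bar>E.polygon (s n) t x - v t x\<bar>) \<le> 2 * (1/2) ^ n"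
    and ae: "\<And>t. AE x in lborel. (\<lambda>n. E.polygon (s n) t x) \<longlonglongrightarrow> v t x"
    by (rule L1_uniform_limit[of C E.polygon, OF E.L1_curve_polygon cauchy]) (assumption, rule that, assumption, assumption, blast+)
  note NV = niceD[OF nv]
  have c0: "(\<lambda>n. 2 * (1/2) ^ n :: real) \<longlonglongrightarrow> 0" by (intro tendsto_mult_right_zero LIMSEQ_power_zero) simp
  define u where "u = (\<lambda>q. v (snd q) (fst q))"
  have um: "u \<in> borel_measurable borel" unfolding u_def by (rule measurable_param_compose[OF NV(1)]; measurable)
  have "u \<in> Linf_Q T"
  proof -
    have Qm: "Q T \<in> sets borel" unfolding Q_def by (intro borel_open open_Times) auto
    have m: "{q \<in> space (lborel \<Otimes>\<^sub>M lborel). \<bar>u q\<bar> \<le> C} \<in> sets (lborel \<Otimes>\<^sub>M lborel :: (real \<times> real) measure)"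
      unfolding lborel_prod using um by measurable
    \<comment> \<open>The bound by \<open>C\<close> holds in almost every point of each slice;
      commuting the quantifiers yields it almost everywhere in the plane, which gives membership in
      \<open>Linf_Q\<close>.\<close>
    have "AE t in lborel. AE x in lborel. \<bar>u (x, t)\<bar> \<le> C"
      using AE_bounded_bvc[OF NV(2)] by (auto simp: u_def)
    then have "AE x in lborel. AE t in lborel. \<bar>u (x, t)\<bar> \<le> C"
      using lborel_pair.AE_commute[of "\<lambda>x t. \<bar>u (x, t)\<bar> \<le> C"] m by simp
    from lborel_pair.AE_pair_measure[OF m this]
    have "AE q in lborel. \<bar>u q\<bar> \<le> C" unfolding lborel_prod .
    then show ?thesis unfolding Linf_Q_def set_borel_measurable_def using um Qm by (auto elim!: eventually_mono)
  qed
  moreover have "u \<in> C_L1 T"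
    unfolding C_L1_def u_def using NV(3) NV(4) by (auto intro: tendsto_mono[OF at_le])
  moreover have "u \<in> Linf_BV T"
    unfolding Linf_BV_def u_def using bvc_imp_BV[OF NV(2)] by auto
  moreover have "(LINT (x, t):Q T|lborel.
            \<eta> k (u (x, t)) * dt \<phi> (x, t) + entropy_flux f k (u (x, t)) * dx \<phi> (x, t)
            + \<eta>' k (u (x, t)) * frac_laplace lam (\<lambda>y. u (y, t)) x * \<phi> (x, t))
        + (LINT x|lborel. \<eta> k (u0 x) * \<phi> (x, 0))
        - (LINT x|lborel. \<eta> k (u (x, T)) * \<phi> (x, T)) \<ge> 0"
    if \<phi>: "\<phi> \<in> test_functions" and pos: "\<forall>x. \<forall>t\<in>{0..T}. \<phi> (x, t) \<ge> 0" for k \<phi>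
  proof -
    obtain S B where tf: "testfun T S B (\<lambda>t x. \<phi> (x, t)) (\<lambda>t x. dx \<phi> (x, t)) (\<lambda>t x. dt \<phi> (x, t))"
      using testfun_of_test_function[OF T \<phi> pos] by metis
    interpret testfun T S B "\<lambda>t x. \<phi> (x, t)" "\<lambda>t x. dx \<phi> (x, t)" "\<lambda>t x. dt \<phi> (x, t)" by (rule tf)
    interpret FT: flux_test p m L T S B "\<lambda>t x. \<phi> (x, t)" "\<lambda>t x. dx \<phi> (x, t)" "\<lambda>t x. dt \<phi> (x, t)" ?J C v
      by unfold_locales (use kJ bJ nv in auto)
    \<comment> \<open>The boundary terms as a function of the level. Their continuity in
      \<open>k\<close> is what allows \<open>all_levels\<close> to pass from the good levels to an
      arbitrary one.\<close>
    define b where "b k = (LINT x|lborel. \<bar>v T x - k\<bar> * \<phi> (x, T)) - (LINT x|lborel. \<bar>u0 x - k\<bar> * \<phi> (x, 0))" for k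
    have bcont: "isCont b k" for k
      unfolding b_def by (intro continuous_diff FT.boundary_isCont[OF NV(2)] FT.boundary_isCont[OF u0])
    have good: "b k \<le> FT.I k" if k: "AE q in lborel. v (fst q) (snd q) \<noteq> k" for k
    proof -
      have hs: "(\<lambda>n. h (s n)) \<longlonglongrightarrow> 0" using LIMSEQ_subseq_LIMSEQ[OF hl s] by (simp add: o_def)
      have l1: "(\<lambda>n. LINT t|lborel. indicator {0..T} t * (LINT x|lborel. FT.Xg (h (s n)) (far_part (h (s n)) ?J) (E.polygon (s n) t) k t x)) \<longlonglongrightarrow> FT.I k"
        by (rule FT.good_limit[OF E.L1_curve_polygon hs h(1) h(2) vs c0 ae k])
      have l2: "(\<lambda>n. LINT x|lborel. \<bar>E.polygon (s n) T x - k\<bar> * \<phi> (x, T)) \<longlonglongrightarrow> (LINT x|lborel. \<bar>v T x - k\<bar> * \<phi> (x, T))"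
        by (rule FT.boundary_limit[OF E.bvc_polygon vs c0])
      have l3: "(\<lambda>n. 1 / real (Suc (s n)) * (B * T)) \<longlonglongrightarrow> 0 * (B * T)"
        using hs by (intro tendsto_mult tendsto_const) (simp add: h_def)
      have ineq: "(LINT x|lborel. \<bar>E.polygon n T x - k\<bar> * \<phi> (x, T)) - (LINT x|lborel. \<bar>u0 x - k\<bar> * \<phi> (x, 0))
         \<le> (LINT t|lborel. indicator {0..T} t * (LINT x|lborel. FT.Xg (h n) (far_part (h n) ?J) (E.polygon n t) k t x)) + 1 / real (Suc n) * (B * T)" for n
      proof -
        have tf': "testfun (real (N n) * \<delta> n) S B (\<lambda>t x. \<phi> (x, t)) (\<lambda>t x. dx \<phi> (x, t)) (\<lambda>t x. dt \<phi> (x, t))" using tf by (simp add: N\<delta>)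
        interpret ET: euler_test p m L "h n" "far_part (h n) ?J" "\<delta> n" "N n" u0 C S B "\<lambda>t x. \<phi> (x, t)" "\<lambda>t x. dx \<phi> (x, t)" "\<lambda>t x. dt \<phi> (x, t)"
          using tf' h(2)[of n] E.euler_axioms[of n] by (intro euler_test.intro euler_test_axioms.intro)
        have X: "ET.X k t x = FT.Xg (h n) (far_part (h n) ?J) (E.polygon n t) k t x" for t x
          by (simp add: ET.X_def FT.Xg_def)
        have "(LINT x|lborel. \<bar>E.polygon n T x - k\<bar> * \<phi> (x, T)) - (LINT x|lborel. \<bar>u0 x - k\<bar> * \<phi> (x, 0))
         \<le> (LINT t|lborel. indicator {0..T} t * (LINT x|lborel. FT.Xg (h n) (far_part (h n) ?J) (E.polygon n t) k t x))
           + (4 * L / h n + 2 * (LINT z|lborel. far_part (h n) ?J z)) * (\<delta> n * E.D n) * B * T"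
          using ET.polygon_entropy[of k] by (simp only: N\<delta> X)
        moreover have "(4 * L / h n + 2 * (LINT z|lborel. far_part (h n) ?J z)) * (\<delta> n * E.D n) * (B * T) \<le> 1 / real (Suc n) * (B * T)"
          using errb[of n] B_nonneg T by (intro mult_right_mono) auto
        ultimately show ?thesis by (simp add: mult.assoc)
      qed
      have "(LINT x|lborel. \<bar>v T x - k\<bar> * \<phi> (x, T)) - (LINT x|lborel. \<bar>u0 x - k\<bar> * \<phi> (x, 0)) \<le> FT.I k + 0 * (B * T)"
        by (rule LIMSEQ_le[OF tendsto_diff[OF l2 tendsto_const] tendsto_add[OF l1 l3]]) (use ineq in auto)
      then show ?thesis by (simp add: b_def)
    qed
    have bI: "b k \<le> FT.I k" by (rule FT.all_levels[OF good bcont])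
    have "(LINT (x, t):Q T|lborel.
            \<eta> k (u (x, t)) * dt \<phi> (x, t) + entropy_flux f k (u (x, t)) * dx \<phi> (x, t)
            + \<eta>' k (u (x, t)) * frac_laplace lam (\<lambda>y. u (y, t)) x * \<phi> (x, t)) = (LINT q:Q T|lborel. FT.Xi k (snd q) (fst q))"
      unfolding set_lebesgue_integral_def
      by (rule Bochner_Integration.integral_cong[OF refl])
         (auto simp: FT.Xi_def u_def \<eta>_def \<eta>'_def entropy_flux_split[OF pm] frac_laplace_eq_G case_prod_beta')
    also have "\<dots> = (LINT t|lborel. indicator {0..T} t * (LINT x|lborel. FT.Xi k t x))"
      by (rule strip_integral_Q(2)[OF FT.measurable_Xi FT.Xi_integrable FT.Xi_bound])
    also have "\<dots> = FT.I k"
      using lborel_fubini_fst[OF strip_integral[OF FT.measurable_Xi FT.Xi_integrable FT.Xi_bound, of 0 T k]] by (simp add: FT.I_def)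
    finally show ?thesis using bI by (simp add: b_def u_def \<eta>_def)
  qed
  ultimately have "BV_entropy_solution lam T f u0 u" unfolding BV_entropy_solution_def by blast
  then show ?thesis by blast
qed

text \<open>Uniqueness is stated for every time slice rather than almost everywhere in the strip;
  this is meaningful because membership in \<open>C_L1\<close> fixes the class of each
  slice.\<close>

theorem corollary4p5:
  fixes lam T :: real and f u0 :: "real \<Rightarrow> real"
  assumes "0 < lam" "lam < 1" and "T > 0"
    and "\<exists>L. L-lipschitz_on UNIV f"
    and "integrable lborel u0" "u0 \<in> BV"
  shows "\<exists>u. BV_entropy_solution lam T f u0 u \<and>
           (\<forall>v. BV_entropy_solution lam T f u0 v \<longrightarrow>
              (\<forall>t\<in>{0..T}. AE x in lborel. v (x, t) = u (x, t)))"
proof -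
  obtain L where L: "L-lipschitz_on UNIV f" using assms(4) by blast
  have lip: "\<bar>f a - f b\<bar> \<le> L * \<bar>a - b\<bar>" for a b
    using lipschitz_onD[OF L, of a b] by (simp add: dist_real_def)
  \<comment> \<open>Adding and subtracting the linear function with slope \<open>L\<close> makes
    both parts nondecreasing because \<open>L\<close> is a Lipschitz constant of \<open>f\<close>.
    The normalization by \<open>f 0\<close> makes both vanish at 0, so they preserve
    integrability.\<close>
  define p m where "p u = (L * u + (f u - f 0)) / 2" and "m u = (L * u - (f u - f 0)) / 2" for u
  have sf: "split_flux p m L"
  proof
    have le: "\<bar>f b - f a\<bar> \<le> L * b - L * a" if "a \<le> b" for a b
      using lip[of b a] that by (simp add: right_diff_distrib)
    show "mono p" "mono m" by (rule monoI, use le in \<open>force simp: p_def m_def\<close>)+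
    show "p u + m u = L * u" for u by (simp add: p_def m_def add_divide_distrib[symmetric])
    show "p 0 = 0" by (simp add: p_def)
  qed
  have pm: "p u - m u = f u - f 0" for u by (simp add: p_def m_def diff_divide_distrib[symmetric])
  obtain C where C: "bvc C u0" using BV_imp_bvc[OF assms(6)] .
  obtain u where u: "BV_entropy_solution lam T f u0 u" using existence[OF assms(1-3) sf pm C] by blast
  then show ?thesis using uniqueness[OF assms(1-3) sf pm C _ u] by blast
qed

end
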